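(* Let $P_L$ be a link projection in $S^2$ and let $\omega$ be good marking data. Let $B\subset S^2$ be a ball containing $\omega$. Then the isomorphism type of $H(P_L,\partial\omega)$ is a tangle invariant of $P_L\cap(S^2\setminus B)$. That is, if $P_L$ and $P'_L$ are two link projections that coincide inside $B$, with the same marking data $\omega\subset B$ (good for both), and whose parts outside $B$ represent the same tangle (i.e. are related by Reidemeister moves performed away from $B$), then $H(P_L,\partial\omega)\cong H(P'_L,\partial\omega)$ as $\mathbb{Z}/2$-vector spaces.
   Context: Marked Khovanov homology. Marking data $\omega$ for $L\subset S^3$: a one-dimensional submanifold of $S^3$ with boundary $\partial\omega=\omega\cap L$ on $L$. Let $A=(\mathbb{Z}/2)[x]/x^2$ with $m(1\otimes1)=1$, $m(1\otimes x)=m(x\otimes1)=x$, $m(x\otimes x)=0$, $\Delta(1)=1\otimes x+x\otimes1$, $\Delta(x)=x\otimes x$. For a projection $P_L$ with $n$ crossings and $v\in\{0,1\}^n$, let $L_v$ be the crossingless resolution determined by $v$, an unlink carrying the marked points $\partial\omega$. The group at $v$ is $A^{\otimes c}$ (one factor per component of $L_v$) if every component carries an even number of points of $\partial\omega$, and $0$ otherwise. $C(P_L,\partial\omega)$ is the direct sum over $v$, with differential the sum over cube edges of $m$ or $\Delta$ (merging or splitting components) when source and target are non-zero, and $0$ otherwise. $H(P_L,\partial\omega)$ (also written $Kh(P_L,\omega)$) is its homology. Good marking data. Say $\omega$ is trivial at a vertex $v$ if no component of $L_v$ has an odd number of endpoints of $\omega$. For every pair of vertices $v,u$ (comparable or not)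 there is a cobordism $S_{vu}\subset[0,1]\times S^3$ from $L_v$ to $L_u$ with one saddle at each crossing where $v,u$ differ, carrying singular bundle data dual to $[0,1]\times\omega$. When $\omega$ is trivial at both $v$ and $u$, the ends can be capped off by disks (closing up the endpoints of $\omega$ in pairs), giving a closed orientable surface $\Sigma$ in a closed $4$-manifold $X$ with bundle data. $\omega$ is called good if for every such pair $v,u$ with $\omega$ trivial at both, $\omega$ does not intertwine any of the genus of the resulting closed surface; equivalently $\mathcal{P}(w_2(P_\Delta))\equiv 0\pmod 4$ for every such cobordism, where $\mathcal{P}$ is the Pontrjagin square. Here, as in Kronheimer–Mrowka, a $PU(2)$-bundle $P$ on $X\setminus\Sigma$ modelled on $\frac14 i\,d\theta$ near $\Sigma$ gives a double cover $\Sigma_\Delta\to\Sigma$ (the two ways to extend $P$ across $\Sigma$), a non-Hausdorff space $X_\Delta\to X$ which is an isomorphism over $X\setminus\Sigma$ and has preimage $\Sigma_\Delta$ over $\Sigma$, and a $PU(2)$-bundle $P_\Delta\to X_\Delta$ agreeing with $P$ away from a neighbourhood of $\Sigma_\Delta$. *)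

theory Defs
  imports "HOL-Analysis.Analysis" "HOL-Homology.Homology" "HOL-Library.Z2"
begin

section \<open>Link projections and tangle diagrams\<close>

text \<open>A diagram is drawn in Morse position and cut into horizontal slices, listed from bottom to
  top; every slice contains one event, whose leftmost strand has the given position (counted from 0
  among the strands below the slice, resp. above it for a cup).  In \<open>Cross i b\<close> the strand from
  bottom left to top right is the overstrand iff \<open>b\<close>.  \<open>Mark i\<close> is a point of \<open>\<partial>\<omega>\<close> on the strand
  \<open>i\<close>.\<close>

datatype slice = Cup nat | Cap nat | Cross nat bool | Mark nat

fun position :: "slice \<Rightarrow> nat" where
  "position (Cup i) = i" | "position (Cap i) = i"
| "position (Cross i b) = i" | "position (Mark i) = i"

fun ins :: "slice \<Rightarrow> nat" where
  "ins (Cup i) = 0" | "ins (Cap i) = 2" | "ins (Cross i b) = 2" | "ins (Mark i) = 1"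

fun outs :: "slice \<Rightarrow> nat" where
  "outs (Cup i) = 2" | "outs (Cap i) = 0" | "outs (Cross i b) = 2" | "outs (Mark i) = 1"

fun place :: "nat \<Rightarrow> slice \<Rightarrow> slice" where
  "place k (Cup i) = Cup k" | "place k (Cap i) = Cap k"
| "place k (Cross i b) = Cross k b" | "place k (Mark i) = Mark k"

text \<open>\<open>tangle m D n\<close>: \<open>D\<close> is a tangle diagram with \<open>m\<close> endpoints on its bottom and \<open>n\<close> endpoints
  on its top line.  Link projections are the case \<open>m = n = 0\<close>.\<close>

fun tangle :: "nat \<Rightarrow> slice list \<Rightarrow> nat \<Rightarrow> bool" where
  "tangle m [] n \<longleftrightarrow> m = n"
| "tangle m (g # D) n \<longleftrightarrow> position g + ins g \<le> m \<and> tangle (m - ins g + outs g) D n"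

definition unmarked :: "slice list \<Rightarrow> bool" where
  "unmarked D \<longleftrightarrow> (\<forall>i. Mark i \<notin> set D)"

text \<open>Planar isotopies rel endpoints (exchange of distant events, cancellation of a minimum against
  a maximum, sliding a crossing past an extremum) and the Reidemeister moves.  In \<open>R3\<close> the three
  strands must be stacked by height, which excludes the two cyclic patterns.\<close>

inductive move :: "slice list \<Rightarrow> slice list \<Rightarrow> bool" where
  exchange: "position g + outs g \<le> position h
    \<Longrightarrow> move [g, h] [place (position h - outs g + ins g) h, g]"
| zigzag_left: "move [Cup i, Cap (Suc i)] []"
| zigzag_right: "move [Cup (Suc i), Cap i] []"
| slide_cup: "move [Cup i, Cross (Suc i) b] [Cup (Suc i), Cross i (\<not> b)]"
| slide_cap: "move [Cross (Suc i) b, Cap i] [Cross i (\<not> b), Cap (Suc i)]"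
| R1_cup: "move [Cup i, Cross i b] [Cup i]"
| R1_cap: "move [Cross i b, Cap i] [Cap i]"
| R2: "move [Cross i b, Cross i (\<not> b)] []"
| R3: "(a = c \<longrightarrow> b = a)
    \<Longrightarrow> move [Cross i a, Cross (Suc i) b, Cross i c] [Cross (Suc i) c, Cross i b, Cross (Suc i) a]"

inductive tangle_equiv :: "nat \<Rightarrow> slice list \<Rightarrow> slice list \<Rightarrow> bool" for m :: nat where
  refl: "tangle_equiv m D D"
| sym: "tangle_equiv m D D' \<Longrightarrow> tangle_equiv m D' D"
| trans: "tangle_equiv m D D' \<Longrightarrow> tangle_equiv m D' D'' \<Longrightarrow> tangle_equiv m D D''"
| in_context: "move M M' \<Longrightarrow> tangle m (X @ M @ Y) 0 \<Longrightarrow> tangle m (X @ M' @ Y) 0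
    \<Longrightarrow> tangle_equiv m (X @ M @ Y) (X @ M' @ Y)"


section \<open>Resolutions\<close>

text \<open>From here on \<open>D\<close> is a link projection.  A vertex \<open>v\<close> of the cube is the set of (slice indices
  of) crossings that receive the 1-resolution.\<close>

definition crossings :: "slice list \<Rightarrow> nat set" where
  "crossings D = {j. j < length D \<and> (\<exists>i b. D ! j = Cross i b)}"

definition level_width :: "slice list \<Rightarrow> nat \<Rightarrow> nat" where
  "level_width D j = foldl (\<lambda>m g. m - ins g + outs g) 0 (take j D)"

text \<open>The node \<open>(j, p)\<close> is the \<open>p\<close>-th intersection point of the diagram with the horizontal line
  between the slices \<open>j - 1\<close> and \<open>j\<close>.\<close>

type_synonym node = "nat \<times> nat"

definition nodes :: "slice list \<Rightarrow> node set" where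
  "nodes D = {(j, p). j \<le> length D \<and> p < level_width D j}"

definition through_arcs :: "slice \<Rightarrow> nat \<Rightarrow> nat \<Rightarrow> (node \<times> node) set" where
  "through_arcs g n j = {((j, p), (Suc j, p)) | p. p < position g}
     \<union> {((j, p), (Suc j, p - ins g + outs g)) | p. position g + ins g \<le> p \<and> p < n}"

text \<open>The 0-resolution joins the two regions swept out when the overstrand is turned
  counterclockwise; it is the vertical resolution iff \<open>b\<close>.\<close>

fun core_arcs :: "slice \<Rightarrow> bool \<Rightarrow> nat \<Rightarrow> (node \<times> node) set" where
  "core_arcs (Cup i) r j = {((Suc j, i), (Suc j, Suc i))}"
| "core_arcs (Cap i) r j = {((j, i), (j, Suc i))}"
| "core_arcs (Mark i) r j = {((j, i), (Suc j, i))}"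
| "core_arcs (Cross i b) r j =
     (if r = b then {((j, i), (j, Suc i)), ((Suc j, i), (Suc j, Suc i))}
      else {((j, i), (Suc j, i)), ((j, Suc i), (Suc j, Suc i))})"

definition slice_arcs :: "slice list \<Rightarrow> nat set \<Rightarrow> nat \<Rightarrow> (node \<times> node) set" where
  "slice_arcs D v j = through_arcs (D ! j) (level_width D j) j \<union> core_arcs (D ! j) (j \<in> v) j"

definition arcs :: "slice list \<Rightarrow> nat set \<Rightarrow> (node \<times> node) set" where
  "arcs D v = (\<Union>j<length D. slice_arcs D v j)"

text \<open>The components of \<open>L\<^sub>v\<close>, each given as the set of its nodes.\<close>

definition circles :: "slice list \<Rightarrow> nat set \<Rightarrow> node set set" where
  "circles D v = nodes D // (arcs D v \<union> (arcs D v)\<inverse>)\<^sup>*"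

definition marks_on :: "slice list \<Rightarrow> node set \<Rightarrow> nat set" where
  "marks_on D C = {j. j < length D \<and> (\<exists>i. D ! j = Mark i \<and> (j, i) \<in> C)}"

definition trivial_at :: "slice list \<Rightarrow> nat set \<Rightarrow> bool" where
  "trivial_at D v \<longleftrightarrow> (\<forall>C \<in> circles D v. even (card (marks_on D C)))"


section \<open>Marked Khovanov homology\<close>

text \<open>The basis elements \<open>A1 = 1\<close> and \<open>Ax = x\<close> of \<open>A\<close>; \<open>m_coeff a b c\<close> is the coefficient of \<open>c\<close> in \<open>m (a \<otimes> b)\<close> and
  \<open>\<Delta>_coeff a b c\<close> the coefficient of \<open>b \<otimes> c\<close> in \<open>\<Delta> a\<close>.\<close>

datatype gen = A1 | Ax

fun m_coeff :: "gen \<Rightarrow> gen \<Rightarrow> gen \<Rightarrow> bit" where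
  "m_coeff A1 A1 c = (if c = A1 then 1 else 0)"
| "m_coeff A1 Ax c = (if c = Ax then 1 else 0)"
| "m_coeff Ax A1 c = (if c = Ax then 1 else 0)"
| "m_coeff Ax Ax c = 0"

fun \<Delta>_coeff :: "gen \<Rightarrow> gen \<Rightarrow> gen \<Rightarrow> bit" where
  "\<Delta>_coeff A1 b c = (if b \<noteq> c then 1 else 0)"
| "\<Delta>_coeff Ax b c = (if b = Ax \<and> c = Ax then 1 else 0)"

text \<open>A standard basis element of the group at \<open>v\<close> is a pair \<open>(v, S)\<close>, where \<open>S\<close> is the set of
  components of \<open>L\<^sub>v\<close> whose tensor factor is \<open>x\<close>.\<close>

type_synonym state = "nat set \<times> node set set"

definition states :: "slice list \<Rightarrow> state set" where
  "states D = {(v, S). v \<subseteq> crossings D \<and> trivial_at D v \<and> S \<subseteq> circles D v}"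

definition label :: "node set set \<Rightarrow> node set \<Rightarrow> gen" where
  "label S C = (if C \<in> S then Ax else A1)"

text \<open>The circles \<open>old\<close> and \<open>new\<close> are those of the source, resp. the target, that meet the crossing
  which is changed.\<close>

definition edge_coeff :: "slice list \<Rightarrow> state \<Rightarrow> state \<Rightarrow> bit" where
  "edge_coeff D s s' =
    (case (s, s') of ((v, S), (v', S')) \<Rightarrow>
      let old = circles D v - circles D v'; new = circles D v' - circles D v in
      if \<not> (\<exists>j \<in> crossings D - v. v' = insert j v) \<or>
         (\<exists>C \<in> circles D v \<inter> circles D v'. label S C \<noteq> label S' C) then 0
      else if \<exists>a b c. a \<noteq> b \<and> old = {a, b} \<and> new = {c} \<and>
                m_coeff (label S a) (label S b) (label S' c) = 1 then 1
      else if \<exists>a b c. b \<noteq> c \<and> old = {a} \<and> new = {b, c} \<and>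
                \<Delta>_coeff (label S a) (label S' b) (label S' c) = 1 then 1
      else 0)"

definition differential :: "slice list \<Rightarrow> (state \<Rightarrow> bit) \<Rightarrow> (state \<Rightarrow> bit)" where
  "differential D f = (\<lambda>s'. if s' \<in> states D then \<Sum>s \<in> states D. edge_coeff D s s' * f s else 0)"

definition chains :: "slice list \<Rightarrow> (state \<Rightarrow> bit) set" where
  "chains D = {f. \<forall>s. s \<notin> states D \<longrightarrow> f s = 0}"

definition cycles :: "slice list \<Rightarrow> (state \<Rightarrow> bit) monoid" where
  "cycles D = \<lparr>carrier = {f \<in> chains D. differential D f = (\<lambda>s. 0)},
               monoid.mult = (\<lambda>f g s. f s + g s), one = (\<lambda>s. 0)\<rparr>"

text \<open>The homology \<open>H(P\<^sub>L, \<partial>\<omega>)\<close>.  Since the scalars of a \<open>\<int>/2\<close>-vector space are 0 and 1, its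
  linear isomorphisms are exactly the isomorphisms of the additive group.\<close>

definition Kh :: "slice list \<Rightarrow> (state \<Rightarrow> bit) set monoid" where
  "Kh D = cycles D Mod (differential D ` chains D)"


section \<open>Marking data\<close>

text \<open>The realisation of a diagram: the node \<open>(j, p)\<close> is the point \<open>(p, j)\<close> of the plane.\<close>

type_synonym r3 = "real \<times> real \<times> real"
type_synonym r4 = "real \<times> real \<times> real \<times> real"

fun node_point :: "node \<Rightarrow> real \<times> real" where
  "node_point (j, p) = (real p, real j)"

text \<open>An arc of slice \<open>j\<close> joining two nodes of the same level is bent into the slice.\<close>

fun curve :: "nat \<Rightarrow> node \<times> node \<Rightarrow> (real \<times> real) set" where
  "curve j (a, b) =
    (if fst a = fst b then
       let w = ((real (snd a) + real (snd b)) / 2,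
                if fst a = j then real j + 1/4 else real j + 3/4)
       in closed_segment (node_point a) w \<union> closed_segment w (node_point b)
     else closed_segment (node_point a) (node_point b))"

definition resolved :: "slice list \<Rightarrow> nat set \<Rightarrow> (real \<times> real) set" where
  "resolved D v = (\<Union>j<length D. \<Union>e \<in> slice_arcs D v j. curve j e)"

fun crossing_strands :: "slice \<Rightarrow> nat \<Rightarrow> r3 set" where
  "crossing_strands (Cross i b) j =
    (let x = real i; y = real j; h = (if b then 1/2 else - (1/2)) in
       closed_segment (x, y, 0) (x + 1/2, y + 1/2, h)
     \<union> closed_segment (x + 1/2, y + 1/2, h) (x + 1, y + 1, 0)
     \<union> closed_segment (x + 1, y, 0) (x + 1/2, y + 1/2, - h)
     \<union> closed_segment (x + 1/2, y + 1/2, - h) (x, y + 1, 0))"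
| "crossing_strands _ j = {}"

definition link :: "slice list \<Rightarrow> r3 set" where
  "link D = (\<Union>j<length D. crossing_strands (D ! j) j \<union>
     {(x, y, 0) | x y. \<exists>e \<in> through_arcs (D ! j) (level_width D j) j \<union>
          (if j \<in> crossings D then {} else core_arcs (D ! j) False j). (x, y) \<in> curve j e})"

definition crossing_balls :: "slice list \<Rightarrow> r3 set" where
  "crossing_balls D = (\<Union>j \<in> crossings D.
     {real (position (D ! j))..real (position (D ! j)) + 1} \<times> {real j..real j + 1} \<times> {-1..1})"

definition mark_points :: "slice list \<Rightarrow> r3 set" where
  "mark_points D = {(real i, real j + 1/2, 0) | i j. j < length D \<and> D ! j = Mark i}"

text \<open>\<open>\<omega>\<close> is a compact locally flat 1-manifold in \<open>S\<^sup>3\<close> (and misses the point at infinity), meets the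
  link exactly in its boundary, which consists of the marked points, and stays away from the balls
  in which the crossings are resolved.\<close>

definition marking_data :: "slice list \<Rightarrow> r3 set \<Rightarrow> bool" where
  "marking_data D \<omega> \<longleftrightarrow> compact \<omega> \<and> \<omega> \<inter> link D = mark_points D \<and> \<omega> \<inter> crossing_balls D = {} \<and>
    (\<forall>p \<in> \<omega> - link D. \<exists>U (f :: r3 \<Rightarrow> r3) f'. open U \<and> p \<in> U \<and> homeomorphism U UNIV f f' \<and>
       f ` (U \<inter> \<omega>) = {(s, 0, 0) | s. True}) \<and>
    (\<forall>p \<in> \<omega> \<inter> link D. \<exists>U (f :: r3 \<Rightarrow> r3) f'. open U \<and> p \<in> U \<and> homeomorphism U UNIV f f' \<and>
       f ` (U \<inter> \<omega>) = {(s, 0, 0) | s. 0 \<le> s} \<and> f ` (U \<inter> link D) = {(0, t, 0) | t. True})"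


section \<open>The closed surfaces in the 4-sphere\<close>

text \<open>The quadrilateral between the four arcs of the two resolutions of a crossing.\<close>

definition saddle :: "nat \<Rightarrow> nat \<Rightarrow> (real \<times> real) set" where
  "saddle i j = {(x, y). let h = min (x - real i) (real i + 1 - x) / 2 in
     0 \<le> h \<and> real j + h \<le> y \<and> y \<le> real j + 1 - h}"

text \<open>The cobordism \<open>S\<^sub>v\<^sub>u\<close> in \<open>[0,1] \<times> \<real>\<^sup>3\<close>, the first coordinate being that of the interval.\<close>

definition cobordism :: "slice list \<Rightarrow> nat set \<Rightarrow> nat set \<Rightarrow> r4 set" where
  "cobordism D v u = {(t, x, y, z). z = 0 \<and>
     (0 \<le> t \<and> t \<le> 1/2 \<and> (x, y) \<in> resolved D v \<or>
      1/2 \<le> t \<and> t \<le> 1 \<and> (x, y) \<in> resolved D u \<or>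
      t = 1/2 \<and> (\<exists>j \<in> (v - u) \<union> (u - v). (x, y) \<in> saddle (position (D ! j)) j))}"

text \<open>Disks bounded by a planar unlink \<open>L\<close>: a circle is pushed to a depth which is larger than that
  of all circles nested in it, and then filled in.  The first coordinate is the depth.\<close>

definition cap_depth :: "(real \<times> real) set \<Rightarrow> (real \<times> real) set \<Rightarrow> real" where
  "cap_depth L c = 1 + real (card {c' \<in> components L. c' \<subseteq> inside c})"

definition caps :: "(real \<times> real) set \<Rightarrow> r3 set" where
  "caps L = {(s, x, y). \<exists>c \<in> components L.
     0 \<le> s \<and> s \<le> cap_depth L c \<and> (x, y) \<in> c \<or> s = cap_depth L c \<and> (x, y) \<in> c \<union> inside c}"

definition closed_surface :: "slice list \<Rightarrow> nat set \<Rightarrow> nat set \<Rightarrow> r4 set" where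
  "closed_surface D v u = cobordism D v u \<union>
     {(t, x, y, z). z = 0 \<and> ((- t, x, y) \<in> caps (resolved D v) \<or> (t - 1, x, y) \<in> caps (resolved D u))}"

text \<open>Filling the two ends of \<open>[0,1] \<times> S\<^sup>3\<close> by balls gives \<open>S\<^sup>4\<close>, in which \<open>\<real> \<times> \<real>\<^sup>3\<close> sits by inverse
  stereographic projection.\<close>

definition stereo :: "r4 \<Rightarrow> real \<times> r4" where
  "stereo p = (((norm p)\<^sup>2 - 1) / ((norm p)\<^sup>2 + 1), (2 / ((norm p)\<^sup>2 + 1)) *\<^sub>R p)"

definition S4 :: "(real \<times> r4) topology" where
  "S4 = top_of_set (sphere 0 1)"


section \<open>Singular bundle data\<close>

text \<open>\<open>X\<^sub>\<Delta>\<close>: a space over \<open>X\<close>, locally homeomorphic to it by the first projection, with one point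
  over each point outside \<open>\<Sigma>\<close> and restricting to a double cover \<open>\<Sigma>\<^sub>\<Delta> \<rightarrow> \<Sigma>\<close>.\<close>

definition doubled_space :: "'a topology \<Rightarrow> 'a set \<Rightarrow> ('a \<times> bool) topology \<Rightarrow> bool" where
  "doubled_space X \<Sigma> X\<Delta> \<longleftrightarrow>
     topspace X\<Delta> = {(x, b). x \<in> topspace X \<and> (b \<longrightarrow> x \<in> \<Sigma>)} \<and>
     (\<forall>p \<in> topspace X\<Delta>. \<exists>U. p \<in> U \<and> openin X\<Delta> U \<and> openin X (fst ` U) \<and>
        homeomorphic_map (subtopology X\<Delta> U) (subtopology X (fst ` U)) fst) \<and>
     (\<forall>x \<in> \<Sigma>. \<exists>V A B. x \<in> V \<and> openin (subtopology X \<Sigma>) V \<and>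
        openin (subtopology X\<Delta> (\<Sigma> \<times> UNIV)) A \<and> openin (subtopology X\<Delta> (\<Sigma> \<times> UNIV)) B \<and>
        A \<inter> B = {} \<and> A \<union> B = V \<times> UNIV \<and>
        homeomorphic_map (subtopology X\<Delta> A) (subtopology X V) fst \<and>
        homeomorphic_map (subtopology X\<Delta> B) (subtopology X V) fst)"

text \<open>A principal \<open>PU(2)\<close>-bundle, \<open>PU(2)\<close> being identified with \<open>SO(3)\<close> by the adjoint
  representation, is given by local trivialisations over open sets \<open>U x \<ni> x\<close> and their transition
  functions.\<close>

definition pu2_bundle :: "'a topology \<Rightarrow> ('a \<Rightarrow> 'a set) \<Rightarrow> ('a \<Rightarrow> 'a \<Rightarrow> 'a \<Rightarrow> real^3^3) \<Rightarrow> bool" where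
  "pu2_bundle X U g \<longleftrightarrow>
     (\<forall>x \<in> topspace X. openin X (U x) \<and> x \<in> U x) \<and>
     (\<forall>x \<in> topspace X. \<forall>y \<in> topspace X.
        continuous_map (subtopology X (U x \<inter> U y)) (top_of_set {Q. rotation_matrix Q}) (g x y)) \<and>
     (\<forall>x \<in> topspace X. \<forall>y \<in> topspace X. \<forall>z \<in> topspace X. \<forall>p \<in> U x \<inter> U y \<inter> U z.
        g x y p ** g y z p = g x z p)"

text \<open>Sections of the pull-back of the bundle by a singular \<open>p\<close>-simplex \<open>\<sigma>\<close>.\<close>

definition section_over :: "'a topology \<Rightarrow> ('a \<Rightarrow> 'a set) \<Rightarrow> ('a \<Rightarrow> 'a \<Rightarrow> 'a \<Rightarrow> real^3^3) \<Rightarrow> nat \<Rightarrow>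
    ((nat \<Rightarrow> real) \<Rightarrow> 'a) \<Rightarrow> ('a \<Rightarrow> (nat \<Rightarrow> real) \<Rightarrow> real^3^3) \<Rightarrow> bool" where
  "section_over X U g p \<sigma> s \<longleftrightarrow>
     (\<forall>x \<in> topspace X. continuous_map
        (subtopology (powertop_real UNIV) {q \<in> standard_simplex p. \<sigma> q \<in> U x})
        (top_of_set {Q. rotation_matrix Q}) (s x)) \<and>
     (\<forall>x \<in> topspace X. \<forall>y \<in> topspace X. \<forall>q \<in> standard_simplex p.
        \<sigma> q \<in> U x \<inter> U y \<longrightarrow> s x q = g x y (\<sigma> q) ** s y q)"

text \<open>The section \<open>s\<close> over the \<open>p\<close>-simplex \<open>\<sigma>\<close> restricts to \<open>s'\<close> over its \<open>k\<close>-th face.\<close>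

definition face_agrees :: "'a topology \<Rightarrow> ('a \<Rightarrow> 'a set) \<Rightarrow> nat \<Rightarrow> nat \<Rightarrow> ((nat \<Rightarrow> real) \<Rightarrow> 'a) \<Rightarrow>
    ('a \<Rightarrow> (nat \<Rightarrow> real) \<Rightarrow> real^3^3) \<Rightarrow> ('a \<Rightarrow> (nat \<Rightarrow> real) \<Rightarrow> real^3^3) \<Rightarrow> bool" where
  "face_agrees X U p k \<sigma> s s' \<longleftrightarrow>
     (\<forall>x \<in> topspace X. \<forall>q \<in> standard_simplex (p - 1).
        \<sigma> (simplical_face k q) \<in> U x \<longrightarrow> s x (simplical_face k q) = s' x q)"

text \<open>\<open>w\<^sub>2\<close> is the primary obstruction to a section of the principal bundle: for sections \<open>e0\<close>, \<open>e1\<close>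
  over the singular 0- and 1-simplices, the obstruction to extending them over a 2-simplex lies in
  \<open>\<pi>\<^sub>1(SO(3)) = \<int>/2\<close>.  A cochain is an integer valued function on singular simplices.\<close>

definition represents_w2 :: "'a topology \<Rightarrow> ('a \<Rightarrow> 'a set) \<Rightarrow> ('a \<Rightarrow> 'a \<Rightarrow> 'a \<Rightarrow> real^3^3) \<Rightarrow>
    (((nat \<Rightarrow> real) \<Rightarrow> 'a) \<Rightarrow> int) \<Rightarrow> bool" where
  "represents_w2 X U g c \<longleftrightarrow> (\<exists>e0 e1.
     (\<forall>\<tau>. singular_simplex 0 X \<tau> \<longrightarrow> section_over X U g 0 \<tau> (e0 \<tau>)) \<and>
     (\<forall>\<tau>. singular_simplex 1 X \<tau> \<longrightarrow> section_over X U g 1 \<tau> (e1 \<tau>) \<and>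
        (\<forall>k\<le>1. face_agrees X U 1 k \<tau> (e1 \<tau>) (e0 (singular_face 1 k \<tau>)))) \<and>
     (\<forall>\<sigma>. singular_simplex 2 X \<sigma> \<longrightarrow>
        c \<sigma> = (if \<exists>s. section_over X U g 2 \<sigma> s \<and>
                       (\<forall>k\<le>2. face_agrees X U 2 k \<sigma> s (e1 (singular_face 2 k \<sigma>)))
                then 0 else 1)))"

definition coboundary :: "nat \<Rightarrow> (((nat \<Rightarrow> real) \<Rightarrow> 'a) \<Rightarrow> int) \<Rightarrow> ((nat \<Rightarrow> real) \<Rightarrow> 'a) \<Rightarrow> int" where
  "coboundary p c \<sigma> = (\<Sum>k\<le>Suc p. (- 1) ^ k * c (singular_face (Suc p) k \<sigma>))"

text \<open>The simplex spanned by the listed vertices of \<open>\<sigma>\<close>.\<close>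

definition subsimplex :: "nat list \<Rightarrow> ((nat \<Rightarrow> real) \<Rightarrow> 'a) \<Rightarrow> (nat \<Rightarrow> real) \<Rightarrow> 'a" where
  "subsimplex vs \<sigma> = restrict
     (\<lambda>q. \<sigma> (\<lambda>i. \<Sum>k<length vs. if vs ! k = i then q k else 0)) (standard_simplex (length vs - 1))"

text \<open>The Pontrjagin square \<open>c \<union> c + c \<union>\<^sub>1 \<delta>c\<close> (mod 4) of an integral 2-cochain \<open>c\<close> that is a cocycle
  mod 2, with Steenrod's formula for the \<open>\<union>\<^sub>1\<close>-product; its signs are irrelevant as \<open>\<delta>c\<close> is even.\<close>

definition pontrjagin_square :: "(((nat \<Rightarrow> real) \<Rightarrow> 'a) \<Rightarrow> int) \<Rightarrow> ((nat \<Rightarrow> real) \<Rightarrow> 'a) \<Rightarrow> int" where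
  "pontrjagin_square c \<sigma> =
     c (subsimplex [0,1,2] \<sigma>) * c (subsimplex [2,3,4] \<sigma>)
     + c (subsimplex [0,3,4] \<sigma>) * coboundary 2 c (subsimplex [0,1,2,3] \<sigma>)
     + c (subsimplex [0,1,4] \<sigma>) * coboundary 2 c (subsimplex [1,2,3,4] \<sigma>)"

definition evaluate :: "(((nat \<Rightarrow> real) \<Rightarrow> 'a) \<Rightarrow> int) \<Rightarrow> (((nat \<Rightarrow> real) \<Rightarrow> 'a) \<Rightarrow>\<^sub>0 int) \<Rightarrow> int" where
  "evaluate c z = (\<Sum>\<sigma> \<in> Poly_Mapping.keys z. Poly_Mapping.lookup z \<sigma> * c \<sigma>)"

text \<open>Charts of a 4-manifold \<open>X\<close> that flatten the surface \<open>F\<close>, and the transverse disk at the centre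
  of such a chart, as a singular 2-simplex whose barycentre is its intersection with \<open>F\<close>.\<close>

definition flat_chart :: "'a topology \<Rightarrow> 'a set \<Rightarrow> (r4 \<Rightarrow> 'a) \<Rightarrow> bool" where
  "flat_chart X F f \<longleftrightarrow> embedding_map euclidean X f \<and> openin X (range f) \<and>
     {p. f p \<in> F} = {(a, b, 0, 0) | a b. True}"

definition normal_disk :: "(r4 \<Rightarrow> 'a) \<Rightarrow> (nat \<Rightarrow> real) \<Rightarrow> 'a" where
  "normal_disk f = restrict (\<lambda>q. f (0, 0, q 1 - 1/3, q 2 - 1/3)) (standard_simplex 2)"

text \<open>The mod 2 class of the 2-cocycle \<open>c\<close> on the 4-manifold \<open>Y\<close> is Poincare dual to the closed
  surface \<open>W\<close> in \<open>Y\<close>: it lifts to the class of \<open>(Y, Y - W)\<close> with value 1 on transverse disks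
  (the Thom class).\<close>

definition dual_to :: "'a topology \<Rightarrow> 'a set \<Rightarrow> (((nat \<Rightarrow> real) \<Rightarrow> 'a) \<Rightarrow> int) \<Rightarrow> bool" where
  "dual_to Y W c \<longleftrightarrow> (\<exists>b.
     (\<forall>\<sigma>. singular_simplex 2 (subtopology Y (- W)) \<sigma> \<longrightarrow> even (c \<sigma> + coboundary 1 b \<sigma>)) \<and>
     (\<forall>f. flat_chart Y W f \<longrightarrow>
        odd (c (normal_disk f) + coboundary 1 b (normal_disk f))))"

text \<open>The local model \<open>(1/4) i d\<theta>\<close> along \<open>\<Sigma>\<close> says that the two local extensions of \<open>P\<close> across \<open>\<Sigma>\<close>
  differ: \<open>w\<^sub>2(P\<^sub>\<Delta>)\<close> is non-zero on the sphere formed by the two lifts of a disk normal to \<open>\<Sigma>\<close>.\<close>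

definition quarter_holonomy :: "'a topology \<Rightarrow> 'a set \<Rightarrow> (((nat \<Rightarrow> real) \<Rightarrow> 'a \<times> bool) \<Rightarrow> int) \<Rightarrow> bool" where
  "quarter_holonomy X \<Sigma> c \<longleftrightarrow> (\<forall>f. flat_chart X \<Sigma> f \<longrightarrow>
     (let lift = (\<lambda>b. simplex_map 2 (\<lambda>x. (x, b \<and> x \<in> \<Sigma>)) (normal_disk f))
      in odd (c (lift True) - c (lift False))))"

text \<open>\<open>c\<close> represents \<open>w\<^sub>2(P\<^sub>\<Delta>)\<close> for singular bundle data \<open>P\<^sub>\<Delta> \<rightarrow> X\<^sub>\<Delta>\<close> on the closed pair
  \<open>(S\<^sup>4, \<Sigma>)\<close> that restricts on the cobordism to data dual to \<open>[0,1] \<times> \<omega>\<close>.  The double cover \<open>\<Sigma>\<^sub>\<Delta>\<close> and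
  the extension over the caps, which closes up \<open>\<omega>\<close>, are then determined.\<close>

definition singular_bundle_data ::
    "(real \<times> r4) set \<Rightarrow> r3 set \<Rightarrow> ((real \<times> r4) \<times> bool) topology \<Rightarrow>
     (((nat \<Rightarrow> real) \<Rightarrow> (real \<times> r4) \<times> bool) \<Rightarrow> int) \<Rightarrow> bool" where
  "singular_bundle_data \<Sigma> \<omega> X\<Delta> c \<longleftrightarrow>
     doubled_space S4 \<Sigma> X\<Delta> \<and>
     (\<exists>U g. pu2_bundle X\<Delta> U g \<and> represents_w2 X\<Delta> U g c) \<and>
     quarter_holonomy S4 \<Sigma> c \<and>
     dual_to (subtopology S4 (stereo ` ({0<..<1} \<times> UNIV) - \<Sigma>)) (stereo ` ({0<..<1} \<times> \<omega>))
       (\<lambda>\<sigma>. c (simplex_map 2 (\<lambda>x. (x, False)) \<sigma>))"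

text \<open>\<open>X\<^sub>\<Delta>\<close> is not Hausdorff and its fundamental class is in general only rational, so that the
  condition \<open>\<P>(w\<^sub>2(P\<^sub>\<Delta>)) \<equiv> 0\<close> mod 4 is imposed on all integral 4-cycles.\<close>

definition good :: "slice list \<Rightarrow> r3 set \<Rightarrow> bool" where
  "good D \<omega> \<longleftrightarrow> (\<forall>v u. v \<subseteq> crossings D \<and> u \<subseteq> crossings D \<and> trivial_at D v \<and> trivial_at D u \<longrightarrow>
     (\<forall>X\<Delta> c. singular_bundle_data (stereo ` closed_surface D v u) \<omega> X\<Delta> c \<longrightarrow>
        (\<forall>z. singular_relcycle 4 X\<Delta> {} z \<longrightarrow> 4 dvd evaluate (pontrjagin_square c) z)))"

end

theory Submission
  imports Defs
begin

text \<open>Why the theorem holds.  The complex of a link projection depends on the projection only through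
  its cube: the family of circles at every vertex, the two strands at every crossing, and the positions
  of the marked points.  The homology is compared before and after every single move in the
  unmarked part of the diagram; the marked part takes no part in the moves, and it is carried along
  as context.

  The first ingredient is that the differential has square zero, also in the presence of marked
  points (\<open>square_zero_cf\<close>).  The checkerboard orientation makes every resolution a permutation of the
  nodes of the diagram, and a change of resolution at one crossing composes it with a transposition.
  Hence it merges two circles or splits one, and nothing else happens (\<open>swap_surgery\<close>).  If a state is
  written as a product of points \<open>x\<^sub>t\<close>, a merge is the identity and a split is multiplication by
  \<open>x\<^sub>a + x\<^sub>b\<close>, so that the faces of the cube commute.  Marked points enter where a vertex of a face is
  non-trivial: such a vertex can be left out without loss, because either the two paths vanish or the
  parities at the other vertices force it to be trivial.

  The second ingredient is Gaussian elimination (\<open>cancellation\<close>).  A small unmarked circle that is created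
  or absorbed at a crossing gives arrows with identity matrices, which can be cancelled
  (\<open>circle_cancellation\<close>).  In the first two moves this leaves the vertices that look like the simplified
  diagram.  In the third move, for the pattern of signs in which each side contains a bigon, it leaves on both sides
  five planar resolutions of three strands.  Zigzags through the cancelled states act as additional
  edges there, and the two complexes coincide after direct edges and zigzags have exchanged their
  roles.  The other patterns of signs follow from this one by the second move and calculations in
  the braid group (\<open>braid_R3\<close>).

  To say that two complexes coincide although their diagrams have different nodes, the part of
  the diagram that is changed is shrunk to a single slice of which only the connections between end
  points are kept.  A circle is determined by its trace on this skeleton, and coefficients of the
  differential only depend on the traces (\<open>pcoef_image\<close>).  What is left for every move is a finite
  verification in a window of at most three strands, or at two distant events in the case of an
  exchange.\<close>

section \<open>Homology of based complexes\<close>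

text \<open>The bit lemmas serve as ring laws here; rewriting sums and products to boolean
  operations would hide the ring structure from the simplifier.\<close>

declare add_bit_eq_xor [simp del] mult_bit_eq_and [simp del]

lemma bit_add_self [simp]: "(a::bit) + a = 0"
  by (cases a) auto

lemma bit_add_self_left [simp]: "(a::bit) + (a + b) = b"
  by (cases a; cases b) auto

lemma bit_add_eq_0_iff: "(a::bit) + b = 0 \<longleftrightarrow> a = b"
  by (cases a; cases b) auto

definition hdiff :: "'s set \<Rightarrow> ('s \<Rightarrow> 's \<Rightarrow> bit) \<Rightarrow> ('s \<Rightarrow> bit) \<Rightarrow> 's \<Rightarrow> bit" where
  "hdiff St c f = (\<lambda>t. if t \<in> St then \<Sum>s\<in>St. c s t * f s else 0)"

definition hchains :: "'s set \<Rightarrow> ('s \<Rightarrow> bit) set" where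
  "hchains St = {f. \<forall>s. s \<notin> St \<longrightarrow> f s = 0}"

definition hcycles :: "'s set \<Rightarrow> ('s \<Rightarrow> 's \<Rightarrow> bit) \<Rightarrow> ('s \<Rightarrow> bit) monoid" where
  "hcycles St c = \<lparr>carrier = {f \<in> hchains St. hdiff St c f = (\<lambda>s. 0)},
               monoid.mult = (\<lambda>f g s. f s + g s), one = (\<lambda>s. 0)\<rparr>"

definition homology :: "'s set \<Rightarrow> ('s \<Rightarrow> 's \<Rightarrow> bit) \<Rightarrow> ('s \<Rightarrow> bit) set monoid" where
  "homology St c = hcycles St c Mod (hdiff St c ` hchains St)"

text \<open>A based complex is a finite set of basis elements with a matrix; the homological grading
  is not recorded, so that a chain complex is just a matrix of square zero.\<close>

definition square_zero :: "'s set \<Rightarrow> ('s \<Rightarrow> 's \<Rightarrow> bit) \<Rightarrow> bool" where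
  "square_zero St c \<longleftrightarrow> finite St \<and> (\<forall>s\<in>St. \<forall>u\<in>St. (\<Sum>t\<in>St. c s t * c t u) = 0)"

lemma hdiff_add: "hdiff St c (\<lambda>s. f s + g s) = (\<lambda>s. hdiff St c f s + hdiff St c g s)"
  by (auto simp: hdiff_def fun_eq_iff sum.distrib algebra_simps)

lemma hdiff_zero [simp]: "hdiff St c (\<lambda>s. 0) = (\<lambda>s. 0)"
  by (auto simp: hdiff_def)

lemma hdiff_in_hchains [simp]: "hdiff St c f \<in> hchains St"
  by (auto simp: hdiff_def hchains_def)

lemma hchains_add: "f \<in> hchains St \<Longrightarrow> g \<in> hchains St \<Longrightarrow> (\<lambda>s. f s + g s) \<in> hchains St"
  by (auto simp: hchains_def)

lemma hchains_zero [simp]: "(\<lambda>s. 0) \<in> hchains St"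
  by (auto simp: hchains_def)

lemma hdiff_hdiff:
  assumes "square_zero St c"
  shows "hdiff St c (hdiff St c f) = (\<lambda>s. 0)"
proof
  fix u
  show "hdiff St c (hdiff St c f) u = 0"
  proof (cases "u \<in> St")
    case True
    have "hdiff St c (hdiff St c f) u = (\<Sum>t\<in>St. c t u * (\<Sum>s\<in>St. c s t * f s))"
      using True by (simp add: hdiff_def cong: sum.cong)
    also have "\<dots> = (\<Sum>t\<in>St. \<Sum>s\<in>St. c s t * c t u * f s)"
      by (simp add: sum_distrib_left mult_ac)
    also have "\<dots> = (\<Sum>s\<in>St. \<Sum>t\<in>St. c s t * c t u * f s)"
      by (rule sum.swap)
    also have "\<dots> = (\<Sum>s\<in>St. (\<Sum>t\<in>St. c s t * c t u) * f s)"
      by (simp add: sum_distrib_right)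
    also have "\<dots> = 0"
      using assms True by (simp add: square_zero_def)
    finally show ?thesis .
  qed (simp add: hdiff_def)
qed

lemma square_zeroI_hdiff:
  assumes fin: "finite St" and dd: "\<And>f. f \<in> hchains St \<Longrightarrow> hdiff St c (hdiff St c f) = (\<lambda>s. 0)"
  shows "square_zero St c"
  unfolding square_zero_def
proof (intro conjI ballI)
  fix s u assume s: "s \<in> St" and u: "u \<in> St"
  define f where "f = (\<lambda>t. if t = s then 1 else (0::bit))"
  have f: "f \<in> hchains St" using s by (auto simp: f_def hchains_def)
  have d1: "hdiff St c f t = c s t" if "t \<in> St" for t
  proof -
    have "(\<Sum>x\<in>St. c x t * f x) = (\<Sum>x\<in>St. if s = x then c s t else 0)"
      by (rule sum.cong) (auto simp: f_def)
    also have "\<dots> = c s t" using s fin by simp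
    finally show ?thesis using that by (simp add: hdiff_def)
  qed
  have "hdiff St c (hdiff St c f) u = (\<Sum>t\<in>St. c t u * hdiff St c f t)"
    using u by (simp add: hdiff_def)
  also have "\<dots> = (\<Sum>t\<in>St. c s t * c t u)"
    by (rule sum.cong) (auto simp: d1 mult.commute)
  finally show "(\<Sum>t\<in>St. c s t * c t u) = 0" using dd[OF f] by simp
qed (rule fin)

lemma comm_group_hcycles: "comm_group (hcycles St c)"
proof (rule comm_groupI)
  fix f assume f: "f \<in> carrier (hcycles St c)"
  show "\<exists>g\<in>carrier (hcycles St c). g \<otimes>\<^bsub>hcycles St c\<^esub> f = \<one>\<^bsub>hcycles St c\<^esub>"
    using f by (intro bexI[of _ f]) (auto simp: hcycles_def)
qed (auto simp: hcycles_def hchains_add hdiff_add ac_simps)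

lemma hcycles_group: "group (hcycles St c)"
  using comm_group_hcycles comm_group.axioms(2) by blast

lemma inv_hcycles: "f \<in> carrier (hcycles St c) \<Longrightarrow> inv\<^bsub>hcycles St c\<^esub> f = f"
  by (rule group.inv_equality[OF hcycles_group]) (auto simp: hcycles_def)

lemma boundaries_normal:
  assumes "square_zero St c"
  shows "(hdiff St c ` hchains St) \<lhd> hcycles St c"
proof -
  interpret comm_group "hcycles St c" by (rule comm_group_hcycles)
  have sub: "hdiff St c ` hchains St \<subseteq> carrier (hcycles St c)"
    using hdiff_hdiff[OF assms] by (auto simp: hcycles_def)
  have "subgroup (hdiff St c ` hchains St) (hcycles St c)"
  proof (rule subgroupI[OF sub])
    show "hdiff St c ` hchains St \<noteq> {}" using hchains_zero by blast
    show "inv\<^bsub>hcycles St c\<^esub> a \<in> hdiff St c ` hchains St" if "a \<in> hdiff St c ` hchains St" for a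
      using that sub by (auto simp: inv_hcycles subset_iff)
    show "a \<otimes>\<^bsub>hcycles St c\<^esub> b \<in> hdiff St c ` hchains St"
      if ab: "a \<in> hdiff St c ` hchains St" "b \<in> hdiff St c ` hchains St" for a b
    proof -
      from ab obtain f g where fg: "a = hdiff St c f" "b = hdiff St c g" "f \<in> hchains St" "g \<in> hchains St"
        by blast
      then have "a \<otimes>\<^bsub>hcycles St c\<^esub> b = hdiff St c (\<lambda>s. f s + g s)"
        by (simp add: hcycles_def hdiff_add)
      then show ?thesis using fg hchains_add by blast
    qed
  qed
  then show ?thesis by (rule subgroup_imp_normal)
qed

text \<open>The last two premises say that the map induced on homology is injective and surjective,
  in the form in which they come out of a cancellation.\<close>

lemma homology_iso_chain_map:
  assumes c: "square_zero St c" and c': "square_zero St' c'"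
    and F: "\<And>f. f \<in> hchains St' \<Longrightarrow> F f \<in> hchains St"
    and add: "\<And>f g. f \<in> hchains St' \<Longrightarrow> g \<in> hchains St' \<Longrightarrow> F (\<lambda>s. f s + g s) = (\<lambda>s. F f s + F g s)"
    and comm: "\<And>f. f \<in> hchains St' \<Longrightarrow> hdiff St c (F f) = F (hdiff St' c' f)"
    and inj: "\<And>f g. f \<in> hchains St' \<Longrightarrow> g \<in> hchains St \<Longrightarrow> F f = hdiff St c g \<Longrightarrow> f \<in> hdiff St' c' ` hchains St'"
    and surj: "\<And>z. z \<in> hchains St \<Longrightarrow> hdiff St c z = (\<lambda>s. 0) \<Longrightarrow>
        \<exists>f\<in>hchains St'. \<exists>u\<in>hchains St. hdiff St' c' f = (\<lambda>s. 0) \<and> z = (\<lambda>s. F f s + hdiff St c u s)"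
  shows "homology St' c' \<cong> homology St c"
proof -
  let ?Z = "hcycles St c" and ?Z' = "hcycles St' c'"
  let ?B = "hdiff St c ` hchains St" and ?B' = "hdiff St' c' ` hchains St'"
  interpret Z: comm_group ?Z by (rule comm_group_hcycles)
  interpret Z': comm_group ?Z' by (rule comm_group_hcycles)
  interpret B: normal ?B ?Z by (rule boundaries_normal[OF c])
  define h where "h f = ?B #>\<^bsub>?Z\<^esub> F f" for f
  have F0: "F (\<lambda>s. 0) = (\<lambda>s. 0)"
  proof -
    have "F (\<lambda>s. 0) = (\<lambda>s. F (\<lambda>s. 0) s + F (\<lambda>s. 0) s)"
      using add[OF hchains_zero hchains_zero] by simp
    then show ?thesis by simp
  qed
  have FZ: "F f \<in> carrier ?Z" if "f \<in> carrier ?Z'" for f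
    using that F comm F0 by (auto simp: hcycles_def)
  have hom: "h \<in> hom ?Z' (?Z Mod ?B)"
  proof (rule homI)
    show "h f \<in> carrier (?Z Mod ?B)" if "f \<in> carrier ?Z'" for f
      using FZ[OF that] by (auto simp: h_def FactGroup_def RCOSETS_def)
    show "h (f \<otimes>\<^bsub>?Z'\<^esub> g) = h f \<otimes>\<^bsub>?Z Mod ?B\<^esub> h g" if "f \<in> carrier ?Z'" "g \<in> carrier ?Z'" for f g
    proof -
      have "F (f \<otimes>\<^bsub>?Z'\<^esub> g) = F f \<otimes>\<^bsub>?Z\<^esub> F g"
        using that add by (auto simp: hcycles_def)
      then show ?thesis
        using B.rcos_sum[OF FZ[OF that(1)] FZ[OF that(2)]] by (simp add: h_def FactGroup_def)
    qed
  qed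
  have gh: "group_hom ?Z' (?Z Mod ?B) h"
    using hom Z'.is_group B.factorgroup_is_group by (simp add: group_hom_def group_hom_axioms_def)
  have ker: "kernel ?Z' (?Z Mod ?B) h = ?B'"
  proof
    show "kernel ?Z' (?Z Mod ?B) h \<subseteq> ?B'"
    proof
      fix f assume f: "f \<in> kernel ?Z' (?Z Mod ?B) h"
      then have fZ: "f \<in> carrier ?Z'" and "?B #>\<^bsub>?Z\<^esub> F f = ?B"
        by (auto simp: kernel_def h_def FactGroup_def)
      then have "F f \<in> ?B"
        using Z.rcos_self[OF FZ[OF fZ] B.subgroup_axioms] by simp
      then show "f \<in> ?B'"
        using inj fZ by (auto simp: hcycles_def)
    qed
    show "?B' \<subseteq> kernel ?Z' (?Z Mod ?B) h"
    proof
      fix f assume "f \<in> ?B'"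
      then obtain g where g: "g \<in> hchains St'" "f = hdiff St' c' g" by blast
      then have fZ: "f \<in> carrier ?Z'" using hdiff_hdiff[OF c'] by (simp add: hcycles_def)
      have "F f = hdiff St c (F g)" using g comm by simp
      then have "F f \<in> ?B" using g F by blast
      then have "?B #>\<^bsub>?Z\<^esub> F f = ?B"
        using Z.coset_join2 FZ[OF fZ] B.subgroup_axioms by blast
      then show "f \<in> kernel ?Z' (?Z Mod ?B) h"
        using fZ by (simp add: kernel_def h_def FactGroup_def)
    qed
  qed
  have onto: "h ` carrier ?Z' = carrier (?Z Mod ?B)"
  proof
    show "h ` carrier ?Z' \<subseteq> carrier (?Z Mod ?B)"
      using hom by (auto simp: hom_def)
    show "carrier (?Z Mod ?B) \<subseteq> h ` carrier ?Z'"
    proof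
      fix x assume "x \<in> carrier (?Z Mod ?B)"
      then obtain z where z: "z \<in> carrier ?Z" "x = ?B #>\<^bsub>?Z\<^esub> z"
        by (auto simp: FactGroup_def RCOSETS_def)
      with surj obtain f u where fu: "f \<in> hchains St'" "u \<in> hchains St" "hdiff St' c' f = (\<lambda>s. 0)"
        "z = (\<lambda>s. F f s + hdiff St c u s)"
        by (fastforce simp: hcycles_def)
      then have fZ: "f \<in> carrier ?Z'" by (simp add: hcycles_def)
      have "z = hdiff St c u \<otimes>\<^bsub>?Z\<^esub> F f" using fu by (simp add: hcycles_def add.commute)
      then have "z \<in> ?B #>\<^bsub>?Z\<^esub> F f" using fu by (auto simp: r_coset_def)
      then have "x = h f"
        using z B.subgroup_axioms FZ[OF fZ] Z.repr_independence[of z ?B "F f"] by (auto simp: h_def)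
      then show "x \<in> h ` carrier ?Z'" using fZ by blast
    qed
  qed
  show ?thesis
    using group_hom.FactGroup_iso[OF gh onto] by (simp add: ker homology_def)
qed

lemma square_zero_bij:
  assumes b: "bij_betw \<phi> St St'" and eq: "\<And>s t. s \<in> St \<Longrightarrow> t \<in> St \<Longrightarrow> c s t = c' (\<phi> s) (\<phi> t)"
    and c: "square_zero St c"
  shows "square_zero St' c'"
proof -
  have im: "St' = \<phi> ` St" and inj: "inj_on \<phi> St" using b by (auto simp: bij_betw_def)
  show ?thesis
    unfolding square_zero_def im
    using c by (auto simp: square_zero_def sum.reindex[OF inj] eq)
qed

lemma homology_iso_bij:
  assumes b: "bij_betw \<phi> St St'" and eq: "\<And>s t. s \<in> St \<Longrightarrow> t \<in> St \<Longrightarrow> c s t = c' (\<phi> s) (\<phi> t)"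
    and c: "square_zero St c"
  shows "homology St' c' \<cong> homology St c"
proof -
  have im: "St' = \<phi> ` St" and inj: "inj_on \<phi> St" using b by (auto simp: bij_betw_def)
  define F where "F f = (\<lambda>s. if s \<in> St then f (\<phi> s) else (0::bit))" for f
  define G where "G f = (\<lambda>t. if t \<in> St' then f (inv_into St \<phi> t) else (0::bit))" for f
  have comm: "hdiff St c (F f) = F (hdiff St' c' f)" for f
    by (auto simp: hdiff_def F_def fun_eq_iff im sum.reindex[OF inj] eq intro!: sum.cong)
  have FG: "F (G f) = f" if "f \<in> hchains St" for f
    using that inj by (auto simp: F_def G_def fun_eq_iff hchains_def im)
  have GF: "G (F f) = f" if "f \<in> hchains St'" for f
    using that by (auto simp: F_def G_def fun_eq_iff hchains_def im f_inv_into_f inv_into_into)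
  have Gc: "G f \<in> hchains St'" for f by (auto simp: G_def hchains_def)
  have Fc: "F f \<in> hchains St" for f by (auto simp: F_def hchains_def)
  show ?thesis
  proof (rule homology_iso_chain_map[OF c square_zero_bij[OF b eq c], where F = F])
    fix f g assume f: "f \<in> hchains St'" and g: "g \<in> hchains St" and fg: "F f = hdiff St c g"
    have "F f = F (hdiff St' c' (G g))" using fg comm[of "G g"] FG[OF g] by simp
    then have "f = hdiff St' c' (G g)" using GF f by (metis hdiff_in_hchains)
    then show "f \<in> hdiff St' c' ` hchains St'" using Gc by blast
  next
    fix z assume z: "z \<in> hchains St" and dz: "hdiff St c z = (\<lambda>s. 0)"
    have "F (hdiff St' c' (G z)) = (\<lambda>s. 0)" using comm[of "G z"] FG[OF z] dz by simp
    then have "hdiff St' c' (G z) = G (\<lambda>s. 0)" using GF by (metis hdiff_in_hchains)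
    then have "hdiff St' c' (G z) = (\<lambda>s. 0)" by (simp add: G_def fun_eq_iff)
    then show "\<exists>f\<in>hchains St'. \<exists>u\<in>hchains St. hdiff St' c' f = (\<lambda>s. 0) \<and> z = (\<lambda>s. F f s + hdiff St c u s)"
      using Gc FG[OF z] by (intro bexI[of _ "G z"] bexI[of _ "\<lambda>s. 0"]) auto
  qed (auto simp: Fc comm, auto simp: F_def fun_eq_iff)
qed

text \<open>Gaussian elimination: basis elements \<open>\<alpha> i\<close> and \<open>\<beta>
  i\<close> joined by an invertible part of the differential can be dropped. The new coefficient
  adds the zigzags from \<open>s\<close> back along the arrow \<open>\<alpha> i \<rightarrow>
  \<beta> i\<close> to \<open>t\<close>. The quotient map is inverted up to homotopy by adding to a
  chain the multiples of the \<open>\<alpha> i\<close> that kill its differential on the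
  \<open>\<beta> i\<close>.\<close>

lemma cancellation:
  fixes c :: "'s \<Rightarrow> 's \<Rightarrow> bit"
  assumes c: "square_zero St c"
    and \<alpha>: "inj_on \<alpha> I" and \<beta>: "inj_on \<beta> I"
    and St: "St = \<alpha> ` I \<union> \<beta> ` I \<union> C" and disj: "\<alpha> ` I \<inter> \<beta> ` I = {}" "\<alpha> ` I \<inter> C = {}" "\<beta> ` I \<inter> C = {}"
    and unit: "\<And>i k. i \<in> I \<Longrightarrow> k \<in> I \<Longrightarrow> c (\<alpha> i) (\<beta> k) = (if i = k then 1 else 0)"
  defines "c' \<equiv> \<lambda>s t. c s t + (\<Sum>i\<in>I. c s (\<beta> i) * c (\<alpha> i) t)"
  shows "square_zero C c'" and "homology C c' \<cong> homology St c"
proof -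
  have fin: "finite St" using c by (simp add: square_zero_def)
  have finI: "finite I" using fin St \<alpha> by (metis finite_Un finite_imageD)
  have finC: "finite C" using fin St by auto
  have split: "(\<Sum>s\<in>St. g s) = (\<Sum>i\<in>I. g (\<alpha> i)) + (\<Sum>i\<in>I. g (\<beta> i)) + (\<Sum>s\<in>C. g s)" for g :: "'s \<Rightarrow> bit"
  proof -
    have "(\<Sum>s\<in>St. g s) = (\<Sum>s\<in>\<alpha> ` I. g s) + (\<Sum>s\<in>\<beta> ` I. g s) + (\<Sum>s\<in>C. g s)"
      unfolding St using disj finI finC by (subst sum.union_disjoint; (subst sum.union_disjoint)?; auto)
    then show ?thesis using \<alpha> \<beta> by (simp add: sum.reindex)
  qed
  \<comment> \<open>the chains whose differential has no component on the targets\<close>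
  define \<iota> where "\<iota> f = (\<lambda>s. if s \<in> C then f s else if s \<in> \<alpha> ` I then
     (\<Sum>t\<in>C. c t (\<beta> (the_inv_into I \<alpha> s)) * f t) else (0::bit))" for f
  have \<iota>C: "\<iota> f s = f s" if "s \<in> C" for f s using that by (simp add: \<iota>_def)
  have \<iota>\<alpha>: "\<iota> f (\<alpha> i) = (\<Sum>t\<in>C. c t (\<beta> i) * f t)" if "i \<in> I" for f i
    using that disj \<alpha> by (auto simp: \<iota>_def the_inv_into_f_f)
  have \<iota>\<beta>: "\<iota> f (\<beta> i) = 0" if "i \<in> I" for f i
    using that disj by (auto simp: \<iota>_def)
  have \<iota>ch: "\<iota> f \<in> hchains St" for f using St by (auto simp: \<iota>_def hchains_def)
  have d\<beta>: "hdiff St c g (\<beta> k) = g (\<alpha> k) + (\<Sum>i\<in>I. c (\<beta> i) (\<beta> k) * g (\<beta> i)) + (\<Sum>s\<in>C. c s (\<beta> k) * g s)"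
    if "k \<in> I" for g k
  proof -
    have "\<beta> k \<in> St" using that St by auto
    then have "hdiff St c g (\<beta> k) = (\<Sum>i\<in>I. c (\<alpha> i) (\<beta> k) * g (\<alpha> i))
        + (\<Sum>i\<in>I. c (\<beta> i) (\<beta> k) * g (\<beta> i)) + (\<Sum>s\<in>C. c s (\<beta> k) * g s)"
      by (simp add: hdiff_def split)
    also have "(\<Sum>i\<in>I. c (\<alpha> i) (\<beta> k) * g (\<alpha> i)) = (\<Sum>i\<in>I. if i = k then g (\<alpha> i) else 0)"
      using that unit by (intro sum.cong) auto
    also have "\<dots> = g (\<alpha> k)" using that finI by (simp add: sum.delta')
    finally show ?thesis .
  qed
  have norm: "g = \<iota> g" if g: "g \<in> hchains St" and b: "\<And>i. i \<in> I \<Longrightarrow> g (\<beta> i) = 0"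
    and d: "\<And>i. i \<in> I \<Longrightarrow> hdiff St c g (\<beta> i) = 0" for g
  proof
    fix s
    consider "s \<in> C" | i where "i \<in> I" "s = \<alpha> i" | i where "i \<in> I" "s = \<beta> i" | "s \<notin> St"
      using St by auto
    then show "g s = \<iota> g s"
    proof cases
      case 2
      then have "0 = g (\<alpha> i) + (\<Sum>t\<in>C. c t (\<beta> i) * g t)"
        using d[of i] d\<beta>[of i g] b by simp
      then show ?thesis using 2 by (metis \<iota>\<alpha> bit_add_eq_0_iff)
    qed (use g b \<iota>C \<iota>\<beta> \<iota>ch in \<open>auto simp: hchains_def\<close>)
  qed
  have d\<iota>\<beta>: "hdiff St c (\<iota> f) (\<beta> k) = 0" if "k \<in> I" for f k
    using that by (simp add: d\<beta> \<iota>\<alpha> \<iota>\<beta> \<iota>C cong: sum.cong)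
  have d\<iota>C: "hdiff St c (\<iota> f) t = hdiff C c' f t" if "t \<in> C" for f t
  proof -
    have "hdiff St c (\<iota> f) t = (\<Sum>i\<in>I. c (\<alpha> i) t * (\<Sum>s\<in>C. c s (\<beta> i) * f s)) + (\<Sum>s\<in>C. c s t * f s)"
    proof -
      have "t \<in> St" using that unfolding St by blast
      then have "hdiff St c (\<iota> f) t = (\<Sum>i\<in>I. c (\<alpha> i) t * \<iota> f (\<alpha> i)) + (\<Sum>i\<in>I. c (\<beta> i) t * \<iota> f (\<beta> i))
          + (\<Sum>s\<in>C. c s t * \<iota> f s)"
        by (simp only: hdiff_def split if_True)
      moreover have "(\<Sum>i\<in>I. c (\<alpha> i) t * \<iota> f (\<alpha> i)) = (\<Sum>i\<in>I. c (\<alpha> i) t * (\<Sum>s\<in>C. c s (\<beta> i) * f s))"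
        by (rule sum.cong) (simp_all add: \<iota>\<alpha>)
      moreover have "(\<Sum>i\<in>I. c (\<beta> i) t * \<iota> f (\<beta> i)) = 0"
        by (rule sum.neutral) (simp add: \<iota>\<beta>)
      moreover have "(\<Sum>s\<in>C. c s t * \<iota> f s) = (\<Sum>s\<in>C. c s t * f s)"
        by (rule sum.cong) (simp_all add: \<iota>C)
      ultimately show ?thesis by simp
    qed
    also have "(\<Sum>i\<in>I. c (\<alpha> i) t * (\<Sum>s\<in>C. c s (\<beta> i) * f s)) = (\<Sum>s\<in>C. (\<Sum>i\<in>I. c s (\<beta> i) * c (\<alpha> i) t) * f s)"
      by (simp add: sum_distrib_left sum_distrib_right mult_ac) (rule sum.swap)
    finally show ?thesis
      using that by (simp add: hdiff_def c'_def sum.distrib distrib_right add.commute)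
  qed
  have \<iota>cong: "\<iota> f = \<iota> g" if "\<And>s. s \<in> C \<Longrightarrow> f s = g s" for f g
    using that by (auto simp: \<iota>_def fun_eq_iff intro!: sum.cong)
  have comm: "hdiff St c (\<iota> f) = \<iota> (hdiff C c' f)" for f
  proof -
    have "hdiff St c (\<iota> f) = \<iota> (hdiff St c (\<iota> f))"
      by (rule norm) (auto simp: d\<iota>\<beta> hdiff_hdiff[OF c])
    also have "\<dots> = \<iota> (hdiff C c' f)"
      by (rule \<iota>cong) (rule d\<iota>C)
    finally show ?thesis .
  qed
  have \<iota>inj: "f = g" if "f \<in> hchains C" "g \<in> hchains C" "\<iota> f = \<iota> g" for f g
  proof
    fix s show "f s = g s"
      using that \<iota>C[of s f] \<iota>C[of s g] by (cases "s \<in> C") (auto simp: hchains_def)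
  qed
  have \<iota>0: "\<iota> (\<lambda>s. 0) = (\<lambda>s. 0)" by (auto simp: \<iota>_def)
  show c'0: "square_zero C c'"
  proof (rule square_zeroI_hdiff[OF finC])
    fix f assume "f \<in> hchains C"
    have "\<iota> (hdiff C c' (hdiff C c' f)) = \<iota> (\<lambda>s. 0)"
      using hdiff_hdiff[OF c, of "\<iota> f"] by (simp add: comm \<iota>0)
    then show "hdiff C c' (hdiff C c' f) = (\<lambda>s. 0)" by (rule \<iota>inj[OF hdiff_in_hchains hchains_zero])
  qed
  \<comment> \<open>every chain is homologous to one that vanishes on the targets\<close>
  have kill: "\<exists>u\<in>hchains St. \<forall>i\<in>I. z (\<beta> i) = hdiff St c u (\<beta> i)" for z
  proof -
    define u where "u = (\<lambda>s. if s \<in> \<alpha> ` I then z (\<beta> (the_inv_into I \<alpha> s)) else 0)"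
    have "u \<in> hchains St" using St by (auto simp: hchains_def u_def)
    moreover have "hdiff St c u (\<beta> k) = z (\<beta> k)" if "k \<in> I" for k
    proof -
      have u0: "u (\<beta> i) = 0" if "i \<in> I" for i using that disj by (auto simp: u_def)
      have uC: "u s = 0" if "s \<in> C" for s using that disj by (auto simp: u_def)
      have "u (\<alpha> k) = z (\<beta> k)" using that \<alpha> by (simp add: u_def the_inv_into_f_f)
      then show ?thesis by (simp add: d\<beta>[OF that] u0 uC)
    qed
    ultimately show ?thesis by force
  qed
  have rep: "\<exists>f\<in>hchains C. \<exists>u\<in>hchains St. z = (\<lambda>s. \<iota> f s + hdiff St c u s)"
    if z: "z \<in> hchains St" and dz: "\<And>i. i \<in> I \<Longrightarrow> hdiff St c z (\<beta> i) = 0" for z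
  proof -
    obtain u where u: "u \<in> hchains St" "\<forall>i\<in>I. z (\<beta> i) = hdiff St c u (\<beta> i)" using kill by blast
    define y where "y = (\<lambda>s. z s + hdiff St c u s)"
    have "y = \<iota> y"
      using z u dz by (intro norm) (auto simp: y_def hchains_add hdiff_add hdiff_hdiff[OF c])
    also have "\<iota> y = \<iota> (\<lambda>s. if s \<in> C then y s else 0)" by (rule \<iota>cong) simp
    finally have y: "y = \<iota> (\<lambda>s. if s \<in> C then y s else 0)" .
    have "z = (\<lambda>s. y s + hdiff St c u s)" by (simp add: y_def add.assoc)
    then have "z = (\<lambda>s. \<iota> (\<lambda>s. if s \<in> C then y s else 0) s + hdiff St c u s)" by (subst (asm) y)
    moreover have "(\<lambda>s. if s \<in> C then y s else 0) \<in> hchains C" by (simp add: hchains_def)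
    ultimately show ?thesis using u(1) by blast
  qed
  have d\<iota>u: "hdiff St c (\<lambda>s. \<iota> h s + hdiff St c u s) = \<iota> (hdiff C c' h)" for h u
    by (simp add: hdiff_add hdiff_hdiff[OF c] comm)
  show "homology C c' \<cong> homology St c"
  proof (rule homology_iso_chain_map[OF c c'0, where F = \<iota>])
    show "\<iota> (\<lambda>s. f s + g s) = (\<lambda>s. \<iota> f s + \<iota> g s)" for f g
      by (auto simp: \<iota>_def fun_eq_iff sum.distrib distrib_left)
  next
    fix f g assume f: "f \<in> hchains C" and g: "g \<in> hchains St" and fg: "\<iota> f = hdiff St c g"
    have "hdiff St c g (\<beta> i) = 0" if "i \<in> I" for i
      using \<iota>\<beta>[OF that, of f] fg by simp
    from rep[OF g this] obtain h u where h: "h \<in> hchains C" "g = (\<lambda>s. \<iota> h s + hdiff St c u s)"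
      by blast
    then have "hdiff St c g = \<iota> (hdiff C c' h)" using d\<iota>u by blast
    then have "f = hdiff C c' h" using \<iota>inj[OF f hdiff_in_hchains[of C c' h]] fg by simp
    then show "f \<in> hdiff C c' ` hchains C" using h by blast
  next
    fix z assume z: "z \<in> hchains St" and dz: "hdiff St c z = (\<lambda>s. 0)"
    have "hdiff St c z (\<beta> i) = 0" for i using dz by simp
    from rep[OF z this] obtain f u
      where fu: "f \<in> hchains C" "u \<in> hchains St" "z = (\<lambda>s. \<iota> f s + hdiff St c u s)"
      by blast
    then have "\<iota> (hdiff C c' f) = \<iota> (\<lambda>s. 0)"
      using dz d\<iota>u[of f u] \<iota>0 by argo
    then have "hdiff C c' f = (\<lambda>s. 0)" using \<iota>inj[OF hdiff_in_hchains hchains_zero] by simp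
    then show "\<exists>f\<in>hchains C. \<exists>u\<in>hchains St. hdiff C c' f = (\<lambda>s. 0) \<and> z = (\<lambda>s. \<iota> f s + hdiff St c u s)"
      using fu by blast
  qed (auto simp: \<iota>ch comm)
qed

section \<open>Coefficients of saddles\<close>

text \<open>A label for circles of any type: after a move the circles are compared as sets of nodes
  of another diagram.\<close>

definition lab :: "'c set \<Rightarrow> 'c \<Rightarrow> gen" where
  "lab S C = (if C \<in> S then Ax else A1)"

lemma label_lab: "label = lab"
  by (simp add: fun_eq_iff label_def lab_def)

text \<open>The coefficient of a saddle depends only on the two families of circles and on their
  labels. Separating it from the diagram lets it be transported along bijections of circles.\<close>

definition pcoef :: "'c set \<Rightarrow> 'c set \<Rightarrow> 'c set \<Rightarrow> 'c set \<Rightarrow> bit" where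
  "pcoef CP S CQ T =
     (if \<exists>C \<in> CP \<inter> CQ. lab S C \<noteq> lab T C then 0
      else if \<exists>a b c. a \<noteq> b \<and> CP - CQ = {a, b} \<and> CQ - CP = {c} \<and>
                m_coeff (lab S a) (lab S b) (lab T c) = 1 then 1
      else if \<exists>a b c. b \<noteq> c \<and> CP - CQ = {a} \<and> CQ - CP = {b, c} \<and>
                \<Delta>_coeff (lab S a) (lab T b) (lab T c) = 1 then 1
      else 0)"

lemma edge_coeff_pcoef:
  "edge_coeff D (v, S) (w, T) =
     (if \<exists>j \<in> crossings D - v. w = insert j v then pcoef (circles D v) S (circles D w) T else 0)"
  unfolding edge_coeff_def label_lab pcoef_def Let_def prod.case by (cases "\<exists>j \<in> crossings D - v. w = insert j v") (simp_all only: not_True_eq_False not_False_eq_True simp_thms if_True if_False)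

lemma lab_eq_iff: "lab S C = lab T C' \<longleftrightarrow> (C \<in> S \<longleftrightarrow> C' \<in> T)"
  by (auto simp: lab_def)

lemma m_coeff_comm: "m_coeff a b c = m_coeff b a c"
  by (cases a; cases b) auto

lemma \<Delta>_coeff_comm: "\<Delta>_coeff a b c = \<Delta>_coeff a c b"
  by (cases a) auto

lemma bit_if_1: "(if x = 1 then 1 else 0) = (x::bit)"
  by (cases x) auto

lemma pcoef_merge:
  assumes CP: "CP = insert A (insert B R)" and CQ: "CQ = insert M R" and
    ne: "A \<noteq> B" "A \<notin> R" "B \<notin> R" "M \<notin> R" "M \<noteq> A" "M \<noteq> B"
  shows "pcoef CP S CQ T =
    (if \<forall>C\<in>R. C \<in> S \<longleftrightarrow> C \<in> T then m_coeff (lab S A) (lab S B) (lab T M) else 0)"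
proof -
  have i: "CP \<inter> CQ = R" and d: "CP - CQ = {A, B}" "CQ - CP = {M}" using ne by (auto simp: CP CQ)
  have 1: "(\<exists>a b c. a \<noteq> b \<and> {A, B} = {a, b} \<and> {M} = {c} \<and> m_coeff (lab S a) (lab S b) (lab T c) = 1)
      \<longleftrightarrow> m_coeff (lab S A) (lab S B) (lab T M) = 1"
    using ne(1) by (auto simp: doubleton_eq_iff m_coeff_comm)
  have 2: "\<not> (\<exists>a b c. b \<noteq> c \<and> {A, B} = {a} \<and> {M} = {b, c} \<and> \<Delta>_coeff (lab S a) (lab T b) (lab T c) = 1)"
    using ne(1) by auto
  show ?thesis
    unfolding pcoef_def i d 1 using 2 by (auto simp: lab_eq_iff bit_if_1)
qed

lemma pcoef_split:
  assumes CP: "CP = insert M R" and CQ: "CQ = insert A (insert B R)" and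
    ne: "A \<noteq> B" "A \<notin> R" "B \<notin> R" "M \<notin> R" "M \<noteq> A" "M \<noteq> B"
  shows "pcoef CP S CQ T =
    (if \<forall>C\<in>R. C \<in> S \<longleftrightarrow> C \<in> T then \<Delta>_coeff (lab S M) (lab T A) (lab T B) else 0)"
proof -
  have i: "CP \<inter> CQ = R" and d: "CP - CQ = {M}" "CQ - CP = {A, B}" using ne by (auto simp: CP CQ)
  have 1: "(\<exists>a b c. b \<noteq> c \<and> {M} = {a} \<and> {A, B} = {b, c} \<and> \<Delta>_coeff (lab S a) (lab T b) (lab T c) = 1)
      \<longleftrightarrow> \<Delta>_coeff (lab S M) (lab T A) (lab T B) = 1"
    using ne(1) by (auto simp: doubleton_eq_iff \<Delta>_coeff_comm)
  have 2: "\<not> (\<exists>a b c. a \<noteq> b \<and> {M} = {a, b} \<and> {A, B} = {c} \<and> m_coeff (lab S a) (lab S b) (lab T c) = 1)"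
    using ne(1) by auto
  show ?thesis
    unfolding pcoef_def i d 1 using 2 by (auto simp: lab_eq_iff bit_if_1)
qed

text \<open>The transport principle behind all comparisons of diagrams. The map has to be injective
  on the circles of both ends together, because \<open>pcoef\<close> compares the two
  families.\<close>

lemma pcoef_image:
  assumes inj: "inj_on \<beta> (CP \<union> CQ)" and S: "S \<subseteq> CP" and T: "T \<subseteq> CQ"
  shows "pcoef (\<beta> ` CP) (\<beta> ` S) (\<beta> ` CQ) (\<beta> ` T) = pcoef CP S CQ T"
proof -
  have lS: "lab (\<beta> ` S) (\<beta> C) = lab S C" if "C \<in> CP \<union> CQ" for C
    using inj S that by (auto simp: lab_def inj_on_def)
  have lT: "lab (\<beta> ` T) (\<beta> C) = lab T C" if "C \<in> CP \<union> CQ" for C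
    using inj T that by (auto simp: lab_def inj_on_def)
  have i: "\<beta> ` CP \<inter> \<beta> ` CQ = \<beta> ` (CP \<inter> CQ)"
    using inj by (auto simp: inj_on_def)
  have d1: "\<beta> ` CP - \<beta> ` CQ = \<beta> ` (CP - CQ)" and d2: "\<beta> ` CQ - \<beta> ` CP = \<beta> ` (CQ - CP)"
    using inj by (auto simp: inj_on_def)
  have two: "(\<beta> ` Z = {a, b} \<and> a \<noteq> b) \<longleftrightarrow> (\<exists>a' b'. Z = {a', b'} \<and> a' \<noteq> b' \<and> a = \<beta> a' \<and> b = \<beta> b')"
    if Z: "Z \<subseteq> CP \<union> CQ" for Z a b
  proof
    assume *: "\<beta> ` Z = {a, b} \<and> a \<noteq> b"
    then obtain a' b' where ab: "a' \<in> Z" "b' \<in> Z" "a = \<beta> a'" "b = \<beta> b'" by (metis imageE insertI1 insertI2)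
    have "z = a' \<or> z = b'" if z: "z \<in> Z" for z
    proof -
      have "\<beta> z = a \<or> \<beta> z = b" using * z by blast
      then show ?thesis using inj Z ab z by (metis inj_onD subsetD)
    qed
    then show "\<exists>a' b'. Z = {a', b'} \<and> a' \<noteq> b' \<and> a = \<beta> a' \<and> b = \<beta> b'" using ab * by blast
  next
    assume "\<exists>a' b'. Z = {a', b'} \<and> a' \<noteq> b' \<and> a = \<beta> a' \<and> b = \<beta> b'"
    then show "\<beta> ` Z = {a, b} \<and> a \<noteq> b" using inj Z by (auto simp: inj_on_def)
  qed
  have one: "\<beta> ` Z = {c} \<longleftrightarrow> (\<exists>c'. Z = {c'} \<and> c = \<beta> c')" if Z: "Z \<subseteq> CP \<union> CQ" for Z c
  proof
    assume *: "\<beta> ` Z = {c}"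
    then obtain c' where c': "c' \<in> Z" "c = \<beta> c'" by blast
    have "z = c'" if z: "z \<in> Z" for z
    proof -
      have "\<beta> z = \<beta> c'" using * z c' by blast
      then show ?thesis using inj_onD[OF inj] z c'(1) Z by blast
    qed
    then show "\<exists>c'. Z = {c'} \<and> c = \<beta> c'" using c' by blast
  qed auto
  have A: "(\<exists>C \<in> \<beta> ` (CP \<inter> CQ). lab (\<beta> ` S) C \<noteq> lab (\<beta> ` T) C) \<longleftrightarrow> (\<exists>C \<in> CP \<inter> CQ. lab S C \<noteq> lab T C)"
    using lS lT by auto
  have B: "(\<exists>a b c. a \<noteq> b \<and> \<beta> ` (CP - CQ) = {a, b} \<and> \<beta> ` (CQ - CP) = {c} \<and>
       m_coeff (lab (\<beta> ` S) a) (lab (\<beta> ` S) b) (lab (\<beta> ` T) c) = 1) \<longleftrightarrow>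
     (\<exists>a b c. a \<noteq> b \<and> CP - CQ = {a, b} \<and> CQ - CP = {c} \<and> m_coeff (lab S a) (lab S b) (lab T c) = 1)"
    (is "?l \<longleftrightarrow> ?r")
  proof
    assume ?l
    then obtain a b c where h: "\<beta> ` (CP - CQ) = {a, b} \<and> a \<noteq> b" "\<beta> ` (CQ - CP) = {c}"
      "m_coeff (lab (\<beta> ` S) a) (lab (\<beta> ` S) b) (lab (\<beta> ` T) c) = 1"
      by (elim exE conjE) (rule that, simp_all)
    have "\<exists>a' b'. CP - CQ = {a', b'} \<and> a' \<noteq> b' \<and> a = \<beta> a' \<and> b = \<beta> b'"
      using h(1) two[of "CP - CQ" a b] by blast
    then obtain a' b' where ab: "CP - CQ = {a', b'}" "a' \<noteq> b'" "a = \<beta> a'" "b = \<beta> b'" by blast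
    have "\<exists>c'. CQ - CP = {c'} \<and> c = \<beta> c'" using h(2) one[of "CQ - CP" c] by blast
    then obtain c' where c: "CQ - CP = {c'}" "c = \<beta> c'" by blast
    have "a' \<in> CP \<union> CQ" "b' \<in> CP \<union> CQ" "c' \<in> CP \<union> CQ" using ab c by blast+
    then have "m_coeff (lab S a') (lab S b') (lab T c') = 1" using h(3) ab c lS lT by simp
    then show ?r using ab c by blast
  next
    assume ?r
    then obtain a b c where h: "a \<noteq> b" "CP - CQ = {a, b}" "CQ - CP = {c}"
      "m_coeff (lab S a) (lab S b) (lab T c) = 1"
      by (elim exE conjE) (rule that, simp_all)
    have "a \<in> CP - CQ" "b \<in> CP - CQ" "c \<in> CQ - CP" unfolding h(2,3) by simp_all
    then have m: "a \<in> CP \<union> CQ" "b \<in> CP \<union> CQ" "c \<in> CP \<union> CQ" by simp_all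
    then have "\<beta> a \<noteq> \<beta> b" using h(1) inj by (auto dest: inj_onD)
    moreover have "lab (\<beta> ` S) (\<beta> a) = lab S a" "lab (\<beta> ` S) (\<beta> b) = lab S b"
      "lab (\<beta> ` T) (\<beta> c) = lab T c" "lab (\<beta> ` T) (\<beta> b) = lab T b"
      using lS lT m by blast+
    ultimately show ?l using h(2-4)
      by (intro exI[of _ "\<beta> a"] exI[of _ "\<beta> b"] exI[of _ "\<beta> c"]) simp
  qed
  have C: "(\<exists>a b c. b \<noteq> c \<and> \<beta> ` (CP - CQ) = {a} \<and> \<beta> ` (CQ - CP) = {b, c} \<and>
       \<Delta>_coeff (lab (\<beta> ` S) a) (lab (\<beta> ` T) b) (lab (\<beta> ` T) c) = 1) \<longleftrightarrow>
     (\<exists>a b c. b \<noteq> c \<and> CP - CQ = {a} \<and> CQ - CP = {b, c} \<and> \<Delta>_coeff (lab S a) (lab T b) (lab T c) = 1)"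
    (is "?l \<longleftrightarrow> ?r")
  proof
    assume ?l
    then obtain a b c where h: "\<beta> ` (CP - CQ) = {a}" "\<beta> ` (CQ - CP) = {b, c} \<and> b \<noteq> c"
      "\<Delta>_coeff (lab (\<beta> ` S) a) (lab (\<beta> ` T) b) (lab (\<beta> ` T) c) = 1"
      by (elim exE conjE) (rule that, simp_all)
    have "\<exists>a' b'. CQ - CP = {a', b'} \<and> a' \<noteq> b' \<and> b = \<beta> a' \<and> c = \<beta> b'"
      using h(2) two[of "CQ - CP" b c] by blast
    then obtain b' c' where bc: "CQ - CP = {b', c'}" "b' \<noteq> c'" "b = \<beta> b'" "c = \<beta> c'" by blast
    have "\<exists>c'. CP - CQ = {c'} \<and> a = \<beta> c'" using h(1) one[of "CP - CQ" a] by blast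
    then obtain a' where a: "CP - CQ = {a'}" "a = \<beta> a'" by blast
    have "a' \<in> CP \<union> CQ" "b' \<in> CP \<union> CQ" "c' \<in> CP \<union> CQ" using a bc by blast+
    then have "\<Delta>_coeff (lab S a') (lab T b') (lab T c') = 1" using h(3) a bc lS lT by simp
    then show ?r using a bc by blast
  next
    assume ?r
    then obtain a b c where h: "b \<noteq> c" "CP - CQ = {a}" "CQ - CP = {b, c}"
      "\<Delta>_coeff (lab S a) (lab T b) (lab T c) = 1"
      by (elim exE conjE) (rule that, simp_all)
    have "a \<in> CP - CQ" "b \<in> CQ - CP" "c \<in> CQ - CP" unfolding h(2,3) by simp_all
    then have m: "a \<in> CP \<union> CQ" "b \<in> CP \<union> CQ" "c \<in> CP \<union> CQ" by simp_all
    then have "\<beta> b \<noteq> \<beta> c" using h(1) inj by (auto dest: inj_onD)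
    moreover have "lab (\<beta> ` S) (\<beta> a) = lab S a" "lab (\<beta> ` S) (\<beta> b) = lab S b"
      "lab (\<beta> ` T) (\<beta> c) = lab T c" "lab (\<beta> ` T) (\<beta> b) = lab T b"
      using lS lT m by blast+
    ultimately show ?l using h(2-4)
      by (intro exI[of _ "\<beta> a"] exI[of _ "\<beta> b"] exI[of _ "\<beta> c"]) simp
  qed
  show ?thesis unfolding pcoef_def i d1 d2 A B C ..
qed

text \<open>A circle that is far from the saddle keeps its label, so that the identity on its tensor
  factor splits off.\<close>

lemma pcoef_drop:
  assumes Z: "Z \<in> CP" "Z \<in> CQ"
  shows "pcoef CP S CQ T =
    (if Z \<in> S \<longleftrightarrow> Z \<in> T then pcoef (CP - {Z}) (S - {Z}) (CQ - {Z}) (T - {Z}) else 0)"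
proof -
  have d: "(CP - {Z}) - (CQ - {Z}) = CP - CQ" "(CQ - {Z}) - (CP - {Z}) = CQ - CP" using Z by auto
  have l: "lab (S - {Z}) C = lab S C" "lab (T - {Z}) C = lab T C" if "C \<noteq> Z" for C
    using that by (auto simp: lab_def)
  have i: "(\<exists>C \<in> (CP - {Z}) \<inter> (CQ - {Z}). lab (S - {Z}) C \<noteq> lab (T - {Z}) C) \<longleftrightarrow>
      (\<exists>C \<in> CP \<inter> CQ - {Z}. lab S C \<noteq> lab T C)"
    using l by auto
  have m: "(\<exists>a b c. a \<noteq> b \<and> CP - CQ = {a, b} \<and> CQ - CP = {c} \<and>
      m_coeff (lab (S - {Z}) a) (lab (S - {Z}) b) (lab (T - {Z}) c) = 1) \<longleftrightarrow>
     (\<exists>a b c. a \<noteq> b \<and> CP - CQ = {a, b} \<and> CQ - CP = {c} \<and>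
      m_coeff (lab S a) (lab S b) (lab T c) = 1)"
  proof -
    have "m_coeff (lab (S - {Z}) a) (lab (S - {Z}) b) (lab (T - {Z}) c) =
        m_coeff (lab S a) (lab S b) (lab T c)" if "CP - CQ = {a, b}" "CQ - CP = {c}" for a b c
    proof -
      have "a \<noteq> Z" "b \<noteq> Z" "c \<noteq> Z" using that Z by auto
      then show ?thesis using l by simp
    qed
    then show ?thesis by metis
  qed
  have s: "(\<exists>a b c. b \<noteq> c \<and> CP - CQ = {a} \<and> CQ - CP = {b, c} \<and>
      \<Delta>_coeff (lab (S - {Z}) a) (lab (T - {Z}) b) (lab (T - {Z}) c) = 1) \<longleftrightarrow>
     (\<exists>a b c. b \<noteq> c \<and> CP - CQ = {a} \<and> CQ - CP = {b, c} \<and>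
      \<Delta>_coeff (lab S a) (lab T b) (lab T c) = 1)"
  proof -
    have "\<Delta>_coeff (lab (S - {Z}) a) (lab (T - {Z}) b) (lab (T - {Z}) c) =
        \<Delta>_coeff (lab S a) (lab T b) (lab T c)" if "CP - CQ = {a}" "CQ - CP = {b, c}" for a b c
    proof -
      have "a \<noteq> Z" "b \<noteq> Z" "c \<noteq> Z" using that Z by auto
      then show ?thesis using l by simp
    qed
    then show ?thesis by metis
  qed
  show ?thesis
  proof (cases "Z \<in> S \<longleftrightarrow> Z \<in> T")
    case True
    then have "(\<exists>C \<in> CP \<inter> CQ - {Z}. lab S C \<noteq> lab T C) \<longleftrightarrow> (\<exists>C \<in> CP \<inter> CQ. lab S C \<noteq> lab T C)"
      by (auto simp: lab_eq_iff)
    then show ?thesis using True unfolding pcoef_def d i m s by simp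
  next
    case False
    then have "\<exists>C \<in> CP \<inter> CQ. lab S C \<noteq> lab T C" using Z by (auto simp: lab_eq_iff)
    then show ?thesis using False by (simp add: pcoef_def)
  qed
qed


section \<open>Merging two classes of an equivalence relation\<close>

definition mrg :: "('a \<times> 'a) set \<Rightarrow> 'a \<Rightarrow> 'a \<Rightarrow> ('a \<times> 'a) set" where
  "mrg R a b = R \<union> R `` {a} \<times> R `` {b} \<union> R `` {b} \<times> R `` {a}"

lemma mrg_iff: "(x, y) \<in> mrg R a b \<longleftrightarrow> (x, y) \<in> R \<or> (a, x) \<in> R \<and> (b, y) \<in> R \<or> (b, x) \<in> R \<and> (a, y) \<in> R"
  by (auto simp: mrg_def)

lemma mrg_comm: "mrg R a b = mrg R b a"
  by (auto simp: mrg_def)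

lemma equivUD:
  assumes "equiv UNIV R"
  shows "(x, x) \<in> R" "(x, y) \<in> R \<Longrightarrow> (y, x) \<in> R" "(x, y) \<in> R \<Longrightarrow> (y, z) \<in> R \<Longrightarrow> (x, z) \<in> R"
  using assms by (auto simp: equiv_def refl_on_def dest: symD transD)

lemma equivUI:
  assumes "\<And>x. (x, x) \<in> R" "\<And>x y. (x, y) \<in> R \<Longrightarrow> (y, x) \<in> R"
    "\<And>x y z. (x, y) \<in> R \<Longrightarrow> (y, z) \<in> R \<Longrightarrow> (x, z) \<in> R"
  shows "equiv UNIV R"
proof (rule equivI)
  show "trans R" using assms(3) by (rule transI)
  show "sym R" using assms(2) by (rule symI)
qed (auto simp: refl_on_def assms(1))

lemma equiv_mrg: 
  assumes R: "equiv UNIV R" shows "equiv UNIV (mrg R a b)"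
proof (rule equivUI)
  note E = equivUD[OF R]
  show "(x, x) \<in> mrg R a b" for x using E(1) by (simp add: mrg_iff)
  show "(x, y) \<in> mrg R a b \<Longrightarrow> (y, x) \<in> mrg R a b" for x y unfolding mrg_iff using E by blast
  show "(x, y) \<in> mrg R a b \<Longrightarrow> (y, z) \<in> mrg R a b \<Longrightarrow> (x, z) \<in> mrg R a b" for x y z
    unfolding mrg_iff by (elim disjE conjE) (use E in blast)+
qed

lemma class_eq_iff: "equiv UNIV R \<Longrightarrow> R `` {x} = R `` {y} \<longleftrightarrow> (x, y) \<in> R"
  using eq_equiv_class_iff[of UNIV R x y] by simp

lemma class_mem: "equiv UNIV R \<Longrightarrow> C \<in> N // R \<Longrightarrow> x \<in> C \<Longrightarrow> C = R `` {x}"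
  by (auto simp: quotient_def dest: equivUD)

lemma class_disjoint: "equiv UNIV R \<Longrightarrow> C \<in> N // R \<Longrightarrow> C' \<in> N // R \<Longrightarrow> C \<noteq> C' \<Longrightarrow> C \<inter> C' = {}"
  using class_mem[of R C N] class_mem[of R C' N] by blast

lemma class_nonempty: "equiv UNIV R \<Longrightarrow> C \<in> N // R \<Longrightarrow> C \<noteq> {}"
  by (auto simp: quotient_def dest: equivUD(1))

lemma mrg_class:
  assumes R: "equiv UNIV R"
  shows "mrg R a b `` {x} = (if (a, x) \<in> R \<or> (b, x) \<in> R then R `` {a} \<union> R `` {b} else R `` {x})"
proof -
  note E = equivUD[OF R]
  show ?thesis
  proof (cases "(a, x) \<in> R \<or> (b, x) \<in> R")
    case True
    have "y \<in> mrg R a b `` {x} \<longleftrightarrow> y \<in> R `` {a} \<union> R `` {b}" for y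
      unfolding Image_singleton_iff Un_iff mrg_iff using True E(2,3) by blast
    then have "mrg R a b `` {x} = R `` {a} \<union> R `` {b}" by (rule Set.set_eqI)
    then show ?thesis using True by simp
  next
    case False
    then show ?thesis by (auto simp: mrg_iff)
  qed
qed

lemma mrg_quotient:
  assumes R: "equiv UNIV R" and ab: "a \<in> N" "b \<in> N" "(a, b) \<notin> R"
  defines "A \<equiv> R `` {a}" and "B \<equiv> R `` {b}" and "Rest \<equiv> N // R - {R `` {a}, R `` {b}}"
  shows "N // R = insert A (insert B Rest)" "N // mrg R a b = insert (A \<union> B) Rest"
    "A \<noteq> B" "A \<notin> Rest" "B \<notin> Rest" "A \<union> B \<notin> Rest" "A \<union> B \<noteq> A" "A \<union> B \<noteq> B" "A \<inter> B = {}"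
proof -
  note E = equivUD[OF R]
  have AN: "A \<in> N // R" "B \<in> N // R" using ab by (auto simp: A_def B_def quotient_def)
  show AB: "A \<noteq> B" using ab class_eq_iff[OF R] by (simp add: A_def B_def)
  show d: "A \<inter> B = {}" using class_disjoint[OF R AN AB] .
  show "N // R = insert A (insert B Rest)" using AN by (auto simp: Rest_def A_def B_def)
  show "A \<notin> Rest" "B \<notin> Rest" by (auto simp: Rest_def A_def B_def)
  have ne: "a \<in> A" "b \<in> B" by (auto simp: A_def B_def E)
  show "A \<union> B \<noteq> A" "A \<union> B \<noteq> B" using d ne by blast+
  show "A \<union> B \<notin> Rest"
  proof
    assume "A \<union> B \<in> Rest"
    then have "A \<union> B \<in> N // R" by (simp add: Rest_def)
    from class_mem[OF R this, of a] ne(1) have "A \<union> B = A" by (simp add: A_def)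
    then show False using d ne by blast
  qed
  show "N // mrg R a b = insert (A \<union> B) Rest"
  proof (rule Set.set_eqI)
    fix C
    have "C \<in> N // mrg R a b \<longleftrightarrow> (\<exists>x\<in>N. C = mrg R a b `` {x})" by (auto simp: quotient_def)
    also have "\<dots> \<longleftrightarrow> C \<in> insert (A \<union> B) Rest"
    proof
      assume "\<exists>x\<in>N. C = mrg R a b `` {x}"
      then obtain x where x: "x \<in> N" "C = mrg R a b `` {x}" by blast
      show "C \<in> insert (A \<union> B) Rest"
      proof (cases "(a, x) \<in> R \<or> (b, x) \<in> R")
        case True then show ?thesis using x by (simp add: mrg_class[OF R] A_def B_def)
      next
        case False
        then have "(x, a) \<notin> R" "(x, b) \<notin> R" using E(2) by blast+
        then have "R `` {x} \<noteq> A" "R `` {x} \<noteq> B"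
          using class_eq_iff[OF R, of x a] class_eq_iff[OF R, of x b] by (simp_all add: A_def B_def)
        moreover have "C = R `` {x}" using False x by (simp add: mrg_class[OF R])
        moreover have "R `` {x} \<in> N // R" using x by (auto simp: quotient_def)
        ultimately show ?thesis by (simp add: Rest_def A_def B_def)
      qed
    next
      assume "C \<in> insert (A \<union> B) Rest"
      then consider "C = A \<union> B" | "C \<in> N // R" "C \<noteq> A" "C \<noteq> B" by (auto simp: Rest_def A_def B_def)
      then show "\<exists>x\<in>N. C = mrg R a b `` {x}"
      proof cases
        case 1 then show ?thesis using ab(1) E(1) by (intro bexI[of _ a]) (simp_all add: mrg_class[OF R] A_def B_def)
      next
        case 2
        then obtain x where x: "x \<in> N" "C = R `` {x}" by (auto simp: quotient_def)
        then have "(a, x) \<notin> R" "(b, x) \<notin> R"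
          using 2 class_eq_iff[OF R, of a x] class_eq_iff[OF R, of b x] by (auto simp: A_def B_def)
        then show ?thesis using x by (intro bexI[of _ x]) (simp_all add: mrg_class[OF R])
      qed
    qed
    finally show "C \<in> N // mrg R a b \<longleftrightarrow> C \<in> insert (A \<union> B) Rest" .
  qed
qed

section \<open>The square of the differential\<close>

text \<open>A set \<open>T\<close> of points is read as the monomial \<open>\<Prod>t\<in>T.
  x\<^sub>t\<close>, where \<open>x\<^sub>t\<close> acts by \<open>x\<close> on the tensor factor of
  the circle through \<open>t\<close>. It labels by \<open>x\<close> the circles that it meets and
  is zero if it meets one of them twice, since \<open>x\<^sup>2 = 0\<close>.\<close>

definition cls :: "('a \<times> 'a) set \<Rightarrow> 'a set \<Rightarrow> 'a set set" where
  "cls R T = (\<lambda>x. R `` {x}) ` T"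

text \<open>A functional \<open>h\<close> on labelled circles, evaluated on monomials in the points.
  In these terms the formulas for merging and splitting need no case distinction on the labels,
  which is what makes the square of the differential computable.\<close>

definition hat :: "('a \<times> 'a) set \<Rightarrow> ('a set set \<Rightarrow> bit) \<Rightarrow> 'a set \<Rightarrow> bit" where
  "hat R h T = (if \<forall>x\<in>T. \<forall>y\<in>T. (x, y) \<in> R \<longrightarrow> x = y then h (cls R T) else 0)"

text \<open>Multiplication by \<open>x\<^sub>a\<close>, and below by \<open>x\<^sub>a +
  x\<^sub>b\<close>, dualised to functionals.\<close>

definition del :: "'a \<Rightarrow> ('a set \<Rightarrow> bit) \<Rightarrow> 'a set \<Rightarrow> bit" where
  "del a F T = (if a \<in> T then 0 else F (insert a T))"

definition dd :: "'a \<Rightarrow> 'a \<Rightarrow> ('a set \<Rightarrow> bit) \<Rightarrow> 'a set \<Rightarrow> bit" where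
  "dd a b F T = del a F T + del b F T"

lemma del_commute: "del a (del b F) = del b (del a F)"
  by (auto simp: del_def fun_eq_iff insert_commute)

lemma dd_commute: "dd a b (dd c d F) = dd c d (dd a b F)"
proof
  fix T
  have u: "del x (dd y z F) T = del x (del y F) T + del x (del z F) T" for x y z
    by (simp add: del_def dd_def)
  have e: "dd a b (dd c d F) T = del a (dd c d F) T + del b (dd c d F) T"
    "dd c d (dd a b F) T = del c (dd a b F) T + del d (dd a b F) T"
    by (simp_all add: dd_def)
  show "dd a b (dd c d F) T = dd c d (dd a b F) T"
    unfolding e u del_commute[of a c] del_commute[of a d] del_commute[of b c] del_commute[of b d]
    by (simp add: ac_simps)
qed

lemma cls_mem:
  assumes R: "equiv UNIV R" and C: "C \<in> N // R"
  shows "C \<in> cls R T \<longleftrightarrow> T \<inter> C \<noteq> {}"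
proof
  assume "C \<in> cls R T"
  then obtain t where "t \<in> T" "C = R `` {t}" by (auto simp: cls_def)
  then show "T \<inter> C \<noteq> {}" using equivUD(1)[OF R, of t] by blast
next
  assume "T \<inter> C \<noteq> {}"
  then obtain t where "t \<in> T" "t \<in> C" by blast
  then show "C \<in> cls R T" using class_mem[OF R C, of t] by (auto simp: cls_def)
qed

lemma cls_subset: "T \<subseteq> N \<Longrightarrow> cls R T \<subseteq> N // R"
  by (auto simp: cls_def quotient_def)

lemma eq_cls_iff:
  assumes R: "equiv UNIV R" and T': "T' \<subseteq> N // R" and U: "U \<subseteq> N"
  shows "T' = cls R U \<longleftrightarrow> (\<forall>C\<in>N // R. C \<in> T' \<longleftrightarrow> U \<inter> C \<noteq> {})"
proof -
  have "T' = cls R U \<longleftrightarrow> (\<forall>C\<in>N // R. C \<in> T' \<longleftrightarrow> C \<in> cls R U)"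
    using T' cls_subset[OF U, of R] by blast
  then show ?thesis using cls_mem[OF R] by simp
qed

lemma finite_quot: "finite N \<Longrightarrow> finite (N // R)"
  by (simp add: quotient_def)

text \<open>Points on the same circle act alike.\<close>

lemma hat_del_eq:
  assumes R: "equiv UNIV R" and ab: "(a, b) \<in> R"
  shows "del a (hat R h) = del b (hat R h)"
proof
  fix T
  note E = equivUD[OF R]
  have cl: "cls R (insert a T) = cls R (insert b T)"
    using class_eq_iff[OF R, of a b] ab by (simp add: cls_def)
  have 1: "del x (hat R h) T = (if (\<exists>t\<in>T. (x, t) \<in> R) \<or> (\<exists>t\<in>T. \<exists>u\<in>T. (t, u) \<in> R \<and> t \<noteq> u) then 0
      else h (cls R (insert x T)))" for x
  proof (cases "\<exists>t\<in>T. (x, t) \<in> R")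
    case True
    then obtain t where t: "t \<in> T" "(x, t) \<in> R" by blast
    have "hat R h (insert x T) = 0" if "x \<notin> T"
    proof -
      have "x \<noteq> t" using that t by blast
      then have "\<not> (\<forall>x'\<in>insert x T. \<forall>y\<in>insert x T. (x', y) \<in> R \<longrightarrow> x' = y)" using t by blast
      then show ?thesis by (simp only: hat_def if_False)
    qed
    then show ?thesis using True by (simp add: del_def)
  next
    case False
    then have x: "x \<notin> T" using E(1) by blast
    have n: "(t, x) \<notin> R" if "t \<in> T" for t using False that E(2) by blast
    have "(\<forall>x'\<in>insert x T. \<forall>y\<in>insert x T. (x', y) \<in> R \<longrightarrow> x' = y) \<longleftrightarrow> (\<forall>t\<in>T. \<forall>u\<in>T. (t, u) \<in> R \<longrightarrow> t = u)"
      using False n by auto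
    then show ?thesis using False x by (auto simp: del_def hat_def)
  qed
  have "(\<exists>t\<in>T. (a, t) \<in> R) \<longleftrightarrow> (\<exists>t\<in>T. (b, t) \<in> R)" using ab E(2,3) by blast
  then show "del a (hat R h) T = del b (hat R h) T" unfolding 1 cl by simp
qed

lemma sum_Pow_delta:
  assumes "finite Z" "X \<subseteq> Z" "\<And>T. T \<subseteq> Z \<Longrightarrow> p T = (if T = X then 1 else (0::bit))"
  shows "(\<Sum>T\<in>Pow Z. p T * h T) = h X"
proof -
  have "(\<Sum>T\<in>Pow Z. p T * h T) = (\<Sum>T\<in>Pow Z. if X = T then h T else 0)"
    by (rule sum.cong) (auto simp: assms(3))
  also have "\<dots> = h X" using assms(1,2) by simp
  finally show ?thesis .
qed

text \<open>Merging is the multiplication of the algebra, so that it maps the monomial of a set of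
  points to the monomial of the same set.\<close>

lemma hat_merge:
  assumes R: "equiv UNIV R" and ab: "a \<in> N" "b \<in> N" "(a, b) \<notin> R" and fin: "finite N" and T: "T \<subseteq> N"
    and Q: "Q = mrg R a b"
  shows "hat R (\<lambda>S. \<Sum>T'\<in>Pow (N // Q). pcoef (N // R) S (N // Q) T' * h T') T = hat Q h T"
proof (cases "\<forall>x\<in>T. \<forall>y\<in>T. (x, y) \<in> R \<longrightarrow> x = y")
  case False
  then have "\<not> (\<forall>x\<in>T. \<forall>y\<in>T. (x, y) \<in> Q \<longrightarrow> x = y)" unfolding Q mrg_iff by blast
  then show ?thesis using False by (simp only: hat_def if_False)
next
  case inj: True
  define A B Rest where defs: "A = R `` {a}" "B = R `` {b}" "Rest = N // R - {R `` {a}, R `` {b}}"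
  note q = mrg_quotient[OF R ab, folded defs Q]
  note E = equivUD[OF R]
  have Qe: "equiv UNIV Q" unfolding Q by (rule equiv_mrg[OF R])
  let ?S = "cls R T"
  have AN: "A \<in> N // R" "B \<in> N // R" "A \<union> B \<in> N // Q" using q(1,2) by blast+
  have RN: "C \<in> N // R" "C \<in> N // Q" if "C \<in> Rest" for C using that q(1,2) by blast+
  have pc: "pcoef (N // R) ?S (N // Q) T' = (if \<forall>C\<in>Rest. T \<inter> C \<noteq> {} \<longleftrightarrow> C \<in> T'
      then m_coeff (lab ?S A) (lab ?S B) (lab T' (A \<union> B)) else 0)" for T'
    using pcoef_merge[OF q(1,2,3,4,5,6,7,8)] cls_mem[OF R RN(1)] by simp
  have AS: "A \<in> ?S \<longleftrightarrow> T \<inter> A \<noteq> {}" "B \<in> ?S \<longleftrightarrow> T \<inter> B \<noteq> {}" using cls_mem[OF R] AN by blast+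
  have l: "hat R (\<lambda>S. \<Sum>T'\<in>Pow (N // Q). pcoef (N // R) S (N // Q) T' * h T') T
      = (\<Sum>T'\<in>Pow (N // Q). pcoef (N // R) ?S (N // Q) T' * h T')"
    using inj by (simp add: hat_def)
  show ?thesis
  proof (cases "T \<inter> A \<noteq> {} \<and> T \<inter> B \<noteq> {}")
    case True
    then have "lab ?S A = Ax" "lab ?S B = Ax" using AS by (simp_all add: lab_def)
    then have "pcoef (N // R) ?S (N // Q) T' = 0" for T' by (simp add: pc)
    then have "(\<Sum>T'\<in>Pow (N // Q). pcoef (N // R) ?S (N // Q) T' * h T') = 0" by simp
    moreover have "hat Q h T = 0"
    proof -
      obtain x y where xy: "x \<in> T" "x \<in> A" "y \<in> T" "y \<in> B" using True by blast
      then have "x \<noteq> y" using q(9) by blast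
      moreover have "(x, y) \<in> Q" using xy by (simp add: Q mrg_iff defs)
      ultimately have "\<not> (\<forall>x\<in>T. \<forall>y\<in>T. (x, y) \<in> Q \<longrightarrow> x = y)" using xy by blast
      then show ?thesis by (simp only: hat_def if_False)
    qed
    ultimately show ?thesis using l by simp
  next
    case False
    have injQ: "\<forall>x\<in>T. \<forall>y\<in>T. (x, y) \<in> Q \<longrightarrow> x = y"
    proof (intro ballI impI)
      fix x y assume xy: "x \<in> T" "y \<in> T" "(x, y) \<in> Q"
      have "\<not> ((a, x) \<in> R \<and> (b, y) \<in> R)" "\<not> ((b, x) \<in> R \<and> (a, y) \<in> R)"
        using False xy(1,2) by (auto simp: defs)
      then show "x = y" using xy inj unfolding Q mrg_iff by blast
    qed
    have "(\<Sum>T'\<in>Pow (N // Q). pcoef (N // R) ?S (N // Q) T' * h T') = h (cls Q T)"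
    proof (rule sum_Pow_delta)
      show "finite (N // Q)" by (rule finite_quot[OF fin])
      show "cls Q T \<subseteq> N // Q" by (rule cls_subset[OF T])
      fix T' assume T': "T' \<subseteq> N // Q"
      have eq: "T' = cls Q T \<longleftrightarrow> (\<forall>C\<in>Rest. C \<in> T' \<longleftrightarrow> T \<inter> C \<noteq> {}) \<and> (A \<union> B \<in> T' \<longleftrightarrow> A \<in> ?S \<or> B \<in> ?S)"
        unfolding eq_cls_iff[OF Qe T' T] q(2) AS ball_simps Int_Un_distrib Un_empty de_Morgan_conj
        by (rule conj_commute)
      have m: "m_coeff (lab ?S A) (lab ?S B) (lab T' (A \<union> B)) = (if A \<union> B \<in> T' \<longleftrightarrow> A \<in> ?S \<or> B \<in> ?S then 1 else 0)"
        using False AS by (auto simp: lab_def)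
      show "pcoef (N // R) ?S (N // Q) T' = (if T' = cls Q T then 1 else 0)"
        unfolding pc eq m by auto
    qed
    then show ?thesis using l injQ by (simp add: hat_def)
  qed
qed

lemma hat_split_hit:
  assumes Q: "equiv UNIV Q" and ab: "a \<in> N" "b \<in> N" "(a, b) \<notin> Q" and fin: "finite N" and T: "T \<subseteq> N"
    and P: "P = mrg Q a b" and inj: "\<forall>x\<in>T. \<forall>y\<in>T. (x, y) \<in> P \<longrightarrow> x = y" and t: "t \<in> T" "(a, t) \<in> Q"
  shows "(\<Sum>T'\<in>Pow (N // Q). pcoef (N // P) (cls P T) (N // Q) T' * h T') = dd a b (hat Q h) T"
proof -
  define A B Rest where defs: "A = Q `` {a}" "B = Q `` {b}" "Rest = N // Q - {Q `` {a}, Q `` {b}}"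
  note q = mrg_quotient[OF Q ab, folded defs P]
  note E = equivUD[OF Q]
  have Pe: "equiv UNIV P" unfolding P by (rule equiv_mrg[OF Q])
  let ?S = "cls P T"
  have MN: "A \<union> B \<in> N // P" using q(2) by blast
  have RN: "C \<in> N // P" if "C \<in> Rest" for C using that q(2) by blast
  have MS: "A \<union> B \<in> ?S" using cls_mem[OF Pe MN] t by (auto simp: defs)
  have pc: "pcoef (N // P) ?S (N // Q) T' = (if \<forall>C\<in>Rest. T \<inter> C \<noteq> {} \<longleftrightarrow> C \<in> T'
      then \<Delta>_coeff Ax (lab T' A) (lab T' B) else 0)" for T'
  proof -
    have "(\<forall>C\<in>Rest. C \<in> ?S \<longleftrightarrow> C \<in> T') \<longleftrightarrow> (\<forall>C\<in>Rest. T \<inter> C \<noteq> {} \<longleftrightarrow> C \<in> T')"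
      using cls_mem[OF Pe RN] by simp
    moreover have "lab ?S (A \<union> B) = Ax" using MS by (simp add: lab_def)
    ultimately show ?thesis unfolding pcoef_split[OF q(2,1,3,4,5,6,7,8)] by (simp only:)
  qed
  have at: "(a, x) \<in> P" "(b, x) \<in> P" if "x \<in> A \<union> B" for x
    using that E(1) unfolding P mrg_iff defs by blast+
  have tM: "x = t" if "x \<in> T" "x \<in> A \<union> B" for x
  proof -
    have "(x, t) \<in> P" using at(1)[OF that(2)] at(1)[of t] t(2) equivUD(2,3)[OF Pe] unfolding defs by blast
    then show ?thesis using inj that(1) t(1) by blast
  qed
  have bT: "b \<notin> T"
  proof
    assume b: "b \<in> T"
    have "b \<in> B" using E(1) by (simp add: defs)
    then have "b = t" using tM b by blast
    then show False using t(2) ab(3) by simp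
  qed
  have a0: "del a (hat Q h) T = 0"
  proof (cases "a \<in> T")
    case False
    then have "a \<noteq> t" using t by blast
    then have "\<not> (\<forall>x\<in>insert a T. \<forall>y\<in>insert a T. (x, y) \<in> Q \<longrightarrow> x = y)" using t by blast
    then show ?thesis using False by (simp only: del_def hat_def if_False)
  qed (simp add: del_def)
  have TB: "x \<notin> T" if "(b, x) \<in> Q" for x
  proof
    assume "x \<in> T"
    then have "x = t" using tM that by (simp add: defs)
    then show False using that t(2) ab(3) E(2,3) by blast
  qed
  have injb: "\<forall>x\<in>insert b T. \<forall>y\<in>insert b T. (x, y) \<in> Q \<longrightarrow> x = y"
  proof (intro ballI impI)
    fix x y assume xy: "x \<in> insert b T" "y \<in> insert b T" "(x, y) \<in> Q"
    show "x = y"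
    proof (cases "x \<in> T \<and> y \<in> T")
      case True
      then show ?thesis using inj xy(3) by (auto simp: P mrg_iff)
    next
      case False
      then show ?thesis using xy TB E(2) by blast
    qed
  qed
  have bN: "insert b T \<subseteq> N" using ab T by blast
  have "(\<Sum>T'\<in>Pow (N // Q). pcoef (N // P) ?S (N // Q) T' * h T') = h (cls Q (insert b T))"
  proof (rule sum_Pow_delta)
    show "finite (N // Q)" by (rule finite_quot[OF fin])
    show "cls Q (insert b T) \<subseteq> N // Q" by (rule cls_subset[OF bN])
    fix T' assume T': "T' \<subseteq> N // Q"
    have i: "insert b T \<inter> A \<noteq> {}" "insert b T \<inter> B \<noteq> {}" using t E(1) by (auto simp: defs)
    have r: "b \<notin> C" if "C \<in> Rest" for C
    proof -
      have "C \<in> N // Q" "B \<in> N // Q" "C \<noteq> B" using that q(1) q(5) by blast+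
      then show ?thesis using class_disjoint[OF Q, of C N B] E(1) by (auto simp: defs)
    qed
    have eq: "T' = cls Q (insert b T) \<longleftrightarrow> (\<forall>C\<in>Rest. C \<in> T' \<longleftrightarrow> T \<inter> C \<noteq> {}) \<and> A \<in> T' \<and> B \<in> T'"
      unfolding eq_cls_iff[OF Q T' bN] q(1) using i r by (simp add: conj_ac cong: ball_cong)
    show "pcoef (N // P) ?S (N // Q) T' = (if T' = cls Q (insert b T) then 1 else 0)"
      unfolding pc eq by (auto simp: lab_def)
  qed
  moreover have "del b (hat Q h) T = h (cls Q (insert b T))"
    using bT injb by (auto simp: del_def hat_def)
  ultimately show ?thesis using a0 by (simp add: dd_def)
qed

text \<open>Splitting is linear over multiplication by points and sends \<open>1\<close> to
  \<open>x\<^sub>a + x\<^sub>b\<close>, with \<open>a\<close> and \<open>b\<close> on the two new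
  circles. The case of a monomial that meets the circle to be split is the preceding lemma.\<close>

lemma hat_split:
  assumes Q: "equiv UNIV Q" and ab: "a \<in> N" "b \<in> N" "(a, b) \<notin> Q" and fin: "finite N" and T: "T \<subseteq> N"
    and P: "P = mrg Q a b"
  shows "hat P (\<lambda>S. \<Sum>T'\<in>Pow (N // Q). pcoef (N // P) S (N // Q) T' * h T') T = dd a b (hat Q h) T"
proof (cases "\<forall>x\<in>T. \<forall>y\<in>T. (x, y) \<in> P \<longrightarrow> x = y")
  case False
  note E = equivUD[OF Q]
  have ni: "hat Q h U = 0" if "x \<in> U" "y \<in> U" "(x, y) \<in> Q" "x \<noteq> y" for x y U
  proof -
    have "\<not> (\<forall>x\<in>U. \<forall>y\<in>U. (x, y) \<in> Q \<longrightarrow> x = y)" using that by blast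
    then show ?thesis by (simp only: hat_def if_False)
  qed
  from False obtain x y where xy: "x \<in> T" "y \<in> T" "(x, y) \<in> P" "x \<noteq> y" by blast
  have "del c (hat Q h) T = 0" if c: "c = a \<or> c = b" for c
  proof (cases "c \<in> T")
    case cT: False
    have "hat Q h (insert c T) = 0"
    proof (cases "(x, y) \<in> Q")
      case True
      then show ?thesis using xy by (intro ni[of x _ y]) auto
    next
      case False
      then have "(c, x) \<in> Q \<or> (c, y) \<in> Q" using xy(3) c unfolding P mrg_iff by blast
      moreover have "c \<noteq> x" "c \<noteq> y" using cT xy by blast+
      ultimately show ?thesis using xy ni[of c "insert c T" x] ni[of c "insert c T" y] by blast
    qed
    then show ?thesis using cT by (simp add: del_def)
  qed (simp add: del_def)
  then have "dd a b (hat Q h) T = 0" by (simp add: dd_def)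
  then show ?thesis using False by (simp only: hat_def if_False)
next
  case inj: True
  note E = equivUD[OF Q]
  have l: "hat P (\<lambda>S. \<Sum>T'\<in>Pow (N // Q). pcoef (N // P) S (N // Q) T' * h T') T
      = (\<Sum>T'\<in>Pow (N // Q). pcoef (N // P) (cls P T) (N // Q) T' * h T')"
    using inj by (simp add: hat_def)
  consider t where "t \<in> T" "(a, t) \<in> Q" | t where "t \<in> T" "(b, t) \<in> Q"
    | "\<And>t. t \<in> T \<Longrightarrow> (a, t) \<notin> Q \<and> (b, t) \<notin> Q" by blast
  then show ?thesis
  proof cases
    case 1
    then show ?thesis using l hat_split_hit[OF Q ab fin T P inj] by simp
  next
    case 2
    have ba: "(b, a) \<notin> Q" using ab(3) E(2) by blast
    have "P = mrg Q b a" using P mrg_comm by metis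
    then show ?thesis
      using l hat_split_hit[OF Q ab(2,1) ba fin T _ inj 2] by (simp add: dd_def add.commute)
  next
    case none: 3
    define A B Rest where defs: "A = Q `` {a}" "B = Q `` {b}" "Rest = N // Q - {Q `` {a}, Q `` {b}}"
    note q = mrg_quotient[OF Q ab, folded defs P]
    have Pe: "equiv UNIV P" unfolding P by (rule equiv_mrg[OF Q])
    let ?S = "cls P T"
    have MN: "A \<union> B \<in> N // P" using q(2) by blast
    have RN: "C \<in> N // P" if "C \<in> Rest" for C using that q(2) by blast
    have MS: "A \<union> B \<notin> ?S" using cls_mem[OF Pe MN] none by (auto simp: defs)
    have pc: "pcoef (N // P) ?S (N // Q) T' = (if \<forall>C\<in>Rest. T \<inter> C \<noteq> {} \<longleftrightarrow> C \<in> T'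
        then \<Delta>_coeff A1 (lab T' A) (lab T' B) else 0)" for T'
    proof -
      have "(\<forall>C\<in>Rest. C \<in> ?S \<longleftrightarrow> C \<in> T') \<longleftrightarrow> (\<forall>C\<in>Rest. T \<inter> C \<noteq> {} \<longleftrightarrow> C \<in> T')"
        using cls_mem[OF Pe RN] by simp
      moreover have "lab ?S (A \<union> B) = A1" using MS by (simp add: lab_def)
      ultimately show ?thesis unfolding pcoef_split[OF q(2,1,3,4,5,6,7,8)] by (simp only:)
    qed
    have nT: "a \<notin> T" "b \<notin> T" using none E(1) by blast+
    have Tinj: "x = y" if "x \<in> T" "y \<in> T" "(x, y) \<in> Q" for x y
      using inj that by (auto simp: P mrg_iff)
    have dl: "del c (hat Q h) T = h (cls Q (insert c T))" if c: "c = a \<or> c = b" for c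
    proof -
      have n: "(c, t) \<notin> Q" "(t, c) \<notin> Q" if "t \<in> T" for t using none[OF that] c E(2) by blast+
      have "\<forall>x\<in>insert c T. \<forall>y\<in>insert c T. (x, y) \<in> Q \<longrightarrow> x = y" using Tinj n by blast
      then show ?thesis using c nT by (auto simp: del_def hat_def)
    qed
    have abN: "insert a T \<subseteq> N" "insert b T \<subseteq> N" using ab T by blast+
    have aA: "a \<in> A" "b \<in> B" "a \<notin> B" "b \<notin> A" using E(1,2) ab(3) by (auto simp: defs)
    have TAB: "T \<inter> A = {}" "T \<inter> B = {}" using none by (auto simp: defs)
    have r: "a \<notin> C" "b \<notin> C" if "C \<in> Rest" for C
    proof -
      have "C \<in> N // Q" "A \<in> N // Q" "B \<in> N // Q" "C \<noteq> A" "C \<noteq> B" using that q(1,4,5) by blast+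
      then show "a \<notin> C" "b \<notin> C" using class_disjoint[OF Q, of C N A] class_disjoint[OF Q, of C N B] aA by blast+
    qed
    have p: "pcoef (N // P) ?S (N // Q) T' = (if T' = cls Q (insert a T) then 1 else 0) + (if T' = cls Q (insert b T) then 1 else 0)"
      if T': "T' \<subseteq> N // Q" for T'
    proof -
      have ea: "T' = cls Q (insert a T) \<longleftrightarrow> (\<forall>C\<in>Rest. C \<in> T' \<longleftrightarrow> T \<inter> C \<noteq> {}) \<and> A \<in> T' \<and> B \<notin> T'"
        unfolding eq_cls_iff[OF Q T' abN(1)] q(1) using r aA TAB by simp blast
      have eb: "T' = cls Q (insert b T) \<longleftrightarrow> (\<forall>C\<in>Rest. C \<in> T' \<longleftrightarrow> T \<inter> C \<noteq> {}) \<and> A \<notin> T' \<and> B \<in> T'"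
        unfolding eq_cls_iff[OF Q T' abN(2)] q(1) using r aA TAB by simp blast
      show ?thesis unfolding pc ea eb by (auto simp: lab_def)
    qed
    have "(\<Sum>T'\<in>Pow (N // Q). pcoef (N // P) ?S (N // Q) T' * h T')
        = (\<Sum>T'\<in>Pow (N // Q). (if T' = cls Q (insert a T) then 1 else 0) * h T')
        + (\<Sum>T'\<in>Pow (N // Q). (if T' = cls Q (insert b T) then 1 else 0) * h T')"
      unfolding sum.distrib[symmetric] by (rule sum.cong) (auto simp: p distrib_right)
    also have "\<dots> = h (cls Q (insert a T)) + h (cls Q (insert b T))"
      using sum_Pow_delta[OF finite_quot[OF fin] cls_subset[OF abN(1)], where p = "\<lambda>T'. if T' = cls Q (insert a T) then 1 else 0"]
        sum_Pow_delta[OF finite_quot[OF fin] cls_subset[OF abN(2)], where p = "\<lambda>T'. if T' = cls Q (insert b T) then 1 else 0"]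
      by simp
    finally show ?thesis using l dl by (simp add: dd_def)
  qed
qed


section \<open>Cubes of resolutions\<close>

text \<open>What the chain complex remembers of a diagram. Points \<open>N\<close>, of which those
  in \<open>K\<close> are marked; crossings \<open>X\<close>; at every vertex an equivalence
  relation whose classes are the circles. A change of the resolution at \<open>j\<close> merges or
  splits the circles at \<open>a j\<close> and \<open>b j\<close>, and there is no third
  possibility; a circle that is turned into a single circle, as for diagrams on non-orientable
  surfaces, would have no edge map.\<close>

locale cube =
  fixes N :: "'n set" and X :: "nat set" and R :: "nat set \<Rightarrow> ('n \<times> 'n) set" and a b :: "nat \<Rightarrow> 'n" and K :: "'n set"
  assumes finN: "finite N" and KN: "K \<subseteq> N" and finX: "finite X" and eqR: "\<And>v. equiv UNIV (R v)"
    and closed: "\<And>v x y. v \<subseteq> X \<Longrightarrow> (x, y) \<in> R v \<Longrightarrow> x \<in> N \<Longrightarrow> y \<in> N"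
    and ab: "\<And>j. j \<in> X \<Longrightarrow> a j \<in> N \<and> b j \<in> N"
    and surgery: "\<And>v j. v \<subseteq> X \<Longrightarrow> j \<in> X - v \<Longrightarrow>
      (a j, b j) \<notin> R v \<and> R (insert j v) = mrg (R v) (a j) (b j) \<or>
      (a j, b j) \<notin> R (insert j v) \<and> R v = mrg (R (insert j v)) (a j) (b j)"
begin

definition circ :: "nat set \<Rightarrow> 'n set set" where "circ v = N // R v"

definition triv :: "nat set \<Rightarrow> bool" where "triv v \<longleftrightarrow> (\<forall>C\<in>circ v. even (card (K \<inter> C)))"

definition sts :: "(nat set \<times> 'n set set) set" where
  "sts = {(v, S). v \<subseteq> X \<and> triv v \<and> S \<subseteq> circ v}"

definition cf :: "nat set \<times> 'n set set \<Rightarrow> nat set \<times> 'n set set \<Rightarrow> bit" where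
  "cf s t = (if \<exists>j\<in>X - fst s. fst t = insert j (fst s) then pcoef (circ (fst s)) (snd s) (circ (fst t)) (snd t) else 0)"

lemma finite_circ: "finite (circ v)" by (simp add: circ_def finite_quot finN)

lemma circ_sub: "v \<subseteq> X \<Longrightarrow> C \<in> circ v \<Longrightarrow> C \<subseteq> N"
  using closed by (auto simp: circ_def quotient_def)

lemma finite_sts: "finite sts"
proof -
  have "sts \<subseteq> (SIGMA v:Pow X. Pow (circ v))" by (auto simp: sts_def)
  then show ?thesis using finX finite_circ by (meson finite_Pow_iff finite_SigmaI finite_subset)
qed

text \<open>An edge of the cube in terms of monomials: the identity for a merge, multiplication by
  \<open>x\<^bsub>a j\<^esub> + x\<^bsub>b j\<^esub>\<close> for a split.\<close>

lemma hat_step: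
  assumes v: "v \<subseteq> X" and j: "j \<in> X - v" and T: "T \<subseteq> N"
  shows "hat (R v) (\<lambda>S. \<Sum>T'\<in>Pow (circ (insert j v)). pcoef (circ v) S (circ (insert j v)) T' * h T') T =
    (if (a j, b j) \<notin> R v then hat (R (insert j v)) h T else dd (a j) (b j) (hat (R (insert j v)) h) T)"
proof -
  have ab': "a j \<in> N" "b j \<in> N" using ab j by auto
  from surgery[OF v j] show ?thesis
  proof
    assume "(a j, b j) \<notin> R v \<and> R (insert j v) = mrg (R v) (a j) (b j)"
    then show ?thesis unfolding circ_def using hat_merge[OF eqR ab' _ finN T HOL.refl, of v h] by (simp only: if_True simp_thms)
  next
    assume *: "(a j, b j) \<notin> R (insert j v) \<and> R v = mrg (R (insert j v)) (a j) (b j)"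
    then have "(a j, b j) \<in> R v" using equivUD(1)[OF eqR] by (simp add: mrg_iff)
    then show ?thesis unfolding circ_def using hat_split[OF eqR ab' _ finN T, of "insert j v" "R v" h] * by (simp only: if_False simp_thms not_True_eq_False)
  qed
qed

text \<open>Even plus even is even; a split, in contrast, can leave two odd circles.\<close>

lemma triv_merge:
  assumes v: "v \<subseteq> X" and w: "w \<subseteq> X" and j: "j \<in> X" and n: "(a j, b j) \<notin> R v"
    and R: "R w = mrg (R v) (a j) (b j)" and t: "triv v" and K: "finite K"
  shows "triv w"
proof -
  have ab': "a j \<in> N" "b j \<in> N" using ab j by auto
  note q = mrg_quotient[OF eqR ab' n]
  have "card (K \<inter> (R v `` {a j} \<union> R v `` {b j})) = card (K \<inter> R v `` {a j}) + card (K \<inter> R v `` {b j})"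
    unfolding Int_Un_distrib using K q(9) by (intro card_Un_disjoint) auto
  moreover have "R v `` {a j} \<in> circ v" "R v `` {b j} \<in> circ v"
    using ab' by (auto simp: circ_def intro: quotientI)
  ultimately have "even (card (K \<inter> (R v `` {a j} \<union> R v `` {b j})))" using t by (simp add: triv_def)
  moreover have "even (card (K \<inter> C))" if "C \<in> N // R v - {R v `` {a j}, R v `` {b j}}" for C
    using that t by (simp add: triv_def circ_def)
  ultimately show ?thesis unfolding triv_def circ_def R q(2) by blast
qed


lemma dd_cong: "(\<And>T. T \<subseteq> N \<Longrightarrow> F T = G T) \<Longrightarrow> x \<in> N \<Longrightarrow> y \<in> N \<Longrightarrow> T \<subseteq> N \<Longrightarrow> dd x y F T = dd x y G T"
  by (simp add: dd_def del_def)

definition stp :: "nat set \<Rightarrow> nat \<Rightarrow> ('n set \<Rightarrow> bit) \<Rightarrow> 'n set \<Rightarrow> bit" where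
  "stp v j F = (if (a j, b j) \<notin> R v then F else dd (a j) (b j) F)"

lemma surgery_cases:
  assumes v: "v \<subseteq> X" and j: "j \<in> X - v" and w: "w = insert j v"
  obtains "(a j, b j) \<notin> R v" "R w = mrg (R v) (a j) (b j)" "(a j, b j) \<in> R w"
  | "(a j, b j) \<in> R v" "(a j, b j) \<notin> R w" "R v = mrg (R w) (a j) (b j)"
proof -
  have i: "(a j, b j) \<in> mrg (R u) (a j) (b j)" for u using equivUD(1)[OF eqR] by (simp add: mrg_iff)
  from surgery[OF v j, folded w] show thesis
  proof (elim disjE conjE)
    assume "(a j, b j) \<notin> R v" "R w = mrg (R v) (a j) (b j)"
    then show thesis using that(1) i[of v] by simp
  next
    assume "(a j, b j) \<notin> R w" "R v = mrg (R w) (a j) (b j)"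
    then show thesis using that(2) i[of w] by simp
  qed
qed

lemma path_value:
  assumes v: "v \<subseteq> X" and j: "j \<in> X - v" and k: "k \<in> X - insert j v" and w: "w = insert k (insert j v)"
    and U: "U \<subseteq> circ w" and T: "T \<subseteq> N"
  shows "hat (R v) (\<lambda>S. \<Sum>T'\<in>Pow (circ (insert j v)).
      pcoef (circ v) S (circ (insert j v)) T' * pcoef (circ (insert j v)) T' (circ w) U) T
    = stp v j (stp (insert j v) k (hat (R w) (\<lambda>T'. if T' = U then 1 else 0))) T"
proof -
  let ?m = "insert j v" and ?\<delta> = "\<lambda>T'. if T' = U then 1 else (0::bit)"
  have m: "?m \<subseteq> X" using v j by blast
  have d: "pcoef (circ ?m) T' (circ w) U = (\<Sum>U'\<in>Pow (circ w). pcoef (circ ?m) T' (circ w) U' * ?\<delta> U')" for T'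
  proof -
    have "(\<Sum>U'\<in>Pow (circ w). pcoef (circ ?m) T' (circ w) U' * ?\<delta> U')
        = (\<Sum>U'\<in>Pow (circ w). if U = U' then pcoef (circ ?m) T' (circ w) U' else 0)"
      by (rule sum.cong) auto
    then show ?thesis using U finite_circ by simp
  qed
  have 2: "hat (R ?m) (\<lambda>T'. pcoef (circ ?m) T' (circ w) U) T' = stp ?m k (hat (R w) ?\<delta>) T'" if "T' \<subseteq> N" for T'
    unfolding d using hat_step[OF m k that, of ?\<delta>, folded w] by (simp only: stp_def if_distribR)
  show ?thesis
    unfolding hat_step[OF v j T] stp_def[of v j]
    using 2[OF T] dd_cong[OF 2 _ _ T, where x = "a j" and y = "b j"] ab j by auto
qed

text \<open>The case in which a vertex on a face could be non-trivial although the other three are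
  trivial. Let \<open>A\<close>, \<open>B\<close> be the circles of \<open>m\<close> that are merged
  at \<open>v\<close>, and \<open>C\<close>, \<open>D\<close> those merged at \<open>w\<close>.
  Circles other than \<open>A\<close>, \<open>B\<close> are circles of \<open>v\<close> and circles
  other than \<open>C\<close>, \<open>D\<close> are circles of \<open>w\<close>, hence even. As the
  two pairs differ, at least one of \<open>A\<close> and \<open>B\<close> is even, and then so is
  the other one because their union is.\<close>

lemma triv_exchange:
  assumes v: "v \<subseteq> X" and w: "w \<subseteq> X" and j: "j \<in> X" and k: "k \<in> X"
    and P: "(a j, b j) \<notin> R m" "R v = mrg (R m) (a j) (b j)"
    and Q: "(a k, b k) \<notin> R m" "R w = mrg (R m) (a k) (b k)"
    and n: "(a k, b k) \<notin> R v" and t: "triv v" "triv w"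
  shows "triv m"
proof (rule ccontr)
  assume "\<not> triv m"
  then obtain C where C: "C \<in> circ m" "odd (card (K \<inter> C))" by (auto simp: triv_def)
  have abj: "a j \<in> N" "b j \<in> N" and abk: "a k \<in> N" "b k \<in> N" using ab j k by auto
  note p = mrg_quotient[OF eqR abj P(1), folded P(2)] and q = mrg_quotient[OF eqR abk Q(1), folded Q(2)]
  note E = equivUD[OF eqR[of m]]
  let ?A = "R m `` {a j}" and ?B = "R m `` {b j}"
  have AB: "?A \<in> circ m" "?B \<in> circ m" using abj by (auto simp: circ_def intro: quotientI)
  have "C \<in> N // R v" if "C \<noteq> ?A" "C \<noteq> ?B" using that C(1) unfolding p(2) circ_def by blast
  then have "C = ?A \<or> C = ?B" using C(2) t(1) by (auto simp: triv_def circ_def)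
  moreover have "even (card (K \<inter> (?A \<union> ?B)))" using t(1) unfolding triv_def circ_def p(2) by blast
  moreover have "card (K \<inter> (?A \<union> ?B)) = card (K \<inter> ?A) + card (K \<inter> ?B)"
    unfolding Int_Un_distrib using finite_subset[OF KN finN] p(9) by (intro card_Un_disjoint) auto
  ultimately have odd: "odd (card (K \<inter> ?A))" "odd (card (K \<inter> ?B))" using C(2) by auto
  have *: "D = R m `` {a k} \<or> D = R m `` {b k}" if D: "D \<in> circ m" "odd (card (K \<inter> D))" for D
  proof (rule ccontr)
    assume "\<not> ?thesis"
    then have "D \<in> circ w" using D(1) unfolding circ_def q(2) by blast
    then show False using D(2) t(2) by (simp add: triv_def)
  qed
  have "?A = R m `` {a k} \<or> ?A = R m `` {b k}" "?B = R m `` {a k} \<or> ?B = R m `` {b k}"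
    using *[OF AB(1) odd(1)] *[OF AB(2) odd(2)] .
  then have "((a j, a k) \<in> R m \<or> (a j, b k) \<in> R m) \<and> ((b j, a k) \<in> R m \<or> (b j, b k) \<in> R m)"
    using class_eq_iff[OF eqR] by blast
  then have "(a k, b k) \<in> mrg (R m) (a j) (b j)" using P(1) E(2,3) unfolding mrg_iff by blast
  then show False using n P(2) by simp
qed

text \<open>Edges multiply by \<open>1\<close> or by some \<open>x\<^sub>a + x\<^sub>b\<close>, and
  these factors commute. What remains is to see that opposite edges of a face carry the same factor
  unless both products vanish, and that a path through a non-trivial vertex, which the differential
  omits, does not destroy the balance.\<close>

lemma face_commutes:
  assumes v: "v \<subseteq> X" and j: "j \<in> X - v" and k: "k \<in> X - v" and jk: "j \<noteq> k"
    and w: "w = insert k (insert j v)" and t: "triv v" "triv w"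
  shows "(if triv (insert j v) then stp v j (stp (insert j v) k (hat (R w) h)) T else 0) =
         (if triv (insert k v) then stp v k (stp (insert k v) j (hat (R w) h)) T else 0)"
proof -
  let ?m = "insert j v" and ?n = "insert k v"
  note E = equivUD[OF eqR]
  have sub: "?m \<subseteq> X" "?n \<subseteq> X" "w \<subseteq> X" "j \<in> X" "k \<in> X" using v j k w by auto
  have w': "w = insert j ?n" using w by auto
  have km: "k \<in> X - ?m" and jn: "j \<in> X - ?n" using j k jk by auto
  have fK: "finite K" using KN finN finite_subset by blast
  have tm: "triv y" if "x \<subseteq> X" "y \<subseteq> X" "i \<in> X" "(a i, b i) \<notin> R x" "R y = mrg (R x) (a i) (b i)" "triv x" for x y i
    using triv_merge that fK by blast
  have le: "R x \<subseteq> mrg (R x) (a i) (b i)" for x i by (auto simp: mrg_iff)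
  consider (M) "(a j, b j) \<notin> R v" "R ?m = mrg (R v) (a j) (b j)" "(a j, b j) \<in> R ?m"
    | (S) "(a j, b j) \<in> R v" "(a j, b j) \<notin> R ?m" "R v = mrg (R ?m) (a j) (b j)"
    using surgery_cases[OF v j HOL.refl] by metis
  note c1 = this
  consider (M) "(a k, b k) \<notin> R ?m" "R w = mrg (R ?m) (a k) (b k)" "(a k, b k) \<in> R w"
    | (S) "(a k, b k) \<in> R ?m" "(a k, b k) \<notin> R w" "R ?m = mrg (R w) (a k) (b k)"
    using surgery_cases[OF sub(1) km w] by metis
  note c2 = this
  consider (M) "(a k, b k) \<notin> R v" "R ?n = mrg (R v) (a k) (b k)" "(a k, b k) \<in> R ?n"
    | (S) "(a k, b k) \<in> R v" "(a k, b k) \<notin> R ?n" "R v = mrg (R ?n) (a k) (b k)"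
    using surgery_cases[OF v k HOL.refl] by metis
  note c3 = this
  consider (M) "(a j, b j) \<notin> R ?n" "R w = mrg (R ?n) (a j) (b j)" "(a j, b j) \<in> R w"
    | (S) "(a j, b j) \<in> R ?n" "(a j, b j) \<notin> R w" "R ?n = mrg (R w) (a j) (b j)"
    using surgery_cases[OF sub(2) jn w'] by metis
  note c4 = this
  \<comment> \<open>splitting along a crossing whose two points end up on one circle contributes zero\<close>
  have dd0: "dd x y (hat (R w) h) T = 0" if "(x, y) \<in> R w" for x y
    using hat_del_eq[OF eqR that, of h] by (simp add: dd_def)
  show ?thesis
  proof (cases rule: c1)
    case 1: M
    show ?thesis
    proof (cases rule: c2)
      case 2: M
      have 3: "(a k, b k) \<notin> R v" using 1(2) 2(1) le by blast
      then have 3: "(a k, b k) \<notin> R v" "R ?n = mrg (R v) (a k) (b k)" using c3 by auto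
      have "(a j, b j) \<in> R w" using 1(3) 2(2) le by blast
      then have 4: "(a j, b j) \<notin> R ?n" using c4 by auto
      have "triv ?m" "triv ?n"
        using tm[OF v sub(1) sub(4) 1(1,2) t(1)] tm[OF v sub(2) sub(5) 3 t(1)] by auto
      then show ?thesis using 1 2 3 4 by (simp add: stp_def)
    next
      case 2: S
      have m: "triv ?m" using tm[OF v sub(1) sub(4) 1(1,2) t(1)] .
      show ?thesis
      proof (cases rule: c3)
        case 3: M
        have n: "triv ?n" using tm[OF v sub(2) sub(5) 3(1,2) t(1)] .
        have 4: "(a j, b j) \<in> R ?n \<and> (a j, b j) \<notin> R w"
        proof (rule ccontr)
          assume "\<not> ?thesis"
          then have "(a j, b j) \<notin> R ?n" "R w = mrg (R ?n) (a j) (b j)" using c4 by auto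
          then have "(a k, b k) \<in> R w" using 3(3) le by blast
          then show False using 2 by simp
        qed
        have "(a j, b j) \<in> mrg (R w) (a k) (b k)" using 1(3) 2(3) by simp
        then have "(a k, a j) \<in> R w \<and> (b k, b j) \<in> R w \<or> (b k, a j) \<in> R w \<and> (a k, b j) \<in> R w"
          using 4 by (simp add: mrg_iff)
        then have "dd (a k) (b k) (hat (R w) h) T = dd (a j) (b j) (hat (R w) h) T"
          using hat_del_eq[OF eqR, of _ _ w h] by (metis add.commute dd_def)
        then show ?thesis using 1 2 3 4 m n by (simp add: stp_def)
      next
        case 3: S
        have "(a j, b j) \<notin> R ?n" using 1(1) 3(3) le by blast
        then have 4: "(a j, b j) \<notin> R ?n" "R w = mrg (R ?n) (a j) (b j)" using c4 by auto
        have "triv ?n" using triv_exchange[OF v sub(3) sub(5) sub(4) 3(2,3) 4 1(1) t] .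
        then show ?thesis using 1 2 3 4 m by (simp add: stp_def)
      qed
    qed
  next
    case 1: S
    show ?thesis
    proof (cases rule: c2)
      case 2: S
      have "(a k, b k) \<in> R v" using 2(1) 1(3) le by blast
      then have 3: "(a k, b k) \<in> R v" "(a k, b k) \<notin> R ?n" "R v = mrg (R ?n) (a k) (b k)" using c3 by auto
      have "(a j, b j) \<notin> R w" using 1(2) 2(3) le by blast
      then have "(a j, b j) \<in> R ?n \<and> (a j, b j) \<notin> R w \<and> R ?n = mrg (R w) (a j) (b j)"
        by (cases rule: c4) simp_all
      then have 4: "(a j, b j) \<in> R ?n" "(a j, b j) \<notin> R w" "R ?n = mrg (R w) (a j) (b j)" by blast+
      have tt: "triv ?m" "triv ?n"
        using tm[OF sub(3) sub(1) sub(5) 2(2,3) t(2)] tm[OF sub(3) sub(2) sub(4) 4(2,3) t(2)] by auto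
      have "dd (a j) (b j) (dd (a k) (b k) (hat (R w) h)) T = dd (a k) (b k) (dd (a j) (b j) (hat (R w) h)) T"
        by (simp only: dd_commute[of "a j"])
      moreover have "\<not> (a j, b j) \<notin> R v" "\<not> (a k, b k) \<notin> R ?m" "\<not> (a k, b k) \<notin> R v" "\<not> (a j, b j) \<notin> R ?n"
        using 1(1) 2(1) 3(1) 4(1) by blast+
      ultimately show ?thesis using tt by (simp only: stp_def if_True if_False)
    next
      case 2: M
      show ?thesis
      proof (cases rule: c3)
        case 3: M
        have "(a k, b k) \<in> R ?n" using 3(3) .
        have n: "triv ?n" using tm[OF v sub(2) sub(5) 3(1,2) t(1)] .
        have m: "triv ?m" using triv_exchange[OF v sub(3) sub(4) sub(5) 1(2,3) 2(1,2) 3(1) t] .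
        have 4: "(a j, b j) \<in> R ?n" using 1(1) 3(2) le by blast
        show ?thesis using 1 2 3 4 m n by (simp add: stp_def)
      next
        case 3: S
        have 4: "(a j, b j) \<in> R w \<and> (a j, b j) \<notin> R ?n"
        proof (rule ccontr)
          assume "\<not> ?thesis"
          then have "R ?n = mrg (R w) (a j) (b j)" using c4 by auto
          then have "(a k, b k) \<in> R ?n" using 2(3) le by blast
          then show False using 3 by simp
        qed
        then show ?thesis using 1 2 3 dd0 by (simp add: stp_def)
      qed
    qed
  qed
qed

text \<open>One point on every circle with label \<open>x\<close>.\<close>

lemma transversal:
  assumes v: "v \<subseteq> X" and S: "S \<subseteq> circ v"
  obtains T where "T \<subseteq> N" "\<And>h. hat (R v) h T = h S"
proof -
  have ne: "\<exists>x. x \<in> C" if "C \<in> S" for C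
  proof -
    have "C \<in> N // R v" using that S by (auto simp: circ_def)
    from class_nonempty[OF eqR this] show ?thesis by blast
  qed
  define r where "r C = (SOME x. x \<in> C)" for C :: "'n set"
  have r: "r C \<in> C" if "C \<in> S" for C unfolding r_def using ne[OF that] by (rule someI_ex)
  have rC: "R v `` {r C} = C" if "C \<in> S" for C
    using class_mem[OF eqR _ r[OF that]] that S by (auto simp: circ_def)
  have "r ` S \<subseteq> N" using r circ_sub[OF v] S by blast
  moreover have "hat (R v) h (r ` S) = h S" for h
  proof -
    have "cls (R v) (r ` S) = S" using rC by (auto simp: cls_def image_image)
    moreover have "\<forall>x\<in>r ` S. \<forall>y\<in>r ` S. (x, y) \<in> R v \<longrightarrow> x = y"
      using rC class_eq_iff[OF eqR, of v] by (metis imageE)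
    ultimately show ?thesis by (auto simp: hat_def)
  qed
  ultimately show thesis using that by blast
qed

theorem square_zero_cf: "square_zero sts cf"
  unfolding square_zero_def
proof (intro conjI ballI)
  show "finite sts" by (rule finite_sts)
  fix s u assume su: "s \<in> sts" "u \<in> sts"
  obtain v S w U where s: "s = (v, S)" and u: "u = (w, U)" by (cases s, cases u)
  have v: "v \<subseteq> X" "triv v" "S \<subseteq> circ v" and w: "w \<subseteq> X" "triv w" "U \<subseteq> circ w"
    using su by (auto simp: s u sts_def)
  show "(\<Sum>t\<in>sts. cf s t * cf t u) = 0"
  proof (cases "\<exists>j k. j \<in> X - v \<and> k \<in> X - v \<and> j \<noteq> k \<and> w = insert k (insert j v)")
    case False
    have "cf s t * cf t u = 0" for t
    proof (rule ccontr)
      assume "cf s t * cf t u \<noteq> 0"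
      then have "cf s t \<noteq> 0" "cf t u \<noteq> 0" by auto
      then obtain j k where "j \<in> X - v" "fst t = insert j v" "k \<in> X - fst t" "w = insert k (fst t)"
        unfolding cf_def s u by (metis fst_conv)
      then show False using False by auto
    qed
    then show ?thesis by (intro sum.neutral) blast
  next
    case True
    then obtain j k where jk: "j \<in> X - v" "k \<in> X - v" "j \<noteq> k" "w = insert k (insert j v)" by blast
    let ?m = "insert j v" and ?n = "insert k v"
    define pth where "pth i S = (\<Sum>T\<in>Pow (circ (insert i v)). pcoef (circ v) S (circ (insert i v)) T *
        pcoef (circ (insert i v)) T (circ w) U)" for i S
    define A where "A i = (if triv (insert i v) then Pair (insert i v) ` Pow (circ (insert i v)) else {})" for i
    \<comment> \<open>two paths lead from \<open>v\<close> to \<open>w\<close>, through the states in \<open>A j\<close> and in \<open>A k\<close>\<close>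
    have ne: "?m \<noteq> ?n" using jk by auto
    have Asub: "A i \<subseteq> sts" if "i = j \<or> i = k" for i using that jk v by (auto simp: A_def sts_def)
    have zero: "cf s t * cf t u = 0" if t: "t \<in> sts - (A j \<union> A k)" for t
    proof (rule ccontr)
      assume "cf s t * cf t u \<noteq> 0"
      then have "cf s t \<noteq> 0" "cf t u \<noteq> 0" by auto
      then obtain i l where il: "i \<in> X - v" "fst t = insert i v" "l \<in> X - fst t" "w = insert l (fst t)"
        unfolding cf_def s u by (metis fst_conv)
      then have "insert l (insert i v) = insert k (insert j v)" "l \<noteq> i" "i \<notin> v" "l \<notin> v" using jk by auto
      then have "i = j \<or> i = k" using jk(1,2) by blast
      moreover have "t = (insert i v, snd t)" "triv (insert i v)" "snd t \<subseteq> circ (insert i v)"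
        using t il by (auto simp: sts_def)
      ultimately have "t \<in> A j \<union> A k" unfolding A_def by (smt (verit) Pow_iff UnI1 UnI2 imageI)
      then show False using t by blast
    qed
    have S1: "(\<Sum>t\<in>A i. cf s t * cf t u) = (if triv (insert i v) then pth i S else 0)"
      if i: "i \<in> X - v" "l \<in> X - insert i v" "w = insert l (insert i v)" for i l
    proof (cases "triv (insert i v)")
      case True
      have c1: "cf s (insert i v, T) = pcoef (circ v) S (circ (insert i v)) T" for T
        using i by (auto simp: cf_def s)
      have c2: "cf (insert i v, T) u = pcoef (circ (insert i v)) T (circ w) U" for T
        using i by (auto simp: cf_def u)
      have "(\<Sum>t\<in>A i. cf s t * cf t u) = (\<Sum>T\<in>Pow (circ (insert i v)). cf s (insert i v, T) * cf (insert i v, T) u)"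
        using True by (simp add: A_def sum.reindex inj_on_def)
      then show ?thesis using True by (simp add: pth_def c1 c2)
    qed (simp add: A_def)
    have "(\<Sum>t\<in>sts. cf s t * cf t u) = (\<Sum>t\<in>A j \<union> A k. cf s t * cf t u)"
      using Asub finite_sts zero by (intro sum.mono_neutral_right) auto
    also have "\<dots> = (\<Sum>t\<in>A j. cf s t * cf t u) + (\<Sum>t\<in>A k. cf s t * cf t u)"
    proof (rule sum.union_disjoint)
      show "finite (A j)" "finite (A k)" using Asub finite_sts finite_subset by blast+
      have "fst t = insert i v" if "t \<in> A i" for t i using that by (auto simp: A_def split: if_splits)
      then show "A j \<inter> A k = {}" using ne by blast
    qed
    also have "\<dots> = (if triv ?m then pth j S else 0) + (if triv ?n then pth k S else 0)"
      using S1[of j k] S1[of k j] jk by (simp add: insert_commute)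
    also have "\<dots> = 0"
    proof -
      obtain T where T: "T \<subseteq> N" "\<And>h. hat (R v) h T = h S" using transversal[OF v(1,3)] by blast
      let ?h = "hat (R w) (\<lambda>T'. if T' = U then 1 else 0)"
      have k': "k \<in> X - ?m" and j': "j \<in> X - ?n" and w': "w = insert j ?n" using jk by auto
      have "pth j S = stp v j (stp ?m k ?h) T"
        using path_value[OF v(1) jk(1) k' jk(4) w(3) T(1)] unfolding T(2) pth_def .
      moreover have "pth k S = stp v k (stp ?n j ?h) T"
        using path_value[OF v(1) jk(2) j' w' w(3) T(1)] unfolding T(2) pth_def .
      ultimately have "(if triv ?m then pth j S else 0) = (if triv ?n then pth k S else 0)"
        using face_commutes[OF v(1) jk v(2) w(2), of "\<lambda>T'. if T' = U then 1 else 0" T] by (simp only:)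
      then show ?thesis using bit_add_self[of "if triv ?n then pth k S else 0"] by argo
    qed
    finally show ?thesis .
  qed
qed

end

section \<open>Cancelling a local circle\<close>

lemma pcoef_zero:
  "Z \<in> CP \<Longrightarrow> Z \<in> CQ \<Longrightarrow> (Z \<in> S) \<noteq> (Z \<in> T) \<Longrightarrow> pcoef CP S CQ T = 0"
  by (subst pcoef_drop[of Z]) auto

text \<open>A saddle that cuts off the circle \<open>Z\<close>: \<open>P\<close> arises from
  \<open>W\<close> by absorbing \<open>Z\<close> into another circle. Deleting the points of
  \<open>Z\<close> identifies the circles of \<open>P\<close> with those of \<open>W\<close> other
  than \<open>Z\<close>.\<close>

locale circle_cut =
  fixes N :: "'n set" and W P :: "('n \<times> 'n) set" and x y :: 'n and Z :: "'n set"
  assumes W: "equiv UNIV W" and xy: "x \<in> N" "y \<in> N" "(x, y) \<notin> W" and P: "P = mrg W x y" and Z: "Z = W `` {x}"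
begin

lemma cut_facts:
  obtains B Rest where "N // W = insert Z (insert B Rest)" "N // P = insert (Z \<union> B) Rest"
    "Z \<noteq> B" "Z \<notin> Rest" "B \<notin> Rest" "Z \<union> B \<notin> Rest" "Z \<union> B \<noteq> Z" "Z \<union> B \<noteq> B" "B - Z = B" "(Z \<union> B) - Z = B"
    "\<And>C. C \<in> Rest \<Longrightarrow> C - Z = C"
proof -
  note q = mrg_quotient[OF W xy, folded Z P]
  have d: "(Z \<union> W `` {y}) - Z = W `` {y}" "W `` {y} - Z = W `` {y}" using q(9) by blast+
  have r: "C - Z = C" if C: "C \<in> N // W - {Z, W `` {y}}" for C
  proof -
    have "Z \<in> N // W" using q(1) by blast
    then have "C \<inter> Z = {}" using C class_disjoint[OF W, of C N Z] by blast
    then show ?thesis by blast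
  qed
  show thesis using that[OF q(1-8) d(2,1) r] by blast
qed

lemma cut_bij: "inj_on (\<lambda>C. C - Z) (N // P)" "(\<lambda>C. C - Z) ` (N // P) = N // W - {Z}" "Z \<in> N // W"
proof -
  obtain B Rest where f: "N // W = insert Z (insert B Rest)" "N // P = insert (Z \<union> B) Rest"
    "Z \<noteq> B" "Z \<notin> Rest" "B \<notin> Rest" "Z \<union> B \<notin> Rest" "Z \<union> B \<noteq> Z" "Z \<union> B \<noteq> B" "B - Z = B" "(Z \<union> B) - Z = B"
    "\<And>C. C \<in> Rest \<Longrightarrow> C - Z = C" by (rule cut_facts) (rule that)
  show "inj_on (\<lambda>C. C - Z) (N // P)"
    unfolding f(2) inj_on_insert using f(5,10,11) by (auto simp: inj_on_def)
  have "(\<lambda>C. C - Z) ` (N // P) = insert B Rest"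
    unfolding f(2) image_insert f(10) using f(11) by simp
  then show "(\<lambda>C. C - Z) ` (N // P) = N // W - {Z}" unfolding f(1) using f(3,4) by auto
  show "Z \<in> N // W" unfolding f(1) by simp
qed

lemma cut_image_eq:
  assumes f: "N // W = insert Z (insert B Rest)" "N // P = insert (Z \<union> B) Rest" "B \<notin> Rest" "Z \<union> B \<notin> Rest"
      "(Z \<union> B) - Z = B" "\<And>C. C \<in> Rest \<Longrightarrow> C - Z = C" "Z \<noteq> B" "Z \<notin> Rest"
    and S: "S \<subseteq> N // P" and T: "T \<subseteq> N // W - {Z}"
  shows "(\<lambda>C. C - Z) ` S = T \<longleftrightarrow> (\<forall>C\<in>Rest. C \<in> S \<longleftrightarrow> C \<in> T) \<and> (Z \<union> B \<in> S \<longleftrightarrow> B \<in> T)"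
proof -
  have S': "S \<subseteq> insert (Z \<union> B) Rest" and T': "T \<subseteq> insert B Rest" using S T unfolding f(1,2) by auto
  have im: "(\<lambda>C. C - Z) ` S = (S \<inter> Rest) \<union> (if Z \<union> B \<in> S then {B} else {})"
  proof -
    have "S = (S \<inter> Rest) \<union> (if Z \<union> B \<in> S then {Z \<union> B} else {})" using S' by auto
    then have "(\<lambda>C. C - Z) ` S = (\<lambda>C. C - Z) ` ((S \<inter> Rest) \<union> (if Z \<union> B \<in> S then {Z \<union> B} else {}))"
      by (rule arg_cong)
    also have "\<dots> = (\<lambda>C. C - Z) ` (S \<inter> Rest) \<union> (if Z \<union> B \<in> S then {B} else {})"
      by (cases "Z \<union> B \<in> S") (simp_all only: if_True if_False image_Un image_insert image_empty f(5) simp_thms)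
    finally have "(\<lambda>C. C - Z) ` S = (\<lambda>C. C - Z) ` (S \<inter> Rest) \<union> (if Z \<union> B \<in> S then {B} else {})" .
    moreover have "(\<lambda>C. C - Z) ` (S \<inter> Rest) = S \<inter> Rest" using f(6) by auto
    ultimately show ?thesis by simp
  qed
  show ?thesis unfolding im using S' T' f(3) by (auto split: if_splits)
qed

text \<open>Comultiplication followed by projection to the label \<open>x\<close> of
  \<open>Z\<close> is the identity.\<close>

lemma cut_split:
  assumes S: "S \<subseteq> N // P" and T: "T \<subseteq> N // W" and ZT: "Z \<in> T"
  shows "pcoef (N // P) S (N // W) T = (if (\<lambda>C. C - Z) ` S = T - {Z} then 1 else 0)"
proof -
  obtain B Rest where f: "N // W = insert Z (insert B Rest)" "N // P = insert (Z \<union> B) Rest"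
    "Z \<noteq> B" "Z \<notin> Rest" "B \<notin> Rest" "Z \<union> B \<notin> Rest" "Z \<union> B \<noteq> Z" "Z \<union> B \<noteq> B" "B - Z = B" "(Z \<union> B) - Z = B"
    "\<And>C. C \<in> Rest \<Longrightarrow> C - Z = C" by (rule cut_facts) (rule that)
  have T': "T - {Z} \<subseteq> N // W - {Z}" using T by blast
  have e: "(\<lambda>C. C - Z) ` S = T - {Z} \<longleftrightarrow> (\<forall>C\<in>Rest. C \<in> S \<longleftrightarrow> C \<in> T) \<and> (Z \<union> B \<in> S \<longleftrightarrow> B \<in> T)"
  proof -
    have "C \<in> T - {Z} \<longleftrightarrow> C \<in> T" if "C \<in> Rest" for C using f(4) that by blast
    moreover have "B \<in> T - {Z} \<longleftrightarrow> B \<in> T" using f(3) by blast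
    moreover have "(\<lambda>C. C - Z) ` S = T - {Z} \<longleftrightarrow>
        (\<forall>C\<in>Rest. C \<in> S \<longleftrightarrow> C \<in> T - {Z}) \<and> (Z \<union> B \<in> S \<longleftrightarrow> B \<in> T - {Z})"
      by (rule cut_image_eq[OF f(1,2,5,6,10) _ f(3,4) S T']) (rule f(11))
    ultimately show ?thesis by (simp cong: ball_cong)
  qed
  show ?thesis
    unfolding pcoef_split[OF f(2,1,3,4,5,6,7,8)] e using ZT by (auto simp: lab_def)
qed

text \<open>Multiplication by the unit, the label of \<open>Z\<close>, is the identity.\<close>

lemma cut_merge:
  assumes S: "S \<subseteq> N // W" and T: "T \<subseteq> N // P" and ZS: "Z \<notin> S"
  shows "pcoef (N // W) S (N // P) T = (if (\<lambda>C. C - Z) ` T = S then 1 else 0)"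
proof -
  obtain B Rest where f: "N // W = insert Z (insert B Rest)" "N // P = insert (Z \<union> B) Rest"
    "Z \<noteq> B" "Z \<notin> Rest" "B \<notin> Rest" "Z \<union> B \<notin> Rest" "Z \<union> B \<noteq> Z" "Z \<union> B \<noteq> B" "B - Z = B" "(Z \<union> B) - Z = B"
    "\<And>C. C \<in> Rest \<Longrightarrow> C - Z = C" by (rule cut_facts) (rule that)
  have S': "S \<subseteq> N // W - {Z}" using S ZS by blast
  have e: "(\<lambda>C. C - Z) ` T = S \<longleftrightarrow> (\<forall>C\<in>Rest. C \<in> S \<longleftrightarrow> C \<in> T) \<and> (Z \<union> B \<in> T \<longleftrightarrow> B \<in> S)"
  proof -
    have "(\<forall>C\<in>Rest. C \<in> S \<longleftrightarrow> C \<in> T) \<longleftrightarrow> (\<forall>C\<in>Rest. C \<in> T \<longleftrightarrow> C \<in> S)" by (rule ball_cong) auto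
    moreover have "(\<lambda>C. C - Z) ` T = S \<longleftrightarrow> (\<forall>C\<in>Rest. C \<in> T \<longleftrightarrow> C \<in> S) \<and> (Z \<union> B \<in> T \<longleftrightarrow> B \<in> S)"
      by (rule cut_image_eq[OF f(1,2,5,6,10) _ f(3,4) T S']) (rule f(11))
    ultimately show ?thesis by (simp only:)
  qed
  show ?thesis
    unfolding pcoef_merge[OF f(1,2,3,4,5,6,7,8)] e using ZS by (auto simp: lab_def)
qed

text \<open>An unmarked circle is even, and cutting it off does not change the parity of the
  others.\<close>

lemma cut_even:
  assumes "K \<inter> Z = {}"
  shows "(\<forall>C\<in>N // P. even (card (K \<inter> C))) \<longleftrightarrow> (\<forall>C\<in>N // W. even (card (K \<inter> C)))"
proof -
  obtain B Rest where f: "N // W = insert Z (insert B Rest)" "N // P = insert (Z \<union> B) Rest"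
    "Z \<noteq> B" "Z \<notin> Rest" "B \<notin> Rest" "Z \<union> B \<notin> Rest" "Z \<union> B \<noteq> Z" "Z \<union> B \<noteq> B" "B - Z = B" "(Z \<union> B) - Z = B"
    "\<And>C. C \<in> Rest \<Longrightarrow> C - Z = C" by (rule cut_facts) (rule that)
  have "K \<inter> (Z \<union> B) = K \<inter> B" using assms by blast
  then show ?thesis unfolding f using assms by simp
qed

end

context cube
begin

lemma cut_at_split:
  assumes v: "v \<subseteq> X" and j: "j \<in> X - v" and Z: "Z \<in> circ (insert j v)" and t: "(a j \<in> Z) \<noteq> (b j \<in> Z)"
  obtains x y where "circle_cut N (R (insert j v)) (R v) x y Z"
proof -
  have abj: "a j \<in> N" "b j \<in> N" using ab j by auto
  have cl: "(a j, b j) \<notin> R (insert j v)"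
  proof
    assume r: "(a j, b j) \<in> R (insert j v)"
    have "a j \<in> Z \<longleftrightarrow> b j \<in> Z"
      using class_mem[OF eqR Z[unfolded circ_def]] r equivUD(2)[OF eqR r] by blast
    then show False using t by blast
  qed
  then have R: "R v = mrg (R (insert j v)) (a j) (b j)" using surgery_cases[OF v j HOL.refl] by metis
  show thesis
  proof (cases "a j \<in> Z")
    case True
    then have "Z = R (insert j v) `` {a j}" using class_mem[OF eqR Z[unfolded circ_def]] by blast
    then show thesis using abj cl R eqR by (intro that[of "a j" "b j"]) (simp add: circle_cut_def)
  next
    case False
    then have "Z = R (insert j v) `` {b j}" using t class_mem[OF eqR Z[unfolded circ_def]] by blast
    moreover have "(b j, a j) \<notin> R (insert j v)" using cl equivUD(2)[OF eqR] by blast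
    ultimately show thesis using abj R eqR mrg_comm[of "R (insert j v)" "a j" "b j"]
      by (intro that[of "b j" "a j"]) (simp add: circle_cut_def)
  qed
qed

lemma cut_at_merge:
  assumes v: "v \<subseteq> X" and j: "j \<in> X - v" and Z: "Z \<in> circ v" and t: "(a j \<in> Z) \<noteq> (b j \<in> Z)"
  obtains x y where "circle_cut N (R v) (R (insert j v)) x y Z"
proof -
  have abj: "a j \<in> N" "b j \<in> N" using ab j by auto
  have cl: "(a j, b j) \<notin> R v"
  proof
    assume r: "(a j, b j) \<in> R v"
    have "a j \<in> Z \<longleftrightarrow> b j \<in> Z"
      using class_mem[OF eqR Z[unfolded circ_def]] r equivUD(2)[OF eqR r] by blast
    then show False using t by blast
  qed
  then have R: "R (insert j v) = mrg (R v) (a j) (b j)" using surgery_cases[OF v j HOL.refl] by metis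
  show thesis
  proof (cases "a j \<in> Z")
    case True
    then have "Z = R v `` {a j}" using class_mem[OF eqR Z[unfolded circ_def]] by blast
    then show thesis using abj cl R eqR by (intro that[of "a j" "b j"]) (simp add: circle_cut_def)
  next
    case False
    then have "Z = R v `` {b j}" using t class_mem[OF eqR Z[unfolded circ_def]] by blast
    moreover have "(b j, a j) \<notin> R v" using cl equivUD(2)[OF eqR] by blast
    ultimately show thesis using abj R eqR mrg_comm[of "R v" "a j" "b j"]
      by (intro that[of "b j" "a j"]) (simp add: circle_cut_def)
  qed
qed

text \<open>Two kinds of arrows are cancelled at once: from the vertices in \<open>Vs\<close> a
  circle \<open>Z\<close> splits off along \<open>p\<close>, where states correspond to those with
  \<open>Z\<close> labelled \<open>x\<close>; at the vertices in \<open>Vm\<close> the circle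
  \<open>Z\<close> is absorbed along \<open>q\<close>, where states correspond to those with
  \<open>Z\<close> labelled \<open>1\<close>. The premise on pairs makes the matrix of the cancelled
  arrows the identity rather than just triangular.\<close>

lemma circle_cancellation:
  assumes Vs: "\<And>v. v \<in> Vs \<Longrightarrow> v \<subseteq> X \<and> p \<notin> v \<and> q \<notin> v \<and> p \<in> X \<and> Z \<in> circ (insert p v) \<and> (a p \<in> Z) \<noteq> (b p \<in> Z)"
    and Vm: "\<And>u. u \<in> Vm \<Longrightarrow> u \<subseteq> X \<and> q \<notin> u \<and> q \<in> X \<and> Z \<in> circ u \<and> (a q \<in> Z) \<noteq> (b q \<in> Z)"
    and disj: "\<And>v u. v \<in> Vs \<Longrightarrow> u \<in> Vm \<Longrightarrow> v \<noteq> u \<and> p \<noteq> q \<and> (\<forall>j. insert q u \<noteq> insert j v)"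
    and KZ: "K \<inter> Z = {}"
  defines "I \<equiv> {s \<in> sts. fst s \<in> Vs \<or> q \<in> fst s \<and> fst s - {q} \<in> Vm}"
    and "\<alpha> \<equiv> \<lambda>s. if fst s \<in> Vs then s else (fst s - {q}, (\<lambda>C. C - Z) ` snd s)"
    and "\<beta> \<equiv> \<lambda>s. if fst s \<in> Vs then (insert p (fst s), insert Z ((\<lambda>C. C - Z) ` snd s)) else s"
    and "C \<equiv> {(w, S) \<in> sts. w \<notin> Vs \<and> \<not> (w \<in> Vm \<and> Z \<notin> S) \<and> \<not> (p \<in> w \<and> w - {p} \<in> Vs \<and> Z \<in> S)
              \<and> \<not> (q \<in> w \<and> w - {q} \<in> Vm)}"
  shows "square_zero C (\<lambda>s t. cf s t + (\<Sum>i\<in>I. cf s (\<beta> i) * cf (\<alpha> i) t))" (is ?th1)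
    and "homology C (\<lambda>s t. cf s t + (\<Sum>i\<in>I. cf s (\<beta> i) * cf (\<alpha> i) t)) \<cong> homology sts cf" (is ?th2)
proof -
  let ?r = "\<lambda>C. C - Z"
  have s_split: "inj_on ?r (circ v)" "?r ` circ v = circ (insert p v) - {Z}" "triv v \<longleftrightarrow> triv (insert p v)"
     "\<And>S T. S \<subseteq> circ v \<Longrightarrow> T \<subseteq> circ (insert p v) \<Longrightarrow> Z \<in> T \<Longrightarrow>
        pcoef (circ v) S (circ (insert p v)) T = (if ?r ` S = T - {Z} then 1 else 0)"
    if v: "v \<in> Vs" for v
  proof -
    obtain x y where "circle_cut N (R (insert p v)) (R v) x y Z" using cut_at_split[of v p Z] Vs[OF v] by auto
    then interpret circle_cut N "R (insert p v)" "R v" x y Z .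
    show "inj_on ?r (circ v)" "?r ` circ v = circ (insert p v) - {Z}" using cut_bij by (simp_all add: circ_def)
    show "triv v \<longleftrightarrow> triv (insert p v)" using cut_even[OF KZ] by (simp add: triv_def circ_def)
    show "\<And>S T. S \<subseteq> circ v \<Longrightarrow> T \<subseteq> circ (insert p v) \<Longrightarrow> Z \<in> T \<Longrightarrow>
        pcoef (circ v) S (circ (insert p v)) T = (if ?r ` S = T - {Z} then 1 else 0)"
      using cut_split by (simp add: circ_def)
  qed
  have s_merge: "inj_on ?r (circ (insert q u))" "?r ` circ (insert q u) = circ u - {Z}" "triv u \<longleftrightarrow> triv (insert q u)"
     "\<And>S T. S \<subseteq> circ u \<Longrightarrow> T \<subseteq> circ (insert q u) \<Longrightarrow> Z \<notin> S \<Longrightarrow>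
        pcoef (circ u) S (circ (insert q u)) T = (if ?r ` T = S then 1 else 0)"
    if u: "u \<in> Vm" for u
  proof -
    obtain x y where "circle_cut N (R u) (R (insert q u)) x y Z" using cut_at_merge[of u q Z] Vm[OF u] by auto
    then interpret circle_cut N "R u" "R (insert q u)" x y Z .
    show "inj_on ?r (circ (insert q u))" "?r ` circ (insert q u) = circ u - {Z}" using cut_bij by (simp_all add: circ_def)
    show "triv u \<longleftrightarrow> triv (insert q u)" using cut_even[OF KZ] by (auto simp add: triv_def circ_def)
    show "\<And>S T. S \<subseteq> circ u \<Longrightarrow> T \<subseteq> circ (insert q u) \<Longrightarrow> Z \<notin> S \<Longrightarrow>
        pcoef (circ u) S (circ (insert q u)) T = (if ?r ` T = S then 1 else 0)"
      using cut_merge by (simp add: circ_def)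
  qed
  have rZ: "Z \<notin> ?r ` S" if "v \<in> Vs" "S \<subseteq> circ v" for v S using s_split(2)[OF that(1)] that(2) by blast
  have rZ': "Z \<notin> ?r ` S" if "u \<in> Vm" "S \<subseteq> circ (insert q u)" for u S using s_merge(2)[OF that(1)] that(2) by blast
  have Icases: thesis
    if "i \<in> I" "\<And>v S. i = (v, S) \<Longrightarrow> v \<in> Vs \<Longrightarrow> triv v \<Longrightarrow> S \<subseteq> circ v \<Longrightarrow> \<alpha> i = (v, S) \<Longrightarrow>
           \<beta> i = (insert p v, insert Z (?r ` S)) \<Longrightarrow> thesis"
       "\<And>u S. i = (insert q u, S) \<Longrightarrow> u \<in> Vm \<Longrightarrow> triv (insert q u) \<Longrightarrow> S \<subseteq> circ (insert q u) \<Longrightarrow>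
           \<alpha> i = (u, ?r ` S) \<Longrightarrow> \<beta> i = (insert q u, S) \<Longrightarrow> thesis" for i thesis
  proof -
    obtain w S where i: "i = (w, S)" by (cases i)
    have st: "w \<subseteq> X" "triv w" "S \<subseteq> circ w" using that(1) by (auto simp: i I_def sts_def)
    show thesis
    proof (cases "w \<in> Vs")
      case True
      then show thesis using that(2) st i by (simp add: \<alpha>_def \<beta>_def)
    next
      case False
      then have q: "q \<in> w" "w - {q} \<in> Vm" using that(1) by (auto simp: I_def i)
      have w: "w = insert q (w - {q})" using q by blast
      show thesis
      proof (rule that(3)[of "w - {q}" S])
        show "i = (insert q (w - {q}), S)" using w i by simp
        show "triv (insert q (w - {q}))" "S \<subseteq> circ (insert q (w - {q}))" using st w by simp_all
        show "\<alpha> i = (w - {q}, ?r ` S)" using False by (simp add: \<alpha>_def i)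
        show "\<beta> i = (insert q (w - {q}), S)" using False w by (simp add: \<beta>_def i)
      qed (rule q)
    qed
  qed
  have Iin: "(v, S) \<in> I" if "v \<in> Vs" "triv v" "S \<subseteq> circ v" for v S
    using that Vs by (auto simp: I_def sts_def)
  have Iin': "(insert q u, S) \<in> I" if "u \<in> Vm" "triv u" "S \<subseteq> circ (insert q u)" for u S
    using that Vm[OF that(1)] s_merge(3)[OF that(1)] by (auto simp: I_def sts_def)
  have im\<alpha>: "\<alpha> ` I = {(w, S) \<in> sts. w \<in> Vs \<or> w \<in> Vm \<and> Z \<notin> S}" (is "_ = ?A")
  proof
    show "\<alpha> ` I \<subseteq> ?A"
    proof
      fix s assume "s \<in> \<alpha> ` I"
      then obtain i where i: "i \<in> I" "s = \<alpha> i" by blast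
      show "s \<in> ?A" using i(1)
      proof (rule Icases)
        fix v S assume "v \<in> Vs" "triv v" "S \<subseteq> circ v" "\<alpha> i = (v, S)"
        then show ?thesis using Vs i(2) by (auto simp: sts_def)
      next
        fix u S assume u: "u \<in> Vm" "triv (insert q u)" "S \<subseteq> circ (insert q u)" "\<alpha> i = (u, ?r ` S)"
        then show ?thesis using Vm[OF u(1)] s_merge[OF u(1)] rZ'[OF u(1,3)] i(2) by (auto simp: sts_def)
      qed
    qed
    show "?A \<subseteq> \<alpha> ` I"
    proof
      fix s assume s: "s \<in> ?A"
      obtain w S where ws: "s = (w, S)" by (cases s)
      have st: "w \<subseteq> X" "triv w" "S \<subseteq> circ w" using s by (auto simp: ws sts_def)
      show "s \<in> \<alpha> ` I"
      proof (cases "w \<in> Vs")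
        case True
        then show ?thesis using Iin[OF True st(2,3)] ws by (auto simp: \<alpha>_def image_iff intro!: bexI[of _ "(w, S)"])
      next
        case False
        then have u: "w \<in> Vm" "Z \<notin> S" using s ws by auto
        have "S \<subseteq> ?r ` circ (insert q w)" using st(3) u(2) unfolding s_merge(2)[OF u(1)] by blast
        then obtain T where T: "T \<subseteq> circ (insert q w)" "S = ?r ` T" by (auto simp: subset_image_iff)
        have "insert q w \<notin> Vs" using Vs by blast
        moreover have "insert q w - {q} = w" using Vm[OF u(1)] by blast
        ultimately have "\<alpha> (insert q w, T) = s" using ws T by (simp add: \<alpha>_def)
        then show ?thesis using Iin'[OF u(1) st(2) T(1)] by (metis image_eqI)
      qed
    qed
  qed
  have im\<beta>: "\<beta> ` I = {(w, S) \<in> sts. p \<in> w \<and> w - {p} \<in> Vs \<and> Z \<in> S \<or> q \<in> w \<and> w - {q} \<in> Vm}" (is "_ = ?B")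
  proof
    show "\<beta> ` I \<subseteq> ?B"
    proof
      fix s assume "s \<in> \<beta> ` I"
      then obtain i where i: "i \<in> I" "s = \<beta> i" by blast
      show "s \<in> ?B" using i(1)
      proof (rule Icases)
        fix v S assume v: "v \<in> Vs" "triv v" "S \<subseteq> circ v" "\<beta> i = (insert p v, insert Z (?r ` S))"
        have "insert p v - {p} = v" using Vs[OF v(1)] by blast
        then show ?thesis using v Vs[OF v(1)] s_split[OF v(1)] i(2) by (auto simp: sts_def)
      next
        fix u S assume u: "u \<in> Vm" "triv (insert q u)" "S \<subseteq> circ (insert q u)" "\<beta> i = (insert q u, S)"
        have "insert q u - {q} = u" using Vm[OF u(1)] by blast
        then show ?thesis using Vm[OF u(1)] u i(2) by (auto simp: sts_def)
      qed
    qed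
    show "?B \<subseteq> \<beta> ` I"
    proof
      fix s assume s: "s \<in> ?B"
      obtain w S where ws: "s = (w, S)" by (cases s)
      have st: "w \<subseteq> X" "triv w" "S \<subseteq> circ w" using s by (auto simp: ws sts_def)
      show "s \<in> \<beta> ` I"
      proof (cases "q \<in> w \<and> w - {q} \<in> Vm")
        case True
        then have w: "w = insert q (w - {q})" by blast
        have "w \<notin> Vs" using Vs True by blast
        then have "\<beta> (w, S) = s" by (simp add: \<beta>_def ws)
        moreover have "(w, S) \<in> I" using True s ws by (auto simp: I_def)
        ultimately show ?thesis by (metis image_eqI)
      next
        case False
        then have v: "p \<in> w" "w - {p} \<in> Vs" "Z \<in> S" using s ws by auto
        then have w: "insert p (w - {p}) = w" by blast
        have "S - {Z} \<subseteq> ?r ` circ (w - {p})" using st(3) unfolding s_split(2)[OF v(2)] w by blast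
        then obtain T where T: "T \<subseteq> circ (w - {p})" "S - {Z} = ?r ` T" by (auto simp: subset_image_iff)
        have "\<beta> (w - {p}, T) = s" using v w T by (auto simp: \<beta>_def ws)
        moreover have "triv (w - {p})" using s_split(3)[OF v(2)] st w by simp
        ultimately show ?thesis using Iin[OF v(2) _ T(1)] by (metis image_eqI)
      qed
    qed
  qed
  have VsVm: "v \<noteq> insert q u" if "v \<in> Vs" for v u using Vs[OF that] by blast
  have inj\<alpha>: "inj_on \<alpha> I"
  proof (rule inj_onI)
    fix i k assume ik: "i \<in> I" "k \<in> I" "\<alpha> i = \<alpha> k"
    show "i = k" using ik(1)
    proof (rule Icases)
      fix v S assume i: "i = (v, S)" "v \<in> Vs" "\<alpha> i = (v, S)"
      show ?thesis using ik(2) by (rule Icases) (use i ik(3) disj in auto)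
    next
      fix u S assume i: "i = (insert q u, S)" "u \<in> Vm" "S \<subseteq> circ (insert q u)" "\<alpha> i = (u, ?r ` S)"
      show ?thesis using ik(2)
      proof (rule Icases)
        fix v T assume "v \<in> Vs" "\<alpha> k = (v, T)"
        then show ?thesis using i ik(3) disj by auto
      next
        fix u' T assume k: "k = (insert q u', T)" "u' \<in> Vm" "T \<subseteq> circ (insert q u')" "\<alpha> k = (u', ?r ` T)"
        then have u: "u' = u" "?r ` S = ?r ` T" using i ik(3) by auto
        then have "S = T" using inj_on_image_eq_iff[OF s_merge(1)[OF i(2)] i(3), of T] k(3) by simp
        then show ?thesis using i(1) k(1) u by simp
      qed
    qed
  qed
  have inj\<beta>: "inj_on \<beta> I"
  proof (rule inj_onI)
    fix i k assume ik: "i \<in> I" "k \<in> I" "\<beta> i = \<beta> k"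
    show "i = k" using ik(1)
    proof (rule Icases)
      fix v S assume i: "i = (v, S)" "v \<in> Vs" "S \<subseteq> circ v" "\<beta> i = (insert p v, insert Z (?r ` S))"
      show ?thesis using ik(2)
      proof (rule Icases)
        fix v' T assume k: "k = (v', T)" "v' \<in> Vs" "T \<subseteq> circ v'" "\<beta> k = (insert p v', insert Z (?r ` T))"
        have "insert p v = insert p v'" using i(4) k(4) ik(3) by simp
        then have v': "v' = v" using Vs[OF i(2)] Vs[OF k(2)] insert_ident[of p v v'] by simp
        have "insert Z (?r ` S) = insert Z (?r ` T)" using i(4) k(4) ik(3) by simp
        then have "?r ` S = ?r ` T" using rZ[OF i(2,3)] rZ[OF k(2,3)] by (meson insert_ident)
        then have "S = T" using inj_on_image_eq_iff[OF s_split(1)[OF i(2)] i(3), of T] k(3) v' by simp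
        then show ?thesis using i(1) k(1) v' by simp
      next
        fix u T assume k: "u \<in> Vm" "\<beta> k = (insert q u, T)"
        then have "insert p v = insert q u" using i(4) ik(3) by simp
        then show ?thesis using Vs[OF i(2)] disj[OF i(2) k(1)] by blast
      qed
    next
      fix u S assume i: "i = (insert q u, S)" "u \<in> Vm" "\<beta> i = (insert q u, S)"
      show ?thesis using ik(2)
      proof (rule Icases)
        fix v T assume k: "v \<in> Vs" "\<beta> k = (insert p v, insert Z (?r ` T))"
        then have "insert p v = insert q u" using i(3) ik(3) by simp
        then show ?thesis using Vs[OF k(1)] disj[OF k(1) i(2)] by blast
      next
        fix u' T assume "k = (insert q u', T)" "\<beta> k = (insert q u', T)"
        then show ?thesis using i ik(3) by simp
      qed
    qed
  qed
  have unit: "cf (\<alpha> i) (\<beta> k) = (if i = k then 1 else 0)" if ik: "i \<in> I" "k \<in> I" for i k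
    using ik(1)
  proof (rule Icases)
    fix v S assume i: "i = (v, S)" "v \<in> Vs" "S \<subseteq> circ v" "\<alpha> i = (v, S)"
    show ?thesis using ik(2)
    proof (rule Icases)
      fix v' T assume k: "k = (v', T)" "v' \<in> Vs" "T \<subseteq> circ v'" "\<beta> k = (insert p v', insert Z (?r ` T))"
      show ?thesis
      proof (cases "v' = v")
        case True
        have "p \<in> X - v" using Vs[OF i(2)] by blast
        then have "cf (\<alpha> i) (\<beta> k) = pcoef (circ v) S (circ (insert p v)) (insert Z (?r ` T))"
          using i(4) k(4) True by (auto simp: cf_def)
        also have "\<dots> = (if ?r ` S = insert Z (?r ` T) - {Z} then 1 else 0)"
          using k True Vs[OF i(2)] s_split(2)[OF i(2)] by (intro s_split(4)[OF i(2,3)]) auto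
        also have "insert Z (?r ` T) - {Z} = ?r ` T" using rZ[OF k(2,3)] by blast
        also have "?r ` S = ?r ` T \<longleftrightarrow> S = T"
          using inj_on_image_eq_iff[OF s_split(1)[OF i(2)] i(3), of T] k(3) True by simp
        finally show ?thesis using i(1) k(1) True by simp
      next
        case False
        have "insert p v' \<noteq> insert j v" if "j \<notin> v" for j
        proof
          assume e: "insert p v' = insert j v"
          then have "p \<in> insert j v" by blast
          then have "j = p" using Vs[OF i(2)] by blast
          then show False using e Vs[OF i(2)] Vs[OF k(2)] insert_ident[of p v' v] False by simp
        qed
        then have "cf (\<alpha> i) (\<beta> k) = 0" using i(4) k(4) by (auto simp: cf_def)
        then show ?thesis using False i(1) k(1) by simp
      qed
    next
      fix u T assume k: "k = (insert q u, T)" "u \<in> Vm" "\<beta> k = (insert q u, T)"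
      have "cf (\<alpha> i) (\<beta> k) = 0" using i(4) k(3) disj[OF i(2) k(2)] by (auto simp: cf_def)
      then show ?thesis using i(1) k(1) VsVm[OF i(2)] by simp
    qed
  next
    fix u S assume i: "i = (insert q u, S)" "u \<in> Vm" "S \<subseteq> circ (insert q u)" "\<alpha> i = (u, ?r ` S)"
    show ?thesis using ik(2)
    proof (rule Icases)
      fix v' T assume k: "k = (v', T)" "v' \<in> Vs" "T \<subseteq> circ v'" "\<beta> k = (insert p v', insert Z (?r ` T))"
      have "pcoef (circ u) (?r ` S) (circ (insert p v')) (insert Z (?r ` T)) = 0"
        using Vm[OF i(2)] Vs[OF k(2)] rZ'[OF i(2,3)] by (intro pcoef_zero[of Z]) auto
      then have "cf (\<alpha> i) (\<beta> k) = 0" using i(4) k(4) by (auto simp: cf_def)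
      then show ?thesis using i(1) k(1) VsVm[OF k(2), of u] by simp
    next
      fix u' T assume k: "k = (insert q u', T)" "u' \<in> Vm" "T \<subseteq> circ (insert q u')" "\<beta> k = (insert q u', T)"
      show ?thesis
      proof (cases "u' = u")
        case True
        have "q \<in> X - u" using Vm[OF i(2)] by blast
        then have "cf (\<alpha> i) (\<beta> k) = pcoef (circ u) (?r ` S) (circ (insert q u)) T"
          using i(4) k(4) True by (auto simp: cf_def)
        also have "\<dots> = (if ?r ` T = ?r ` S then 1 else 0)"
        proof (rule s_merge(4)[OF i(2)])
          show "?r ` S \<subseteq> circ u" using s_merge(2)[OF i(2)] i(3) by blast
          show "T \<subseteq> circ (insert q u)" using k(3) True by simp
          show "Z \<notin> ?r ` S" by (rule rZ'[OF i(2,3)])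
        qed
        also have "?r ` T = ?r ` S \<longleftrightarrow> S = T"
          using inj_on_image_eq_iff[OF s_merge(1)[OF i(2)] i(3), of T] k(3) True by auto
        finally show ?thesis using i(1) k(1) True by simp
      next
        case False
        have ne: "insert q u' \<noteq> insert j u" if "j \<notin> u" for j
        proof
          assume e: "insert q u' = insert j u"
          then have "q \<in> insert j u" by blast
          then have "j = q" using Vm[OF i(2)] by blast
          then show False using e Vm[OF i(2)] Vm[OF k(2)] insert_ident[of q u' u] False by simp
        qed
        then have "cf (\<alpha> i) (\<beta> k) = 0" using i(4) k(4) by (auto simp: cf_def)
        moreover have "insert q u \<noteq> insert q u'" using ne[of q] Vm[OF i(2)] by metis
        ultimately show ?thesis using i(1) k(1) by simp
      qed
    qed
  qed
  have un: "sts = \<alpha> ` I \<union> \<beta> ` I \<union> C" unfolding im\<alpha> im\<beta> C_def by auto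
  have d1: "\<alpha> ` I \<inter> \<beta> ` I = {}"
  proof -
    have False if "(w, S) \<in> \<alpha> ` I" "(w, S) \<in> \<beta> ` I" for w S
    proof -
      have A: "w \<in> Vs \<or> w \<in> Vm \<and> Z \<notin> S" using that(1) unfolding im\<alpha> by blast
      have B: "p \<in> w \<and> w - {p} \<in> Vs \<and> Z \<in> S \<or> q \<in> w \<and> w - {q} \<in> Vm" using that(2) unfolding im\<beta> by blast
      show False using A B Vs[of w] Vm[of w] by blast
    qed
    then show ?thesis by auto
  qed
  have d2: "\<alpha> ` I \<inter> C = {}" "\<beta> ` I \<inter> C = {}" unfolding im\<alpha> im\<beta> C_def by auto
  show ?th1 by (rule cancellation(1)[OF square_zero_cf inj\<alpha> inj\<beta> un d1 d2 unit])
  show ?th2 by (rule cancellation(2)[OF square_zero_cf inj\<alpha> inj\<beta> un d1 d2 unit])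
qed

end

section \<open>Image complexes\<close>

text \<open>After a move, vertices and circles are renamed so that the complexes of both sides can
  be compared; these are the states of the renamed complex and their coefficients.\<close>

definition image_states :: "'v set \<Rightarrow> ('v \<Rightarrow> 'd set) \<Rightarrow> ('v \<times> 'd set) set" where
  "image_states V cc = (SIGMA w:V. Pow (cc w))"

definition image_coeff :: "('v \<Rightarrow> 'v \<Rightarrow> bool) \<Rightarrow> ('v \<Rightarrow> 'd set) \<Rightarrow> 'v \<times> 'd set \<Rightarrow> 'v \<times> 'd set \<Rightarrow> bit" where
  "image_coeff A cc s t = (if A (fst s) (fst t) then pcoef (cc (fst s)) (snd s) (cc (fst t)) (snd t) else 0)"

text \<open>The labels in \<open>E\<close> are common to all states, since they belong to a circle
  with a fixed label that survives a cancellation. The renaming drops them.\<close>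

lemma image_complex_iso:
  assumes sq: "square_zero St c"
    and St: "St = (\<lambda>(w, S). (w, S \<union> E)) ` (SIGMA w:V. Pow (D w))"
    and E: "\<And>w. w \<in> V \<Longrightarrow> E \<inter> D w = {}"
    and inj: "inj_on \<zeta> V" "\<And>w. w \<in> V \<Longrightarrow> inj_on \<beta> (D w)"
    and W: "W = \<zeta> ` V" and cc: "\<And>w. w \<in> V \<Longrightarrow> cc (\<zeta> w) = \<beta> ` D w"
    and c: "\<And>w S x T. w \<in> V \<Longrightarrow> x \<in> V \<Longrightarrow> S \<subseteq> D w \<Longrightarrow> T \<subseteq> D x \<Longrightarrow> c (w, S \<union> E) (x, T \<union> E) =
       (if A (\<zeta> w) (\<zeta> x) then pcoef (\<beta> ` D w) (\<beta> ` S) (\<beta> ` D x) (\<beta> ` T) else 0)"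
  shows "homology (image_states W cc) (image_coeff A cc) \<cong> homology St c"
proof (rule homology_iso_bij[OF _ _ sq])
  define \<phi> where "\<phi> s = (\<zeta> (fst s), \<beta> ` (snd s - E))" for s
  have \<phi>: "\<phi> (w, S \<union> E) = (\<zeta> w, \<beta> ` S)" if "w \<in> V" "S \<subseteq> D w" for w S
  proof -
    have "S \<union> E - E = S" using that E[OF that(1)] by blast
    then show ?thesis by (simp add: \<phi>_def)
  qed
  have stE: "\<exists>w S. s = (w, S \<union> E) \<and> w \<in> V \<and> S \<subseteq> D w" if "s \<in> St" for s
    using that unfolding St by auto
  show "bij_betw \<phi> St (image_states W cc)"
    unfolding bij_betw_def
  proof
    show "inj_on \<phi> St"
    proof (rule inj_onI)
      fix s t assume st: "s \<in> St" "t \<in> St" "\<phi> s = \<phi> t"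
      obtain w S x T where s: "s = (w, S \<union> E)" "w \<in> V" "S \<subseteq> D w" and t: "t = (x, T \<union> E)" "x \<in> V" "T \<subseteq> D x"
        using stE st(1,2) by meson
      have "\<zeta> w = \<zeta> x" "\<beta> ` S = \<beta> ` T" using st(3) \<phi> s t by auto
      then have "w = x" using inj(1) s t by (auto dest: inj_onD)
      then show "s = t" using \<open>\<beta> ` S = \<beta> ` T\<close> inj_on_image_eq_iff[OF inj(2)[OF s(2)] s(3), of T] s t by simp
    qed
    show "\<phi> ` St = image_states W cc"
    proof
      show "\<phi> ` St \<subseteq> image_states W cc"
      proof
        fix y assume "y \<in> \<phi> ` St"
        then obtain s where "s \<in> St" "y = \<phi> s" by blast
        moreover then obtain w S where "s = (w, S \<union> E)" and w: "w \<in> V" "S \<subseteq> D w" using stE by blast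
        ultimately have "y = (\<zeta> w, \<beta> ` S)" using \<phi>[OF w] by simp
        then show "y \<in> image_states W cc" using w cc[OF w(1)] W by (auto simp: image_states_def)
      qed
      show "image_states W cc \<subseteq> \<phi> ` St"
      proof
        fix y assume y: "y \<in> image_states W cc"
        then obtain w where w: "w \<in> V" "fst y = \<zeta> w" "snd y \<subseteq> \<beta> ` D w"
          unfolding image_states_def W using cc by auto
        obtain S where S: "S \<subseteq> D w" "snd y = \<beta> ` S" using w(3) by (auto simp: subset_image_iff)
        have "y = \<phi> (w, S \<union> E)" using \<phi>[OF w(1) S(1)] w S by (simp add: prod_eq_iff)
        moreover have "(w, S \<union> E) \<in> St" using w S unfolding St by auto
        ultimately show "y \<in> \<phi> ` St" by blast
      qed
    qed
  qed
  fix s t assume st: "s \<in> St" "t \<in> St"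
  obtain w S x T where s: "s = (w, S \<union> E)" "w \<in> V" "S \<subseteq> D w" and t: "t = (x, T \<union> E)" "x \<in> V" "T \<subseteq> D x"
    using stE st(1,2) by meson
  show "c s t = image_coeff A cc (\<phi> s) (\<phi> t)"
    unfolding s(1) t(1) \<phi>[OF s(2,3)] \<phi>[OF t(2,3)] c[OF s(2) t(2) s(3) t(3)]
    by (simp add: image_coeff_def cc[OF s(2)] cc[OF t(2)])
qed

context cube
begin

definition adj :: "nat set \<Rightarrow> nat set \<Rightarrow> bool" where
  "adj v w \<longleftrightarrow> (\<exists>j\<in>X - v. w = insert j v)"

lemma adj_image_iso:
  assumes sq: "square_zero St c"
    and St: "St = {(w, S) \<in> sts. w \<in> V \<and> S \<inter> Zs = E}" and E: "E \<subseteq> Zs"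
    and V: "\<And>w. w \<in> V \<Longrightarrow> w \<subseteq> X \<and> triv w \<and> Zs \<subseteq> circ w" and Zs: "Zs \<subseteq> {Z}"
    and c: "\<And>s t. s \<in> St \<Longrightarrow> t \<in> St \<Longrightarrow> c s t = cf s t"
    and inj: "inj_on \<zeta> V" "\<And>w. w \<in> V \<Longrightarrow> inj_on \<beta> (circ w - Zs)"
      "\<And>w x. w \<in> V \<Longrightarrow> x \<in> V \<Longrightarrow> adj w x \<Longrightarrow> inj_on \<beta> ((circ w - Zs) \<union> (circ x - Zs))"
    and W: "W = \<zeta> ` V" and cc: "\<And>w. w \<in> V \<Longrightarrow> cc (\<zeta> w) = \<beta> ` (circ w - Zs)"
    and A: "\<And>w x. w \<in> V \<Longrightarrow> x \<in> V \<Longrightarrow> A (\<zeta> w) (\<zeta> x) \<longleftrightarrow> adj w x"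
  shows "homology (image_states W cc) (image_coeff A cc) \<cong> homology St c"
proof (rule image_complex_iso[where D = "\<lambda>w. circ w - Zs" and \<beta> = \<beta> and \<zeta> = \<zeta> and V = V and E = E, OF sq _ _ inj(1) _ W])
  show eq: "St = (\<lambda>(w, S). (w, S \<union> E)) ` (SIGMA w:V. Pow (circ w - Zs))"
  proof
    show "St \<subseteq> (\<lambda>(w, S). (w, S \<union> E)) ` (SIGMA w:V. Pow (circ w - Zs))"
    proof
      fix s assume s: "s \<in> St"
      obtain w S where ws: "s = (w, S)" by (cases s)
      have *: "w \<in> V" "S \<inter> Zs = E" "S \<subseteq> circ w" using s unfolding St ws sts_def by auto
      have "S - Zs \<union> E = S" using *(2) by blast
      then have "s = (\<lambda>(w, S). (w, S \<union> E)) (w, S - Zs)" using ws by simp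
      moreover have "(w, S - Zs) \<in> (SIGMA w:V. Pow (circ w - Zs))" using * by auto
      ultimately show "s \<in> (\<lambda>(w, S). (w, S \<union> E)) ` (SIGMA w:V. Pow (circ w - Zs))" by (rule image_eqI)
    qed
    show "(\<lambda>(w, S). (w, S \<union> E)) ` (SIGMA w:V. Pow (circ w - Zs)) \<subseteq> St"
    proof
      fix s assume "s \<in> (\<lambda>(w, S). (w, S \<union> E)) ` (SIGMA w:V. Pow (circ w - Zs))"
      then obtain w S where s: "s = (w, S \<union> E)" "w \<in> V" "S \<subseteq> circ w - Zs" by auto
      have "(S \<union> E) \<inter> Zs = E" using s(3) E by blast
      moreover have "S \<union> E \<subseteq> circ w" using s(3) E V[OF s(2)] by blast
      ultimately show "s \<in> St" using V[OF s(2)] s(2) unfolding St s(1) sts_def by simp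
    qed
  qed
  fix w S x T assume h: "w \<in> V" "x \<in> V" "S \<subseteq> circ w - Zs" "T \<subseteq> circ x - Zs"
  have "(w, S \<union> E) \<in> St" "(x, T \<union> E) \<in> St" unfolding eq using h by auto
  then have "c (w, S \<union> E) (x, T \<union> E) = cf (w, S \<union> E) (x, T \<union> E)" by (rule c)
  also have "\<dots> = (if adj w x then pcoef (circ w) (S \<union> E) (circ x) (T \<union> E) else 0)"
    by (simp add: cf_def adj_def)
  also have "pcoef (circ w) (S \<union> E) (circ x) (T \<union> E) = pcoef (circ w - Zs) S (circ x - Zs) T"
  proof (cases "Zs = {}")
    case True
    then show ?thesis using E by simp
  next
    case False
    then have Z: "Zs = {Z}" using Zs by blast
    have "Z \<in> circ w" "Z \<in> circ x" using V h Z by blast+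
    moreover have "S \<union> E - {Z} = S" "T \<union> E - {Z} = T" "Z \<in> S \<union> E \<longleftrightarrow> Z \<in> T \<union> E" using h E Z by blast+
    ultimately show ?thesis unfolding Z by (subst pcoef_drop[of Z]) simp_all
  qed
  also have "(if adj w x then pcoef (circ w - Zs) S (circ x - Zs) T else 0) =
     (if A (\<zeta> w) (\<zeta> x) then pcoef (\<beta> ` (circ w - Zs)) (\<beta> ` S) (\<beta> ` (circ x - Zs)) (\<beta> ` T) else 0)"
    using pcoef_image[OF inj(3)[OF h(1,2)] h(3,4)] A[OF h(1,2)] by simp
  finally show "c (w, S \<union> E) (x, T \<union> E) = \<dots>" .
qed (use E inj(2) cc in blast)+

end

section \<open>Reidemeister moves of a cube\<close>

context cube
begin

text \<open>The map \<open>tr\<close> restricts circles to points that survive the move. It has to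
  be injective only on the circles at the two ends of an edge: coefficients involve no more, and for
  some moves it is not possible on all vertices at once.\<close>

lemma isotopy_iso:
  assumes inj: "inj_on \<zeta> {w. w \<subseteq> X \<and> triv w}" "\<And>w. w \<subseteq> X \<Longrightarrow> inj_on tr (circ w)"
      "\<And>w x. w \<subseteq> X \<Longrightarrow> x \<subseteq> X \<Longrightarrow> adj w x \<Longrightarrow> inj_on tr (circ w \<union> circ x)"
    and W: "W = \<zeta> ` {w. w \<subseteq> X \<and> triv w}" and cc: "\<And>w. w \<subseteq> X \<Longrightarrow> cc (\<zeta> w) = tr ` circ w"
    and A: "\<And>w x. w \<subseteq> X \<Longrightarrow> x \<subseteq> X \<Longrightarrow> A (\<zeta> w) (\<zeta> x) \<longleftrightarrow> adj w x"
  shows "homology (image_states W cc) (image_coeff A cc) \<cong> homology sts cf"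
  by (rule adj_image_iso[OF square_zero_cf _ empty_subsetI _ empty_subsetI _ inj(1) _ _ W])
     (use inj cc A in \<open>auto simp: sts_def\<close>)

text \<open>The vertices without \<open>p\<close> cancel against those with \<open>p\<close> and
  label \<open>x\<close> on the small circle. There are no zigzags, because an arrow from a
  surviving vertex never leads to a cancelled target with label \<open>x\<close>.\<close>

lemma R1_split_iso:
  assumes p: "p \<in> X" and Z: "\<And>w. w \<subseteq> X \<Longrightarrow> p \<in> w \<Longrightarrow> Z \<in> circ w" and t: "(a p \<in> Z) \<noteq> (b p \<in> Z)" and KZ: "K \<inter> Z = {}"
    and inj: "inj_on \<zeta> {w. w \<subseteq> X \<and> p \<in> w \<and> triv w}" "\<And>w. w \<subseteq> X \<Longrightarrow> p \<in> w \<Longrightarrow> inj_on tr (circ w - {Z})"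
      "\<And>w x. w \<subseteq> X \<Longrightarrow> p \<in> w \<Longrightarrow> x \<subseteq> X \<Longrightarrow> p \<in> x \<Longrightarrow> adj w x \<Longrightarrow> inj_on tr ((circ w - {Z}) \<union> (circ x - {Z}))"
    and W: "W = \<zeta> ` {w. w \<subseteq> X \<and> p \<in> w \<and> triv w}" and cc: "\<And>w. w \<subseteq> X \<Longrightarrow> p \<in> w \<Longrightarrow> cc (\<zeta> w) = tr ` (circ w - {Z})"
    and A: "\<And>w x. w \<subseteq> X \<Longrightarrow> x \<subseteq> X \<Longrightarrow> p \<in> w \<Longrightarrow> p \<in> x \<Longrightarrow> A (\<zeta> w) (\<zeta> x) \<longleftrightarrow> adj w x"
  shows "homology (image_states W cc) (image_coeff A cc) \<cong> homology sts cf"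
proof -
  define Vs where "Vs = {v. v \<subseteq> X \<and> p \<notin> v}"
  define I where "I = {s \<in> sts. fst s \<in> Vs \<or> p \<in> fst s \<and> fst s - {p} \<in> {}}"
  define \<alpha> where "\<alpha> s = (if fst s \<in> Vs then s else (fst s - {p}, (\<lambda>C. C - Z) ` snd s))" for s :: "nat set \<times> 'n set set"
  define \<beta> where "\<beta> s = (if fst s \<in> Vs then (insert p (fst s), insert Z ((\<lambda>C. C - Z) ` snd s)) else s)" for s :: "nat set \<times> 'n set set"
  define C where "C = {(w, S) \<in> sts. p \<in> w \<and> Z \<notin> S}"
  define c' where "c' s t = cf s t + (\<Sum>i\<in>I. cf s (\<beta> i) * cf (\<alpha> i) t)" for s t
  have Vs: "v \<subseteq> X \<and> p \<notin> v \<and> p \<notin> v \<and> p \<in> X \<and> Z \<in> circ (insert p v) \<and> (a p \<in> Z) \<noteq> (b p \<in> Z)" if "v \<in> Vs" for v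
    using that p Z[of "insert p v"] t by (auto simp: Vs_def)
  have C: "C = {(w, S) \<in> sts. w \<notin> Vs \<and> \<not> (w \<in> {} \<and> Z \<notin> S) \<and> \<not> (p \<in> w \<and> w - {p} \<in> Vs \<and> Z \<in> S)
              \<and> \<not> (p \<in> w \<and> w - {p} \<in> {})}"
    by (auto simp: C_def Vs_def sts_def)
  note cc' = circle_cancellation[of Vs p p Z "{}", OF Vs _ _ KZ, folded I_def \<alpha>_def \<beta>_def C c'_def]
  have c'eq: "c' = (\<lambda>s t. cf s t + (\<Sum>i\<in>I. cf s (\<beta> i) * cf (\<alpha> i) t))" by (simp add: fun_eq_iff c'_def)
  have sq: "square_zero C c'" and iso: "homology C c' \<cong> homology sts cf"
    unfolding c'eq using cc' by auto
  have c: "c' s t' = cf s t'" if s: "s \<in> C" "t' \<in> C" for s t'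
  proof -
    have "cf s (\<beta> i) = 0" if i: "i \<in> I" for i
    proof -
      obtain w S where ws: "s = (w, S)" by (cases s)
      have w: "w \<subseteq> X" "p \<in> w" "Z \<notin> S" using s by (auto simp: ws C_def sts_def)
      have v: "fst i \<in> Vs" using i by (auto simp: I_def)
      then have "pcoef (circ w) S (circ (insert p (fst i))) (insert Z ((\<lambda>C. C - Z) ` snd i)) = 0"
        using Z[OF w(1,2)] Vs[OF v] w(3) by (intro pcoef_zero[of Z]) auto
      then show ?thesis using v by (simp add: cf_def ws \<beta>_def)
    qed
    then show ?thesis by (simp add: c'_def)
  qed
  have "homology (image_states W cc) (image_coeff A cc) \<cong> homology C c'"
  proof (rule adj_image_iso[where V = "{w. w \<subseteq> X \<and> p \<in> w \<and> triv w}" and \<zeta> = \<zeta> and \<beta> = tr and Zs = "{Z}" and E = "{}" and Z = Z,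
      OF sq _ empty_subsetI _ subset_refl c inj(1) _ _ W])
    show "C = {(w, S) \<in> sts. w \<in> {w. w \<subseteq> X \<and> p \<in> w \<and> triv w} \<and> S \<inter> {Z} = {}}" by (auto simp: C_def sts_def)
    fix w x assume w: "w \<in> {w. w \<subseteq> X \<and> p \<in> w \<and> triv w}"
    then have w': "w \<subseteq> X" "p \<in> w" "triv w" by simp_all
    show "w \<subseteq> X \<and> triv w \<and> {Z} \<subseteq> circ w" using w' Z by blast
    show "inj_on tr (circ w - {Z})" using inj(2) w' by simp
    show "cc (\<zeta> w) = tr ` (circ w - {Z})" using cc w' by simp
    assume "x \<in> {w. w \<subseteq> X \<and> p \<in> w \<and> triv w}"
    then have x': "x \<subseteq> X" "p \<in> x" "triv x" by simp_all
    show "A (\<zeta> w) (\<zeta> x) \<longleftrightarrow> adj w x" using A w' x' by simp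
    assume "adj w x"
    then show "inj_on tr ((circ w - {Z}) \<union> (circ x - {Z}))" using inj(3) w' x' by simp
  qed
  then show ?thesis using iso iso_trans by blast
qed

text \<open>Here the small circle is present in the 0-resolution and is absorbed along
  \<open>p\<close>; the states with label \<open>x\<close> on it survive.\<close>

lemma R1_merge_iso:
  assumes p: "p \<in> X" and Z: "\<And>w. w \<subseteq> X \<Longrightarrow> p \<notin> w \<Longrightarrow> Z \<in> circ w" and t: "(a p \<in> Z) \<noteq> (b p \<in> Z)" and KZ: "K \<inter> Z = {}"
    and inj: "inj_on \<zeta> {w. w \<subseteq> X \<and> p \<notin> w \<and> triv w}" "\<And>w. w \<subseteq> X \<Longrightarrow> p \<notin> w \<Longrightarrow> inj_on tr (circ w - {Z})"
      "\<And>w x. w \<subseteq> X \<Longrightarrow> p \<notin> w \<Longrightarrow> x \<subseteq> X \<Longrightarrow> p \<notin> x \<Longrightarrow> adj w x \<Longrightarrow> inj_on tr ((circ w - {Z}) \<union> (circ x - {Z}))"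
    and W: "W = \<zeta> ` {w. w \<subseteq> X \<and> p \<notin> w \<and> triv w}" and cc: "\<And>w. w \<subseteq> X \<Longrightarrow> p \<notin> w \<Longrightarrow> cc (\<zeta> w) = tr ` (circ w - {Z})"
    and A: "\<And>w x. w \<subseteq> X \<Longrightarrow> x \<subseteq> X \<Longrightarrow> p \<notin> w \<Longrightarrow> p \<notin> x \<Longrightarrow> A (\<zeta> w) (\<zeta> x) \<longleftrightarrow> adj w x"
  shows "homology (image_states W cc) (image_coeff A cc) \<cong> homology sts cf"
proof -
  define Vm where "Vm = {v. v \<subseteq> X \<and> p \<notin> v}"
  define I where "I = {s \<in> sts. fst s \<in> {} \<or> p \<in> fst s \<and> fst s - {p} \<in> Vm}"
  define \<alpha> where "\<alpha> s = (if fst s \<in> {} then s else (fst s - {p}, (\<lambda>C. C - Z) ` snd s))" for s :: "nat set \<times> 'n set set"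
  define \<beta> where "\<beta> s = (if fst s \<in> {} then (insert p (fst s), insert Z ((\<lambda>C. C - Z) ` snd s)) else s)" for s :: "nat set \<times> 'n set set"
  define C where "C = {(w, S) \<in> sts. p \<notin> w \<and> Z \<in> S}"
  define c' where "c' s t = cf s t + (\<Sum>i\<in>I. cf s (\<beta> i) * cf (\<alpha> i) t)" for s t
  have Vm: "v \<subseteq> X \<and> p \<notin> v \<and> p \<in> X \<and> Z \<in> circ v \<and> (a p \<in> Z) \<noteq> (b p \<in> Z)" if "v \<in> Vm" for v
    using that p Z[of v] t by (auto simp: Vm_def)
  have C: "C = {(w, S) \<in> sts. w \<notin> {} \<and> \<not> (w \<in> Vm \<and> Z \<notin> S) \<and> \<not> (p \<in> w \<and> w - {p} \<in> {} \<and> Z \<in> S)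
              \<and> \<not> (p \<in> w \<and> w - {p} \<in> Vm)}"
    by (auto simp: C_def Vm_def sts_def)
  note cc' = circle_cancellation[of "{}" p p Z Vm, OF _ Vm _ KZ, folded I_def \<alpha>_def \<beta>_def C c'_def]
  have c'eq: "c' = (\<lambda>s t. cf s t + (\<Sum>i\<in>I. cf s (\<beta> i) * cf (\<alpha> i) t))" by (simp add: fun_eq_iff c'_def)
  have sq: "square_zero C c'" and iso: "homology C c' \<cong> homology sts cf"
    unfolding c'eq using cc' by auto
  have c: "c' s t' = cf s t'" if s: "s \<in> C" "t' \<in> C" for s t'
  proof -
    have "cf (\<alpha> i) t' = 0" if i: "i \<in> I" for i
    proof -
      obtain w S where ws: "t' = (w, S)" by (cases t')
      have w: "w \<subseteq> X" "p \<notin> w" "Z \<in> S" using s by (auto simp: ws C_def sts_def)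
      have v: "fst i - {p} \<in> Vm" using i by (auto simp: I_def)
      have "Z \<notin> (\<lambda>C. C - Z) ` snd i"
      proof
        assume "Z \<in> (\<lambda>C. C - Z) ` snd i"
        then have "Z = {}" by blast
        then show False using t by simp
      qed
      then have "pcoef (circ (fst i - {p})) ((\<lambda>C. C - Z) ` snd i) (circ w) S = 0"
        using Z[OF w(1,2)] Vm[OF v] w(3) by (intro pcoef_zero[of Z]) auto
      then show ?thesis by (simp add: cf_def ws \<alpha>_def)
    qed
    then show ?thesis by (simp add: c'_def)
  qed
  have "homology (image_states W cc) (image_coeff A cc) \<cong> homology C c'"
  proof (rule adj_image_iso[where V = "{w. w \<subseteq> X \<and> p \<notin> w \<and> triv w}" and \<zeta> = \<zeta> and \<beta> = tr and Zs = "{Z}" and E = "{Z}" and Z = Z,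
      OF sq _ subset_refl _ subset_refl c inj(1) _ _ W])
    show "C = {(w, S) \<in> sts. w \<in> {w. w \<subseteq> X \<and> p \<notin> w \<and> triv w} \<and> S \<inter> {Z} = {Z}}" by (auto simp: C_def sts_def)
    fix w x assume w: "w \<in> {w. w \<subseteq> X \<and> p \<notin> w \<and> triv w}"
    then have w': "w \<subseteq> X" "p \<notin> w" "triv w" by simp_all
    show "w \<subseteq> X \<and> triv w \<and> {Z} \<subseteq> circ w" using w' Z by blast
    show "inj_on tr (circ w - {Z})" using inj(2) w' by simp
    show "cc (\<zeta> w) = tr ` (circ w - {Z})" using cc w' by simp
    assume "x \<in> {w. w \<subseteq> X \<and> p \<notin> w \<and> triv w}"
    then have x': "x \<subseteq> X" "p \<notin> x" "triv x" by simp_all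
    show "A (\<zeta> w) (\<zeta> x) \<longleftrightarrow> adj w x" using A w' x' by simp
    assume "adj w x"
    then show "inj_on tr ((circ w - {Z}) \<union> (circ x - {Z}))" using inj(3) w' x' by simp
  qed
  then show ?thesis using iso iso_trans by blast
qed

text \<open>The crossings \<open>p\<close> and \<open>q\<close> bound a bigon that closes up to a
  circle \<open>Z\<close> at the resolution with \<open>p\<close> alone. This vertex, with label
  \<open>x\<close> on \<open>Z\<close>, cancels the one with neither crossing, and with label
  \<open>1\<close> it cancels the one with both, which leaves the vertices with \<open>q\<close>
  alone. The predicate \<open>G\<close> restricts this to the part of the cube where the circle
  exists; for the second move it is always true, for the third it excludes the third crossing. The
  last conclusions describe the zigzags that contribute.\<close>

lemma bigon_cancellation:
  assumes pq: "p \<in> X" "q \<in> X" "p \<noteq> q" and G: "\<And>v w. G w \<Longrightarrow> v \<subseteq> w \<Longrightarrow> G v"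
    and Z: "\<And>v. v \<subseteq> X - {p, q} \<Longrightarrow> G v \<Longrightarrow> Z \<in> circ (insert p v)"
    and t: "(a p \<in> Z) \<noteq> (b p \<in> Z)" "(a q \<in> Z) \<noteq> (b q \<in> Z)" and KZ: "K \<inter> Z = {}"
  defines "C \<equiv> {(w, S) \<in> sts. G (w - {p, q}) \<longrightarrow> q \<in> w \<and> p \<notin> w}"
  obtains I f g where "square_zero C (\<lambda>s t. cf s t + (\<Sum>i\<in>I. cf s (g i) * cf (f i) t))"
    "homology C (\<lambda>s t. cf s t + (\<Sum>i\<in>I. cf s (g i) * cf (f i) t)) \<cong> homology sts cf" "finite I"
    "\<And>s t i. s \<in> C \<Longrightarrow> t \<in> C \<Longrightarrow> i \<in> I \<Longrightarrow> cf s (g i) * cf (f i) t \<noteq> 0 \<Longrightarrow>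
       \<exists>v j. v \<subseteq> X - {p, q} \<and> G v \<and> fst s = insert q v \<and> fst i = insert q (insert p v) \<and> j \<in> X \<and>
         snd i \<subseteq> circ (fst i) \<and> fst t = insert j (insert p v) \<and> \<not> G (fst t - {p, q})"
    "\<And>v U. v \<subseteq> X - {p, q} \<Longrightarrow> G v \<Longrightarrow> triv (insert q (insert p v)) \<Longrightarrow> U \<subseteq> circ (insert q (insert p v)) \<Longrightarrow>
       (insert q (insert p v), U) \<in> I \<and> f (insert q (insert p v), U) = (insert p v, (\<lambda>C. C - Z) ` U) \<and>
       g (insert q (insert p v), U) = (insert q (insert p v), U)"
proof -
  define Vs where "Vs = {v. v \<subseteq> X - {p, q} \<and> G v}"
  \<comment> \<open>the vertices at which the circle splits off, and those at which it is absorbed\<close>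
  define Vm where "Vm = insert p ` Vs"
  define I where "I = {s \<in> sts. fst s \<in> Vs \<or> q \<in> fst s \<and> fst s - {q} \<in> Vm}"
  define \<alpha> where "\<alpha> s = (if fst s \<in> Vs then s else (fst s - {q}, (\<lambda>C. C - Z) ` snd s))" for s :: "nat set \<times> 'n set set"
  define \<beta> where "\<beta> s = (if fst s \<in> Vs then (insert p (fst s), insert Z ((\<lambda>C. C - Z) ` snd s)) else s)" for s :: "nat set \<times> 'n set set"
  have Vs: "v \<subseteq> X \<and> p \<notin> v \<and> q \<notin> v \<and> p \<in> X \<and> Z \<in> circ (insert p v) \<and> (a p \<in> Z) \<noteq> (b p \<in> Z)" if "v \<in> Vs" for v
    using that pq Z[of v] t by (auto simp: Vs_def)
  have Vm: "u \<subseteq> X \<and> q \<notin> u \<and> q \<in> X \<and> Z \<in> circ u \<and> (a q \<in> Z) \<noteq> (b q \<in> Z)" if "u \<in> Vm" for u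
    using that Vs pq t by (auto simp: Vm_def)
  have disj: "v \<noteq> u \<and> p \<noteq> q \<and> (\<forall>j. insert q u \<noteq> insert j v)" if "v \<in> Vs" "u \<in> Vm" for v u
  proof (intro conjI allI)
    have u: "p \<in> u" using that(2) by (auto simp: Vm_def)
    show "v \<noteq> u" using Vs[OF that(1)] u by blast
    show "insert q u \<noteq> insert j v" for j
    proof
      assume "insert q u = insert j v"
      then have "q \<in> insert j v" "p \<in> insert j v" using u by blast+
      then show False using Vs[OF that(1)] pq by blast
    qed
  qed (rule pq)
  have VmI: "w \<in> Vm \<longleftrightarrow> p \<in> w \<and> w - {p} \<in> Vs" for w
  proof
    assume "w \<in> Vm"
    then obtain v where v: "v \<in> Vs" "w = insert p v" by (auto simp: Vm_def)
    then have "w - {p} = v" using Vs[OF v(1)] by blast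
    then show "p \<in> w \<and> w - {p} \<in> Vs" using v by simp
  next
    assume w: "p \<in> w \<and> w - {p} \<in> Vs"
    then have "w = insert p (w - {p})" by blast
    then show "w \<in> Vm" using w unfolding Vm_def by blast
  qed
  have C: "C = {(w, S) \<in> sts. w \<notin> Vs \<and> \<not> (w \<in> Vm \<and> Z \<notin> S) \<and> \<not> (p \<in> w \<and> w - {p} \<in> Vs \<and> Z \<in> S)
              \<and> \<not> (q \<in> w \<and> w - {q} \<in> Vm)}"
  proof -
    have "(G (w - {p, q}) \<longrightarrow> q \<in> w \<and> p \<notin> w) \<longleftrightarrow> w \<notin> Vs \<and> w \<notin> Vm \<and> \<not> (q \<in> w \<and> w - {q} \<in> Vm)"
      if "w \<subseteq> X" for w
    proof -
      have 1: "w \<in> Vs \<longleftrightarrow> p \<notin> w \<and> q \<notin> w \<and> G (w - {p, q})"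
        using that by (cases "p \<notin> w \<and> q \<notin> w") (auto simp: Vs_def)
      have 2: "w \<in> Vm \<longleftrightarrow> p \<in> w \<and> q \<notin> w \<and> G (w - {p, q})"
      proof (cases "q \<in> w")
        case False
        then have "w - {p} = w - {p, q}" by blast
        then show ?thesis using that False unfolding VmI Vs_def by auto
      qed (use VmI pq in \<open>auto simp: Vs_def\<close>)
      have "w - {q} - {p} = w - {p, q}" by blast
      then have 3: "q \<in> w \<and> w - {q} \<in> Vm \<longleftrightarrow> p \<in> w \<and> q \<in> w \<and> G (w - {p, q})"
        using that pq unfolding VmI Vs_def by auto
      show ?thesis unfolding 1 2 3 by blast
    qed
    then show ?thesis unfolding C_def VmI by (auto simp: sts_def)
  qed
  note cc' = circle_cancellation[of Vs p q Z Vm, OF Vs Vm disj KZ, folded I_def \<alpha>_def \<beta>_def C]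
  show thesis
  proof (rule that[OF cc'])
    show "finite I" using finite_sts by (auto simp: I_def)
  next
    fix s t' i assume st: "s \<in> C" "t' \<in> C" and i: "i \<in> I" and nz: "cf s (\<beta> i) * cf (\<alpha> i) t' \<noteq> 0"
    obtain w S where s: "s = (w, S)" by (cases s)
    have w: "w \<subseteq> X" "G (w - {p, q}) \<Longrightarrow> q \<in> w \<and> p \<notin> w" using st(1) by (auto simp: s C_def sts_def)
    have x: "G (fst t' - {p, q}) \<Longrightarrow> p \<notin> fst t'" using st(2) by (auto simp: C_def)
    have "cf s (\<beta> i) \<noteq> 0" using nz by auto
    then obtain j where j: "j \<in> X - w" "fst (\<beta> i) = insert j w" unfolding cf_def s by (metis fst_conv)
    have "cf (\<alpha> i) t' \<noteq> 0" using nz by auto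
    then obtain j' where j': "j' \<in> X" "fst t' = insert j' (fst (\<alpha> i))" unfolding cf_def by (metis DiffD1)
    show "\<exists>v j. v \<subseteq> X - {p, q} \<and> G v \<and> fst s = insert q v \<and> fst i = insert q (insert p v) \<and> j \<in> X \<and>
         snd i \<subseteq> circ (fst i) \<and> fst t' = insert j (insert p v) \<and> \<not> G (fst t' - {p, q})"
    proof (cases "fst i \<in> Vs")
      case True
      then have e: "insert p (fst i) = insert j w" using j by (simp add: \<beta>_def)
      have "w - {p, q} \<subseteq> fst i" using e by blast
      then have "G (w - {p, q})" using True G by (auto simp: Vs_def)
      then have "q \<in> w" using w by blast
      then have "q \<in> insert p (fst i)" using e by blast
      then show ?thesis using Vs[OF True] pq by blast
    next
      case False
      then have q: "q \<in> fst i" "fst i - {q} \<in> Vm" using i by (auto simp: I_def)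
      then obtain v where v: "v \<in> Vs" "fst i - {q} = insert p v" by (auto simp: Vm_def)
      have fi: "fst i = insert q (insert p v)" using q v by blast
      have e: "insert q (insert p v) = insert j w" using j False fi by (simp add: \<beta>_def)
      have "w - {p, q} \<subseteq> v" using e by blast
      then have "G (w - {p, q})" using v G by (auto simp: Vs_def)
      then have qw: "q \<in> w" "p \<notin> w" using w by auto
      have "p \<in> insert j w" using e by blast
      then have "j = p" using qw by blast
      then have we: "w = insert q v" using e qw pq Vs[OF v(1)] j(1)
        by (metis Diff_iff Diff_insert_absorb insertE insert_commute insert_ident)
      have te: "fst t' = insert j' (insert p v)" using j' False fi q v by (simp add: \<alpha>_def)
      then have "\<not> G (fst t' - {p, q})" using x by blast
      moreover have "snd i \<subseteq> circ (fst i)" using i by (auto simp: I_def sts_def)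
      ultimately show ?thesis using v(1) s we fi te j'(1) by (auto simp: Vs_def)
    qed
  next
    fix v U assume v: "v \<subseteq> X - {p, q}" "G v" "triv (insert q (insert p v))" "U \<subseteq> circ (insert q (insert p v))"
    have vV: "v \<in> Vs" using v by (simp add: Vs_def)
    have n: "insert q (insert p v) \<notin> Vs" by (auto simp: Vs_def)
    have d: "insert q (insert p v) - {q} = insert p v" using v(1) pq by blast
    have "insert p v \<in> Vm" using vV by (simp add: Vm_def)
    then have "(insert q (insert p v), U) \<in> I" using v pq d by (auto simp: I_def sts_def)
    then show "(insert q (insert p v), U) \<in> I \<and> \<alpha> (insert q (insert p v), U) = (insert p v, (\<lambda>C. C - Z) ` U) \<and>
       \<beta> (insert q (insert p v), U) = (insert q (insert p v), U)"
      using n d by (simp add: \<alpha>_def \<beta>_def)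
  qed
qed

text \<open>With the full bigon cancellation no zigzag is left: it would end at a vertex outside
  \<open>G\<close>.\<close>

lemma R2_iso:
  assumes pq: "p \<in> X" "q \<in> X" "p \<noteq> q"
    and Z: "\<And>v. v \<subseteq> X - {p, q} \<Longrightarrow> Z \<in> circ (insert p v)"
    and t: "(a p \<in> Z) \<noteq> (b p \<in> Z)" "(a q \<in> Z) \<noteq> (b q \<in> Z)" and KZ: "K \<inter> Z = {}"
    and inj: "inj_on \<zeta> {w. w \<subseteq> X \<and> q \<in> w \<and> p \<notin> w \<and> triv w}" "\<And>w. w \<subseteq> X \<Longrightarrow> q \<in> w \<Longrightarrow> p \<notin> w \<Longrightarrow> inj_on tr (circ w)"
      "\<And>w x. w \<subseteq> X \<Longrightarrow> q \<in> w \<Longrightarrow> p \<notin> w \<Longrightarrow> x \<subseteq> X \<Longrightarrow> q \<in> x \<Longrightarrow> p \<notin> x \<Longrightarrow> adj w x \<Longrightarrow> inj_on tr (circ w \<union> circ x)"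
    and W: "W = \<zeta> ` {w. w \<subseteq> X \<and> q \<in> w \<and> p \<notin> w \<and> triv w}"
    and cc: "\<And>w. w \<subseteq> X \<Longrightarrow> q \<in> w \<Longrightarrow> p \<notin> w \<Longrightarrow> cc (\<zeta> w) = tr ` circ w"
    and A: "\<And>w x. w \<subseteq> X \<Longrightarrow> x \<subseteq> X \<Longrightarrow> q \<in> w \<Longrightarrow> p \<notin> w \<Longrightarrow> q \<in> x \<Longrightarrow> p \<notin> x \<Longrightarrow> A (\<zeta> w) (\<zeta> x) \<longleftrightarrow> adj w x"
  shows "homology (image_states W cc) (image_coeff A cc) \<cong> homology sts cf"
proof -
  define C where "C = {(w, S) \<in> sts. True \<longrightarrow> q \<in> w \<and> p \<notin> w}"
  have Z2: "Z \<in> circ (insert p v)" if "v \<subseteq> X - {p, q}" True for v using Z that by blast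
  have G2: True if True "v \<subseteq> w" for v w :: "nat set" ..
  show ?thesis
  proof (rule bigon_cancellation[of p q "\<lambda>_. True" Z, OF pq G2 Z2 t KZ, folded C_def])
  fix I f g
  assume I: "square_zero C (\<lambda>s t. cf s t + (\<Sum>i\<in>I. cf s (g i) * cf (f i) t))"
    "homology C (\<lambda>s t. cf s t + (\<Sum>i\<in>I. cf s (g i) * cf (f i) t)) \<cong> homology sts cf" "finite I"
    and nz: "\<And>s t i. s \<in> C \<Longrightarrow> t \<in> C \<Longrightarrow> i \<in> I \<Longrightarrow> cf s (g i) * cf (f i) t \<noteq> 0 \<Longrightarrow>
       \<exists>v j. v \<subseteq> X - {p, q} \<and> True \<and> fst s = insert q v \<and> fst i = insert q (insert p v) \<and> j \<in> X \<and>
         snd i \<subseteq> circ (fst i) \<and> fst t = insert j (insert p v) \<and> \<not> True"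
  have c: "cf s t' + (\<Sum>i\<in>I. cf s (g i) * cf (f i) t') = cf s t'" if st: "s \<in> C" "t' \<in> C" for s t'
  proof -
    have "cf s (g i) * cf (f i) t' = 0" if "i \<in> I" for i using nz[OF st that] by blast
    then have "(\<Sum>i\<in>I. cf s (g i) * cf (f i) t') = 0" by (rule sum.neutral[OF ballI])
    then show ?thesis by simp
  qed
  have "homology (image_states W cc) (image_coeff A cc) \<cong> homology C (\<lambda>s t. cf s t + (\<Sum>i\<in>I. cf s (g i) * cf (f i) t))"
  proof (rule adj_image_iso[where V = "{w. w \<subseteq> X \<and> q \<in> w \<and> p \<notin> w \<and> triv w}" and \<zeta> = \<zeta> and \<beta> = tr and Zs = "{}" and E = "{}",
      OF I(1) _ empty_subsetI _ empty_subsetI c inj(1) _ _ W])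
    show "C = {(w, S) \<in> sts. w \<in> {w. w \<subseteq> X \<and> q \<in> w \<and> p \<notin> w \<and> triv w} \<and> S \<inter> {} = {}}" by (auto simp: C_def sts_def)
    fix w x assume w: "w \<in> {w. w \<subseteq> X \<and> q \<in> w \<and> p \<notin> w \<and> triv w}"
    then have w': "w \<subseteq> X" "q \<in> w" "p \<notin> w" "triv w" by simp_all
    show "w \<subseteq> X \<and> triv w \<and> {} \<subseteq> circ w" using w'  by blast
    show "inj_on tr (circ w - {})" using inj(2) w' by simp
    show "cc (\<zeta> w) = tr ` (circ w - {})" using cc w' by simp
    assume "x \<in> {w. w \<subseteq> X \<and> q \<in> w \<and> p \<notin> w \<and> triv w}"
    then have x': "x \<subseteq> X" "q \<in> x" "p \<notin> x" "triv x" by simp_all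
    show "A (\<zeta> w) (\<zeta> x) \<longleftrightarrow> adj w x" using A w' x' by simp
    assume "adj w x"
    then show "inj_on tr ((circ w - {}) \<union> (circ x - {}))" using inj(3) w' x' by simp
  qed
  then show ?thesis using I(2) iso_trans by blast
  qed
qed

text \<open>The only kind of zigzag in the third move runs from \<open>q\<close> to \<open>p,
  q\<close>, back to \<open>p\<close> along the absorption of \<open>Z\<close>, and then to
  \<open>p, m\<close>, where \<open>Z\<close> is absorbed along \<open>m\<close>. The last two steps
  are renamings of circles, so that the zigzag has the value of a single saddle from
  \<open>q\<close> to \<open>p, m\<close>.\<close>

lemma zigzag_value:
  assumes v: "v \<subseteq> X - {p, q, m}" and pqm: "p \<in> X" "q \<in> X" "m \<in> X" "p \<noteq> q" "p \<noteq> m" "q \<noteq> m"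
    and Z: "Z \<in> circ (insert p v)" and t: "(a q \<in> Z) \<noteq> (b q \<in> Z)" "(a m \<in> Z) \<noteq> (b m \<in> Z)" and KZ: "K \<inter> Z = {}"
    and inj: "inj_on tr (circ (insert q v) \<union> circ (insert q (insert p v)))" and tr: "\<And>C. tr (C - Z) = tr C"
    and S: "S \<subseteq> circ (insert q v)" and T: "T \<subseteq> circ (insert m (insert p v))"
  shows "(\<Sum>U\<in>Pow (circ (insert q (insert p v))). pcoef (circ (insert q v)) S (circ (insert q (insert p v))) U *
      pcoef (circ (insert p v)) ((\<lambda>C. C - Z) ` U) (circ (insert m (insert p v))) T)
    = pcoef (tr ` circ (insert q v)) (tr ` S) (tr ` circ (insert m (insert p v))) (tr ` T)"
    and "triv (insert m (insert p v)) \<longleftrightarrow> triv (insert q (insert p v))"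
proof -
  let ?r = "\<lambda>C. C - Z" and ?u = "insert p v" and ?x = "insert m (insert p v)" and ?y = "insert q (insert p v)"
  have u: "?u \<subseteq> X" "q \<in> X - ?u" "m \<in> X - ?u" using v pqm by auto
  obtain x1 y1 where c1: "circle_cut N (R ?u) (R ?y) x1 y1 Z" by (rule cut_at_merge[OF u(1,2) Z t(1)])
  obtain x2 y2 where c2: "circle_cut N (R ?u) (R ?x) x2 y2 Z" by (rule cut_at_merge[OF u(1,3) Z t(2)])
  interpret q: circle_cut N "R ?u" "R ?y" x1 y1 Z by (rule c1)
  interpret m: circle_cut N "R ?u" "R ?x" x2 y2 Z by (rule c2)
  show "triv ?x \<longleftrightarrow> triv ?y" using m.cut_even[OF KZ] q.cut_even[OF KZ] by (simp add: triv_def circ_def)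
  have iq: "inj_on ?r (circ ?y)" "?r ` circ ?y = circ ?u - {Z}" using q.cut_bij by (simp_all add: circ_def)
  have im: "?r ` circ ?x = circ ?u - {Z}" using m.cut_bij by (simp_all add: circ_def)
  have "?r ` T \<subseteq> ?r ` circ ?y" using T unfolding iq(2) im[symmetric] by blast
  \<comment> \<open>the state at \<open>q, p\<close> through which the zigzag to \<open>T\<close> has to pass\<close>
  then obtain U0 where U0: "U0 \<subseteq> circ ?y" "?r ` T = ?r ` U0" by (auto simp: subset_image_iff)
  have p2: "pcoef (circ ?u) (?r ` U) (circ ?x) T = (if U = U0 then 1 else 0)" if U: "U \<subseteq> circ ?y" for U
  proof -
    have "?r ` U \<subseteq> circ ?u - {Z}" using U unfolding iq(2)[symmetric] by blast
    then have "pcoef (circ ?u) (?r ` U) (circ ?x) T = (if ?r ` T = ?r ` U then 1 else 0)"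
      using T unfolding circ_def by (intro m.cut_merge) blast+
    also have "?r ` T = ?r ` U \<longleftrightarrow> U = U0"
      unfolding U0(2) eq_commute[of "?r ` U0"] by (rule inj_on_image_eq_iff[OF iq(1) U U0(1)])
    finally show ?thesis .
  qed
  have "(\<Sum>U\<in>Pow (circ ?y). pcoef (circ (insert q v)) S (circ ?y) U * pcoef (circ ?u) (?r ` U) (circ ?x) T)
     = (\<Sum>U\<in>Pow (circ ?y). pcoef (circ ?u) (?r ` U) (circ ?x) T * pcoef (circ (insert q v)) S (circ ?y) U)"
    by (simp add: mult.commute)
  also have "\<dots> = pcoef (circ (insert q v)) S (circ ?y) U0"
    by (rule sum_Pow_delta[OF finite_circ U0(1) p2])
  also have "\<dots> = pcoef (tr ` circ (insert q v)) (tr ` S) (tr ` circ ?y) (tr ` U0)"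
    using pcoef_image[OF inj S U0(1)] by simp
  also have "tr ` circ ?y = tr ` circ ?x"
  proof -
    have "tr ` circ ?y = tr ` (?r ` circ ?y)" "tr ` circ ?x = tr ` (?r ` circ ?x)" using tr by (simp_all add: image_image)
    then show ?thesis by (simp add: iq(2) im)
  qed
  also have "tr ` U0 = tr ` T"
  proof -
    have "tr ` U0 = tr ` (?r ` U0)" "tr ` T = tr ` (?r ` T)" using tr by (simp_all add: image_image)
    then show ?thesis by (simp add: U0(2))
  qed
  finally show "(\<Sum>U\<in>Pow (circ ?y). pcoef (circ (insert q v)) S (circ ?y) U * pcoef (circ ?u) (?r ` U) (circ ?x) T)
    = pcoef (tr ` circ (insert q v)) (tr ` S) (tr ` circ ?x) (tr ` T)" .
qed

definition zig :: "nat \<Rightarrow> nat \<Rightarrow> nat \<Rightarrow> nat set \<Rightarrow> nat set \<Rightarrow> bool" where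
  "zig p q m w x \<longleftrightarrow> (\<exists>v\<subseteq>X - {p, q, m}. w = insert q v \<and> x = insert m (insert p v))"

text \<open>After the cancellation the zigzags act as edges, which is why they enter the adjacency
  relation of the renamed complex. A direct edge of one side of the move corresponds to a zigzag of
  the other side.\<close>

lemma R3_iso:
  assumes pqm: "p \<in> X" "q \<in> X" "m \<in> X" "p \<noteq> q" "p \<noteq> m" "q \<noteq> m"
    and Z: "\<And>v. v \<subseteq> X - {p, q, m} \<Longrightarrow> Z \<in> circ (insert p v)"
    and t: "(a p \<in> Z) \<noteq> (b p \<in> Z)" "(a q \<in> Z) \<noteq> (b q \<in> Z)" "(a m \<in> Z) \<noteq> (b m \<in> Z)" and KZ: "K \<inter> Z = {}"
  defines "V \<equiv> {w. w \<subseteq> X \<and> (m \<in> w \<or> q \<in> w \<and> p \<notin> w) \<and> triv w}"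
  assumes inj: "inj_on \<zeta> V" "\<And>w. w \<in> V \<Longrightarrow> inj_on tr (circ w)"
      "\<And>w x. w \<in> V \<Longrightarrow> x \<in> V \<Longrightarrow> adj w x \<Longrightarrow> inj_on tr (circ w \<union> circ x)"
      "\<And>v. v \<subseteq> X - {p, q, m} \<Longrightarrow> inj_on tr (circ (insert q v) \<union> circ (insert q (insert p v)))"
    and tr: "\<And>C. tr (C - Z) = tr C"
    and W: "W = \<zeta> ` V" and cc: "\<And>w. w \<in> V \<Longrightarrow> cc (\<zeta> w) = tr ` circ w"
    and A: "\<And>w x. w \<in> V \<Longrightarrow> x \<in> V \<Longrightarrow> A (\<zeta> w) (\<zeta> x) \<longleftrightarrow> adj w x \<or> zig p q m w x"
  shows "homology (image_states W cc) (image_coeff A cc) \<cong> homology sts cf"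
proof -
  define C where "C = {(w, S) \<in> sts. m \<notin> w - {p, q} \<longrightarrow> q \<in> w \<and> p \<notin> w}"
  have Z': "Z \<in> circ (insert p v)" if "v \<subseteq> X - {p, q}" "m \<notin> v" for v using that Z by blast
  have G3: "m \<notin> v" if "m \<notin> w" "v \<subseteq> w" for v w :: "nat set" using that by blast
  show ?thesis
  proof (rule bigon_cancellation[of p q "\<lambda>v. m \<notin> v" Z, OF pqm(1,2,4) G3 Z' t(1,2) KZ, folded C_def])
  fix I f g
  assume I: "square_zero C (\<lambda>s t. cf s t + (\<Sum>i\<in>I. cf s (g i) * cf (f i) t))"
    "homology C (\<lambda>s t. cf s t + (\<Sum>i\<in>I. cf s (g i) * cf (f i) t)) \<cong> homology sts cf" "finite I"
    and nz: "\<And>s t i. s \<in> C \<Longrightarrow> t \<in> C \<Longrightarrow> i \<in> I \<Longrightarrow> cf s (g i) * cf (f i) t \<noteq> 0 \<Longrightarrow>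
       \<exists>v j. v \<subseteq> X - {p, q} \<and> m \<notin> v \<and> fst s = insert q v \<and> fst i = insert q (insert p v) \<and> j \<in> X \<and>
         snd i \<subseteq> circ (fst i) \<and> fst t = insert j (insert p v) \<and> \<not> m \<notin> fst t - {p, q}"
    and Iin: "\<And>v U. v \<subseteq> X - {p, q} \<Longrightarrow> m \<notin> v \<Longrightarrow> triv (insert q (insert p v)) \<Longrightarrow> U \<subseteq> circ (insert q (insert p v)) \<Longrightarrow>
       (insert q (insert p v), U) \<in> I \<and> f (insert q (insert p v), U) = (insert p v, (\<lambda>C. C - Z) ` U) \<and>
       g (insert q (insert p v), U) = (insert q (insert p v), U)"
  have Cin: "(w, S) \<in> C \<longleftrightarrow> w \<in> V \<and> S \<subseteq> circ w" for w S
    using pqm by (auto simp: C_def V_def sts_def)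
  have St: "C = (\<lambda>(w, S). (w, S \<union> {})) ` (SIGMA w:V. Pow (circ w))"
  proof -
    have "s \<in> C \<longleftrightarrow> s \<in> (SIGMA w:V. Pow (circ w))" for s using Cin[of "fst s" "snd s"] by (simp add: mem_Sigma_iff[of "fst s" "snd s", simplified])
    then have "C = (SIGMA w:V. Pow (circ w))" by blast
    then show ?thesis by force
  qed
  have val: "cf (w, S) (x, T) + (\<Sum>i\<in>I. cf (w, S) (g i) * cf (f i) (x, T)) =
       (if A (\<zeta> w) (\<zeta> x) then pcoef (tr ` circ w) (tr ` S) (tr ` circ x) (tr ` T) else 0)"
    if w: "w \<in> V" "x \<in> V" and ST: "S \<subseteq> circ w" "T \<subseteq> circ x" for w S x T
  proof -
    have stC: "(w, S) \<in> C" "(x, T) \<in> C" using Cin w ST by auto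
    have d: "cf (w, S) (x, T) = (if adj w x then pcoef (tr ` circ w) (tr ` S) (tr ` circ x) (tr ` T) else 0)"
      using pcoef_image[OF inj(3)[OF w] ST] by (auto simp: cf_def adj_def)
    show ?thesis
    proof (cases "zig p q m w x")
      case False
      have "cf (w, S) (g i) * cf (f i) (x, T) = 0" if i: "i \<in> I" for i
      proof (rule ccontr)
        assume "cf (w, S) (g i) * cf (f i) (x, T) \<noteq> 0"
        from nz[OF stC i this] obtain v j where v: "v \<subseteq> X - {p, q}" "m \<notin> v" "w = insert q v" "x = insert j (insert p v)"
          "m \<in> x" by auto
        then have "j = m" using pqm by auto
        then have "zig p q m w x" unfolding zig_def using v by (intro exI[of _ v]) auto
        then show False using False by simp
      qed
      then have "(\<Sum>i\<in>I. cf (w, S) (g i) * cf (f i) (x, T)) = 0" by (rule sum.neutral[OF ballI])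
      then show ?thesis using d A[OF w] False by simp
    next
      case True
      then obtain v where v: "v \<subseteq> X - {p, q, m}" "w = insert q v" "x = insert m (insert p v)" by (auto simp: zig_def)
      let ?y = "insert q (insert p v)"
      have "q \<notin> x" using v pqm by auto
      then have na: "\<not> adj w x" using v(2) by (auto simp: adj_def)
      note zv = zigzag_value[OF v(1) pqm Z[OF v(1)] t(2,3) KZ inj(4)[OF v(1)] tr]
      have ST': "S \<subseteq> circ (insert q v)" "T \<subseteq> circ (insert m (insert p v))" using ST v by auto
      have ty: "triv ?y" using zv(2)[OF ST'] w(2) v by (simp add: V_def)
      have v': "v \<subseteq> X - {p, q}" "m \<notin> v" using v(1) by auto
      have sub: "Pair ?y ` Pow (circ ?y) \<subseteq> I" using Iin[OF v' ty] by blast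
      have "(\<Sum>i\<in>I. cf (w, S) (g i) * cf (f i) (x, T)) = (\<Sum>i\<in>Pair ?y ` Pow (circ ?y). cf (w, S) (g i) * cf (f i) (x, T))"
      proof (rule sum.mono_neutral_right[OF I(3) sub], rule ballI, rule ccontr)
        fix i assume i: "i \<in> I - Pair ?y ` Pow (circ ?y)" and n: "cf (w, S) (g i) * cf (f i) (x, T) \<noteq> 0"
        have "i \<in> I" using i by blast
        from nz[OF stC this n] obtain v1 where v1: "v1 \<subseteq> X - {p, q}" "w = insert q v1" "fst i = insert q (insert p v1)"
          "snd i \<subseteq> circ (fst i)" unfolding fst_conv by (elim exE conjE) (rule that)
        have "v1 = v" using insert_ident[of q v1 v] v1(1,2) v(1,2) by auto
        then have "i \<in> Pair ?y ` Pow (circ ?y)" using v1 by (metis Pow_iff image_eqI prod.collapse)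
        then show False using i by blast
      qed
      also have "\<dots> = (\<Sum>U\<in>Pow (circ ?y). cf (w, S) (g (?y, U)) * cf (f (?y, U)) (x, T))"
        by (simp add: sum.reindex inj_on_def)
      also have "\<dots> = (\<Sum>U\<in>Pow (circ ?y). pcoef (circ (insert q v)) S (circ ?y) U *
          pcoef (circ (insert p v)) ((\<lambda>C. C - Z) ` U) (circ (insert m (insert p v))) T)"
      proof (rule sum.cong)
        fix U assume "U \<in> Pow (circ ?y)"
        then have e: "g (?y, U) = (?y, U)" "f (?y, U) = (insert p v, (\<lambda>C. C - Z) ` U)" using Iin[OF v' ty] by auto
        have "\<exists>j\<in>X - insert q v. ?y = insert j (insert q v)" using pqm v(1) by (intro bexI[of _ p]) auto
        moreover have "\<exists>j\<in>X - insert p v. x = insert j (insert p v)" using pqm v by (intro bexI[of _ m]) auto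
        ultimately show "cf (w, S) (g (?y, U)) * cf (f (?y, U)) (x, T) = pcoef (circ (insert q v)) S (circ ?y) U *
          pcoef (circ (insert p v)) ((\<lambda>C. C - Z) ` U) (circ (insert m (insert p v))) T"
          unfolding e cf_def fst_conv snd_conv v(2) using v(3) by simp
      qed simp
      also have "\<dots> = pcoef (tr ` circ w) (tr ` S) (tr ` circ x) (tr ` T)"
        unfolding zv(1)[OF ST'] v(2,3) ..
      finally show ?thesis using d na A[OF w] True by simp
    qed
  qed
  have "homology (image_states W cc) (image_coeff A cc) \<cong> homology C (\<lambda>s t. cf s t + (\<Sum>i\<in>I. cf s (g i) * cf (f i) t))"
    by (rule image_complex_iso[where D = circ and \<beta> = tr and \<zeta> = \<zeta> and V = V and E = "{}", OF I(1) St _ inj(1) _ W])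
       (use inj(2) cc val in auto)
  then show ?thesis using I(2) iso_trans by blast
  qed
qed

end

section \<open>Composing a permutation with a transposition\<close>

definition gen_rel :: "('a \<times> 'a) set \<Rightarrow> ('a \<times> 'a) set" where
  "gen_rel A = (A \<union> A\<inverse>)\<^sup>*"

lemma equiv_gen_rel: "equiv UNIV (gen_rel A)"
  unfolding gen_rel_def
proof (rule equivI)
  show "sym ((A \<union> A\<inverse>)\<^sup>*)" by (rule sym_rtrancl) (auto simp: sym_def)
  show "trans ((A \<union> A\<inverse>)\<^sup>*)" by (rule trans_rtrancl)
qed (auto simp: refl_on_def)

lemma gen_rel_base: "(x, y) \<in> A \<Longrightarrow> (x, y) \<in> gen_rel A"
  by (auto simp: gen_rel_def)

lemma gen_rel_graph: "(x, f x) \<in> gen_rel {(x, f x) | x. True}"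
  by (rule gen_rel_base) blast

lemma gen_rel_least:
  assumes E: "equiv UNIV E" and A: "\<And>x y. (x, y) \<in> A \<Longrightarrow> (f x, f y) \<in> E" and xy: "(x, y) \<in> gen_rel A"
  shows "(f x, f y) \<in> E"
  using xy unfolding gen_rel_def
proof (induction rule: rtrancl_induct)
  case base
  show ?case by (rule equivUD(1)[OF E])
next
  case (step y z)
  then have "(f y, f z) \<in> E" using A equivUD(2)[OF E] by blast
  then show ?case using step.IH equivUD(3)[OF E] by blast
qed

lemma gen_rel_subset: "equiv UNIV E \<Longrightarrow> (\<And>x y. (x, y) \<in> A \<Longrightarrow> (x, y) \<in> E) \<Longrightarrow> gen_rel A \<subseteq> E"
  using gen_rel_least[of E A "\<lambda>x. x"] by auto

text \<open>A power of a permutation of a finite set inverts it, so that forward iteration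
  suffices.\<close>

lemma gen_rel_perm:
  assumes p: "\<pi> permutes N" and fin: "finite N"
  shows "gen_rel {(x, \<pi> x) | x. True} = {(x, (\<pi> ^^ k) x) | x k. True}"
proof
  let ?G = "{(x, (\<pi> ^^ k) x) | x k. True}"
  have inj: "inj \<pi>" using p permutes_inj by blast
  have per: "\<exists>r>0. (\<pi> ^^ r) x = x" for x
  proof (cases "x \<in> N")
    case True
    have "(\<pi> ^^ k) x \<in> N" for k using True permutes_in_image[OF p] by (induction k) auto
    then have "finite {y. \<exists>k. y = (\<pi> ^^ k) x}" using fin by (auto intro: finite_subset)
    then show ?thesis using funpow_inj_finite[OF inj] by metis
  next
    case False
    then show ?thesis using p by (intro exI[of _ 1]) (auto simp: permutes_def)
  qed
  have Gi: "(u, w) \<in> ?G \<longleftrightarrow> (\<exists>k. w = (\<pi> ^^ k) u)" for u w by auto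
  have E: "equiv UNIV ?G"
  proof (rule equivUI)
    show "(x, x) \<in> ?G" for x unfolding Gi by (rule exI[of _ 0]) simp
    show "(x, z) \<in> ?G" if h: "(x, y) \<in> ?G" "(y, z) \<in> ?G" for x y z
    proof -
      obtain k where "y = (\<pi> ^^ k) x" using h(1) unfolding Gi ..
      moreover obtain l where "z = (\<pi> ^^ l) y" using h(2) unfolding Gi ..
      ultimately have "z = (\<pi> ^^ (l + k)) x" by (simp add: funpow_add)
      then show ?thesis by blast
    qed
    show "(y, x) \<in> ?G" if h: "(x, y) \<in> ?G" for x y
    proof -
      obtain k where k: "y = (\<pi> ^^ k) x" using h unfolding Gi ..
      obtain r where r: "r > 0" "(\<pi> ^^ r) x = x" using per by blast
      have "(\<pi> ^^ (r * k)) x = x" using funpow_mod_eq[OF r(2), of "r * k"] by simp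
      moreover have "k \<le> r * k" using r(1) by simp
      ultimately have "(\<pi> ^^ (r * k - k)) y = x" unfolding k by (metis comp_apply funpow_add le_add_diff_inverse2)
      then show ?thesis by blast
    qed
  qed
  show "gen_rel {(x, \<pi> x) | x. True} \<subseteq> ?G"
  proof (rule gen_rel_subset[OF E])
    fix x y assume "(x, y) \<in> {(x, \<pi> x) | x. True}"
    then have "y = (\<pi> ^^ 1) x" by simp
    then show "(x, y) \<in> ?G" by blast
  qed
  show "?G \<subseteq> gen_rel {(x, \<pi> x) | x. True}"
  proof clarify
    fix x k
    note G = equivUD[OF equiv_gen_rel[of "{(x, \<pi> x) | x. True}"]]
    show "(x, (\<pi> ^^ k) x) \<in> gen_rel {(x, \<pi> x) | x. True}"
    proof (induction k)
      case 0
      then show ?case using G(1) by simp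
    next
      case (Suc k)
      have "((\<pi> ^^ k) x, (\<pi> ^^ Suc k) x) \<in> gen_rel {(x, \<pi> x) | x. True}"
        by (rule gen_rel_base) auto
      then show ?case using Suc G(3) by blast
    qed
  qed
qed

text \<open>An orbit that returns to its start before meeting \<open>w\<close> never meets
  it.\<close>

lemma orbit_avoids:
  assumes "(f ^^ k) z = z" "0 < k" "\<And>i. 0 < i \<Longrightarrow> i < k \<Longrightarrow> (f ^^ i) z \<noteq> w" "w \<noteq> z"
  shows "(f ^^ l) z \<noteq> w"
proof -
  have "(f ^^ l) z = (f ^^ (l mod k)) z" using funpow_mod_eq[OF assms(1), of l] by simp
  moreover have "l mod k < k" using assms(2) by simp
  ultimately show ?thesis using assms(3)[of "l mod k"] assms(4) by (cases "l mod k = 0") auto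
qed

text \<open>Composition with a transposition changes the number of cycles: if \<open>x\<close> and
  \<open>y\<close> lie on one cycle they are separated, and otherwise their cycles are joined. The
  first return of the orbit of \<open>x\<close> to \<open>{x, y}\<close> decides which case
  holds.\<close>

lemma swap_orbits:
  assumes p: "\<pi> permutes N" and fin: "finite N" and xy: "x \<noteq> y" "x \<in> N" "y \<in> N"
  defines "\<pi>' \<equiv> \<pi>(x := \<pi> y, y := \<pi> x)"
  shows "\<pi>' permutes N"
    and "(x, y) \<in> gen_rel {(x, \<pi> x) | x. True} \<longleftrightarrow> (x, y) \<notin> gen_rel {(x, \<pi>' x) | x. True}"
proof -
  have pi': "\<pi>' = \<pi> \<circ> Transposition.transpose x y" by (auto simp: \<pi>'_def fun_eq_iff Transposition.transpose_def)
  show p': "\<pi>' permutes N" unfolding pi' using p xy by (intro permutes_compose permutes_swap_id)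
  have inj: "inj \<pi>" using p permutes_inj by blast
  obtain r where r: "r > 0" "(\<pi> ^^ r) x = x"
  proof -
    have "(\<pi> x, x) \<in> gen_rel {(x, \<pi> x) | x. True}"
      by (rule equivUD(2)[OF equiv_gen_rel]) (rule gen_rel_base, auto)
    then obtain k where "x = (\<pi> ^^ k) (\<pi> x)" unfolding gen_rel_perm[OF p fin] by blast
    then have "(\<pi> ^^ Suc k) x = x" by (simp add: funpow_swap1)
    then show thesis using that by blast
  qed
  \<comment> \<open>the orbit of \<open>y\<close> under the new permutation agrees with that of \<open>x\<close> under the old one up to this time\<close>
  define k where "k = (LEAST k. 0 < k \<and> (\<pi> ^^ k) x \<in> {x, y})"
  have k: "0 < k" "(\<pi> ^^ k) x \<in> {x, y}"
    using LeastI[of "\<lambda>k. 0 < k \<and> (\<pi> ^^ k) x \<in> {x, y}" r] r unfolding k_def by auto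
  have least: "(\<pi> ^^ i) x \<notin> {x, y}" if "0 < i" "i < k" for i
    using not_less_Least[of i "\<lambda>k. 0 < k \<and> (\<pi> ^^ k) x \<in> {x, y}"] that unfolding k_def by blast
  have eq: "(\<pi>' ^^ i) y = (\<pi> ^^ i) x" if "0 < i" "i \<le> k" for i
    using that
  proof (induction i)
    case (Suc i)
    show ?case
    proof (cases "i = 0")
      case True
      then show ?thesis by (simp add: \<pi>'_def)
    next
      case False
      then have "(\<pi>' ^^ i) y = (\<pi> ^^ i) x" "(\<pi> ^^ i) x \<notin> {x, y}" using Suc least by auto
      then have "(\<pi>' ^^ Suc i) y = \<pi>' ((\<pi> ^^ i) x)" by simp
      also have "\<dots> = \<pi> ((\<pi> ^^ i) x)" using \<open>(\<pi> ^^ i) x \<notin> {x, y}\<close> by (simp add: \<pi>'_def)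
      finally show ?thesis by simp
    qed
  qed simp
  have G: "(x, y) \<in> gen_rel {(x, \<pi> x) | x. True} \<longleftrightarrow> (\<exists>l. (\<pi> ^^ l) x = y)"
    unfolding gen_rel_perm[OF p fin] by auto
  have "(x, y) \<in> gen_rel {(x, \<pi>' x) | x. True} \<longleftrightarrow> (y, x) \<in> gen_rel {(x, \<pi>' x) | x. True}"
    using equivUD(2)[OF equiv_gen_rel[of "{(x, \<pi>' x) | x. True}"]] by blast
  also have "\<dots> \<longleftrightarrow> (\<exists>l. (\<pi>' ^^ l) y = x)"
    unfolding gen_rel_perm[OF p' fin] by auto
  finally have G': "(x, y) \<in> gen_rel {(x, \<pi>' x) | x. True} \<longleftrightarrow> (\<exists>l. (\<pi>' ^^ l) y = x)" .
  show "(x, y) \<in> gen_rel {(x, \<pi> x) | x. True} \<longleftrightarrow> (x, y) \<notin> gen_rel {(x, \<pi>' x) | x. True}"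
  proof (cases "(\<pi> ^^ k) x = y")
    case True
    have "(\<pi>' ^^ l) y \<noteq> x" for l
    proof (rule orbit_avoids[of k])
      show "(\<pi>' ^^ k) y = y" using eq[of k] k True by simp
      show "(\<pi>' ^^ i) y \<noteq> x" if "0 < i" "i < k" for i using eq[of i] least[of i] that by auto
    qed (use k xy in auto)
    then show ?thesis unfolding G G' using True by blast
  next
    case False
    then have x: "(\<pi> ^^ k) x = x" using k by blast
    have "(\<pi> ^^ l) x \<noteq> y" for l
      by (rule orbit_avoids[OF x k(1)]) (use least xy in auto)
    moreover have "(\<pi>' ^^ k) y = x" using eq[of k] k x by simp
    ultimately show ?thesis unfolding G G' by blast
  qed
qed

text \<open>In either case the relation of one permutation is the other one with the classes of
  \<open>x\<close> and \<open>y\<close> merged. This is how planar diagrams satisfy the surgery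
  premise of cubes.\<close>

lemma swap_surgery:
  assumes p: "\<pi> permutes N" and fin: "finite N" and xy: "x \<noteq> y" "x \<in> N" "y \<in> N"
    and \<pi>': "\<pi>' = \<pi>(x := \<pi> y, y := \<pi> x)"
    and E: "E = gen_rel {(x, \<pi> x) | x. True}" and E': "E' = gen_rel {(x, \<pi>' x) | x. True}"
  shows "(x, y) \<notin> E \<and> E' = mrg E x y \<or> (x, y) \<notin> E' \<and> E = mrg E' x y"
proof -
  have eE: "equiv UNIV E" "equiv UNIV E'" unfolding E E' by (rule equiv_gen_rel)+
  note F = equivUD[OF eE(1)] and F' = equivUD[OF eE(2)]
  have sub: "gen_rel {(x, \<rho>' x) | x. True} \<subseteq> mrg (gen_rel {(x, \<rho> x) | x. True}) x y"
    if \<rho>': "\<rho>' = \<rho>(x := \<rho> y, y := \<rho> x)" for \<rho> \<rho>'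
  proof (rule gen_rel_subset[OF equiv_mrg[OF equiv_gen_rel]])
    fix u w assume "(u, w) \<in> {(x, \<rho>' x) | x. True}"
    then have w: "w = \<rho>' u" by simp
    let ?G = "gen_rel {(x, \<rho> x) | x. True}"
    note G = equivUD[OF equiv_gen_rel[of "{(x, \<rho> x) | x. True}"]]
    have b: "(z, \<rho> z) \<in> ?G" for z by (rule gen_rel_graph)
    show "(u, w) \<in> mrg ?G x y"
    proof (cases "u = x \<or> u = y")
      case True
      then show ?thesis using b G(1) unfolding mrg_iff w \<rho>' by (auto split: if_splits)
    next
      case False
      then show ?thesis using b unfolding mrg_iff w \<rho>' by auto
    qed
  qed
  have s1: "E' \<subseteq> mrg E x y" unfolding E E' by (rule sub[OF \<pi>'])
  have "\<pi> = \<pi>'(x := \<pi>' y, y := \<pi>' x)" using xy(1) by (auto simp: \<pi>' fun_eq_iff)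
  then have s2: "E \<subseteq> mrg E' x y" unfolding E E' by (rule sub)
  have swap: "(x, y) \<in> E \<longleftrightarrow> (x, y) \<notin> E'" unfolding E E' \<pi>' by (rule swap_orbits(2)[OF p fin xy])
  have abs: "mrg A x y \<subseteq> B" if "equiv UNIV A" "equiv UNIV B" "A \<subseteq> mrg B x y" "(x, y) \<in> B" for A B
  proof -
    note Q = equivUD[OF that(2)]
    have "mrg B x y \<subseteq> B"
    proof
      fix z assume z: "z \<in> mrg B x y"
      obtain u w where uw: "z = (u, w)" by (cases z)
      have "(u, w) \<in> B \<or> (x, u) \<in> B \<and> (y, w) \<in> B \<or> (y, u) \<in> B \<and> (x, w) \<in> B"
        using z unfolding uw mrg_iff .
      then show "z \<in> B" unfolding uw using that(4) Q(2,3) by blast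
    qed
    then have AB: "A \<subseteq> B" using that(3) by blast
    show "mrg A x y \<subseteq> B"
    proof
      fix z assume z: "z \<in> mrg A x y"
      obtain u w where uw: "z = (u, w)" by (cases z)
      have "(u, w) \<in> B \<or> (x, u) \<in> B \<and> (y, w) \<in> B \<or> (y, u) \<in> B \<and> (x, w) \<in> B"
        using z AB unfolding uw mrg_iff by blast
      then show "z \<in> B" unfolding uw using that(4) Q(2,3) by blast
    qed
  qed
  show ?thesis
  proof (cases "(x, y) \<in> E")
    case False
    then have "mrg E x y \<subseteq> E'" using swap abs[OF eE s2] by blast
    then show ?thesis using s1 False by blast
  next
    case True
    then have "mrg E' x y \<subseteq> E" using abs[OF eE(2,1) s1] by blast
    then show ?thesis using s2 swap True by blast
  qed
qed

section \<open>The cube of a diagram\<close>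

fun wd :: "nat \<Rightarrow> slice list \<Rightarrow> nat" where
  "wd m [] = m" | "wd m (g # D) = wd (m - ins g + outs g) D"

lemma wd_append [simp]: "wd m (A @ B) = wd (wd m A) B"
  by (induction A arbitrary: m) auto

lemma wd_foldl: "foldl (\<lambda>m g. m - ins g + outs g) m D = wd m D"
  by (induction D arbitrary: m) auto

lemma level_width_wd: "level_width D j = wd 0 (take j D)"
  by (simp add: level_width_def wd_foldl)

lemma tangle_append: "tangle m (A @ B) n \<longleftrightarrow> tangle m A (wd m A) \<and> tangle (wd m A) B n"
  by (induction A arbitrary: m) auto

lemma tangle_wd: "tangle m D n \<Longrightarrow> wd m D = n"
  by (induction D arbitrary: m) auto

lemma level_width_Suc:
  "j < length D \<Longrightarrow> level_width D (Suc j) = level_width D j - ins (D ! j) + outs (D ! j)"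
  by (simp add: level_width_wd take_Suc_conv_app_nth)

lemma tangle_nth:
  assumes "tangle 0 D 0" "j < length D"
  shows "position (D ! j) + ins (D ! j) \<le> level_width D j"
proof -
  have "D = take j D @ D ! j # drop (Suc j) D" using assms(2) by (rule id_take_nth_drop)
  then have "tangle 0 (take j D @ D ! j # drop (Suc j) D) 0" using assms(1) by simp
  then show ?thesis by (simp add: tangle_append level_width_wd)
qed

lemma level_width_ends: "level_width D 0 = 0" "tangle 0 D 0 \<Longrightarrow> level_width D (length D) = 0"
  by (simp_all add: level_width_wd tangle_wd)

definition sarc :: "slice \<Rightarrow> bool \<Rightarrow> nat \<Rightarrow> nat \<Rightarrow> (node \<times> node) set" where
  "sarc g r m j = through_arcs g m j \<union> core_arcs g r j"

lemma slice_arcs_sarc: "slice_arcs D v j = sarc (D ! j) (j \<in> v) (level_width D j) j"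
  by (simp add: slice_arcs_def sarc_def)

text \<open>The other end of the arc of a slice that starts at the given node.\<close>

fun core_mate :: "slice \<Rightarrow> bool \<Rightarrow> nat \<Rightarrow> node \<Rightarrow> node" where
  "core_mate (Cup i) r j (l, p) = (l, if p = i then Suc i else i)"
| "core_mate (Cap i) r j (l, p) = (l, if p = i then Suc i else i)"
| "core_mate (Mark i) r j (l, p) = (if l = j then Suc j else j, p)"
| "core_mate (Cross i b) r j (l, p) = (if r = b then (l, if p = i then Suc i else i) else (if l = j then Suc j else j, p))"

definition mate :: "slice \<Rightarrow> bool \<Rightarrow> nat \<Rightarrow> node \<Rightarrow> node" where
  "mate g r j n = (case n of (l, p) \<Rightarrow>
     if p < position g then (if l = j then Suc j else j, p)
     else if l = j \<and> position g + ins g \<le> p then (Suc j, p - ins g + outs g)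
     else if l = Suc j \<and> position g + outs g \<le> p then (j, p - outs g + ins g)
     else core_mate g r j n)"

text \<open>Checkerboard orientation: the strands in even positions point up and those in odd
  positions point down. Every event preserves the parity of the positions to its right, and both
  resolutions of a crossing, as well as cups and caps, join an incoming end to an outgoing one; so
  all resolutions carry this orientation. A node \<open>enters\<close> slice \<open>j\<close> if the
  orientation points into the slice there.\<close>

definition enters :: "nat \<Rightarrow> node \<Rightarrow> bool" where
  "enters j n \<longleftrightarrow> fst n = j \<and> even (snd n) \<or> fst n = Suc j \<and> odd (snd n)"

definition rim :: "slice \<Rightarrow> nat \<Rightarrow> nat \<Rightarrow> node set" where
  "rim g m j = {j} \<times> {..<m} \<union> {Suc j} \<times> {..<m - ins g + outs g}"

lemma even_shift: "position g + ins g \<le> p \<Longrightarrow> even (p - ins g + outs g) \<longleftrightarrow> even p"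
  by (cases g) auto

lemma sarc_mate:
  assumes g: "position g + ins g \<le> m" and xy: "(x, y) \<in> sarc g r m j"
  shows "x \<in> rim g m j \<and> y \<in> rim g m j \<and> mate g r j x = y \<and> mate g r j y = x \<and> (enters j x \<longleftrightarrow> \<not> enters j y)"
proof -
  have "(x, y) \<in> through_arcs g m j \<or> (x, y) \<in> core_arcs g r j" using xy by (auto simp: sarc_def)
  then consider p where "p < position g" "x = (j, p)" "y = (Suc j, p)"
    | p where "position g + ins g \<le> p" "p < m" "x = (j, p)" "y = (Suc j, p - ins g + outs g)"
    | "(x, y) \<in> core_arcs g r j"
    by (auto simp: through_arcs_def)
  then show ?thesis
  proof cases
    case (1 p)
    then show ?thesis using g by (auto simp: rim_def mate_def enters_def)
  next
    case (2 p)
    have "p - ins g + outs g - outs g + ins g = p" using 2 by simp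
    then show ?thesis using 2 g even_shift[OF 2(1)] by (auto simp: rim_def mate_def enters_def)
  next
    case 3
    then show ?thesis
      using g by (cases g) (auto simp: rim_def mate_def enters_def split: if_splits)
  qed
qed

lemma mate_sarc:
  assumes g: "position g + ins g \<le> m" and n: "n \<in> rim g m j"
  shows "(n, mate g r j n) \<in> sarc g r m j \<or> (mate g r j n, n) \<in> sarc g r m j"
proof -
  obtain l p where lp: "n = (l, p)" by (cases n)
  consider "p < position g" | "l = j" "position g + ins g \<le> p" "p < m"
    | "l = Suc j" "position g + outs g \<le> p" "p < m - ins g + outs g"
    | "l = j" "position g \<le> p" "p < position g + ins g" | "l = Suc j" "position g \<le> p" "p < position g + outs g"
  proof -
    have "l = j \<and> p < m \<or> l = Suc j \<and> p < m - ins g + outs g" using n by (auto simp: rim_def lp)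
    then show thesis using that by (meson not_le)
  qed
  then show ?thesis
  proof cases
    case 1
    then show ?thesis using n by (auto simp: sarc_def through_arcs_def mate_def lp rim_def)
  next
    case 2
    then show ?thesis by (auto simp: sarc_def through_arcs_def mate_def lp)
  next
    case 3
    then have "((j, p - outs g + ins g), (Suc j, p - outs g + ins g - ins g + outs g)) \<in> through_arcs g m j"
      using g unfolding through_arcs_def by auto
    then show ?thesis using 3 by (auto simp: sarc_def mate_def lp)
  next
    case 4
    then show ?thesis by (cases g) (auto simp: sarc_def mate_def lp less_Suc_eq)
  next
    case 5
    then show ?thesis by (cases g) (auto simp: sarc_def mate_def lp less_Suc_eq)
  qed
qed


definition dmarks :: "slice list \<Rightarrow> node set" where
  "dmarks D = {(j, i) | j i. j < length D \<and> D ! j = Mark i}"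

lemma card_marks_on: "card (marks_on D C) = card (dmarks D \<inter> C)"
proof (rule bij_betw_same_card)
  show "bij_betw (\<lambda>j. (j, position (D ! j))) (marks_on D C) (dmarks D \<inter> C)"
    by (auto simp: bij_betw_def inj_on_def marks_on_def dmarks_def image_iff)
qed

lemma rim_nodes:
  assumes j: "j < length D"
  shows "rim (D ! j) (level_width D j) j = {n \<in> nodes D. fst n = j \<or> fst n = Suc j}"
  using level_width_Suc[OF j] j by (auto simp: rim_def nodes_def)

lemma finite_nodes: "finite (nodes D)"
proof -
  have "nodes D = (SIGMA j:{..length D}. {..<level_width D j})" by (auto simp: nodes_def)
  then show ?thesis by simp
qed

locale diagram =
  fixes D :: "slice list"
  assumes D: "tangle 0 D 0"
begin

abbreviation mt :: "nat set \<Rightarrow> nat \<Rightarrow> node \<Rightarrow> node" where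
  "mt v j \<equiv> mate (D ! j) (j \<in> v) j"

text \<open>The slice into which the oriented strand runs from a node.\<close>

definition slot :: "node \<Rightarrow> nat" where
  "slot n = (if even (snd n) then fst n else fst n - 1)"

lemma slot:
  assumes n: "n \<in> nodes D"
  shows "slot n < length D" "enters (slot n) n" "n \<in> rim (D ! slot n) (level_width D (slot n)) (slot n)"
    "enters j n \<Longrightarrow> j = slot n"
proof -
  obtain l p where lp: "n = (l, p)" by (cases n)
  have 1: "l \<le> length D" "p < level_width D l" using n by (auto simp: lp nodes_def)
  then have "0 < l" "l < length D" using level_width_ends[of D] D by (cases "l = 0"; cases "l = length D"; auto)+
  then show a: "slot n < length D" "enters (slot n) n" by (auto simp: slot_def lp enters_def)
  then show "n \<in> rim (D ! slot n) (level_width D (slot n)) (slot n)"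
    unfolding rim_nodes[OF a(1)] using n by (auto simp: enters_def)
  show "enters j n \<Longrightarrow> j = slot n" by (auto simp: slot_def enters_def)
qed

lemma mt_props:
  assumes j: "j < length D" and n: "n \<in> rim (D ! j) (level_width D j) j"
  shows "mt v j n \<in> rim (D ! j) (level_width D j) j" "mt v j (mt v j n) = n" "enters j (mt v j n) \<longleftrightarrow> \<not> enters j n"
    "(n, mt v j n) \<in> slice_arcs D v j \<or> (mt v j n, n) \<in> slice_arcs D v j"
proof -
  note t = tangle_nth[OF D j]
  show m: "(n, mt v j n) \<in> slice_arcs D v j \<or> (mt v j n, n) \<in> slice_arcs D v j"
    unfolding slice_arcs_sarc by (rule mate_sarc[OF t n])
  then show "mt v j n \<in> rim (D ! j) (level_width D j) j" "mt v j (mt v j n) = n" "enters j (mt v j n) \<longleftrightarrow> \<not> enters j n"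
    unfolding slice_arcs_sarc using sarc_mate[OF t, of n "mt v j n" "j \<in> v" j] sarc_mate[OF t, of "mt v j n" n "j \<in> v" j] by blast+
qed

text \<open>The resolution as a permutation: every node moves on to the next one along its circle.
  This works because of the checkerboard orientation and turns components into cycles.\<close>

definition \<pi> :: "nat set \<Rightarrow> node \<Rightarrow> node" where
  "\<pi> v n = (if n \<in> nodes D then mt v (slot n) n else n)"

lemma permutes_\<pi>: "\<pi> v permutes nodes D"
proof -
  have in_nodes: "\<pi> v n \<in> nodes D" if n: "n \<in> nodes D" for n
    using mt_props(1)[OF slot(1,3)[OF n], of v] n unfolding rim_nodes[OF slot(1)[OF n]] by (simp add: \<pi>_def)
  have inj: "inj_on (\<pi> v) (nodes D)"
  proof (rule inj_onI)
    fix n n' assume n: "n \<in> nodes D" "n' \<in> nodes D" and e: "\<pi> v n = \<pi> v n'"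
    let ?m = "\<pi> v n"
    have m: "?m = mt v (slot n) n" "?m = mt v (slot n') n'" using n e by (simp_all add: \<pi>_def)
    have r: "?m \<in> rim (D ! slot n) (level_width D (slot n)) (slot n)"
        "?m \<in> rim (D ! slot n') (level_width D (slot n')) (slot n')"
      using mt_props(1)[OF slot(1,3)[OF n(1)], of v] mt_props(1)[OF slot(1,3)[OF n(2)], of v] m by simp_all
    have x: "\<not> enters (slot n) ?m" "\<not> enters (slot n') ?m"
      using mt_props(3)[OF slot(1,3)[OF n(1)], of v] mt_props(3)[OF slot(1,3)[OF n(2)], of v] slot(2)[OF n(1)] slot(2)[OF n(2)] m
      by simp_all
    have "slot n = slot n'" using r x by (auto simp: rim_def enters_def)
    then show "n = n'" using m mt_props(2)[OF slot(1,3)[OF n(1)], of v] mt_props(2)[OF slot(1,3)[OF n(2)], of v] by metis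
  qed
  have "\<pi> v ` nodes D = nodes D"
    using in_nodes by (intro card_subset_eq finite_nodes) (auto simp: card_image[OF inj])
  then have "bij_betw (\<pi> v) (nodes D) (nodes D)" using inj by (simp add: bij_betw_def)
  then show ?thesis by (rule bij_imp_permutes) (simp add: \<pi>_def)
qed

definition Rel :: "nat set \<Rightarrow> (node \<times> node) set" where
  "Rel v = gen_rel (arcs D v)"

lemma arc_in: "(x, y) \<in> slice_arcs D v j \<Longrightarrow> j < length D \<Longrightarrow>
   x \<in> nodes D \<and> y \<in> nodes D \<and> mt v j x = y \<and> mt v j y = x \<and> (enters j x \<longleftrightarrow> \<not> enters j y)"
  using sarc_mate[OF tangle_nth[OF D], of j x y "j \<in> v" j] rim_nodes[of j D] unfolding slice_arcs_sarc by blast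

lemma Rel_\<pi>: "Rel v = gen_rel {(x, \<pi> v x) | x. True}"
proof
  show "Rel v \<subseteq> gen_rel {(x, \<pi> v x) | x. True}"
    unfolding Rel_def
  proof (rule gen_rel_subset[OF equiv_gen_rel])
    fix x y assume "(x, y) \<in> arcs D v"
    then obtain j where j: "j < length D" "(x, y) \<in> slice_arcs D v j" by (auto simp: arcs_def)
    note a = arc_in[OF j(2,1)]
    show "(x, y) \<in> gen_rel {(x, \<pi> v x) | x. True}"
    proof (cases "enters j x")
      case True
      then have "\<pi> v x = y" using a slot(4)[of x j] by (auto simp: \<pi>_def)
      with gen_rel_graph[of x "\<pi> v"] show ?thesis by (simp only:)
    next
      case False
      then have "\<pi> v y = x" using a slot(4)[of y j] by (auto simp: \<pi>_def)
      then have "(y, x) \<in> gen_rel {(x, \<pi> v x) | x. True}" using gen_rel_graph[of y "\<pi> v"] by (simp only:)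
      then show ?thesis by (rule equivUD(2)[OF equiv_gen_rel])
    qed
  qed
  show "gen_rel {(x, \<pi> v x) | x. True} \<subseteq> Rel v"
  proof (rule gen_rel_subset)
    show e: "equiv UNIV (Rel v)" unfolding Rel_def by (rule equiv_gen_rel)
    fix x y assume "(x, y) \<in> {(x, \<pi> v x) | x. True}"
    then have y: "y = \<pi> v x" by auto
    show "(x, y) \<in> Rel v"
    proof (cases "x \<in> nodes D")
      case True
      then have "(x, y) \<in> slice_arcs D v (slot x) \<or> (y, x) \<in> slice_arcs D v (slot x)"
        using mt_props(4)[OF slot(1,3)[OF True], of v] y by (simp add: \<pi>_def)
      then have "(x, y) \<in> arcs D v \<or> (y, x) \<in> arcs D v" using slot(1)[OF True] by (auto simp: arcs_def)
      then have "(x, y) \<in> Rel v \<or> (y, x) \<in> Rel v"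
        using gen_rel_base[of x y "arcs D v"] gen_rel_base[of y x "arcs D v"] unfolding Rel_def by blast
      then show ?thesis using equivUD(2)[OF e] by blast
    next
      case False
      then show ?thesis using y equivUD(1)[OF e] by (simp add: \<pi>_def)
    qed
  qed
qed

text \<open>The two nodes that enter a crossing exchange their successors when its resolution is
  changed. They are \<open>x\<close> and \<open>y\<close>; depending on the parity they are not the
  corners chosen for the cube, but the pair of circles through them is the same.\<close>

lemma crossing_swap:
  assumes j: "j \<in> crossings D - v"
  obtains x y where "x \<noteq> y" "x \<in> nodes D" "y \<in> nodes D" "\<pi> (insert j v) = (\<pi> v)(x := \<pi> v y, y := \<pi> v x)"
    "\<And>u. u \<in> {v, insert j v} \<Longrightarrow>
       mrg (Rel u) x y = mrg (Rel u) (j, position (D ! j)) (Suc j, Suc (position (D ! j))) \<and>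
       ((x, y) \<in> Rel u \<longleftrightarrow> ((j, position (D ! j)), (Suc j, Suc (position (D ! j)))) \<in> Rel u)"
proof -
  obtain i b where g: "D ! j = Cross i b" and jl: "j < length D" using j by (auto simp: crossings_def)
  have w: "i + 2 \<le> level_width D j" using tangle_nth[OF D jl] g by simp
  have nd: "(j, i) \<in> nodes D" "(j, Suc i) \<in> nodes D" "(Suc j, i) \<in> nodes D" "(Suc j, Suc i) \<in> nodes D"
    using w jl level_width_Suc[OF jl] g by (auto simp: nodes_def)
  \<comment> \<open>the nodes that enter the crossing in the checkerboard orientation\<close>
  define x y where "x = (if even i then (j, i) else (j, Suc i))" and "y = (if even i then (Suc j, Suc i) else (Suc j, i))"
  have ent: "enters j n \<longleftrightarrow> n = x \<or> n = y" if "n \<in> {(j, i), (j, Suc i), (Suc j, i), (Suc j, Suc i)}" for n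
    using that by (auto simp: enters_def x_def y_def)
  have xy: "x \<noteq> y" "x \<in> nodes D" "y \<in> nodes D" using nd by (auto simp: x_def y_def)
  have sl: "slot x = j" "slot y = j" using slot(4)[OF xy(2), of j] slot(4)[OF xy(3), of j] ent by (auto simp: x_def y_def)
  have piv: "\<pi> u x = mt u j x" "\<pi> u y = mt u j y" for u using xy sl by (simp_all add: \<pi>_def)
  have swap: "mt (insert j v) j x = mt v j y" "mt (insert j v) j y = mt v j x"
    using j g by (auto simp: mate_def x_def y_def)
  have other: "\<pi> (insert j v) n = \<pi> v n" if n: "n \<noteq> x" "n \<noteq> y" for n
  proof (cases "n \<in> nodes D \<and> slot n = j")
    case True
    then have e: "enters j n" using slot(2)[of n] by simp
    then have "n \<notin> {(j, i), (j, Suc i), (Suc j, i), (Suc j, Suc i)}" using ent n by blast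
    moreover obtain l p where lp: "n = (l, p)" by (cases n)
    moreover have "l = j \<or> l = Suc j" using e by (auto simp: enters_def lp)
    ultimately have "mt (insert j v) j n = mt v j n" using g
      by (auto simp: mate_def not_less_eq_eq le_Suc_eq)
    then show ?thesis using True by (simp add: \<pi>_def)
  next
    case False
    then show ?thesis by (auto simp: \<pi>_def)
  qed
  have pi: "\<pi> (insert j v) = (\<pi> v)(x := \<pi> v y, y := \<pi> v x)"
    using other piv swap by (auto simp: fun_eq_iff)
  have cl: "mrg (Rel u) x y = mrg (Rel u) (j, i) (Suc j, Suc i) \<and> ((x, y) \<in> Rel u \<longleftrightarrow> ((j, i), (Suc j, Suc i)) \<in> Rel u)" for u
  proof -
    have eq: "equiv UNIV (Rel u)" unfolding Rel_def by (rule equiv_gen_rel)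
    note E = equivUD[OF eq]
    have a: "(x', y') \<in> Rel u" if "(x', y') \<in> core_arcs (D ! j) (j \<in> u) j" for x' y'
      unfolding Rel_def using that jl by (intro gen_rel_base) (auto simp: arcs_def slice_arcs_def)
    show ?thesis
    proof (cases "even i")
      case True then show ?thesis by (simp add: x_def y_def)
    next
      case False
      have h: "Rel u `` {(j, Suc i)} = Rel u `` {(j, i)} \<and> Rel u `` {(Suc j, i)} = Rel u `` {(Suc j, Suc i)} \<or>
        Rel u `` {(j, Suc i)} = Rel u `` {(Suc j, Suc i)} \<and> Rel u `` {(Suc j, i)} = Rel u `` {(j, i)}"
      proof (cases "(j \<in> u) = b")
        case True
        then have "((j, i), (j, Suc i)) \<in> Rel u" "((Suc j, i), (Suc j, Suc i)) \<in> Rel u" using a g by auto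
        then show ?thesis using E(2) by (auto simp: class_eq_iff[OF eq])
      next
        case False
        then have "((j, i), (Suc j, i)) \<in> Rel u" "((j, Suc i), (Suc j, Suc i)) \<in> Rel u" using a g by auto
        then show ?thesis using E(2) by (auto simp: class_eq_iff[OF eq])
      qed
      have m: "mrg (Rel u) (j, Suc i) (Suc j, i) = mrg (Rel u) (j, i) (Suc j, Suc i)"
        using h unfolding mrg_def by auto
      have "Rel u `` {(j, Suc i)} = Rel u `` {(Suc j, i)} \<longleftrightarrow> Rel u `` {(j, i)} = Rel u `` {(Suc j, Suc i)}"
        using h by metis
      then show ?thesis using m False by (simp add: x_def y_def class_eq_iff[OF eq])
    qed
  qed
  show thesis using that[OF xy pi] cl g by simp
qed

sublocale cube "nodes D" "crossings D" Rel "\<lambda>j. (j, position (D ! j))" "\<lambda>j. (Suc j, Suc (position (D ! j)))" "dmarks D"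
proof
  show "finite (nodes D)" by (rule finite_nodes)
  show "dmarks D \<subseteq> nodes D"
  proof
    fix n assume "n \<in> dmarks D"
    then obtain j i where n: "n = (j, i)" "j < length D" "D ! j = Mark i" by (auto simp: dmarks_def)
    then show "n \<in> nodes D" using tangle_nth[OF D n(2)] by (simp add: nodes_def)
  qed
  show "finite (crossings D)" by (simp add: crossings_def)
  show eq: "equiv UNIV (Rel v)" for v unfolding Rel_def by (rule equiv_gen_rel)
  show "y \<in> nodes D" if "(x, y) \<in> Rel v" "x \<in> nodes D" for v x y
  proof -
    have "(x, y) \<in> {(x, (\<pi> v ^^ k) x) | x k. True}"
      using that(1) unfolding Rel_\<pi> gen_rel_perm[OF permutes_\<pi> finite_nodes] .
    then obtain k where y: "y = (\<pi> v ^^ k) x" by blast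
    have "(\<pi> v ^^ k) x \<in> nodes D" for k
      using that(2) permutes_in_image[OF permutes_\<pi>[of v]] by (induction k) auto
    then show ?thesis using y by blast
  qed
  show "(j, position (D ! j)) \<in> nodes D \<and> (Suc j, Suc (position (D ! j))) \<in> nodes D" if j: "j \<in> crossings D" for j
  proof -
    obtain i b where g: "D ! j = Cross i b" and jl: "j < length D" using j by (auto simp: crossings_def)
    have "i + 2 \<le> level_width D j" using tangle_nth[OF D jl] g by simp
    then show ?thesis using jl level_width_Suc[OF jl] g by (auto simp: nodes_def)
  qed
  fix v j assume v: "v \<subseteq> crossings D" and j: "j \<in> crossings D - v"
  from crossing_swap[OF j] obtain x y where xy: "x \<noteq> y" "x \<in> nodes D" "y \<in> nodes D"
    and pi: "\<pi> (insert j v) = (\<pi> v)(x := \<pi> v y, y := \<pi> v x)"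
    and m: "\<And>u. u \<in> {v, insert j v} \<Longrightarrow>
       mrg (Rel u) x y = mrg (Rel u) (j, position (D ! j)) (Suc j, Suc (position (D ! j))) \<and>
       ((x, y) \<in> Rel u \<longleftrightarrow> ((j, position (D ! j)), (Suc j, Suc (position (D ! j)))) \<in> Rel u)" by metis
  show "((j, position (D ! j)), Suc j, Suc (position (D ! j))) \<notin> Rel v \<and>
       Rel (insert j v) = mrg (Rel v) (j, position (D ! j)) (Suc j, Suc (position (D ! j))) \<or>
       ((j, position (D ! j)), Suc j, Suc (position (D ! j))) \<notin> Rel (insert j v) \<and>
       Rel v = mrg (Rel (insert j v)) (j, position (D ! j)) (Suc j, Suc (position (D ! j)))"
    using swap_surgery[OF permutes_\<pi> finite_nodes xy pi Rel_\<pi> Rel_\<pi>] m[of v] m[of "insert j v"] by simp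
qed

lemma circ_circles: "circ v = circles D v"
  by (simp add: circ_def circles_def Rel_def gen_rel_def)

lemma triv_trivial_at: "triv v \<longleftrightarrow> trivial_at D v"
  by (simp add: triv_def trivial_at_def circ_circles card_marks_on)

lemma sts_states: "sts = states D"
  by (simp add: sts_def states_def circ_circles triv_trivial_at)

lemma cf_edge_coeff: "cf = edge_coeff D"
proof (intro ext)
  fix s t :: state
  show "cf s t = edge_coeff D s t"
    by (cases s; cases t) (simp add: cf_def edge_coeff_pcoef circ_circles)
qed

lemma Kh_homology: "Kh D = homology sts cf"
  by (simp add: Kh_def homology_def sts_states cf_edge_coeff cycles_def hcycles_def chains_def hchains_def
      differential_def[abs_def] hdiff_def[abs_def] fun_eq_iff)

end

section \<open>Arcs of a tangle\<close>

text \<open>The arcs of a tangle diagram with \<open>m\<close> bottom points, where the slices are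
  numbered from \<open>k\<close> on.\<close>

fun tarcs :: "nat \<Rightarrow> nat \<Rightarrow> slice list \<Rightarrow> nat set \<Rightarrow> (node \<times> node) set" where
  "tarcs k m [] v = {}"
| "tarcs k m (g # D) v = sarc g (k \<in> v) m k \<union> tarcs (Suc k) (m - ins g + outs g) D v"

lemma tarcs_append: "tarcs k m (A @ B) v = tarcs k m A v \<union> tarcs (k + length A) (wd m A) B v"
  by (induction A arbitrary: k m) auto

lemma tarcs_UN: "tarcs k m D v = (\<Union>j<length D. sarc (D ! j) (k + j \<in> v) (wd m (take j D)) (k + j))"
proof (induction D arbitrary: k m)
  case (Cons g D)
  have "(\<Union>j<length (g # D). sarc ((g # D) ! j) (k + j \<in> v) (wd m (take j (g # D))) (k + j))
     = sarc g (k \<in> v) m k \<union> (\<Union>j<length D. sarc (D ! j) (Suc k + j \<in> v) (wd (m - ins g + outs g) (take j D)) (Suc k + j))"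
    by (auto simp: lessThan_Suc_eq_insert_0)
  then show ?case using Cons by simp
qed simp

lemma arcs_tarcs: "arcs D v = tarcs 0 0 D v"
  by (simp add: arcs_def tarcs_UN slice_arcs_sarc level_width_wd)

text \<open>Translation of nodes from level \<open>k\<close> to level \<open>k'\<close>.\<close>

definition mv :: "nat \<Rightarrow> nat \<Rightarrow> node \<Rightarrow> node" where
  "mv k k' n = (fst n - k + k', snd n)"

lemma sarc_levels: "(u, u') \<in> sarc g r m j \<Longrightarrow> fst u \<in> {j, Suc j} \<and> fst u' \<in> {j, Suc j}"
  by (cases g) (auto simp: sarc_def through_arcs_def split: if_splits)

lemma sarc_mv:
  assumes "(u, u') \<in> sarc g r m j"
  shows "(mv j j' u, mv j j' u') \<in> sarc g r m j'"
proof -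
  from assms consider p where "p < position g" "u = (j, p)" "u' = (Suc j, p)"
    | p where "position g + ins g \<le> p" "p < m" "u = (j, p)" "u' = (Suc j, p - ins g + outs g)"
    | "(u, u') \<in> core_arcs g r j"
    by (auto simp: sarc_def through_arcs_def)
  then show ?thesis
  proof cases
    case 3
    then show ?thesis by (cases g) (auto simp: sarc_def mv_def split: if_splits)
  qed (auto simp: sarc_def through_arcs_def mv_def)
qed

lemma tarcs_mv:
  assumes "(u, u') \<in> tarcs k m D v" "\<And>j. j < length D \<Longrightarrow> k + j \<in> v \<longleftrightarrow> k' + j \<in> v'"
  shows "(mv k k' u, mv k k' u') \<in> tarcs k' m D v'"
    and "k \<le> fst u \<and> fst u \<le> k + length D \<and> k \<le> fst u' \<and> fst u' \<le> k + length D"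
proof -
  have "(mv k k' u, mv k k' u') \<in> tarcs k' m D v' \<and>
    k \<le> fst u \<and> fst u \<le> k + length D \<and> k \<le> fst u' \<and> fst u' \<le> k + length D"
    using assms
  proof (induction D arbitrary: k k' m)
    case (Cons g D)
    from Cons.prems(1) consider "(u, u') \<in> sarc g (k \<in> v) m k" | "(u, u') \<in> tarcs (Suc k) (m - ins g + outs g) D v"
      by auto
    then show ?case
    proof cases
      case 1
      have "k \<in> v \<longleftrightarrow> k' \<in> v'" using Cons.prems(2)[of 0] by simp
      then show ?thesis using sarc_mv[OF 1, of k'] sarc_levels[OF 1] by auto
    next
      case 2
      have "Suc k + j \<in> v \<longleftrightarrow> Suc k' + j \<in> v'" if "j < length D" for j using Cons.prems(2)[of "Suc j"] that by simp
      from Cons.IH[OF 2 this]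
      have *: "(mv (Suc k) (Suc k') u, mv (Suc k) (Suc k') u') \<in> tarcs (Suc k') (m - ins g + outs g) D v'"
        "Suc k \<le> fst u \<and> fst u \<le> Suc k + length D \<and> Suc k \<le> fst u' \<and> fst u' \<le> Suc k + length D" by blast+
      moreover have "mv (Suc k) (Suc k') z = mv k k' z" if "Suc k \<le> fst z" for z using that by (auto simp: mv_def)
      ultimately show ?thesis by auto
    qed
  qed simp
  then show "(mv k k' u, mv k k' u') \<in> tarcs k' m D v'"
    "k \<le> fst u \<and> fst u \<le> k + length D \<and> k \<le> fst u' \<and> fst u' \<le> k + length D" by blast+
qed

lemma mv_id [simp]: "k \<le> fst u \<Longrightarrow> mv k k u = u"
  by (simp add: mv_def)

lemma tarcs_cong:
  assumes "\<And>j. j < length D \<Longrightarrow> k + j \<in> v \<longleftrightarrow> k + j \<in> v'"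
  shows "tarcs k m D v = tarcs k m D v'"
proof -
  have "tarcs k m D v \<subseteq> tarcs k m D v'" if a: "\<And>j. j < length D \<Longrightarrow> k + j \<in> v \<longleftrightarrow> k + j \<in> v'" for v v'
  proof
    fix e assume "e \<in> tarcs k m D v"
    then obtain u u' where e: "e = (u, u')" "(u, u') \<in> tarcs k m D v" by (cases e) auto
    show "e \<in> tarcs k m D v'" using tarcs_mv[OF e(2) a] e(1) by simp
  qed
  from this[of v v'] this[of v' v] assms show ?thesis by blast
qed

section \<open>Replacing a part of a diagram\<close>

text \<open>To compare \<open>X @ M @ Y\<close> with \<open>X @ M' @ Y\<close>, the part
  \<open>M\<close> is shrunk to a single slice between the levels of \<open>X\<close> and those of
  \<open>Y\<close>, of which only a relation \<open>\<rho>\<close> between its end points is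
  remembered. The result, the skeleton, does not mention \<open>M\<close>, and it is the common
  target of both sides of a move.\<close>

definition skel_nodes :: "slice list \<Rightarrow> nat \<Rightarrow> slice list \<Rightarrow> node set" where
  "skel_nodes X n Y = {(j, p). j \<le> length X \<and> p < wd 0 (take j X)} \<union>
     {(Suc (length X) + j, p) | j p. j \<le> length Y \<and> p < wd n (take j Y)}"

definition skel_rel :: "slice list \<Rightarrow> nat \<Rightarrow> slice list \<Rightarrow> (node \<times> node) set \<Rightarrow> nat set \<Rightarrow> nat set \<Rightarrow> (node \<times> node) set" where
  "skel_rel X n Y \<rho> a c = gen_rel (tarcs 0 0 X a \<union> (\<lambda>(u, u'). (mv 0 (length X) u, mv 0 (length X) u')) ` \<rho>
     \<union> tarcs (Suc (length X)) n Y ((+) (Suc (length X)) ` c))"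

definition skel_circles :: "slice list \<Rightarrow> nat \<Rightarrow> slice list \<Rightarrow> (node \<times> node) set \<Rightarrow> nat set \<Rightarrow> nat set \<Rightarrow> node set set" where
  "skel_circles X n Y \<rho> a c = (\<lambda>u. {u' \<in> skel_nodes X n Y. (u, u') \<in> skel_rel X n Y \<rho> a c}) ` skel_nodes X n Y"

definition skel_marks :: "slice list \<Rightarrow> slice list \<Rightarrow> node set" where
  "skel_marks X Y = {(j, i) | j i. j < length X \<and> X ! j = Mark i} \<union>
     {(Suc (length X) + j, i) | j i. j < length Y \<and> Y ! j = Mark i}"

text \<open>The skeleton numbers the two levels around the shrunken part by \<open>0\<close> and
  \<open>1\<close>; this maps them to the bottom and the top of a tangle with \<open>l\<close>
  slices.\<close>

definition ends :: "nat \<Rightarrow> node \<Rightarrow> node" where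
  "ends l u = (if fst u = 0 then 0 else l, snd u)"

text \<open>The resolution \<open>b\<close> of the tangle \<open>M\<close> connects its end points
  as \<open>\<rho>\<close> does, up to closed components with node set \<open>Z\<close>. The
  retraction \<open>g\<close> sends every inner node outside \<open>Z\<close> to an end of its
  strand. It is part of the notion since two resolutions that are joined by an edge have to admit
  the same \<open>g\<close>: circles are then recovered from their traces on the skeleton at both
  ends simultaneously.\<close>

definition realizes :: "nat \<Rightarrow> slice list \<Rightarrow> nat set \<Rightarrow> (node \<times> node) set \<Rightarrow> (node \<Rightarrow> node) \<Rightarrow> node set \<Rightarrow> bool" where
  "realizes m M b \<rho> g Z \<longleftrightarrow>
     (\<forall>(u, u') \<in> \<rho>. fst u \<le> 1 \<and> fst u' \<le> 1 \<and> (ends (length M) u, ends (length M) u') \<in> gen_rel (tarcs 0 m M b)) \<and>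
     (\<forall>(u, u') \<in> tarcs 0 m M b. (g u, g u') \<in> gen_rel \<rho>) \<and>
     (\<forall>j p. 0 < j \<and> j < length M \<and> p < wd m (take j M) \<and> (j, p) \<notin> Z \<longrightarrow>
        fst (g (j, p)) \<le> 1 \<and> (ends (length M) (g (j, p)), (j, p)) \<in> gen_rel (tarcs 0 m M b)) \<and>
     (\<forall>p<m. g (0, p) = (0, p)) \<and>
     (if M = [] then \<forall>p<m. ((0, p), (1, p)) \<in> \<rho> else \<forall>p<wd m M. g (length M, p) = (1, p)) \<and>
     (\<forall>u\<in>Z. 0 < fst u \<and> fst u < length M)"

definition local_circle :: "nat \<Rightarrow> slice list \<Rightarrow> nat set \<Rightarrow> node set \<Rightarrow> bool" where
  "local_circle m M b Z \<longleftrightarrow> Z \<noteq> {} \<and> (\<forall>(u, u') \<in> tarcs 0 m M b. u \<in> Z \<longleftrightarrow> u' \<in> Z) \<and>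
     (\<forall>u\<in>Z. \<forall>u'\<in>Z. (u, u') \<in> gen_rel (tarcs 0 m M b)) \<and>
     (\<forall>u\<in>Z. 0 < fst u \<and> fst u < length M \<and> snd u < wd m (take (fst u) M))"

locale split_diagram =
  fixes X M Y :: "slice list"
  assumes XMY: "tangle 0 (X @ M @ Y) 0" and unM: "unmarked M"
begin

abbreviation "x \<equiv> length X"
abbreviation "l \<equiv> length M"
abbreviation "m \<equiv> wd 0 X"
abbreviation "n \<equiv> wd m M"

sublocale diagram "X @ M @ Y"
  by unfold_locales (rule XMY)

text \<open>The inclusion of the nodes of the skeleton.\<close>

definition f :: "node \<Rightarrow> node" where
  "f u = (if fst u \<le> x then u else (fst u - 1 + l, snd u))"

text \<open>The retraction of the diagram to the skeleton that extends the local one.\<close>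

definition ext :: "(node \<Rightarrow> node) \<Rightarrow> node \<Rightarrow> node" where
  "ext g u = (if fst u < x then u else if fst u \<le> x + l then mv 0 x (g (mv x 0 u)) else (fst u + 1 - l, snd u))"

text \<open>The parts of a vertex that belong to \<open>X\<close>, to \<open>M\<close> and to
  \<open>Y\<close>.\<close>

definition lo :: "nat set \<Rightarrow> nat set" where "lo w = w \<inter> {..<x}"
definition mi :: "nat set \<Rightarrow> nat set" where "mi w = {k. k < l \<and> x + k \<in> w}"
definition hi :: "nat set \<Rightarrow> nat set" where "hi w = {j. x + l + j \<in> w}"

abbreviation S :: "(node \<times> node) set \<Rightarrow> nat set \<Rightarrow> (node \<times> node) set" where
  "S \<rho> w \<equiv> skel_rel X n Y \<rho> (lo w) (hi w)"

abbreviation "msk \<equiv> skel_nodes X n Y"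

lemma width: "j \<le> x \<Longrightarrow> level_width (X @ M @ Y) j = wd 0 (take j X)"
    "k \<le> l \<Longrightarrow> level_width (X @ M @ Y) (x + k) = wd m (take k M)"
    "level_width (X @ M @ Y) (x + l + j) = wd n (take j Y)"
  by (simp_all add: level_width_wd)

lemma node_cases:
  assumes "u \<in> nodes (X @ M @ Y)"
  obtains "fst u < x" "snd u < wd 0 (take (fst u) X)"
  | k where "fst u = x + k" "k \<le> l" "snd u < wd m (take k M)"
  | j where "fst u = x + l + j" "0 < j" "j \<le> length Y" "snd u < wd n (take j Y)"
proof -
  obtain k p where u: "u = (k, p)" by (cases u)
  have h: "k \<le> x + l + length Y" "p < level_width (X @ M @ Y) k" using assms by (auto simp: nodes_def u)
  consider "k < x" | "x \<le> k" "k \<le> x + l" | "x + l < k" by linarith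
  then show thesis
  proof cases
    case 1 then show thesis using that(1) h width(1)[of k] by (simp add: u)
  next
    case 2
    then have "k = x + (k - x)" by simp
    then show thesis using that(2)[of "k - x"] h(2) width(2)[of "k - x"] 2 by (simp add: u)
  next
    case 3
    then have "k = x + l + (k - x - l)" by simp
    then show thesis using that(3)[of "k - x - l"] h width(3)[of "k - x - l"] 3 by (simp add: u)
  qed
qed

lemma f_nodes: "f u \<in> nodes (X @ M @ Y) \<longleftrightarrow> u \<in> msk"
proof -
  obtain j p where u: "u = (j, p)" by (cases u)
  show ?thesis
  proof (cases "j \<le> x")
    case True
    then show ?thesis using width(1)[of j] by (auto simp: f_def u nodes_def skel_nodes_def)
  next
    case False
    then obtain k where j: "j = Suc x + k" using less_iff_Suc_add[of x j] by auto
    have "j - 1 + l = x + l + k" using j by simp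
    then have "f u = (x + l + k, p)" using False by (simp add: f_def u)
    then show ?thesis using width(3)[of k] j by (auto simp: nodes_def skel_nodes_def u)
  qed
qed

lemma lift_local:
  assumes "(u, u') \<in> gen_rel (tarcs 0 m M (mi w))"
  shows "(mv 0 x u, mv 0 x u') \<in> Rel w"
proof (rule gen_rel_least[OF eqR _ assms])
  fix u u' assume a: "(u, u') \<in> tarcs 0 m M (mi w)"
  have "(mv 0 x u, mv 0 x u') \<in> tarcs x m M w" by (rule tarcs_mv(1)[OF a]) (simp add: mi_def)
  then show "(mv 0 x u, mv 0 x u') \<in> Rel w"
    unfolding Rel_def by (intro gen_rel_base) (simp add: arcs_tarcs tarcs_append)
qed

lemma f_ends: "fst u \<le> 1 \<Longrightarrow> f (mv 0 x u) = mv 0 x (ends l u)"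
  by (auto simp: f_def mv_def ends_def)

lemma Rel_arcs_cases:
  assumes "(u, u') \<in> arcs (X @ M @ Y) w"
  obtains "(u, u') \<in> tarcs 0 0 X w" | "(u, u') \<in> tarcs x m M w" | "(u, u') \<in> tarcs (x + l) n Y w"
  using assms by (auto simp: arcs_tarcs tarcs_append)

context
  fixes w b :: "nat set" and \<rho> :: "(node \<times> node) set" and g :: "node \<Rightarrow> node" and Z :: "node set"
  assumes b: "b = mi w" and real: "realizes m M b \<rho> g Z"
begin

lemma equiv_S: "equiv UNIV (S \<rho> w)"
  by (simp add: skel_rel_def equiv_gen_rel)

text \<open>Strands of the skeleton are strands of the diagram, where the inner ones are replaced by
  paths through \<open>M\<close>.\<close>

lemma skel_to_rel:
  assumes "(u, u') \<in> S \<rho> w"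
  shows "(f u, f u') \<in> Rel w"
  using assms unfolding skel_rel_def
proof (rule gen_rel_least[OF eqR, rotated])
  fix u u'
  assume "(u, u') \<in> tarcs 0 0 X (lo w) \<union> (\<lambda>(u, u'). (mv 0 x u, mv 0 x u')) ` \<rho> \<union> tarcs (Suc x) n Y ((+) (Suc x) ` hi w)"
  then consider "(u, u') \<in> tarcs 0 0 X (lo w)" | v v' where "(v, v') \<in> \<rho>" "u = mv 0 x v" "u' = mv 0 x v'"
    | "(u, u') \<in> tarcs (Suc x) n Y ((+) (Suc x) ` hi w)" by auto
  then show "(f u, f u') \<in> Rel w"
  proof cases
    case 1
    have e: "tarcs 0 0 X (lo w) = tarcs 0 0 X w" by (rule tarcs_cong) (simp add: lo_def)
    have "fst u \<le> x" "fst u' \<le> x" using tarcs_mv(2)[OF 1 HOL.refl] by auto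
    then show ?thesis using 1 e unfolding Rel_def by (intro gen_rel_base) (simp add: f_def arcs_tarcs tarcs_append)
  next
    case (2 v v')
    then have "fst v \<le> 1" "fst v' \<le> 1" "(ends l v, ends l v') \<in> gen_rel (tarcs 0 m M (mi w))"
      using real b by (auto simp: realizes_def)
    then show ?thesis using lift_local[of "ends l v" "ends l v'" w] f_ends 2 by simp
  next
    case 3
    have c: "Suc x + j \<in> (+) (Suc x) ` hi w \<longleftrightarrow> x + l + j \<in> w" for j by (auto simp: hi_def)
    have "(mv (Suc x) (x + l) u, mv (Suc x) (x + l) u') \<in> tarcs (x + l) n Y w" by (rule tarcs_mv(1)[OF 3]) (rule c)
    moreover have "Suc x \<le> fst u" "Suc x \<le> fst u'" using tarcs_mv(2)[OF 3 c] by auto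
    then have "f u = mv (Suc x) (x + l) u" "f u' = mv (Suc x) (x + l) u'" by (auto simp: f_def mv_def)
    ultimately show ?thesis unfolding Rel_def by (intro gen_rel_base) (simp add: arcs_tarcs tarcs_append)
  qed
qed

lemma ext_low:
  assumes "u \<in> nodes (X @ M @ Y)" "fst u \<le> x"
  shows "ext g u = u"
proof (cases "fst u < x")
  case False
  then have "fst u = x" using assms by simp
  moreover have "snd u < m" using assms calculation width(1)[of x] by (auto simp: nodes_def)
  moreover have "g (0, snd u) = (0, snd u)" using real calculation(2) by (simp add: realizes_def)
  ultimately show ?thesis by (simp add: ext_def mv_def prod_eq_iff)
qed (simp add: ext_def)

lemma rho_in_S: "(v, v') \<in> \<rho> \<Longrightarrow> (mv 0 x v, mv 0 x v') \<in> S \<rho> w"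
  unfolding skel_rel_def by (rule gen_rel_base) force

lemma ext_high:
  assumes u: "u \<in> nodes (X @ M @ Y)" "x + l \<le> fst u"
  shows "(ext g u, mv (x + l) (Suc x) u) \<in> S \<rho> w"
proof (cases "fst u = x + l")
  case False
  then have "ext g u = mv (x + l) (Suc x) u" using u by (auto simp: ext_def mv_def)
  then show ?thesis using equivUD(1)[OF equiv_S] by simp
next
  case True
  have p: "snd u < n" using u True width(3)[of 0] by (auto simp: nodes_def)
  show ?thesis
  proof (cases "M = []")
    case False
    then have "g (l, snd u) = (1, snd u)" using real p by (simp add: realizes_def)
    then have "ext g u = mv (x + l) (Suc x) u" using True by (simp add: ext_def mv_def)
    then show ?thesis using equivUD(1)[OF equiv_S] by simp
  next
    case M: True
    then have "((0, snd u), (1, snd u)) \<in> \<rho>" using real p by (simp add: realizes_def)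
    from rho_in_S[OF this] have "((x, snd u), (Suc x, snd u)) \<in> S \<rho> w" by (simp add: mv_def)
    moreover have "ext g u = u" using ext_low[OF u(1)] True M by simp
    moreover have "u = (x, snd u)" using True M by (simp add: prod_eq_iff)
    ultimately show ?thesis using True M by (simp add: mv_def)
  qed
qed

text \<open>Conversely the retraction maps arcs to connected nodes.\<close>

lemma rel_to_skel:
  assumes "(v, v') \<in> Rel w"
  shows "(ext g v, ext g v') \<in> S \<rho> w"
  using assms unfolding Rel_def
proof (rule gen_rel_least[OF equiv_S, rotated])
  fix u u' assume a: "(u, u') \<in> arcs (X @ M @ Y) w"
  then obtain j where "j < length (X @ M @ Y)" "(u, u') \<in> slice_arcs (X @ M @ Y) w j" by (auto simp: arcs_def)
  then have nd: "u \<in> nodes (X @ M @ Y)" "u' \<in> nodes (X @ M @ Y)" using arc_in by blast+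
  note E = equivUD[OF equiv_S]
  from a show "(ext g u, ext g u') \<in> S \<rho> w"
  proof (cases rule: Rel_arcs_cases)
    case 1
    have e: "tarcs 0 0 X w = tarcs 0 0 X (lo w)" by (rule tarcs_cong) (simp add: lo_def)
    have "fst u \<le> x" "fst u' \<le> x" using tarcs_mv(2)[OF 1 HOL.refl] by auto
    then show ?thesis using 1 e nd ext_low unfolding skel_rel_def by (intro gen_rel_base) auto
  next
    case 2
    have c: "x + k \<in> w \<longleftrightarrow> 0 + k \<in> mi w" if "k < l" for k using that by (simp add: mi_def)
    have t: "(mv x 0 u, mv x 0 u') \<in> tarcs 0 m M (mi w)" by (rule tarcs_mv(1)[OF 2 c])
    have lv: "x \<le> fst u" "fst u \<le> x + l" "x \<le> fst u'" "fst u' \<le> x + l" using tarcs_mv(2)[OF 2 c] by auto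
    have "(g (mv x 0 u), g (mv x 0 u')) \<in> gen_rel \<rho>" using real t b by (auto simp: realizes_def)
    from gen_rel_least[OF equiv_S, where f = "mv 0 x", OF rho_in_S this]
    have "(mv 0 x (g (mv x 0 u)), mv 0 x (g (mv x 0 u'))) \<in> S \<rho> w" by simp
    moreover have "ext g z = mv 0 x (g (mv x 0 z))" if "x \<le> fst z" "fst z \<le> x + l" for z
      using that by (simp add: ext_def)
    ultimately show ?thesis using lv by simp
  next
    case 3
    have c: "x + l + j \<in> w \<longleftrightarrow> Suc x + j \<in> (+) (Suc x) ` hi w" for j by (auto simp: hi_def)
    have "(mv (x + l) (Suc x) u, mv (x + l) (Suc x) u') \<in> tarcs (Suc x) n Y ((+) (Suc x) ` hi w)"
      by (rule tarcs_mv(1)[OF 3 c])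
    then have "(mv (x + l) (Suc x) u, mv (x + l) (Suc x) u') \<in> S \<rho> w"
      unfolding skel_rel_def by (intro gen_rel_base) auto
    moreover have "x + l \<le> fst u" "x + l \<le> fst u'" using tarcs_mv(2)[OF 3 c] by auto
    ultimately show ?thesis using ext_high[OF nd(1)] ext_high[OF nd(2)] E(2,3) by blast
  qed
qed

lemma f_ext:
  assumes u: "u \<in> nodes (X @ M @ Y)" "u \<notin> mv 0 x ` Z"
  shows "(f (ext g u), u) \<in> Rel w"
  using u(1)
proof (cases rule: node_cases)
  case 1
  then show ?thesis using equivUD(1)[OF eqR] by (simp add: ext_def f_def)
next
  case (2 k)
  show ?thesis
  proof (cases "k = 0 \<or> k = l")
    case True
    show ?thesis
    proof (cases "k = 0")
      case True
      then have "ext g u = u" using ext_low[OF u(1)] 2 by simp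
      then show ?thesis using equivUD(1)[OF eqR] 2 True by (simp add: f_def)
    next
      case False
      then have k: "k = l" "M \<noteq> []" using True by auto
      then have "g (l, snd u) = (1, snd u)" using real 2 by (simp add: realizes_def)
      then have "ext g u = (Suc x, snd u)" using k 2 by (simp add: ext_def mv_def)
      then have "f (ext g u) = u" using k 2 by (simp add: f_def prod_eq_iff)
      then show ?thesis using equivUD(1)[OF eqR] by simp
    qed
  next
    case False
    have mvu: "mv x 0 u = (k, snd u)" using 2 by (simp add: mv_def)
    have u': "u = mv 0 x (k, snd u)" using 2 by (simp add: mv_def prod_eq_iff)
    have kl: "0 < k" "k < l" using False 2(2) by simp_all
    have "(k, snd u) \<notin> Z" using u(2) u' by blast
    then have "fst (g (k, snd u)) \<le> 1" "(ends l (g (k, snd u)), (k, snd u)) \<in> gen_rel (tarcs 0 m M b)"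
      using real kl 2(3) unfolding realizes_def by blast+
    then have "(mv 0 x (ends l (g (k, snd u))), mv 0 x (k, snd u)) \<in> Rel w" and e: "f (mv 0 x (g (k, snd u))) = mv 0 x (ends l (g (k, snd u)))"
      using lift_local b f_ends by auto
    moreover have "ext g u = mv 0 x (g (k, snd u))" using 2 mvu by (simp add: ext_def)
    ultimately show ?thesis using u' by simp
  qed
next
  case (3 j)
  then have "ext g u = (Suc x + j, snd u)" by (simp add: ext_def)
  then have "f (ext g u) = u" using 3 by (simp add: f_def prod_eq_iff)
  then show ?thesis using equivUD(1)[OF eqR] by simp
qed

lemma ext_f:
  assumes u: "u \<in> msk"
  shows "(ext g (f u), u) \<in> S \<rho> w"
proof (cases "fst u \<le> x")
  case True
  then have fu: "f u = u" by (simp add: f_def)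
  then have "u \<in> nodes (X @ M @ Y)" using f_nodes[of u] u by simp
  then have "ext g (f u) = u" using ext_low True fu by simp
  then show ?thesis using equivUD(1)[OF equiv_S] by simp
next
  case False
  then have "x + l \<le> fst (f u)" "mv (x + l) (Suc x) (f u) = u" by (auto simp: f_def mv_def prod_eq_iff)
  then show ?thesis using ext_high[of "f u"] u f_nodes by simp
qed

lemma skel_rel_iff:
  assumes "u \<in> msk" "u' \<in> msk"
  shows "(u, u') \<in> S \<rho> w \<longleftrightarrow> (f u, f u') \<in> Rel w"
proof
  assume "(f u, f u') \<in> Rel w"
  then have "(ext g (f u), ext g (f u')) \<in> S \<rho> w" by (rule rel_to_skel)
  then show "(u, u') \<in> S \<rho> w" using ext_f[OF assms(1)] ext_f[OF assms(2)] equivUD(2,3)[OF equiv_S] by blast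
qed (rule skel_to_rel)

end

text \<open>The trace of a circle on the skeleton.\<close>

definition tr :: "node set \<Rightarrow> node set" where "tr C = {u. f u \<in> C}"

lemma f_notin_mid: "\<forall>u\<in>Z. 0 < fst u \<and> fst u < l \<Longrightarrow> f u \<notin> mv 0 x ` Z"
  by (auto simp: f_def mv_def)

lemma trace_circ:
  assumes w: "w \<subseteq> crossings (X @ M @ Y)" and real: "realizes m M (mi w) \<rho> g Z" and Z: "Z = {} \<or> mv 0 x ` Z \<in> circ w"
  shows "tr ` (circ w - {mv 0 x ` Z}) = skel_circles X n Y \<rho> (lo w) (hi w)"
proof -
  note E = equivUD[OF eqR[of w]]
  note iff = skel_rel_iff[OF HOL.refl real]
  have Zl: "\<forall>u\<in>Z. 0 < fst u \<and> fst u < l" using real by (simp add: realizes_def)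
  have cl: "tr (Rel w `` {f u}) = {u' \<in> msk. (u, u') \<in> S \<rho> w}" if u: "u \<in> msk" for u
  proof -
    have "u' \<in> msk" if "(f u, f u') \<in> Rel w" for u'
      using closed[OF w that] u f_nodes by blast
    then show ?thesis using iff[OF u] by (auto simp: tr_def)
  qed
  show ?thesis
  proof
    show "tr ` (circ w - {mv 0 x ` Z}) \<subseteq> skel_circles X n Y \<rho> (lo w) (hi w)"
    proof
      fix B assume "B \<in> tr ` (circ w - {mv 0 x ` Z})"
      then obtain C where C: "C \<in> circ w" "C \<noteq> mv 0 x ` Z" "B = tr C" by blast
      then obtain v where v: "v \<in> nodes (X @ M @ Y)" "C = Rel w `` {v}" by (auto simp: circ_def quotient_def)
      have "v \<in> C" using v E by blast
      then have "v \<notin> mv 0 x ` Z" using Z C class_disjoint[OF eqR, of C "nodes (X @ M @ Y)" w "mv 0 x ` Z"] by (auto simp: circ_def)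
      then have fv: "(f (ext g v), v) \<in> Rel w" using f_ext[OF HOL.refl real v(1)] by blast
      then have "f (ext g v) \<in> nodes (X @ M @ Y)" using closed[OF w] E(2) v(1) by blast
      then have "ext g v \<in> msk" by (simp add: f_nodes)
      moreover have "C = Rel w `` {f (ext g v)}" using fv v(2) class_eq_iff[OF eqR, of w "f (ext g v)" v] by simp
      ultimately show "B \<in> skel_circles X n Y \<rho> (lo w) (hi w)" using cl C(3) by (auto simp: skel_circles_def)
    qed
    show "skel_circles X n Y \<rho> (lo w) (hi w) \<subseteq> tr ` (circ w - {mv 0 x ` Z})"
    proof
      fix B assume "B \<in> skel_circles X n Y \<rho> (lo w) (hi w)"
      then obtain u where u: "u \<in> msk" "B = {u' \<in> msk. (u, u') \<in> S \<rho> w}" by (auto simp: skel_circles_def)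
      have "Rel w `` {f u} \<in> circ w" using u(1) f_nodes[of u] unfolding circ_def by (intro quotientI) simp
      moreover have "f u \<in> Rel w `` {f u}" using E by blast
      then have "Rel w `` {f u} \<noteq> mv 0 x ` Z" using f_notin_mid[OF Zl, of u] by blast
      ultimately show "B \<in> tr ` (circ w - {mv 0 x ` Z})" using cl[OF u(1)] u(2) by blast
    qed
  qed
qed

text \<open>A circle other than \<open>Z\<close> consists of the nodes that are retracted into its
  trace. The retraction is the same at both vertices, so that circles of the one and of the other
  can be compared by their traces.\<close>

lemma trace_inj:
  assumes w: "w \<subseteq> crossings (X @ M @ Y)" "w' \<subseteq> crossings (X @ M @ Y)"
    and real: "realizes m M (mi w) \<rho> g Z" "realizes m M (mi w') \<rho>' g Z"
    and Z: "Z = {} \<or> mv 0 x ` Z \<in> circ w" "Z = {} \<or> mv 0 x ` Z \<in> circ w'"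
  shows "inj_on tr ((circ w - {mv 0 x ` Z}) \<union> (circ w' - {mv 0 x ` Z}))"
proof -
  have C: "C = {v \<in> nodes (X @ M @ Y) - mv 0 x ` Z. ext g v \<in> tr C}"
    if w: "w \<subseteq> crossings (X @ M @ Y)" and r: "realizes m M (mi w) \<rho> g Z" and Z: "Z = {} \<or> mv 0 x ` Z \<in> circ w"
      and C: "C \<in> circ w - {mv 0 x ` Z}" for w \<rho> C
  proof -
    have sub: "C \<subseteq> nodes (X @ M @ Y)" using circ_sub[OF w] C by blast
    have dis: "C \<inter> mv 0 x ` Z = {}" using Z C class_disjoint[OF eqR, of C "nodes (X @ M @ Y)" w "mv 0 x ` Z"] by (auto simp: circ_def)
    have "v \<in> C \<longleftrightarrow> f (ext g v) \<in> C" if v: "v \<in> nodes (X @ M @ Y)" "v \<notin> mv 0 x ` Z" for v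
    proof -
      have r: "(f (ext g v), v) \<in> Rel w" using f_ext[OF HOL.refl r v] .
      have C': "C \<in> nodes (X @ M @ Y) // Rel w" using C by (simp add: circ_def)
      show ?thesis using class_mem[OF eqR C', of v] class_mem[OF eqR C', of "f (ext g v)"] r equivUD(2)[OF eqR r] by blast
    qed
    then show ?thesis using sub dis unfolding tr_def by (intro Set.set_eqI) blast
  qed
  show ?thesis
  proof (rule inj_onI)
    fix C C' assume CC: "C \<in> (circ w - {mv 0 x ` Z}) \<union> (circ w' - {mv 0 x ` Z})"
      "C' \<in> (circ w - {mv 0 x ` Z}) \<union> (circ w' - {mv 0 x ` Z})" and e: "tr C = tr C'"
    have "C = {v \<in> nodes (X @ M @ Y) - mv 0 x ` Z. ext g v \<in> tr C}" using CC(1) C[OF w(1) real(1) Z(1)] C[OF w(2) real(2) Z(2)] by blast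
    moreover have "C' = {v \<in> nodes (X @ M @ Y) - mv 0 x ` Z. ext g v \<in> tr C'}" using CC(2) C[OF w(1) real(1) Z(1)] C[OF w(2) real(2) Z(2)] by blast
    ultimately show "C = C'" using e by simp
  qed
qed

lemma local_circle_circ:
  assumes w: "w \<subseteq> crossings (X @ M @ Y)" and Z: "local_circle m M (mi w) Z"
  shows "mv 0 x ` Z \<in> circ w"
proof -
  obtain z where z: "z \<in> Z" using Z by (auto simp: local_circle_def)
  have Zl: "0 < fst u \<and> fst u < l \<and> snd u < wd m (take (fst u) M)" if "u \<in> Z" for u
    using Z that by (simp add: local_circle_def)
  have nd: "mv 0 x z \<in> nodes (X @ M @ Y)"
    using Zl[OF z] width(2)[of "fst z"] by (simp add: nodes_def mv_def add.commute)
  have inside: "u \<in> mv 0 x ` Z \<longleftrightarrow> u' \<in> mv 0 x ` Z" if a: "(u, u') \<in> arcs (X @ M @ Y) w" for u u'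
    using a
  proof (cases rule: Rel_arcs_cases)
    case 1
    have "fst u \<le> x" "fst u' \<le> x" using tarcs_mv(2)[OF 1 HOL.refl] by auto
    then show ?thesis using Zl by (fastforce simp: mv_def)
  next
    case 2
    have c: "x + k \<in> w \<longleftrightarrow> 0 + k \<in> mi w" if "k < l" for k using that by (simp add: mi_def)
    have t: "(mv x 0 u, mv x 0 u') \<in> tarcs 0 m M (mi w)" by (rule tarcs_mv(1)[OF 2 c])
    have lv: "x \<le> fst u" "x \<le> fst u'" using tarcs_mv(2)[OF 2 c] by auto
    have i: "v \<in> mv 0 x ` Z \<longleftrightarrow> mv x 0 v \<in> Z" if "x \<le> fst v" for v
    proof
      assume "mv x 0 v \<in> Z"
      moreover have "v = mv 0 x (mv x 0 v)" using that by (simp add: mv_def)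
      ultimately show "v \<in> mv 0 x ` Z" by blast
    qed (auto simp: mv_def)
    have "mv x 0 u \<in> Z \<longleftrightarrow> mv x 0 u' \<in> Z" using Z t by (auto simp: local_circle_def)
    then show ?thesis using i lv by simp
  next
    case 3
    have "x + l \<le> fst u" "x + l \<le> fst u'" using tarcs_mv(2)[OF 3 HOL.refl] by auto
    then show ?thesis using Zl by (fastforce simp: mv_def)
  qed
  have "Rel w `` {mv 0 x z} = mv 0 x ` Z"
  proof
    have "u \<in> mv 0 x ` Z" if "(mv 0 x z, u) \<in> Rel w" for u
      using that unfolding Rel_def gen_rel_def
    proof (induction rule: rtrancl_induct)
      case base show ?case using z by blast
    next
      case (step u v)
      then show ?case using inside[of u v] inside[of v u] by blast
    qed
    then show "Rel w `` {mv 0 x z} \<subseteq> mv 0 x ` Z" by blast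
    show "mv 0 x ` Z \<subseteq> Rel w `` {mv 0 x z}"
      using lift_local[of z _ w] Z z by (auto simp: local_circle_def)
  qed
  then show ?thesis using nd by (auto simp: circ_def quotient_def)
qed

lemma marks_mid: "local_circle m M b Z \<or> Z = {} \<Longrightarrow> dmarks (X @ M @ Y) \<inter> mv 0 x ` Z = {}"
proof -
  assume Z: "local_circle m M b Z \<or> Z = {}"
  have "u \<notin> mv 0 x ` Z" if u: "u \<in> dmarks (X @ M @ Y)" for u
  proof
    assume "u \<in> mv 0 x ` Z"
    then obtain z where z: "z \<in> Z" "u = mv 0 x z" by blast
    then have "fst u = x + fst z" "0 < fst z" "fst z < l" using Z by (auto simp: local_circle_def mv_def)
    moreover obtain i where "(X @ M @ Y) ! fst u = Mark i" using u by (auto simp: dmarks_def)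
    ultimately have "M ! fst z = Mark i" "fst z < l" by (simp_all add: nth_append)
    then show False using unM nth_mem[of "fst z" M] by (auto simp: unmarked_def)
  qed
  then show "dmarks (X @ M @ Y) \<inter> mv 0 x ` Z = {}" by blast
qed

text \<open>The part \<open>M\<close> carries no marked points.\<close>

lemma f_marks: "bij_betw f (skel_marks X Y) (dmarks (X @ M @ Y))"
  unfolding bij_betw_def
proof
  show "inj_on f (skel_marks X Y)"
    by (rule inj_onI) (auto simp: skel_marks_def f_def prod_eq_iff split: if_splits)
  show "f ` skel_marks X Y = dmarks (X @ M @ Y)"
  proof
    show "f ` skel_marks X Y \<subseteq> dmarks (X @ M @ Y)"
      by (auto simp: skel_marks_def f_def dmarks_def nth_append)
    show "dmarks (X @ M @ Y) \<subseteq> f ` skel_marks X Y"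
    proof
      fix u assume "u \<in> dmarks (X @ M @ Y)"
      then obtain j i where u: "u = (j, i)" "j < x + l + length Y" "(X @ M @ Y) ! j = Mark i" by (auto simp: dmarks_def)
      consider "j < x" | "x \<le> j" "j < x + l" | "x + l \<le> j" by linarith
      then show "u \<in> f ` skel_marks X Y"
      proof cases
        case 1
        then have "u \<in> skel_marks X Y" "f u = u" using u by (auto simp: skel_marks_def f_def nth_append)
        then show ?thesis by force
      next
        case 2
        then have jl: "j - x < l" by linarith
        then have "M ! (j - x) = Mark i" "j - x < l" using u 2 by (simp_all add: nth_append)
        then show ?thesis using unM nth_mem[of "j - x" M] by (auto simp: unmarked_def)
      next
        case 3
        then obtain k where k: "j = x + l + k" using le_Suc_ex by blast
        then have "Y ! k = Mark i" "k < length Y" using u by (auto simp: nth_append)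
        then have "(Suc x + k, i) \<in> skel_marks X Y" by (auto simp: skel_marks_def)
        moreover have "f (Suc x + k, i) = u" using k u by (simp add: f_def)
        ultimately show ?thesis by force
      qed
    qed
  qed
qed

lemma card_marks_trace: "card (dmarks (X @ M @ Y) \<inter> C) = card (skel_marks X Y \<inter> tr C)"
proof -
  have "bij_betw f (skel_marks X Y \<inter> tr C) (dmarks (X @ M @ Y) \<inter> C)"
  proof -
    have "f ` (A \<inter> {u. f u \<in> C}) = f ` A \<inter> C" for A by blast
    moreover have "inj_on f (skel_marks X Y \<inter> tr C)"
      using f_marks by (auto simp: bij_betw_def intro: inj_on_subset)
    ultimately show ?thesis using f_marks by (simp add: bij_betw_def tr_def)
  qed
  then show ?thesis by (simp add: bij_betw_same_card)
qed

lemma triv_trace: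
  assumes w: "w \<subseteq> crossings (X @ M @ Y)" and real: "realizes m M (mi w) \<rho> g Z" and Z: "Z = {} \<or> local_circle m M (mi w) Z"
  shows "triv w \<longleftrightarrow> (\<forall>B\<in>skel_circles X n Y \<rho> (lo w) (hi w). even (card (skel_marks X Y \<inter> B)))"
proof -
  have Z': "Z = {} \<or> mv 0 x ` Z \<in> circ w" using Z local_circle_circ[OF w] by blast
  have "triv w \<longleftrightarrow> (\<forall>C\<in>circ w - {mv 0 x ` Z}. even (card (dmarks (X @ M @ Y) \<inter> C)))"
    using marks_mid[of "mi w" Z] Z by (auto simp: triv_def)
  also have "\<dots> \<longleftrightarrow> (\<forall>B\<in>tr ` (circ w - {mv 0 x ` Z}). even (card (skel_marks X Y \<inter> B)))"
    by (simp add: card_marks_trace)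
  finally show ?thesis unfolding trace_circ[OF w real Z'] .
qed

end

section \<open>The complex of a skeleton\<close>

text \<open>A vertex consists of the resolutions of \<open>X\<close> and of \<open>Y\<close> and, in
  between, of a name for a resolution of \<open>M\<close>. The names are shared by both sides of a
  move.\<close>

type_synonym skel_vertex = "nat set \<times> nat set \<times> nat set"

definition skel_cc :: "slice list \<Rightarrow> nat \<Rightarrow> slice list \<Rightarrow> (nat set \<Rightarrow> (node \<times> node) set) \<Rightarrow> skel_vertex \<Rightarrow> node set set" where
  "skel_cc X n Y \<rho> = (\<lambda>(a, e, c). skel_circles X n Y (\<rho> e) a c)"

definition skel_verts :: "slice list \<Rightarrow> nat \<Rightarrow> slice list \<Rightarrow> nat set set \<Rightarrow> (nat set \<Rightarrow> (node \<times> node) set) \<Rightarrow> skel_vertex set" where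
  "skel_verts X n Y EL \<rho> = {(a, e, c). a \<subseteq> crossings X \<and> e \<in> EL \<and> c \<subseteq> crossings Y \<and>
     (\<forall>B\<in>skel_circles X n Y (\<rho> e) a c. even (card (skel_marks X Y \<inter> B)))}"

definition skel_adj :: "slice list \<Rightarrow> slice list \<Rightarrow> (nat set \<Rightarrow> nat set \<Rightarrow> bool) \<Rightarrow> skel_vertex \<Rightarrow> skel_vertex \<Rightarrow> bool" where
  "skel_adj X Y AL = (\<lambda>(a, e, c) (a', e', c'). (\<exists>j\<in>crossings X - a. a' = insert j a \<and> e' = e \<and> c' = c) \<or>
     a' = a \<and> AL e e' \<and> c' = c \<or> (\<exists>j\<in>crossings Y - c. a' = a \<and> e' = e \<and> c' = insert j c))"

text \<open>The parameters describe the local part: the set \<open>EL\<close> of names, the relation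
  \<open>\<rho> e\<close> between end points for every name, and the adjacency \<open>AL\<close> of
  names. No other data on \<open>M\<close> enter.\<close>

definition skel_homology :: "slice list \<Rightarrow> nat \<Rightarrow> slice list \<Rightarrow> nat set set \<Rightarrow> (nat set \<Rightarrow> (node \<times> node) set) \<Rightarrow>
    (nat set \<Rightarrow> nat set \<Rightarrow> bool) \<Rightarrow> (skel_vertex \<times> node set set \<Rightarrow> bit) set monoid" where
  "skel_homology X n Y EL \<rho> AL = homology (image_states (skel_verts X n Y EL \<rho>) (skel_cc X n Y \<rho>))
     (image_coeff (skel_adj X Y AL) (skel_cc X n Y \<rho>))"

definition ladj :: "slice list \<Rightarrow> nat set \<Rightarrow> nat set \<Rightarrow> bool" where
  "ladj M b b' \<longleftrightarrow> (\<exists>k\<in>crossings M - b. b' = insert k b)"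

context split_diagram
begin

abbreviation "cr \<equiv> crossings (X @ M @ Y)"

lemma cr_iff:
  "j \<in> cr \<longleftrightarrow> j < x \<and> j \<in> crossings X \<or> x \<le> j \<and> j < x + l \<and> j - x \<in> crossings M \<or> x + l \<le> j \<and> j - x - l \<in> crossings Y"
proof -
  consider "j < x" | "x \<le> j" "j < x + l" | "x + l \<le> j" by linarith
  then show ?thesis
  proof cases
    case 2
    then have "j - x < l" by linarith
    then show ?thesis using 2 by (auto simp: crossings_def nth_append)
  next
    case 3
    then show ?thesis by (auto simp: crossings_def nth_append)
  qed (auto simp: crossings_def nth_append)
qed

lemma cr_lt: "j \<in> crossings L \<Longrightarrow> j < length L"
  by (simp add: crossings_def)

lemma parts_sub:
  assumes "w \<subseteq> cr"
  shows "lo w \<subseteq> crossings X" "mi w \<subseteq> crossings M" "hi w \<subseteq> crossings Y"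
proof -
  show "lo w \<subseteq> crossings X" using assms cr_iff by (auto simp: lo_def)
  show "mi w \<subseteq> crossings M"
  proof
    fix k assume "k \<in> mi w"
    then have "k < l" "x + k \<in> cr" using assms by (auto simp: mi_def)
    then show "k \<in> crossings M" using cr_iff[of "x + k"] by auto
  qed
  show "hi w \<subseteq> crossings Y"
  proof
    fix k assume "k \<in> hi w"
    then have "x + l + k \<in> cr" using assms by (auto simp: hi_def)
    then show "k \<in> crossings Y" using cr_iff[of "x + l + k"] by auto
  qed
qed

text \<open>The inverse of splitting a vertex into its three parts.\<close>

definition asm :: "nat set \<Rightarrow> nat set \<Rightarrow> nat set \<Rightarrow> nat set" where
  "asm a b c = a \<union> (+) x ` b \<union> (+) (x + l) ` c"

lemma asm_parts:
  assumes "a \<subseteq> crossings X" "b \<subseteq> crossings M" "c \<subseteq> crossings Y"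
  shows "asm a b c \<subseteq> cr" "lo (asm a b c) = a" "mi (asm a b c) = b" "hi (asm a b c) = c"
proof -
  have lt: "j < x" if "j \<in> a" for j using assms(1) that cr_lt by blast
  have lt': "j < l" if "j \<in> b" for j using assms(2) that cr_lt by blast
  show "asm a b c \<subseteq> cr"
  proof
    fix j assume "j \<in> asm a b c"
    then consider "j \<in> a" | k where "k \<in> b" "j = x + k" | k where "k \<in> c" "j = x + l + k" by (auto simp: asm_def)
    then show "j \<in> cr"
    proof cases
      case 1 then show ?thesis using lt assms(1) cr_iff by blast
    next
      case 2 then show ?thesis using lt' assms(2) cr_iff[of j] by auto
    next
      case 3 then show ?thesis using assms(3) cr_iff[of j] by auto
    qed
  qed
  show "lo (asm a b c) = a" using lt by (auto simp: lo_def asm_def)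
  show "mi (asm a b c) = b"
  proof (intro Set.set_eqI iffI)
    fix k assume "k \<in> mi (asm a b c)"
    then have "k < l" "x + k \<in> asm a b c" by (auto simp: mi_def)
    then show "k \<in> b" using lt[of "x + k"] by (auto simp: asm_def)
  next
    fix k assume "k \<in> b"
    then show "k \<in> mi (asm a b c)" using lt' by (auto simp: mi_def asm_def)
  qed
  show "hi (asm a b c) = c"
  proof (intro Set.set_eqI iffI)
    fix k assume "k \<in> hi (asm a b c)"
    then have "x + l + k \<in> asm a b c" by (auto simp: hi_def)
    then show "k \<in> c" using lt[of "x + l + k"] lt'[of "l + k"] by (auto simp: asm_def)
  qed (auto simp: hi_def asm_def)
qed

lemma parts_asm: "asm (lo w) (mi w) (hi w) = w"
proof (intro Set.set_eqI iffI)
  fix j assume j: "j \<in> w"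
  consider "j < x" | "x \<le> j" "j < x + l" | "x + l \<le> j" by linarith
  then show "j \<in> asm (lo w) (mi w) (hi w)"
  proof cases
    case 1 then show ?thesis using j by (auto simp: asm_def lo_def)
  next
    case 2
    then have "j - x \<in> mi w" "j = x + (j - x)" using j by (auto simp: mi_def)
    then show ?thesis unfolding asm_def by blast
  next
    case 3
    then have "j - x - l \<in> hi w" "j = x + l + (j - x - l)" using j by (auto simp: hi_def)
    then show ?thesis unfolding asm_def by blast
  qed
qed (auto simp: asm_def lo_def mi_def hi_def)

lemma parts_eq: "lo w = lo w' \<Longrightarrow> mi w = mi w' \<Longrightarrow> hi w = hi w' \<Longrightarrow> w = w'"
  using parts_asm by metis

lemma parts_insert:
  "j < x \<Longrightarrow> lo (insert j w) = insert j (lo w) \<and> mi (insert j w) = mi w \<and> hi (insert j w) = hi w"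
  "k < l \<Longrightarrow> lo (insert (x + k) w) = lo w \<and> mi (insert (x + k) w) = insert k (mi w) \<and> hi (insert (x + k) w) = hi w"
  "lo (insert (x + l + i) w) = lo w \<and> mi (insert (x + l + i) w) = mi w \<and> hi (insert (x + l + i) w) = insert i (hi w)"
  by (auto simp: lo_def mi_def hi_def)

lemma adj_split:
  "adj w w' \<longleftrightarrow> (\<exists>j\<in>crossings X - lo w. lo w' = insert j (lo w) \<and> mi w' = mi w \<and> hi w' = hi w) \<or>
     lo w' = lo w \<and> ladj M (mi w) (mi w') \<and> hi w' = hi w \<or>
     (\<exists>j\<in>crossings Y - hi w. lo w' = lo w \<and> mi w' = mi w \<and> hi w' = insert j (hi w))" (is "_ \<longleftrightarrow> ?r")
proof
  assume "adj w w'"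
  then obtain j where j: "j \<in> cr" "j \<notin> w" "w' = insert j w" by (auto simp: adj_def)
  from j(1) cr_iff[of j] consider "j < x" "j \<in> crossings X" | "x \<le> j" "j < x + l" "j - x \<in> crossings M"
    | "x + l \<le> j" "j - x - l \<in> crossings Y" by blast
  then show ?r
  proof cases
    case 1
    then show ?thesis using parts_insert(1)[OF 1(1), of w] j by (auto simp: lo_def)
  next
    case 2
    then have "x + (j - x) = j" "j - x < l" by auto
    then have "lo w' = lo w \<and> mi w' = insert (j - x) (mi w) \<and> hi w' = hi w" "j - x \<notin> mi w"
      using parts_insert(2)[of "j - x" w] j by (auto simp: mi_def)
    then show ?thesis using 2 unfolding ladj_def by blast
  next
    case 3
    then have "x + l + (j - x - l) = j" by auto
    then have "lo w' = lo w \<and> mi w' = mi w \<and> hi w' = insert (j - x - l) (hi w)" "j - x - l \<notin> hi w"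
      using parts_insert(3)[of "j - x - l" w] j by (auto simp: hi_def)
    then show ?thesis using 3 by blast
  qed
next
  assume ?r
  then consider j where "j \<in> crossings X - lo w" "lo w' = insert j (lo w) \<and> mi w' = mi w \<and> hi w' = hi w"
    | k where "k \<in> crossings M - mi w" "lo w' = lo w \<and> mi w' = insert k (mi w) \<and> hi w' = hi w"
    | j where "j \<in> crossings Y - hi w" "lo w' = lo w \<and> mi w' = mi w \<and> hi w' = insert j (hi w)"
    unfolding ladj_def by blast
  then show "adj w w'"
  proof cases
    case (1 j)
    then have jx: "j < x" using cr_lt by blast
    then have "w' = insert j w" using 1 parts_insert(1)[OF jx, of w] by - (rule parts_eq, simp_all)
    moreover have "j \<in> cr - w" using 1 jx cr_iff[of j] by (auto simp: lo_def)
    ultimately show ?thesis by (auto simp: adj_def)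
  next
    case (2 k)
    then have kl: "k < l" using cr_lt by blast
    then have "w' = insert (x + k) w" using 2 parts_insert(2)[OF kl, of w] by - (rule parts_eq, simp_all)
    moreover have "x + k \<in> cr - w" using 2 kl cr_iff[of "x + k"] by (auto simp: mi_def)
    ultimately show ?thesis by (auto simp: adj_def)
  next
    case (3 j)
    then have "w' = insert (x + l + j) w" using parts_insert(3)[of j w] by - (rule parts_eq, simp_all)
    moreover have "x + l + j \<in> cr - w" using 3 cr_iff[of "x + l + j"] by (auto simp: hi_def)
    ultimately show ?thesis by (auto simp: adj_def)
  qed
qed

text \<open>In the sequel \<open>VL\<close> is the set of the local vertices that survive the
  cancellation and \<open>\<zeta>\<close> is the map that names them.\<close>

definition nm :: "(nat set \<Rightarrow> nat set) \<Rightarrow> nat set \<Rightarrow> skel_vertex" where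
  "nm \<zeta> w = (lo w, \<zeta> (mi w), hi w)"

lemma nm_inj: "inj_on \<zeta> VL \<Longrightarrow> inj_on (nm \<zeta>) {w. w \<subseteq> cr \<and> mi w \<in> VL \<and> P w}"
proof (rule inj_onI)
  fix w w' assume \<zeta>: "inj_on \<zeta> VL" and w: "w \<in> {w. w \<subseteq> cr \<and> mi w \<in> VL \<and> P w}" "w' \<in> {w. w \<subseteq> cr \<and> mi w \<in> VL \<and> P w}"
    and e: "nm \<zeta> w = nm \<zeta> w'"
  have "mi w = mi w'" using inj_onD[OF \<zeta>, of "mi w" "mi w'"] w e by (simp add: nm_def)
  then show "w = w'" using e by - (rule parts_eq, simp_all add: nm_def)
qed

context
  fixes VL :: "nat set set" and \<zeta> :: "nat set \<Rightarrow> nat set" and \<rho> :: "nat set \<Rightarrow> (node \<times> node) set" and Z :: "node set"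
  assumes VL: "\<And>b. b \<in> VL \<Longrightarrow> b \<subseteq> crossings M" and \<zeta>: "inj_on \<zeta> VL"
    and real: "\<And>b. b \<in> VL \<Longrightarrow> \<exists>g. realizes m M b (\<rho> (\<zeta> b)) g Z"
    and real2: "\<And>b b'. b \<in> VL \<Longrightarrow> b' \<in> VL \<Longrightarrow> ladj M b b' \<Longrightarrow>
       \<exists>g. realizes m M b (\<rho> (\<zeta> b)) g Z \<and> realizes m M b' (\<rho> (\<zeta> b')) g Z"
    and Z: "Z = {} \<or> (\<forall>b\<in>VL. local_circle m M b Z)"
begin

lemma Z_circ: "w \<subseteq> cr \<Longrightarrow> mi w \<in> VL \<Longrightarrow> Z = {} \<or> mv 0 x ` Z \<in> circ w"
  using Z local_circle_circ by blast

lemma skel_cc_nm: "w \<subseteq> cr \<Longrightarrow> mi w \<in> VL \<Longrightarrow> skel_cc X n Y \<rho> (nm \<zeta> w) = tr ` (circ w - {mv 0 x ` Z})"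
proof -
  assume w: "w \<subseteq> cr" "mi w \<in> VL"
  obtain g where "realizes m M (mi w) (\<rho> (\<zeta> (mi w))) g Z" using real[OF w(2)] by blast
  from trace_circ[OF w(1) this Z_circ[OF w]] show ?thesis by (simp add: skel_cc_def nm_def)
qed

lemma skel_verts_nm: "skel_verts X n Y (\<zeta> ` VL) \<rho> = nm \<zeta> ` {w. w \<subseteq> cr \<and> mi w \<in> VL \<and> triv w}"
proof -
  have t: "triv w \<longleftrightarrow> (\<forall>B\<in>skel_circles X n Y (\<rho> (\<zeta> (mi w))) (lo w) (hi w). even (card (skel_marks X Y \<inter> B)))"
    if w: "w \<subseteq> cr" "mi w \<in> VL" for w
  proof -
    obtain g where "realizes m M (mi w) (\<rho> (\<zeta> (mi w))) g Z" using real[OF w(2)] by blast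
    from triv_trace[OF w(1) this] show ?thesis using Z w by blast
  qed
  show ?thesis
  proof
    show "nm \<zeta> ` {w. w \<subseteq> cr \<and> mi w \<in> VL \<and> triv w} \<subseteq> skel_verts X n Y (\<zeta> ` VL) \<rho>"
    proof
      fix s assume "s \<in> nm \<zeta> ` {w. w \<subseteq> cr \<and> mi w \<in> VL \<and> triv w}"
      then obtain w where w: "w \<subseteq> cr" "mi w \<in> VL" "triv w" "s = nm \<zeta> w" by blast
      then show "s \<in> skel_verts X n Y (\<zeta> ` VL) \<rho>" using t[OF w(1,2)] parts_sub[OF w(1)] by (simp add: skel_verts_def nm_def)
    qed
    show "skel_verts X n Y (\<zeta> ` VL) \<rho> \<subseteq> nm \<zeta> ` {w. w \<subseteq> cr \<and> mi w \<in> VL \<and> triv w}"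
    proof
      fix s assume "s \<in> skel_verts X n Y (\<zeta> ` VL) \<rho>"
      then obtain a b c where s: "s = (a, \<zeta> b, c)" "a \<subseteq> crossings X" "b \<in> VL" "c \<subseteq> crossings Y"
        "\<forall>B\<in>skel_circles X n Y (\<rho> (\<zeta> b)) a c. even (card (skel_marks X Y \<inter> B))" by (auto simp: skel_verts_def)
      note p = asm_parts[OF s(2) VL[OF s(3)] s(4)]
      have "s = nm \<zeta> (asm a b c)" using p s(1) by (simp add: nm_def)
      moreover have "triv (asm a b c)" using t[OF p(1)] p s(3,5) by simp
      moreover have "mi (asm a b c) \<in> VL" using p(3) s(3) by simp
      ultimately show "s \<in> nm \<zeta> ` {w. w \<subseteq> cr \<and> mi w \<in> VL \<and> triv w}"
        using p(1) by (intro image_eqI[of _ _ "asm a b c"]) simp_all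
    qed
  qed
qed

lemma trace_inj1: "w \<subseteq> cr \<Longrightarrow> mi w \<in> VL \<Longrightarrow> inj_on tr (circ w - {mv 0 x ` Z})"
proof -
  assume w: "w \<subseteq> cr" "mi w \<in> VL"
  obtain g where "realizes m M (mi w) (\<rho> (\<zeta> (mi w))) g Z" using real[OF w(2)] by blast
  from trace_inj[OF w(1,1) this this Z_circ[OF w] Z_circ[OF w]] show ?thesis by simp
qed

lemma trace_inj2:
  assumes w: "w \<subseteq> cr" "mi w \<in> VL" "w' \<subseteq> cr" "mi w' \<in> VL" and a: "adj w w'"
  shows "inj_on tr ((circ w - {mv 0 x ` Z}) \<union> (circ w' - {mv 0 x ` Z}))"
proof -
  have "\<exists>g. realizes m M (mi w) (\<rho> (\<zeta> (mi w))) g Z \<and> realizes m M (mi w') (\<rho> (\<zeta> (mi w'))) g Z"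
  proof (cases "mi w' = mi w")
    case True then show ?thesis using real[OF w(2)] by simp
  next
    case False
    then have "ladj M (mi w) (mi w')" using a unfolding adj_split by blast
    then show ?thesis by (rule real2[OF w(2,4)])
  qed
  then show ?thesis using trace_inj[OF w(1,3) _ _ Z_circ[OF w(1,2)] Z_circ[OF w(3,4)]] by blast
qed

lemma skel_adj_nm:
  assumes w: "mi w \<in> VL" "mi w' \<in> VL"
  shows "skel_adj X Y AL (nm \<zeta> w) (nm \<zeta> w') \<longleftrightarrow>
     (\<exists>j\<in>crossings X - lo w. lo w' = insert j (lo w) \<and> mi w' = mi w \<and> hi w' = hi w) \<or>
     lo w' = lo w \<and> AL (\<zeta> (mi w)) (\<zeta> (mi w')) \<and> hi w' = hi w \<or>
     (\<exists>j\<in>crossings Y - hi w. lo w' = lo w \<and> mi w' = mi w \<and> hi w' = insert j (hi w))"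
proof -
  have "\<zeta> (mi w') = \<zeta> (mi w) \<longleftrightarrow> mi w' = mi w" using \<zeta> w by (auto dest: inj_onD)
  then show ?thesis by (simp add: skel_adj_def nm_def)
qed

end

lemma Diff_empty_circ: "circ w - {mv 0 x ` {}} = circ w"
  using class_nonempty[OF eqR] by (auto simp: circ_def)

text \<open>All of the local cube survives, as for planar isotopies.\<close>

theorem skel_isotopy:
  assumes \<zeta>: "inj_on \<zeta> (Pow (crossings M))" and real: "\<And>b. b \<subseteq> crossings M \<Longrightarrow> realizes m M b (\<rho> (\<zeta> b)) g {}"
    and AL: "\<And>b b'. b \<subseteq> crossings M \<Longrightarrow> b' \<subseteq> crossings M \<Longrightarrow> AL (\<zeta> b) (\<zeta> b') \<longleftrightarrow> ladj M b b'"
  shows "skel_homology X n Y (\<zeta> ` Pow (crossings M)) \<rho> AL \<cong> Kh (X @ M @ Y)"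
proof -
  let ?VL = "Pow (crossings M)"
  have V: "{w. w \<subseteq> cr \<and> mi w \<in> ?VL \<and> triv w} = {w. w \<subseteq> cr \<and> triv w}" using parts_sub(2) by auto
  have mi: "mi w \<in> ?VL" if "w \<subseteq> cr" for w using parts_sub(2)[OF that] by simp
  have r: "\<exists>g. realizes m M b (\<rho> (\<zeta> b)) g {}" if "b \<in> ?VL" for b using real that by blast
  have r2: "\<exists>g. realizes m M b (\<rho> (\<zeta> b)) g {} \<and> realizes m M b' (\<rho> (\<zeta> b')) g {}" if "b \<in> ?VL" "b' \<in> ?VL" "ladj M b b'" for b b'
    using real that by blast
  have vl: "b \<subseteq> crossings M" if "b \<in> ?VL" for b using that by simp
  have z: "{} = {} \<or> (\<forall>b\<in>?VL. local_circle m M b {})" by simp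
  note F = vl \<zeta> r r2 z
  show ?thesis
    unfolding Kh_homology skel_homology_def
  proof (rule isotopy_iso[where \<zeta> = "nm \<zeta>" and tr = tr])
    show "inj_on (nm \<zeta>) {w. w \<subseteq> cr \<and> triv w}" using nm_inj[OF \<zeta>, of triv] V by simp
    show "inj_on tr (circ w)" if "w \<subseteq> cr" for w
      using trace_inj1[OF F that mi[OF that]] by (simp only: Diff_empty_circ)
    show "inj_on tr (circ w \<union> circ w')" if "w \<subseteq> cr" "w' \<subseteq> cr" "adj w w'" for w w'
      using trace_inj2[OF F that(1) mi[OF that(1)] that(2) mi[OF that(2)] that(3)] by (simp only: Diff_empty_circ)
    show "skel_verts X n Y (\<zeta> ` ?VL) \<rho> = nm \<zeta> ` {w. w \<subseteq> cr \<and> triv w}" using skel_verts_nm[OF F] V by simp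
    show "skel_cc X n Y \<rho> (nm \<zeta> w) = tr ` circ w" if "w \<subseteq> cr" for w
      using skel_cc_nm[OF F that mi[OF that]] by (simp only: Diff_empty_circ)
    show "skel_adj X Y AL (nm \<zeta> w) (nm \<zeta> w') \<longleftrightarrow> adj w w'" if w: "w \<subseteq> cr" "w' \<subseteq> cr" for w w'
      using skel_adj_nm[OF F mi[OF w(1)] mi[OF w(2)], of AL] AL[OF parts_sub(2)[OF w(1)] parts_sub(2)[OF w(2)]]
      unfolding adj_split by (simp only:)
  qed
qed

text \<open>Exactly one of the two strands at the crossing \<open>k\<close> belongs to
  \<open>Z\<close>; so the other resolution joins \<open>Z\<close> to a different circle.\<close>

definition touches :: "nat \<Rightarrow> node set \<Rightarrow> bool" where
  "touches k Z \<longleftrightarrow> ((k, position (M ! k)) \<in> Z) \<noteq> ((Suc k, Suc (position (M ! k))) \<in> Z)"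

lemma touches_lift:
  assumes "touches k Z" "k < l"
  shows "((x + k, position ((X @ M @ Y) ! (x + k))) \<in> mv 0 x ` Z) \<noteq>
    ((Suc (x + k), Suc (position ((X @ M @ Y) ! (x + k)))) \<in> mv 0 x ` Z)"
proof -
  have i: "(x + i, p) \<in> mv 0 x ` Z \<longleftrightarrow> (i, p) \<in> Z" for i p
  proof
    assume "(i, p) \<in> Z"
    moreover have "(x + i, p) = mv 0 x (i, p)" by (simp add: mv_def)
    ultimately show "(x + i, p) \<in> mv 0 x ` Z" by blast
  qed (auto simp: mv_def)
  have "(X @ M @ Y) ! (x + k) = M ! k" using assms(2) by (simp add: nth_append)
  then show ?thesis using assms(1) i[of k] i[of "Suc k"] by (simp add: touches_def)
qed

lemma cr_mid: "k \<in> crossings M \<Longrightarrow> x + k \<in> cr"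
  using cr_iff[of "x + k"] cr_lt[of k M] by simp

lemma mi_mem: "k < l \<Longrightarrow> x + k \<in> w \<longleftrightarrow> k \<in> mi w"
  by (simp add: mi_def)

text \<open>The vertices at which the small circle is present survive.\<close>

theorem skel_R1:
  assumes k: "k \<in> crossings M" and VL: "VL = {b. b \<subseteq> crossings M \<and> (k \<in> b \<longleftrightarrow> s)}"
    and \<zeta>: "inj_on \<zeta> VL" and real: "\<And>b. b \<in> VL \<Longrightarrow> realizes m M b (\<rho> (\<zeta> b)) g Z"
    and Z: "\<And>b. b \<in> VL \<Longrightarrow> local_circle m M b Z" and t: "touches k Z"
    and AL: "\<And>b b'. b \<in> VL \<Longrightarrow> b' \<in> VL \<Longrightarrow> AL (\<zeta> b) (\<zeta> b') \<longleftrightarrow> ladj M b b'"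
  shows "skel_homology X n Y (\<zeta> ` VL) \<rho> AL \<cong> Kh (X @ M @ Y)"
proof -
  have kl: "k < l" using k by (rule cr_lt)
  have mi: "mi w \<in> VL \<longleftrightarrow> (x + k \<in> w \<longleftrightarrow> s)" if "w \<subseteq> cr" for w
    using parts_sub(2)[OF that] mi_mem[OF kl, of w] by (simp add: VL)
  have r: "\<exists>g. realizes m M b (\<rho> (\<zeta> b)) g Z" if "b \<in> VL" for b using real that by blast
  have r2: "\<exists>g. realizes m M b (\<rho> (\<zeta> b)) g Z \<and> realizes m M b' (\<rho> (\<zeta> b')) g Z" if "b \<in> VL" "b' \<in> VL" "ladj M b b'" for b b'
    using real that by blast
  have vl: "b \<subseteq> crossings M" if "b \<in> VL" for b using that by (simp add: VL)
  have z: "Z = {} \<or> (\<forall>b\<in>VL. local_circle m M b Z)" using Z by blast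
  note F = vl \<zeta> r r2 z
  have V: "{w. w \<subseteq> cr \<and> mi w \<in> VL \<and> triv w} = {w. w \<subseteq> cr \<and> (x + k \<in> w \<longleftrightarrow> s) \<and> triv w}" using mi by blast
  have Zc: "mv 0 x ` Z \<in> circ w" if "w \<subseteq> cr" "x + k \<in> w \<longleftrightarrow> s" for w
    using local_circle_circ[OF that(1) Z] mi[OF that(1)] that(2) by blast
  have "{b. b \<in> VL} \<noteq> {}"
  proof -
    have "(if s then {k} else {}) \<in> VL" using k by (simp add: VL)
    then show ?thesis by blast
  qed
  then have KZ: "dmarks (X @ M @ Y) \<inter> mv 0 x ` Z = {}" using marks_mid Z by blast
  have inj0: "inj_on (nm \<zeta>) {w. w \<subseteq> cr \<and> (x + k \<in> w \<longleftrightarrow> s) \<and> triv w}" using nm_inj[OF \<zeta>, of triv] V by simp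
  have inj1: "inj_on tr (circ w - {mv 0 x ` Z})" if "w \<subseteq> cr" "x + k \<in> w \<longleftrightarrow> s" for w
    using trace_inj1[OF F that(1)] mi[OF that(1)] that(2) by blast
  have inj2: "inj_on tr ((circ w - {mv 0 x ` Z}) \<union> (circ w' - {mv 0 x ` Z}))"
    if "w \<subseteq> cr" "x + k \<in> w \<longleftrightarrow> s" "w' \<subseteq> cr" "x + k \<in> w' \<longleftrightarrow> s" "adj w w'" for w w'
    using trace_inj2[OF F that(1) _ that(3) _ that(5)] mi[OF that(1)] mi[OF that(3)] that(2,4) by blast
  have vs: "skel_verts X n Y (\<zeta> ` VL) \<rho> = nm \<zeta> ` {w. w \<subseteq> cr \<and> (x + k \<in> w \<longleftrightarrow> s) \<and> triv w}"
    using skel_verts_nm[OF F] V by simp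
  have cc: "skel_cc X n Y \<rho> (nm \<zeta> w) = tr ` (circ w - {mv 0 x ` Z})" if "w \<subseteq> cr" "x + k \<in> w \<longleftrightarrow> s" for w
    using skel_cc_nm[OF F that(1)] mi[OF that(1)] that(2) by blast
  have ad: "skel_adj X Y AL (nm \<zeta> w) (nm \<zeta> w') \<longleftrightarrow> adj w w'"
    if w: "w \<subseteq> cr" "x + k \<in> w \<longleftrightarrow> s" "w' \<subseteq> cr" "x + k \<in> w' \<longleftrightarrow> s" for w w'
  proof -
    have m: "mi w \<in> VL" "mi w' \<in> VL" using mi w by blast+
    show ?thesis using skel_adj_nm[OF F m, of AL] AL[OF m] unfolding adj_split by (simp only:)
  qed
  show ?thesis
    unfolding Kh_homology skel_homology_def
  proof (cases s)
    case True
    show "homology (image_states (skel_verts X n Y (\<zeta> ` VL) \<rho>) (skel_cc X n Y \<rho>))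
       (image_coeff (skel_adj X Y AL) (skel_cc X n Y \<rho>)) \<cong> homology sts cf"
    proof (rule R1_split_iso[where p = "x + k" and Z = "mv 0 x ` Z" and \<zeta> = "nm \<zeta>" and tr = tr, OF cr_mid[OF k] _ touches_lift[OF t kl] KZ])
      show "inj_on (nm \<zeta>) {w. w \<subseteq> cr \<and> x + k \<in> w \<and> triv w}" using inj0 True by simp
      show "skel_verts X n Y (\<zeta> ` VL) \<rho> = nm \<zeta> ` {w. w \<subseteq> cr \<and> x + k \<in> w \<and> triv w}" using vs True by simp
      fix w assume w: "w \<subseteq> cr" "x + k \<in> w"
      then have w1: "x + k \<in> w \<longleftrightarrow> s" using True by simp
      show "mv 0 x ` Z \<in> circ w" by (rule Zc[OF w(1) w1])
      show "inj_on tr (circ w - {mv 0 x ` Z})" by (rule inj1[OF w(1) w1])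
      show "skel_cc X n Y \<rho> (nm \<zeta> w) = tr ` (circ w - {mv 0 x ` Z})" by (rule cc[OF w(1) w1])
      fix w' assume w': "w' \<subseteq> cr" "x + k \<in> w'"
      then have w1': "x + k \<in> w' \<longleftrightarrow> s" using True by simp
      show "skel_adj X Y AL (nm \<zeta> w) (nm \<zeta> w') \<longleftrightarrow> adj w w'" by (rule ad[OF w(1) w1 w'(1) w1'])
      assume "adj w w'"
      then show "inj_on tr ((circ w - {mv 0 x ` Z}) \<union> (circ w' - {mv 0 x ` Z}))" by (rule inj2[OF w(1) w1 w'(1) w1'])
    qed
  next
    case False
    show "homology (image_states (skel_verts X n Y (\<zeta> ` VL) \<rho>) (skel_cc X n Y \<rho>))
       (image_coeff (skel_adj X Y AL) (skel_cc X n Y \<rho>)) \<cong> homology sts cf"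
    proof (rule R1_merge_iso[where p = "x + k" and Z = "mv 0 x ` Z" and \<zeta> = "nm \<zeta>" and tr = tr, OF cr_mid[OF k] _ touches_lift[OF t kl] KZ])
      show "inj_on (nm \<zeta>) {w. w \<subseteq> cr \<and> x + k \<notin> w \<and> triv w}" using inj0 False by simp
      show "skel_verts X n Y (\<zeta> ` VL) \<rho> = nm \<zeta> ` {w. w \<subseteq> cr \<and> x + k \<notin> w \<and> triv w}" using vs False by simp
      fix w assume w: "w \<subseteq> cr" "x + k \<notin> w"
      then have w1: "x + k \<in> w \<longleftrightarrow> s" using False by simp
      show "mv 0 x ` Z \<in> circ w" by (rule Zc[OF w(1) w1])
      show "inj_on tr (circ w - {mv 0 x ` Z})" by (rule inj1[OF w(1) w1])
      show "skel_cc X n Y \<rho> (nm \<zeta> w) = tr ` (circ w - {mv 0 x ` Z})" by (rule cc[OF w(1) w1])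
      fix w' assume w': "w' \<subseteq> cr" "x + k \<notin> w'"
      then have w1': "x + k \<in> w' \<longleftrightarrow> s" using False by simp
      show "skel_adj X Y AL (nm \<zeta> w) (nm \<zeta> w') \<longleftrightarrow> adj w w'" by (rule ad[OF w(1) w1 w'(1) w1'])
      assume "adj w w'"
      then show "inj_on tr ((circ w - {mv 0 x ` Z}) \<union> (circ w' - {mv 0 x ` Z}))" by (rule inj2[OF w(1) w1 w'(1) w1'])
    qed
  qed
qed

theorem skel_R2:
  assumes pq: "p \<in> crossings M" "q \<in> crossings M" "p \<noteq> q"
    and VL: "VL = {b. b \<subseteq> crossings M \<and> q \<in> b \<and> p \<notin> b}"
    and \<zeta>: "inj_on \<zeta> VL" and real: "\<And>b. b \<in> VL \<Longrightarrow> realizes m M b (\<rho> (\<zeta> b)) g {}"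
    and Z: "\<And>b. b \<subseteq> crossings M - {p, q} \<Longrightarrow> local_circle m M (insert p b) Z" and t: "touches p Z" "touches q Z"
    and AL: "\<And>b b'. b \<in> VL \<Longrightarrow> b' \<in> VL \<Longrightarrow> AL (\<zeta> b) (\<zeta> b') \<longleftrightarrow> ladj M b b'"
  shows "skel_homology X n Y (\<zeta> ` VL) \<rho> AL \<cong> Kh (X @ M @ Y)"
proof -
  have pl: "p < l" "q < l" using pq cr_lt by blast+
  have mi: "mi w \<in> VL \<longleftrightarrow> x + q \<in> w \<and> x + p \<notin> w" if "w \<subseteq> cr" for w
    using parts_sub(2)[OF that] mi_mem[OF pl(1), of w] mi_mem[OF pl(2), of w] by (simp add: VL)
  have r: "\<exists>g. realizes m M b (\<rho> (\<zeta> b)) g {}" if "b \<in> VL" for b using real that by blast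
  have r2: "\<exists>g. realizes m M b (\<rho> (\<zeta> b)) g {} \<and> realizes m M b' (\<rho> (\<zeta> b')) g {}" if "b \<in> VL" "b' \<in> VL" "ladj M b b'" for b b'
    using real that by blast
  have vl: "b \<subseteq> crossings M" if "b \<in> VL" for b using that by (simp add: VL)
  have z: "{} = {} \<or> (\<forall>b\<in>VL. local_circle m M b {})" by simp
  note F = vl \<zeta> r r2 z
  have V: "{w. w \<subseteq> cr \<and> mi w \<in> VL \<and> triv w} = {w. w \<subseteq> cr \<and> x + q \<in> w \<and> x + p \<notin> w \<and> triv w}" using mi by blast
  have Zc: "mv 0 x ` Z \<in> circ (insert (x + p) v)" if v: "v \<subseteq> cr - {x + p, x + q}" for v
  proof (rule local_circle_circ)
    show "insert (x + p) v \<subseteq> cr" using v cr_mid[OF pq(1)] by blast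
    have "mi v \<subseteq> crossings M - {p, q}" using parts_sub(2)[of v] v by (auto simp: mi_def)
    then show "local_circle m M (mi (insert (x + p) v)) Z" using Z parts_insert(2)[OF pl(1), of v] by simp
  qed
  have KZ: "dmarks (X @ M @ Y) \<inter> mv 0 x ` Z = {}" using marks_mid Z[of "{}"] by blast
  show ?thesis
    unfolding Kh_homology skel_homology_def
  proof (rule R2_iso[where p = "x + p" and q = "x + q" and Z = "mv 0 x ` Z" and \<zeta> = "nm \<zeta>" and tr = tr,
        OF cr_mid[OF pq(1)] cr_mid[OF pq(2)] _ Zc touches_lift[OF t(1) pl(1)] touches_lift[OF t(2) pl(2)] KZ])
    show "x + p \<noteq> x + q" using pq by simp
    show "inj_on (nm \<zeta>) {w. w \<subseteq> cr \<and> x + q \<in> w \<and> x + p \<notin> w \<and> triv w}" using nm_inj[OF \<zeta>, of triv] V by simp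
    show "skel_verts X n Y (\<zeta> ` VL) \<rho> = nm \<zeta> ` {w. w \<subseteq> cr \<and> x + q \<in> w \<and> x + p \<notin> w \<and> triv w}"
      using skel_verts_nm[OF F] V by simp
    fix w assume w: "w \<subseteq> cr" "x + q \<in> w" "x + p \<notin> w"
    then have mw: "mi w \<in> VL" using mi by blast
    show "inj_on tr (circ w)" using trace_inj1[OF F w(1) mw] by (simp only: Diff_empty_circ)
    show "skel_cc X n Y \<rho> (nm \<zeta> w) = tr ` circ w" using skel_cc_nm[OF F w(1) mw] by (simp only: Diff_empty_circ)
    fix w' assume w': "w' \<subseteq> cr" "x + q \<in> w'" "x + p \<notin> w'"
    then have mw': "mi w' \<in> VL" using mi by blast
    show "skel_adj X Y AL (nm \<zeta> w) (nm \<zeta> w') \<longleftrightarrow> adj w w'"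
      using skel_adj_nm[OF F mw mw', of AL] AL[OF mw mw'] unfolding adj_split by (simp only:)
    assume "adj w w'"
    then show "inj_on tr (circ w \<union> circ w')"
      using trace_inj2[OF F w(1) mw w'(1) mw'] by (simp only: Diff_empty_circ)
  qed
qed

text \<open>The third premise on retractions concerns the edge from \<open>q\<close> to \<open>p,
  q\<close>, the first step of the zigzags; its target is cancelled, so that its relation is not one
  of the named ones.\<close>

theorem skel_R3:
  assumes pqr: "p \<in> crossings M" "q \<in> crossings M" "r \<in> crossings M" "p \<noteq> q" "p \<noteq> r" "q \<noteq> r"
    and VL: "VL = {b. b \<subseteq> crossings M \<and> (r \<in> b \<or> q \<in> b \<and> p \<notin> b)}"
    and \<zeta>: "inj_on \<zeta> VL" and real: "\<And>b. b \<in> VL \<Longrightarrow> \<exists>g. realizes m M b (\<rho> (\<zeta> b)) g {}"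
    and real2: "\<And>b b'. b \<in> VL \<Longrightarrow> b' \<in> VL \<Longrightarrow> ladj M b b' \<Longrightarrow>
       \<exists>g. realizes m M b (\<rho> (\<zeta> b)) g {} \<and> realizes m M b' (\<rho> (\<zeta> b')) g {}"
    and real3: "\<And>b. b \<subseteq> crossings M - {p, q, r} \<Longrightarrow>
       \<exists>g \<rho>1 \<rho>2. realizes m M (insert q b) \<rho>1 g {} \<and> realizes m M (insert q (insert p b)) \<rho>2 g {}"
    and Z: "\<And>b. b \<subseteq> crossings M - {p, q, r} \<Longrightarrow> local_circle m M (insert p b) Z"
    and t: "touches p Z" "touches q Z" "touches r Z"
    and AL: "\<And>b b'. b \<in> VL \<Longrightarrow> b' \<in> VL \<Longrightarrow> AL (\<zeta> b) (\<zeta> b') \<longleftrightarrow> ladj M b b' \<or>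
       (\<exists>v\<subseteq>crossings M - {p, q, r}. b = insert q v \<and> b' = insert r (insert p v))"
  shows "skel_homology X n Y (\<zeta> ` VL) \<rho> AL \<cong> Kh (X @ M @ Y)"
proof -
  have pl: "p < l" "q < l" "r < l" using pqr cr_lt by blast+
  have mi: "mi w \<in> VL \<longleftrightarrow> x + r \<in> w \<or> x + q \<in> w \<and> x + p \<notin> w" if "w \<subseteq> cr" for w
    using parts_sub(2)[OF that] mi_mem[OF pl(1), of w] mi_mem[OF pl(2), of w] mi_mem[OF pl(3), of w] by (simp add: VL)
  have vl: "b \<subseteq> crossings M" if "b \<in> VL" for b using that by (simp add: VL)
  have z: "{} = {} \<or> (\<forall>b\<in>VL. local_circle m M b {})" by simp
  note F = vl \<zeta> real real2 z
  let ?V = "{w. w \<subseteq> cr \<and> (x + r \<in> w \<or> x + q \<in> w \<and> x + p \<notin> w) \<and> triv w}"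
  have V: "{w. w \<subseteq> cr \<and> mi w \<in> VL \<and> triv w} = ?V" using mi by blast
  have miv: "mi v \<subseteq> crossings M - {p, q, r}" if v: "v \<subseteq> cr - {x + p, x + q, x + r}" for v
    using parts_sub(2)[of v] v by (auto simp: mi_def)
  have Zc: "mv 0 x ` Z \<in> circ (insert (x + p) v)" if v: "v \<subseteq> cr - {x + p, x + q, x + r}" for v
  proof (rule local_circle_circ)
    show "insert (x + p) v \<subseteq> cr" using v cr_mid[OF pqr(1)] by blast
    show "local_circle m M (mi (insert (x + p) v)) Z" using Z[OF miv[OF v]] parts_insert(2)[OF pl(1), of v] by simp
  qed
  have KZ: "dmarks (X @ M @ Y) \<inter> mv 0 x ` Z = {}" using marks_mid Z[of "{}"] by blast
  have Zl: "\<forall>u\<in>Z. 0 < fst u \<and> fst u < l" using Z[of "{}"] by (simp add: local_circle_def)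
  have trZ: "tr (C - mv 0 x ` Z) = tr C" for C using f_notin_mid[OF Zl] by (auto simp: tr_def)
  have zig: "zig (x + p) (x + q) (x + r) w w' \<longleftrightarrow> lo w' = lo w \<and> hi w' = hi w \<and>
      (\<exists>v\<subseteq>crossings M - {p, q, r}. mi w = insert q v \<and> mi w' = insert r (insert p v))"
    if w: "w \<subseteq> cr" "w' \<subseteq> cr" for w w'
  proof
    assume "zig (x + p) (x + q) (x + r) w w'"
    then obtain v where v: "v \<subseteq> cr - {x + p, x + q, x + r}" "w = insert (x + q) v" "w' = insert (x + r) (insert (x + p) v)"
      by (auto simp: zig_def)
    then show "lo w' = lo w \<and> hi w' = hi w \<and>
      (\<exists>v\<subseteq>crossings M - {p, q, r}. mi w = insert q v \<and> mi w' = insert r (insert p v))"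
      using miv[OF v(1)] parts_insert(2)[OF pl(1), of v] parts_insert(2)[OF pl(2), of v]
        parts_insert(2)[OF pl(3), of "insert (x + p) v"] by auto
  next
    assume *: "lo w' = lo w \<and> hi w' = hi w \<and>
      (\<exists>v\<subseteq>crossings M - {p, q, r}. mi w = insert q v \<and> mi w' = insert r (insert p v))"
    then obtain b where b: "b \<subseteq> crossings M - {p, q, r}" "mi w = insert q b" "mi w' = insert r (insert p b)" by blast
    let ?v = "asm (lo w) b (hi w)"
    have bM: "b \<subseteq> crossings M" using b by blast
    note pa = asm_parts[OF parts_sub(1)[OF w(1)] bM parts_sub(3)[OF w(1)]]
    have "?v \<subseteq> cr - {x + p, x + q, x + r}"
      using pa(1) pa(3) mi_mem[OF pl(1), of ?v] mi_mem[OF pl(2), of ?v] mi_mem[OF pl(3), of ?v] b(1) by blast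
    moreover have "w = insert (x + q) ?v"
      by (rule parts_eq) (use parts_insert(2)[OF pl(2), of ?v] pa b in simp_all)
    moreover have "w' = insert (x + r) (insert (x + p) ?v)"
      by (rule parts_eq) (use parts_insert(2)[OF pl(1), of ?v] parts_insert(2)[OF pl(3), of "insert (x + p) ?v"] pa b * in simp_all)
    ultimately show "zig (x + p) (x + q) (x + r) w w'" unfolding zig_def by blast
  qed
  show ?thesis
    unfolding Kh_homology skel_homology_def
  proof (rule R3_iso[where p = "x + p" and q = "x + q" and m = "x + r" and Z = "mv 0 x ` Z" and \<zeta> = "nm \<zeta>" and tr = tr,
        OF cr_mid[OF pqr(1)] cr_mid[OF pqr(2)] cr_mid[OF pqr(3)] _ _ _ Zc
        touches_lift[OF t(1) pl(1)] touches_lift[OF t(2) pl(2)] touches_lift[OF t(3) pl(3)] KZ])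
    show "x + p \<noteq> x + q" "x + p \<noteq> x + r" "x + q \<noteq> x + r" using pqr by simp_all
    show "inj_on (nm \<zeta>) ?V" using nm_inj[OF \<zeta>, of triv] V by simp
    show "skel_verts X n Y (\<zeta> ` VL) \<rho> = nm \<zeta> ` ?V" using skel_verts_nm[OF F] V by simp
    show "tr (C - mv 0 x ` Z) = tr C" for C by (rule trZ)
    show "inj_on tr (circ (insert (x + q) v) \<union> circ (insert (x + q) (insert (x + p) v)))"
      if v: "v \<subseteq> cr - {x + p, x + q, x + r}" for v
    proof -
      obtain g \<rho>1 \<rho>2 where g: "realizes m M (insert q (mi v)) \<rho>1 g {}" "realizes m M (insert q (insert p (mi v))) \<rho>2 g {}"
        using real3[OF miv[OF v]] by blast
      have e: "mi (insert (x + q) v) = insert q (mi v)" "mi (insert (x + q) (insert (x + p) v)) = insert q (insert p (mi v))"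
        using parts_insert(2)[OF pl(2), of v] parts_insert(2)[OF pl(2), of "insert (x + p) v"] parts_insert(2)[OF pl(1), of v] by simp_all
      have s: "insert (x + q) v \<subseteq> cr" "insert (x + q) (insert (x + p) v) \<subseteq> cr" using v cr_mid pqr by blast+
      have "inj_on tr ((circ (insert (x + q) v) - {mv 0 x ` {}}) \<union> (circ (insert (x + q) (insert (x + p) v)) - {mv 0 x ` {}}))"
        by (rule trace_inj[OF s g[folded e]]) simp_all
      then show ?thesis by (simp only: Diff_empty_circ)
    qed
    fix w assume "w \<in> ?V"
    then have w: "w \<subseteq> cr" "mi w \<in> VL" using mi by blast+
    show "inj_on tr (circ w)" using trace_inj1[OF F w] by (simp only: Diff_empty_circ)
    show "skel_cc X n Y \<rho> (nm \<zeta> w) = tr ` circ w" using skel_cc_nm[OF F w] by (simp only: Diff_empty_circ)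
    fix w' assume "w' \<in> ?V"
    then have w': "w' \<subseteq> cr" "mi w' \<in> VL" using mi by blast+
    show "skel_adj X Y AL (nm \<zeta> w) (nm \<zeta> w') \<longleftrightarrow> adj w w' \<or> zig (x + p) (x + q) (x + r) w w'"
      using skel_adj_nm[OF F w(2) w'(2), of AL] AL[OF w(2) w'(2)] unfolding adj_split zig[OF w(1) w'(1)] by blast
    assume "adj w w'"
    then show "inj_on tr (circ w \<union> circ w')" using trace_inj2[OF F w w'] by (simp only: Diff_empty_circ)
  qed
qed

end

section \<open>Local models\<close>

text \<open>The connections made by a resolution are computed through functions that are constant
  along its arcs: two nodes are connected iff every such function takes the same value on them. This
  turns statements on generated equivalence relations into equational reasoning, which the
  simplifier can do.\<close>

definition const_on :: "(node \<times> node) set \<Rightarrow> (node \<Rightarrow> 'b) \<Rightarrow> bool" where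
  "const_on A \<phi> \<longleftrightarrow> (\<forall>u u'. (u, u') \<in> A \<longrightarrow> \<phi> u = \<phi> u')"

text \<open>For the converse direction take the function that maps a node to its class; this is why
  functions with values in sets of nodes suffice.\<close>

lemma gen_rel_const_on: "(u, u') \<in> gen_rel A \<longleftrightarrow> (\<forall>\<phi> :: node \<Rightarrow> node set. const_on A \<phi> \<longrightarrow> \<phi> u = \<phi> u')"
proof
  assume r: "(u, u') \<in> gen_rel A"
  have e: "equiv UNIV {(u, u'). \<phi> u = \<phi> u'}" for \<phi> :: "node \<Rightarrow> node set"
    by (rule equivUI) auto
  show "\<forall>\<phi> :: node \<Rightarrow> node set. const_on A \<phi> \<longrightarrow> \<phi> u = \<phi> u'"
  proof (intro allI impI)
    fix \<phi> :: "node \<Rightarrow> node set" assume c: "const_on A \<phi>"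
    have "gen_rel A \<subseteq> {(u, u'). \<phi> u = \<phi> u'}"
      by (rule gen_rel_subset[OF e]) (use c in \<open>auto simp: const_on_def\<close>)
    then show "\<phi> u = \<phi> u'" using r by blast
  qed
next
  assume *: "\<forall>\<phi> :: node \<Rightarrow> node set. const_on A \<phi> \<longrightarrow> \<phi> u = \<phi> u'"
  have "const_on A (\<lambda>u. gen_rel A `` {u})"
  proof -
    have "gen_rel A `` {u} = gen_rel A `` {u'}" if "(u, u') \<in> A" for u u'
      using gen_rel_base[OF that] class_eq_iff[OF equiv_gen_rel, of A u u'] by (rule iffD2[rotated])
    then show ?thesis unfolding const_on_def by blast
  qed
  then have "gen_rel A `` {u} = gen_rel A `` {u'}"
    using *[rule_format, of "\<lambda>u. gen_rel A `` {u}"] by simp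
  then show "(u, u') \<in> gen_rel A" using class_eq_iff[OF equiv_gen_rel, of A u u'] by simp
qed

lemma const_on_Un [simp]: "const_on (A \<union> B) \<phi> \<longleftrightarrow> const_on A \<phi> \<and> const_on B \<phi>"
  by (auto simp: const_on_def)

lemma const_on_empty [simp]: "const_on {} \<phi>"
  by (simp add: const_on_def)

lemma const_on_Collect: "const_on {(f p, g p) | p. P p} \<phi> \<longleftrightarrow> (\<forall>p. P p \<longrightarrow> \<phi> (f p) = \<phi> (g p))"
  unfolding const_on_def by blast

lemma const_on_insert [simp]: "const_on (insert (u, u') A) \<phi> \<longleftrightarrow> \<phi> u = \<phi> u' \<and> const_on A \<phi>"
  unfolding const_on_def by blast


text \<open>The condition that the core of a slice imposes on a function, in terms of its values
  \<open>A\<close> below and \<open>B\<close> above, counted from the position of the slice.\<close>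

fun core_ok :: "slice \<Rightarrow> bool \<Rightarrow> (nat \<Rightarrow> 'b) \<Rightarrow> (nat \<Rightarrow> 'b) \<Rightarrow> bool" where
  "core_ok (Cup i) r A B \<longleftrightarrow> B 0 = B 1"
| "core_ok (Cap i) r A B \<longleftrightarrow> A 0 = A 1"
| "core_ok (Mark i) r A B \<longleftrightarrow> A 0 = B 0"
| "core_ok (Cross i b) r A B \<longleftrightarrow> (if r = b then A 0 = A 1 \<and> B 0 = B 1 else A 0 = B 0 \<and> A 1 = B 1)"

lemma core_ok_cong: "(\<And>q. q < ins g \<Longrightarrow> A q = A' q) \<Longrightarrow> (\<And>q. q < outs g \<Longrightarrow> B q = B' q) \<Longrightarrow>
    core_ok g r A B \<longleftrightarrow> core_ok g r A' B'"
  by (cases g) auto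

lemma const_on_core: "const_on (core_arcs g r j) \<phi> \<longleftrightarrow>
    core_ok g r (\<lambda>q. \<phi> (j, position g + q)) (\<lambda>q. \<phi> (Suc j, position g + q))"
  by (cases g) auto

lemma const_on_sarc: "const_on (sarc g r (position g + ins g + t) j) \<phi> \<longleftrightarrow>
    (\<forall>p<position g. \<phi> (j, p) = \<phi> (Suc j, p)) \<and>
    core_ok g r (\<lambda>q. \<phi> (j, position g + q)) (\<lambda>q. \<phi> (Suc j, position g + q)) \<and>
    (\<forall>q<t. \<phi> (j, position g + ins g + q) = \<phi> (Suc j, position g + outs g + q))"
proof -
  have "(\<forall>p. position g + ins g \<le> p \<and> p < position g + ins g + t \<longrightarrow> \<phi> (j, p) = \<phi> (Suc j, p - ins g + outs g)) \<longleftrightarrow>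
    (\<forall>q<t. \<phi> (j, position g + ins g + q) = \<phi> (Suc j, position g + outs g + q))" (is "?l \<longleftrightarrow> ?r")
  proof
    assume l: ?l
    show ?r
    proof (intro allI impI)
      fix q assume "q < t"
      then have "\<phi> (j, position g + ins g + q) = \<phi> (Suc j, position g + ins g + q - ins g + outs g)"
        using l by (metis add.assoc le_add1 nat_add_left_cancel_less)
      moreover have "position g + ins g + q - ins g + outs g = position g + outs g + q" by simp
      ultimately show "\<phi> (j, position g + ins g + q) = \<phi> (Suc j, position g + outs g + q)" by (simp only:)
    qed
  next
    assume r: ?r
    show ?l
    proof (intro allI impI)
      fix p assume p: "position g + ins g \<le> p \<and> p < position g + ins g + t"
      define q where "q = p - position g - ins g"
      have q: "p = position g + ins g + q" "q < t" using p by (auto simp: q_def)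
      show "\<phi> (j, p) = \<phi> (Suc j, p - ins g + outs g)" using r q(2) by (simp add: q(1) ac_simps)
    qed
  qed
  then show ?thesis
    by (simp only: sarc_def through_arcs_def const_on_Un const_on_Collect const_on_core conj_assoc)
       (simp only: conj_ac)
qed

lemma all_less_add: "(\<forall>q<x + y. P q) \<longleftrightarrow> (\<forall>q<x. P q) \<and> (\<forall>q<y::nat. P (x + q))"
proof -
  have "P q" if "\<forall>q<x. P q" "\<forall>q<y. P (x + q)" "q < x + y" for q
  proof (cases "q < x")
    case False
    then show ?thesis using that(2)[rule_format, of "q - x"] that(3) by simp
  qed (use that in simp)
  then show ?thesis by auto
qed

lemma all_less_1: "(\<forall>q<Suc (i + t). P q) \<longleftrightarrow> (\<forall>q<i. P q) \<and> P i \<and> (\<forall>q<t. P (Suc (i + q)))"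
  using all_less_add[of "Suc i" t P] by (simp add: less_Suc_eq) blast

lemma all_less_2: "(\<forall>q<Suc (Suc (i + t)). P q) \<longleftrightarrow>
    (\<forall>q<i. P q) \<and> P i \<and> P (Suc i) \<and> (\<forall>q<t. P (Suc (Suc (i + q))))"
  using all_less_1[of "Suc i" t P] by (simp add: less_Suc_eq) blast

lemma all_less_3: "(\<forall>q<Suc (Suc (Suc (i + t))). P q) \<longleftrightarrow>
    (\<forall>q<i. P q) \<and> P i \<and> P (Suc i) \<and> P (Suc (Suc i)) \<and> (\<forall>q<t. P (Suc (Suc (Suc (i + q)))))"
  using all_less_2[of "Suc i" t P] by (simp add: less_Suc_eq) blast

lemma all_less_Suc_shift: "(\<forall>q<Suc t. P q) \<longleftrightarrow> P 0 \<and> (\<forall>q<t. P (Suc q))"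
  using all_less_1[of 0 t P] by simp

lemma all_less_Suc_last: "(\<forall>q<Suc t. P q) \<longleftrightarrow> (\<forall>q<t. P q) \<and> P t"
  by (auto simp: less_Suc_eq)

text \<open>All moves act in a window of at most three strands, starting at position
  \<open>i\<close>. Writing the width as \<open>i\<close> plus the window plus \<open>t\<close> and
  splitting the through strands accordingly makes the conditions on both sides of a move
  syntactically comparable.\<close>

lemma window_simps:
  "const_on (sarc (Cross i b) r (Suc (Suc (i + t))) j) \<phi> \<longleftrightarrow> (\<forall>p<i. \<phi> (j, p) = \<phi> (Suc j, p)) \<and>
    (if r = b then \<phi> (j, i) = \<phi> (j, Suc i) \<and> \<phi> (Suc j, i) = \<phi> (Suc j, Suc i)
     else \<phi> (j, i) = \<phi> (Suc j, i) \<and> \<phi> (j, Suc i) = \<phi> (Suc j, Suc i)) \<and>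
    (\<forall>q<t. \<phi> (j, Suc (Suc (i + q))) = \<phi> (Suc j, Suc (Suc (i + q))))"
  "const_on (sarc (Cap i) r (Suc (Suc (i + t))) j) \<phi> \<longleftrightarrow> (\<forall>p<i. \<phi> (j, p) = \<phi> (Suc j, p)) \<and>
    \<phi> (j, i) = \<phi> (j, Suc i) \<and> (\<forall>q<t. \<phi> (j, Suc (Suc (i + q))) = \<phi> (Suc j, i + q))"
  "const_on (sarc (Cup i) r (i + t) j) \<phi> \<longleftrightarrow> (\<forall>p<i. \<phi> (j, p) = \<phi> (Suc j, p)) \<and>
    \<phi> (Suc j, i) = \<phi> (Suc j, Suc i) \<and> (\<forall>q<t. \<phi> (j, i + q) = \<phi> (Suc j, Suc (Suc (i + q))))"
  using const_on_sarc[of "Cross i b" r t j \<phi>] const_on_sarc[of "Cap i" r t j \<phi>]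
    const_on_sarc[of "Cup i" r t j \<phi>] by simp_all

text \<open>The same conditions for a slice inside a window of three strands, respectively one
  strand on the narrow side of a cup or cap.\<close>

lemma window_simps3:
  "const_on (sarc (Cross i b) r (Suc (Suc (Suc (i + t)))) j) \<phi> \<longleftrightarrow> (\<forall>p<i. \<phi> (j, p) = \<phi> (Suc j, p)) \<and>
    (if r = b then \<phi> (j, i) = \<phi> (j, Suc i) \<and> \<phi> (Suc j, i) = \<phi> (Suc j, Suc i)
     else \<phi> (j, i) = \<phi> (Suc j, i) \<and> \<phi> (j, Suc i) = \<phi> (Suc j, Suc i)) \<and>
    \<phi> (j, Suc (Suc i)) = \<phi> (Suc j, Suc (Suc i)) \<and>
    (\<forall>q<t. \<phi> (j, Suc (Suc (Suc (i + q)))) = \<phi> (Suc j, Suc (Suc (Suc (i + q)))))"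
  "const_on (sarc (Cross (Suc i) b) r (Suc (Suc (Suc (i + t)))) j) \<phi> \<longleftrightarrow> (\<forall>p<i. \<phi> (j, p) = \<phi> (Suc j, p)) \<and>
    \<phi> (j, i) = \<phi> (Suc j, i) \<and>
    (if r = b then \<phi> (j, Suc i) = \<phi> (j, Suc (Suc i)) \<and> \<phi> (Suc j, Suc i) = \<phi> (Suc j, Suc (Suc i))
     else \<phi> (j, Suc i) = \<phi> (Suc j, Suc i) \<and> \<phi> (j, Suc (Suc i)) = \<phi> (Suc j, Suc (Suc i))) \<and>
    (\<forall>q<t. \<phi> (j, Suc (Suc (Suc (i + q)))) = \<phi> (Suc j, Suc (Suc (Suc (i + q)))))"
  "const_on (sarc (Cap i) r (Suc (Suc (Suc (i + t)))) j) \<phi> \<longleftrightarrow> (\<forall>p<i. \<phi> (j, p) = \<phi> (Suc j, p)) \<and>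
    \<phi> (j, i) = \<phi> (j, Suc i) \<and> \<phi> (j, Suc (Suc i)) = \<phi> (Suc j, i) \<and>
    (\<forall>q<t. \<phi> (j, Suc (Suc (Suc (i + q)))) = \<phi> (Suc j, Suc (i + q)))"
  "const_on (sarc (Cap (Suc i)) r (Suc (Suc (Suc (i + t)))) j) \<phi> \<longleftrightarrow> (\<forall>p<i. \<phi> (j, p) = \<phi> (Suc j, p)) \<and>
    \<phi> (j, i) = \<phi> (Suc j, i) \<and> \<phi> (j, Suc i) = \<phi> (j, Suc (Suc i)) \<and>
    (\<forall>q<t. \<phi> (j, Suc (Suc (Suc (i + q)))) = \<phi> (Suc j, Suc (i + q)))"
  "const_on (sarc (Cup i) r (Suc (i + t)) j) \<phi> \<longleftrightarrow> (\<forall>p<i. \<phi> (j, p) = \<phi> (Suc j, p)) \<and>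
    \<phi> (Suc j, i) = \<phi> (Suc j, Suc i) \<and> \<phi> (j, i) = \<phi> (Suc j, Suc (Suc i)) \<and>
    (\<forall>q<t. \<phi> (j, Suc (i + q)) = \<phi> (Suc j, Suc (Suc (Suc (i + q)))))"
  "const_on (sarc (Cup (Suc i)) r (Suc (i + t)) j) \<phi> \<longleftrightarrow> (\<forall>p<i. \<phi> (j, p) = \<phi> (Suc j, p)) \<and>
    \<phi> (j, i) = \<phi> (Suc j, i) \<and> \<phi> (Suc j, Suc i) = \<phi> (Suc j, Suc (Suc i)) \<and>
    (\<forall>q<t. \<phi> (j, Suc (i + q)) = \<phi> (Suc j, Suc (Suc (Suc (i + q)))))"
  by (simp_all only: window_simps(1)[of i b r "Suc t" j, unfolded add_Suc_right] window_simps(1)[of "Suc i" b r t j, unfolded add_Suc]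
      window_simps(2)[of i r "Suc t" j, unfolded add_Suc_right] window_simps(2)[of "Suc i" r t j, unfolded add_Suc]
      window_simps(3)[of i r "Suc t" j, unfolded add_Suc_right] window_simps(3)[of "Suc i" r t j, unfolded add_Suc]
      all_less_Suc_shift[of t] all_less_Suc_last[of i] add_Suc_right add_Suc add_0_right conj_assoc)

definition id_rel :: "nat \<Rightarrow> (node \<times> node) set" where
  "id_rel m = {((0, p), (1, p)) | p. p < m}"

lemma const_on_id_rel: "const_on (id_rel m) \<phi> \<longleftrightarrow> (\<forall>p<m. \<phi> (0, p) = \<phi> (Suc 0, p))"
  by (auto simp: const_on_def id_rel_def)

text \<open>Relations between end points live on the levels 0 and 1.\<close>

definition low_rel :: "(node \<times> node) set \<Rightarrow> bool" where
  "low_rel \<rho> \<longleftrightarrow> (\<forall>(u, u') \<in> \<rho>. fst u \<le> 1 \<and> fst u' \<le> 1)"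

lemma low_sarc: "low_rel (sarc g r m 0)"
  using sarc_levels[of _ _ g r m 0] by (fastforce simp: low_rel_def)

lemma low_id_rel: "low_rel (id_rel m)"
  by (auto simp: low_rel_def id_rel_def)

text \<open>A retraction that is given on the inner nodes \<open>(j, p)\<close> by \<open>h j
  p\<close>.\<close>

definition retr :: "nat \<Rightarrow> (nat \<Rightarrow> nat \<Rightarrow> node) \<Rightarrow> node \<Rightarrow> node" where
  "retr l h u = (if fst u = 0 then u else if fst u = l then (1, snd u) else h (fst u) (snd u))"

lemma retr_simps [simp]: "retr l h (0, p) = (0, p)" "0 < l \<Longrightarrow> retr l h (l, p) = (1, p)"
    "0 < j \<Longrightarrow> j \<noteq> l \<Longrightarrow> retr l h (j, p) = h j p"
  by (auto simp: retr_def)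

lemma ends_simps [simp]: "ends l (0, p) = (0, p)" "ends l (Suc j, p) = (l, p)"
  by (auto simp: ends_def)

lemma realizesI:
  assumes M: "length M = l" "0 < l" and low: "low_rel \<rho>"
    and 1: "\<And>\<phi> :: node \<Rightarrow> node set. const_on (tarcs 0 m M b) \<phi> \<Longrightarrow> const_on \<rho> (\<lambda>u. \<phi> (ends l u))"
    and 2: "\<And>\<phi> :: node \<Rightarrow> node set. const_on \<rho> \<phi> \<Longrightarrow> const_on (tarcs 0 m M b) (\<lambda>u. \<phi> (retr l h u))"
    and 3: "\<And>\<phi> :: node \<Rightarrow> node set. \<And>j p. const_on (tarcs 0 m M b) \<phi> \<Longrightarrow> 0 < j \<Longrightarrow> j < l \<Longrightarrow>
        p < wd m (take j M) \<Longrightarrow> (j, p) \<notin> Z \<Longrightarrow> \<phi> (ends l (h j p)) = \<phi> (j, p)"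
    and 4: "\<And>j p. fst (h j p) \<le> 1" and Z: "\<And>u. u \<in> Z \<Longrightarrow> 0 < fst u \<and> fst u < l"
  shows "realizes m M b \<rho> (retr l h) Z"
  unfolding realizes_def gen_rel_const_on M(1)
proof (intro conjI)
  show "\<forall>(u, u')\<in>\<rho>. fst u \<le> 1 \<and> fst u' \<le> 1 \<and> (\<forall>\<phi> :: node \<Rightarrow> node set. const_on (tarcs 0 m M b) \<phi> \<longrightarrow> \<phi> (ends l u) = \<phi> (ends l u'))"
    using low 1 by (fastforce simp: low_rel_def const_on_def[of \<rho>])
  show "\<forall>(u, u')\<in>tarcs 0 m M b. \<forall>\<phi> :: node \<Rightarrow> node set. const_on \<rho> \<phi> \<longrightarrow> \<phi> (retr l h u) = \<phi> (retr l h u')"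
    using 2 by (fastforce simp: const_on_def[of "tarcs 0 m M b"])
qed (use 3 4 Z M in \<open>auto\<close>)

lemma realizesI2:
  assumes "length M = 2" "low_rel \<rho>" "\<And>p. fst (h p) \<le> 1" "\<And>u. u \<in> Z \<Longrightarrow> fst u = 1"
    and 1: "\<And>\<phi> :: node \<Rightarrow> node set. const_on (tarcs 0 m M b) \<phi> \<Longrightarrow> const_on \<rho> (\<lambda>u. \<phi> (ends 2 u)) \<and>
        (\<forall>p<wd m (take 1 M). (1, p) \<notin> Z \<longrightarrow> \<phi> (ends 2 (h p)) = \<phi> (1, p))"
    and 2: "\<And>\<phi> :: node \<Rightarrow> node set. const_on \<rho> \<phi> \<Longrightarrow> const_on (tarcs 0 m M b) (\<lambda>u. \<phi> (retr 2 (\<lambda>j. h) u))"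
  shows "realizes m M b \<rho> (retr 2 (\<lambda>j. h)) Z"
proof (rule realizesI)
  fix \<phi> :: "node \<Rightarrow> node set" and j p :: nat
  assume a: "const_on (tarcs 0 m M b) \<phi>" "0 < j" "j < 2" "p < wd m (take j M)" "(j, p) \<notin> Z"
  then have "j = 1" by simp
  then show "\<phi> (ends 2 (h p)) = \<phi> (j, p)" using conjunct2[OF 1[OF a(1)], rule_format, of p] a(4,5) by metis
qed (use assms in auto)

lemma realizesI3:
  assumes "length M = 3" "low_rel \<rho>" "\<And>j p. fst (h j p) \<le> 1"
    and 1: "\<And>\<phi> :: node \<Rightarrow> node set. const_on (tarcs 0 m M b) \<phi> \<Longrightarrow> const_on \<rho> (\<lambda>u. \<phi> (ends 3 u)) \<and>
        (\<forall>p<wd m (take 1 M). \<phi> (ends 3 (h 1 p)) = \<phi> (1, p)) \<and>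
        (\<forall>p<wd m (take 2 M). \<phi> (ends 3 (h 2 p)) = \<phi> (2, p))"
    and 2: "\<And>\<phi> :: node \<Rightarrow> node set. const_on \<rho> \<phi> \<Longrightarrow> const_on (tarcs 0 m M b) (\<lambda>u. \<phi> (retr 3 h u))"
  shows "realizes m M b \<rho> (retr 3 h) {}"
proof (rule realizesI)
  fix \<phi> :: "node \<Rightarrow> node set" and j p :: nat
  assume a: "const_on (tarcs 0 m M b) \<phi>" "0 < j" "j < 3" "p < wd m (take j M)"
  then have "j = 1 \<or> j = 2" by auto
  then show "\<phi> (ends 3 (h j p)) = \<phi> (j, p)" using 1[OF a(1)] a(4) by auto
qed (use assms in auto)

lemma realizes_single: "realizes m [g] b (sarc g (0 \<in> b) m 0) (\<lambda>u. u) {}"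
proof -
  have "ends (Suc 0) u = u" if "fst u \<le> 1" for u using that by (auto simp: ends_def prod_eq_iff)
  moreover have "fst u \<le> 1" "fst u' \<le> 1" if "(u, u') \<in> sarc g (0 \<in> b) m 0" for u u'
    using sarc_levels[OF that] by auto
  ultimately show ?thesis unfolding realizes_def by (auto intro!: gen_rel_base)
qed

lemma realizes_Nil: "realizes m [] b (id_rel m) (\<lambda>u. u) {}"
  unfolding realizes_def id_rel_def using equivUD(1)[OF equiv_gen_rel] by auto

lemma crossings_Nil [simp]: "crossings [] = {}"
  by (simp add: crossings_def)

lemma crossings_Cons: "crossings (g # D) = (if \<exists>i b. g = Cross i b then {0} else {}) \<union> Suc ` crossings D"
proof (intro Set.set_eqI)
  fix j show "j \<in> crossings (g # D) \<longleftrightarrow> j \<in> (if \<exists>i b. g = Cross i b then {0} else {}) \<union> Suc ` crossings D"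
    by (cases j) (auto simp: crossings_def image_iff)
qed


lemma id_window:
  "const_on (id_rel (Suc (i + t))) \<phi> \<longleftrightarrow> (\<forall>p<i. \<phi> (0, p) = \<phi> (Suc 0, p)) \<and> \<phi> (0, i) = \<phi> (Suc 0, i) \<and>
    (\<forall>q<t. \<phi> (0, Suc (i + q)) = \<phi> (Suc 0, Suc (i + q)))"
  "const_on (id_rel (Suc (Suc (i + t)))) \<phi> \<longleftrightarrow> (\<forall>p<i. \<phi> (0, p) = \<phi> (Suc 0, p)) \<and> \<phi> (0, i) = \<phi> (Suc 0, i) \<and>
    \<phi> (0, Suc i) = \<phi> (Suc 0, Suc i) \<and> (\<forall>q<t. \<phi> (0, Suc (Suc (i + q))) = \<phi> (Suc 0, Suc (Suc (i + q))))"
  "const_on (id_rel (Suc (Suc (Suc (i + t))))) \<phi> \<longleftrightarrow> (\<forall>p<i. \<phi> (0, p) = \<phi> (Suc 0, p)) \<and> \<phi> (0, i) = \<phi> (Suc 0, i) \<and>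
    \<phi> (0, Suc i) = \<phi> (Suc 0, Suc i) \<and> \<phi> (0, Suc (Suc i)) = \<phi> (Suc 0, Suc (Suc i)) \<and>
    (\<forall>q<t. \<phi> (0, Suc (Suc (Suc (i + q)))) = \<phi> (Suc 0, Suc (Suc (Suc (i + q)))))"
  by (simp_all add: const_on_id_rel all_less_1 all_less_2 all_less_3)

lemmas model_simps = window_simps window_simps3 id_window all_less_1 all_less_2 all_less_3 low_sarc low_id_rel
  eval_nat_numeral retr_def ends_def

section \<open>Local models of the moves in a window\<close>

text \<open>The models below specify, for each side of a move, the relation that its resolutions
  realise and a retraction of the inner nodes. The relations agree on both sides. An inner node is
  sent to an end that its strand has in all resolutions in which the retraction is used.\<close>

lemma zigzag_left_realizes:
  "realizes (Suc (i + t)) [Cup i, Cap (Suc i)] b (id_rel (Suc (i + t)))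
     (retr 2 (\<lambda>j p. if p < i then (1, p) else if p < Suc (Suc i) then (1, i) else (0, p - 2))) {}"
  by (rule realizesI2; (simp add: model_simps)?; (elim conjE)?; (simp add: model_simps)?; (fastforce | metis)?)

lemma zigzag_right_realizes:
  "realizes (Suc (i + t)) [Cup (Suc i), Cap i] b (id_rel (Suc (i + t)))
     (retr 2 (\<lambda>j p. if p < i then (0, p) else if p < Suc (Suc (Suc i)) then (0, i) else (0, p - 2))) {}"
  by (rule realizesI2; (simp add: model_simps)?; (elim conjE)?; (simp add: model_simps)?; (fastforce | metis)?)

text \<open>One resolution of the crossing leaves the minimum in place and the other one moves it to
  the neighbouring position. On the other side of the move the roles of the resolutions are
  exchanged, which the opposite sign of the crossing makes up for.\<close>

lemma slide_cup_left_realizes: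
  "realizes (Suc (i + t)) [Cup i, Cross (Suc i) c] b (sarc (Cup (if (1 \<in> b) = c then Suc i else i)) True (Suc (i + t)) 0)
     (retr 2 (\<lambda>j p. if p < i then (1, p) else if p < Suc (Suc i) then (1, i) else if p = Suc (Suc i) then (0, i) else (0, p - 2))) {}"
  by (cases "(1 \<in> b) = c"; rule realizesI2; (simp add: model_simps)?; (elim conjE)?; (simp add: model_simps)?; metis?)

lemma slide_cup_right_realizes:
  "realizes (Suc (i + t)) [Cup (Suc i), Cross i (\<not> c)] b (sarc (Cup (if (1 \<in> b) = c then Suc i else i)) True (Suc (i + t)) 0)
     (retr 2 (\<lambda>j p. if p \<le> i then (0, p) else if p \<le> Suc (Suc i) then (1, Suc (Suc i)) else (0, p - 2))) {}"
  by (cases "(1 \<in> b) = c"; rule realizesI2; (simp add: model_simps)?; (elim conjE)?; (simp add: model_simps)?; metis?)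

lemma slide_cap_left_realizes:
  "realizes (Suc (Suc (Suc (i + t)))) [Cross (Suc i) c, Cap i] b (sarc (Cap (if (0 \<in> b) = c then Suc i else i)) True (Suc (Suc (Suc (i + t)))) 0)
     (retr 2 (\<lambda>j p. if p \<le> i then (0, p) else if p = Suc i then (0, i) else if p = Suc (Suc i) then (1, i) else (0, p))) {}"
  by (cases "(0 \<in> b) = c"; rule realizesI2; (simp add: model_simps)?; (elim conjE)?; (simp add: model_simps)?; metis?)

lemma slide_cap_right_realizes:
  "realizes (Suc (Suc (Suc (i + t)))) [Cross i (\<not> c), Cap (Suc i)] b (sarc (Cap (if (0 \<in> b) = c then Suc i else i)) True (Suc (Suc (Suc (i + t)))) 0)
     (retr 2 (\<lambda>j p. if p < i then (0, p) else if p = i then (1, i) else if p \<le> Suc (Suc i) then (0, Suc (Suc i)) else (0, p))) {}"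
  by (cases "(0 \<in> b) = c"; rule realizesI2; (simp add: model_simps)?; (elim conjE)?; (simp add: model_simps)?; metis?)

text \<open>The resolution that cuts off the small circle.\<close>

lemma R1_cup_realizes:
  "(1 \<in> b) = c \<Longrightarrow> realizes (i + t) [Cup i, Cross i c] b (sarc (Cup i) True (i + t) 0)
     (retr 2 (\<lambda>j p. if p < i then (0, p) else if p \<le> Suc i then (1, i) else (0, p - 2))) {(1, i), (1, Suc i)}"
  by (rule realizesI2; (simp add: model_simps)?; (elim conjE disjE)?; (simp add: model_simps)?; (fastforce | metis)?)

lemma R1_cap_realizes:
  "(0 \<in> b) = c \<Longrightarrow> realizes (Suc (Suc (i + t))) [Cross i c, Cap i] b (sarc (Cap i) True (Suc (Suc (i + t))) 0)
     (retr 2 (\<lambda>j p. (0, p))) {(1, i), (1, Suc i)}"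
  by (rule realizesI2; (simp add: model_simps)?; (elim conjE disjE)?; (simp add: model_simps)?; (fastforce | metis)?)

lemma R2_realizes:
  "(0 \<in> b) \<noteq> c \<Longrightarrow> (1 \<in> b) = c \<Longrightarrow> realizes (Suc (Suc (i + t))) [Cross i c, Cross i (\<not> c)] b (id_rel (Suc (Suc (i + t))))
     (retr 2 (\<lambda>j p. (0, p))) {}"
  by (rule realizesI2; (simp add: model_simps)?; (elim conjE)?; (simp add: model_simps)?; (fastforce | metis)?)


text \<open>The two resolutions of three strands that have one arc below, one arc above and one
  strand across, other than the two in which the arcs face each other.\<close>

definition turn_left :: "nat \<Rightarrow> nat \<Rightarrow> (node \<times> node) set" where
  "turn_left i t = {((0, p), (1, p)) | p. p < i} \<union> {((0, i + p), (1, i + p)) | p. 3 \<le> p \<and> p < 3 + t} \<union>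
     {((0, Suc i), (0, Suc (Suc i))), ((1, i), (1, Suc i)), ((0, i), (1, Suc (Suc i)))}"

definition turn_right :: "nat \<Rightarrow> nat \<Rightarrow> (node \<times> node) set" where
  "turn_right i t = {((0, p), (1, p)) | p. p < i} \<union> {((0, i + p), (1, i + p)) | p. 3 \<le> p \<and> p < 3 + t} \<union>
     {((0, i), (0, Suc i)), ((1, Suc i), (1, Suc (Suc i))), ((0, Suc (Suc i)), (1, i))}"

lemma low_turn: "low_rel (turn_left i t)" "low_rel (turn_right i t)"
  by (auto simp: low_rel_def turn_left_def turn_right_def)

lemma all_from_3: "(\<forall>p. 3 \<le> p \<and> p < 3 + t \<longrightarrow> P p) \<longleftrightarrow> (\<forall>q<t. P (Suc (Suc (Suc q))))"
proof -
  have "P p" if "\<forall>q<t. P (Suc (Suc (Suc q)))" "3 \<le> p" "p < 3 + t" for p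
    using that(1)[rule_format, of "p - 3"] that(2,3) by (simp add: eval_nat_numeral Suc_diff_Suc)
  then show ?thesis by auto
qed

lemma turn_window:
  "const_on (turn_left i t) \<phi> \<longleftrightarrow> (\<forall>p<i. \<phi> (0, p) = \<phi> (Suc 0, p)) \<and>
    (\<forall>q<t. \<phi> (0, Suc (Suc (Suc (i + q)))) = \<phi> (Suc 0, Suc (Suc (Suc (i + q))))) \<and>
    \<phi> (0, Suc i) = \<phi> (0, Suc (Suc i)) \<and> \<phi> (Suc 0, i) = \<phi> (Suc 0, Suc i) \<and> \<phi> (0, i) = \<phi> (Suc 0, Suc (Suc i))"
  "const_on (turn_right i t) \<phi> \<longleftrightarrow> (\<forall>p<i. \<phi> (0, p) = \<phi> (Suc 0, p)) \<and>
    (\<forall>q<t. \<phi> (0, Suc (Suc (Suc (i + q)))) = \<phi> (Suc 0, Suc (Suc (Suc (i + q))))) \<and>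
    \<phi> (0, i) = \<phi> (0, Suc i) \<and> \<phi> (Suc 0, Suc i) = \<phi> (Suc 0, Suc (Suc i)) \<and> \<phi> (0, Suc (Suc i)) = \<phi> (Suc 0, i)"
  unfolding turn_left_def turn_right_def const_on_Un const_on_Collect all_from_3 by simp_all

text \<open>The five planar resolutions of three strands without closed components, as products of
  cup-cap pairs. The name of a resolution is the set of crossings with 1-resolution, which is the
  same on both sides of the move unless the resolution is the identity; the empty name stands for
  the identity.\<close>

definition R3_rel :: "nat \<Rightarrow> nat \<Rightarrow> nat set \<Rightarrow> (node \<times> node) set" where
  "R3_rel i t e = (if 1 \<notin> e then id_rel (Suc (Suc (Suc (i + t))))
     else if 0 \<in> e then (if 2 \<in> e then turn_right i t else sarc (Cross i True) True (Suc (Suc (Suc (i + t)))) 0)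
     else if 2 \<in> e then sarc (Cross (Suc i) True) True (Suc (Suc (Suc (i + t)))) 0 else turn_left i t)"

abbreviation "R3_left i \<equiv> [Cross i True, Cross (Suc i) True, Cross i False]"
abbreviation "R3_right i \<equiv> [Cross (Suc i) False, Cross i True, Cross (Suc i) True]"

text \<open>A retraction on the window of three strands, given by the lists of the images on the
  first and on the second inner level.\<close>

definition win :: "nat \<Rightarrow> node list \<Rightarrow> node list \<Rightarrow> nat \<Rightarrow> nat \<Rightarrow> node" where
  "win i A B j p = (if i \<le> p \<and> p < i + 3 then (if j = 1 then A else B) ! (p - i) else (0, p))"

lemma win_simps [simp]:
  "p < i \<Longrightarrow> win i A B j p = (0, p)"
  "win i [a, b, c] [a', b', c'] (Suc 0) i = a" "win i [a, b, c] [a', b', c'] (Suc 0) (Suc i) = b"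
  "win i [a, b, c] [a', b', c'] (Suc 0) (Suc (Suc i)) = c"
  "win i [a, b, c] [a', b', c'] (Suc (Suc 0)) i = a'" "win i [a, b, c] [a', b', c'] (Suc (Suc 0)) (Suc i) = b'"
  "win i [a, b, c] [a', b', c'] (Suc (Suc 0)) (Suc (Suc i)) = c'"
  "win i [a, b, c] [a', b', c'] j (Suc (Suc (Suc (i + q)))) = (0, Suc (Suc (Suc (i + q))))"
  by (simp_all add: win_def)

lemma fst_win: "fst a \<le> 1 \<Longrightarrow> fst b \<le> 1 \<Longrightarrow> fst c \<le> 1 \<Longrightarrow> fst a' \<le> 1 \<Longrightarrow> fst b' \<le> 1 \<Longrightarrow> fst c' \<le> 1 \<Longrightarrow>
    fst (win i [a, b, c] [a', b', c'] j p) \<le> 1"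
  by (auto simp: win_def nth_Cons split: nat.split)

text \<open>Two consecutive lemmas with the same retraction form an edge of the local cube, or the
  first step of the zigzag in the case of the last two. No retraction works for all resolutions at
  once, because the strand of an inner node can change both of its ends along a path of
  edges.\<close>

lemma R3_left_1: "realizes (Suc (Suc (Suc (i + t)))) (R3_left i) {2} (R3_rel i t {}) (retr 3 (win i [(0, i), (0, Suc i), (0, Suc (Suc i))] [(1, i), (1, Suc i), (1, Suc (Suc i))])) {}"
  by (rule realizesI3; (simp add: model_simps R3_rel_def turn_window fst_win[unfolded One_nat_def] low_turn)?; (elim conjE)?; (simp add: model_simps)?; metis?)

lemma R3_left_2: "realizes (Suc (Suc (Suc (i + t)))) (R3_left i) {1, 2} (R3_rel i t {1, 2}) (retr 3 (win i [(0, i), (0, Suc i), (0, Suc (Suc i))] [(1, i), (1, Suc i), (1, Suc (Suc i))])) {}"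
  by (rule realizesI3; (simp add: model_simps R3_rel_def turn_window fst_win[unfolded One_nat_def] low_turn)?; (elim conjE)?; (simp add: model_simps)?; metis?)

lemma R3_left_3: "realizes (Suc (Suc (Suc (i + t)))) (R3_left i) {1} (R3_rel i t {1}) (retr 3 (win i [(1, Suc (Suc i)), (0, Suc (Suc i)), (0, Suc (Suc i))] [(1, Suc (Suc i)), (1, Suc (Suc i)), (1, Suc (Suc i))])) {}"
  by (rule realizesI3; (simp add: model_simps R3_rel_def turn_window fst_win[unfolded One_nat_def] low_turn)?; (elim conjE)?; (simp add: model_simps)?; metis?)

lemma R3_left_4: "realizes (Suc (Suc (Suc (i + t)))) (R3_left i) {0, 1} (R3_rel i t {0, 1}) (retr 3 (win i [(1, Suc (Suc i)), (0, Suc (Suc i)), (0, Suc (Suc i))] [(1, Suc (Suc i)), (1, Suc (Suc i)), (1, Suc (Suc i))])) {}"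
  by (rule realizesI3; (simp add: model_simps R3_rel_def turn_window fst_win[unfolded One_nat_def] low_turn)?; (elim conjE)?; (simp add: model_simps)?; metis?)

lemma R3_left_5: "realizes (Suc (Suc (Suc (i + t)))) (R3_left i) {1} (R3_rel i t {1}) (retr 3 (win i [(0, i), (0, Suc i), (0, Suc (Suc i))] [(0, i), (1, Suc (Suc i)), (1, Suc (Suc i))])) {}"
  by (rule realizesI3; (simp add: model_simps R3_rel_def turn_window fst_win[unfolded One_nat_def] low_turn)?; (elim conjE)?; (simp add: model_simps)?; metis?)

lemma R3_left_6: "realizes (Suc (Suc (Suc (i + t)))) (R3_left i) {1, 2} (R3_rel i t {1, 2}) (retr 3 (win i [(0, i), (0, Suc i), (0, Suc (Suc i))] [(0, i), (1, Suc (Suc i)), (1, Suc (Suc i))])) {}"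
  by (rule realizesI3; (simp add: model_simps R3_rel_def turn_window fst_win[unfolded One_nat_def] low_turn)?; (elim conjE)?; (simp add: model_simps)?; metis?)

lemma R3_left_7: "realizes (Suc (Suc (Suc (i + t)))) (R3_left i) {0, 1} (R3_rel i t {0, 1}) (retr 3 (win i [(0, Suc (Suc i)), (0, Suc (Suc i)), (0, Suc (Suc i))] [(0, Suc (Suc i)), (1, Suc (Suc i)), (1, Suc (Suc i))])) {}"
  by (rule realizesI3; (simp add: model_simps R3_rel_def turn_window fst_win[unfolded One_nat_def] low_turn)?; (elim conjE)?; (simp add: model_simps)?; metis?)

lemma R3_left_8: "realizes (Suc (Suc (Suc (i + t)))) (R3_left i) {0, 1, 2} (R3_rel i t {0, 1, 2}) (retr 3 (win i [(0, Suc (Suc i)), (0, Suc (Suc i)), (0, Suc (Suc i))] [(0, Suc (Suc i)), (1, Suc (Suc i)), (1, Suc (Suc i))])) {}"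
  by (rule realizesI3; (simp add: model_simps R3_rel_def turn_window fst_win[unfolded One_nat_def] low_turn)?; (elim conjE)?; (simp add: model_simps)?; metis?)

lemma R3_left_9: "realizes (Suc (Suc (Suc (i + t)))) (R3_left i) {1, 2} (R3_rel i t {1, 2}) (retr 3 (win i [(1, i), (0, Suc (Suc i)), (0, Suc (Suc i))] [(1, i), (1, Suc i), (1, Suc (Suc i))])) {}"
  by (rule realizesI3; (simp add: model_simps R3_rel_def turn_window fst_win[unfolded One_nat_def] low_turn)?; (elim conjE)?; (simp add: model_simps)?; metis?)

lemma R3_left_10: "realizes (Suc (Suc (Suc (i + t)))) (R3_left i) {0, 1, 2} (R3_rel i t {0, 1, 2}) (retr 3 (win i [(1, i), (0, Suc (Suc i)), (0, Suc (Suc i))] [(1, i), (1, Suc i), (1, Suc (Suc i))])) {}"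
  by (rule realizesI3; (simp add: model_simps R3_rel_def turn_window fst_win[unfolded One_nat_def] low_turn)?; (elim conjE)?; (simp add: model_simps)?; metis?)

lemma R3_left_11: "realizes (Suc (Suc (Suc (i + t)))) (R3_left i) {2} (R3_rel i t {}) (retr 3 (win i [(1, i), (1, Suc i), (1, Suc (Suc i))] [(1, i), (1, Suc i), (1, Suc (Suc i))])) {}"
  by (rule realizesI3; (simp add: model_simps R3_rel_def turn_window fst_win[unfolded One_nat_def] low_turn)?; (elim conjE)?; (simp add: model_simps)?; metis?)

lemma R3_left_12: "realizes (Suc (Suc (Suc (i + t)))) (R3_left i) {0, 2} (R3_rel i t {0, 1}) (retr 3 (win i [(1, i), (1, Suc i), (1, Suc (Suc i))] [(1, i), (1, Suc i), (1, Suc (Suc i))])) {}"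
  by (rule realizesI3; (simp add: model_simps R3_rel_def turn_window fst_win[unfolded One_nat_def] low_turn)?; (elim conjE)?; (simp add: model_simps)?; metis?)

lemma R3_right_1: "realizes (Suc (Suc (Suc (i + t)))) (R3_right i) {0} (R3_rel i t {}) (retr 3 (win i [(0, i), (0, Suc i), (0, Suc (Suc i))] [(1, i), (1, Suc i), (1, Suc (Suc i))])) {}"
  by (rule realizesI3; (simp add: model_simps R3_rel_def turn_window fst_win[unfolded One_nat_def] low_turn)?; (elim conjE)?; (simp add: model_simps)?; metis?)

lemma R3_right_2: "realizes (Suc (Suc (Suc (i + t)))) (R3_right i) {0, 1} (R3_rel i t {0, 1}) (retr 3 (win i [(0, i), (0, Suc i), (0, Suc (Suc i))] [(1, i), (1, Suc i), (1, Suc (Suc i))])) {}"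
  by (rule realizesI3; (simp add: model_simps R3_rel_def turn_window fst_win[unfolded One_nat_def] low_turn)?; (elim conjE)?; (simp add: model_simps)?; metis?)

lemma R3_right_3: "realizes (Suc (Suc (Suc (i + t)))) (R3_right i) {1} (R3_rel i t {1}) (retr 3 (win i [(0, i), (0, i), (1, Suc (Suc i))] [(1, i), (1, Suc i), (1, Suc (Suc i))])) {}"
  by (rule realizesI3; (simp add: model_simps R3_rel_def turn_window fst_win[unfolded One_nat_def] low_turn)?; (elim conjE)?; (simp add: model_simps)?; metis?)

lemma R3_right_4: "realizes (Suc (Suc (Suc (i + t)))) (R3_right i) {0, 1} (R3_rel i t {0, 1}) (retr 3 (win i [(0, i), (0, i), (1, Suc (Suc i))] [(1, i), (1, Suc i), (1, Suc (Suc i))])) {}"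
  by (rule realizesI3; (simp add: model_simps R3_rel_def turn_window fst_win[unfolded One_nat_def] low_turn)?; (elim conjE)?; (simp add: model_simps)?; metis?)

lemma R3_right_5: "realizes (Suc (Suc (Suc (i + t)))) (R3_right i) {1} (R3_rel i t {1}) (retr 3 (win i [(0, i), (0, i), (0, i)] [(1, i), (1, i), (0, i)])) {}"
  by (rule realizesI3; (simp add: model_simps R3_rel_def turn_window fst_win[unfolded One_nat_def] low_turn)?; (elim conjE)?; (simp add: model_simps)?; metis?)

lemma R3_right_6: "realizes (Suc (Suc (Suc (i + t)))) (R3_right i) {1, 2} (R3_rel i t {1, 2}) (retr 3 (win i [(0, i), (0, i), (0, i)] [(1, i), (1, i), (0, i)])) {}"
  by (rule realizesI3; (simp add: model_simps R3_rel_def turn_window fst_win[unfolded One_nat_def] low_turn)?; (elim conjE)?; (simp add: model_simps)?; metis?)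

lemma R3_right_7: "realizes (Suc (Suc (Suc (i + t)))) (R3_right i) {0, 1} (R3_rel i t {0, 1}) (retr 3 (win i [(0, i), (0, Suc i), (0, Suc (Suc i))] [(1, i), (1, i), (0, Suc (Suc i))])) {}"
  by (rule realizesI3; (simp add: model_simps R3_rel_def turn_window fst_win[unfolded One_nat_def] low_turn)?; (elim conjE)?; (simp add: model_simps)?; metis?)

lemma R3_right_8: "realizes (Suc (Suc (Suc (i + t)))) (R3_right i) {0, 1, 2} (R3_rel i t {0, 1, 2}) (retr 3 (win i [(0, i), (0, Suc i), (0, Suc (Suc i))] [(1, i), (1, i), (0, Suc (Suc i))])) {}"
  by (rule realizesI3; (simp add: model_simps R3_rel_def turn_window fst_win[unfolded One_nat_def] low_turn)?; (elim conjE)?; (simp add: model_simps)?; metis?)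

lemma R3_right_9: "realizes (Suc (Suc (Suc (i + t)))) (R3_right i) {1, 2} (R3_rel i t {1, 2}) (retr 3 (win i [(0, i), (0, i), (1, i)] [(1, i), (1, i), (1, i)])) {}"
  by (rule realizesI3; (simp add: model_simps R3_rel_def turn_window fst_win[unfolded One_nat_def] low_turn)?; (elim conjE)?; (simp add: model_simps)?; metis?)

lemma R3_right_10: "realizes (Suc (Suc (Suc (i + t)))) (R3_right i) {0, 1, 2} (R3_rel i t {0, 1, 2}) (retr 3 (win i [(0, i), (0, i), (1, i)] [(1, i), (1, i), (1, i)])) {}"
  by (rule realizesI3; (simp add: model_simps R3_rel_def turn_window fst_win[unfolded One_nat_def] low_turn)?; (elim conjE)?; (simp add: model_simps)?; metis?)

lemma R3_right_11: "realizes (Suc (Suc (Suc (i + t)))) (R3_right i) {0} (R3_rel i t {}) (retr 3 (win i [(0, i), (0, Suc i), (0, Suc (Suc i))] [(0, i), (0, Suc i), (0, Suc (Suc i))])) {}"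
  by (rule realizesI3; (simp add: model_simps R3_rel_def turn_window fst_win[unfolded One_nat_def] low_turn)?; (elim conjE)?; (simp add: model_simps)?; metis?)

lemma R3_right_12: "realizes (Suc (Suc (Suc (i + t)))) (R3_right i) {0, 2} (R3_rel i t {1, 2}) (retr 3 (win i [(0, i), (0, Suc i), (0, Suc (Suc i))] [(0, i), (0, Suc i), (0, Suc (Suc i))])) {}"
  by (rule realizesI3; (simp add: model_simps R3_rel_def turn_window fst_win[unfolded One_nat_def] low_turn)?; (elim conjE)?; (simp add: model_simps)?; metis?)


text \<open>Two distant events seen in one slice: the core of \<open>g\<close>, \<open>e\<close>
  strands between them, the core of \<open>h\<close>, and \<open>t\<close> strands to the right. The
  positions below and above differ as soon as \<open>g\<close> changes the number of
  strands.\<close>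

definition exch_rel :: "slice \<Rightarrow> slice \<Rightarrow> nat \<Rightarrow> nat \<Rightarrow> bool \<Rightarrow> bool \<Rightarrow> (node \<times> node) set" where
  "exch_rel g h e t r s = {((0, p), (1, p)) | p. p < position g} \<union> core_arcs g r 0 \<union>
    {((0, position g + ins g + q), (1, position g + outs g + q)) | q. q < e} \<union>
    (let s' = \<lambda>u. (fst u, position g + (if fst u = 0 then ins g else outs g) + e + snd u)
     in (\<lambda>(u, u'). (s' u, s' u')) ` core_arcs (place 0 h) s 0) \<union>
    {((0, position g + ins g + e + ins h + q), (1, position g + outs g + e + outs h + q)) | q. q < t}"

lemma place_simps [simp]: "position (place k g) = k" "ins (place k g) = ins g" "outs (place k g) = outs g"
    "core_ok (place k g) r A B \<longleftrightarrow> core_ok g r A B"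
  by (cases g; simp)+

lemma const_on_image:
  fixes \<phi> :: "node \<Rightarrow> 'b"
  shows "const_on ((\<lambda>(u, u'). (s u, s u')) ` A) \<phi> \<longleftrightarrow> const_on A (\<lambda>u. \<phi> (s u))"
proof -
  have "const_on B \<psi> \<longleftrightarrow> (\<forall>e\<in>B. \<psi> (fst e) = \<psi> (snd e))" for B and \<psi> :: "node \<Rightarrow> 'b"
    unfolding const_on_def by force
  then show ?thesis by (simp add: split_beta)
qed

lemma const_on_exch: "const_on (exch_rel g h e t r s) \<phi> \<longleftrightarrow>
    (\<forall>p<position g. \<phi> (0, p) = \<phi> (1, p)) \<and>
    core_ok g r (\<lambda>q. \<phi> (0, position g + q)) (\<lambda>q. \<phi> (1, position g + q)) \<and>
    (\<forall>q<e. \<phi> (0, position g + ins g + q) = \<phi> (1, position g + outs g + q)) \<and>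
    core_ok h s (\<lambda>q. \<phi> (0, position g + ins g + e + q)) (\<lambda>q. \<phi> (1, position g + outs g + e + q)) \<and>
    (\<forall>q<t. \<phi> (0, position g + ins g + e + ins h + q) = \<phi> (1, position g + outs g + e + outs h + q))"
  unfolding exch_rel_def Let_def const_on_Un const_on_Collect const_on_image const_on_core by simp

lemma low_exch: "low_rel (exch_rel g h e t r s)"
proof -
  have "fst u \<le> 1 \<and> fst u' \<le> 1" if "(u, u') \<in> core_arcs f r 0" for u u' f r
    using that by (cases f) (auto split: if_splits)
  then show ?thesis by (fastforce simp: low_rel_def exch_rel_def Let_def)
qed

lemma const_on_exch_left:
  assumes "position h = position g + outs g + e"
  shows "const_on (tarcs 0 (position g + ins g + (e + ins h + t)) [g, h] b) \<phi> \<longleftrightarrow>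
    (\<forall>p<position g. \<phi> (0, p) = \<phi> (1, p)) \<and>
    core_ok g (0 \<in> b) (\<lambda>q. \<phi> (0, position g + q)) (\<lambda>q. \<phi> (1, position g + q)) \<and>
    (\<forall>q<e. \<phi> (0, position g + ins g + q) = \<phi> (1, position g + outs g + q)) \<and>
    (\<forall>q<ins h. \<phi> (0, position g + ins g + e + q) = \<phi> (1, position g + outs g + e + q)) \<and>
    (\<forall>q<t. \<phi> (0, position g + ins g + e + ins h + q) = \<phi> (1, position g + outs g + e + ins h + q)) \<and>
    (\<forall>p<position g. \<phi> (1, p) = \<phi> (2, p)) \<and>
    (\<forall>q < outs g. \<phi> (1, position g + q) = \<phi> (2, position g + q)) \<and>
    (\<forall>q<e. \<phi> (1, position g + outs g + q) = \<phi> (2, position g + outs g + q)) \<and>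
    core_ok h (1 \<in> b) (\<lambda>q. \<phi> (1, position g + outs g + e + q)) (\<lambda>q. \<phi> (2, position g + outs g + e + q)) \<and>
    (\<forall>q<t. \<phi> (1, position g + outs g + e + ins h + q) = \<phi> (2, position g + outs g + e + outs h + q))"
proof -
  have w: "position g + ins g + (e + ins h + t) - ins g + outs g = position h + ins h + t" using assms by simp
  show ?thesis
    by (simp only: tarcs.simps w const_on_Un const_on_empty const_on_sarc)
       (simp only: all_less_add assms add.assoc conj_assoc One_nat_def numeral_2_eq_2 simp_thms)
qed

lemma const_on_exch_right:
  assumes "k = position g + ins g + e"
  shows "const_on (tarcs 0 (position g + ins g + (e + ins h + t)) [place k h, g] b) \<phi> \<longleftrightarrow>
    (\<forall>p<position g. \<phi> (0, p) = \<phi> (1, p)) \<and>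
    (\<forall>q<ins g. \<phi> (0, position g + q) = \<phi> (1, position g + q)) \<and>
    (\<forall>q<e. \<phi> (0, position g + ins g + q) = \<phi> (1, position g + ins g + q)) \<and>
    core_ok h (0 \<in> b) (\<lambda>q. \<phi> (0, position g + ins g + e + q)) (\<lambda>q. \<phi> (1, position g + ins g + e + q)) \<and>
    (\<forall>q<t. \<phi> (0, position g + ins g + e + ins h + q) = \<phi> (1, position g + ins g + e + outs h + q)) \<and>
    (\<forall>p<position g. \<phi> (1, p) = \<phi> (2, p)) \<and>
    core_ok g (1 \<in> b) (\<lambda>q. \<phi> (1, position g + q)) (\<lambda>q. \<phi> (2, position g + q)) \<and>
    (\<forall>q<e. \<phi> (1, position g + ins g + q) = \<phi> (2, position g + outs g + q)) \<and>
    (\<forall>q < outs h. \<phi> (1, position g + ins g + e + q) = \<phi> (2, position g + outs g + e + q)) \<and>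
    (\<forall>q<t. \<phi> (1, position g + ins g + e + outs h + q) = \<phi> (2, position g + outs g + e + outs h + q))"
proof -
  have w: "position g + ins g + (e + ins h + t) = position (place k h) + ins (place k h) + t"
    "position (place k h) + ins (place k h) + t - ins (place k h) + outs (place k h) = position g + ins g + (e + outs h + t)"
    using assms by simp_all
  show ?thesis
    by (simp only: tarcs.simps w const_on_Un const_on_empty const_on_sarc)
       (simp only: place_simps all_less_add assms add.assoc conj_assoc One_nat_def numeral_2_eq_2 simp_thms)
qed

lemma exchange_left_realizes:
  assumes "position h = position g + outs g + e"
  shows "realizes (position g + ins g + (e + ins h + t)) [g, h] b (exch_rel g h e t (0 \<in> b) (1 \<in> b))
    (retr 2 (\<lambda>j p. if p < position g + outs g then (1, p) else (0, p - outs g + ins g))) {}"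
proof (rule realizesI2)
  fix \<phi> :: "node \<Rightarrow> node set"
  assume "const_on (tarcs 0 (position g + ins g + (e + ins h + t)) [g, h] b) \<phi>"
  note c = this[unfolded const_on_exch_left[OF assms]]
  have w: "wd (position g + ins g + (e + ins h + t)) (take 1 [g, h]) = position g + outs g + e + ins h + t"
    by simp
  show "const_on (exch_rel g h e t (0 \<in> b) (1 \<in> b)) (\<lambda>u. \<phi> (ends 2 u)) \<and>
    (\<forall>p<wd (position g + ins g + (e + ins h + t)) (take 1 [g, h]). (1, p) \<notin> {} \<longrightarrow>
      \<phi> (ends 2 (if p < position g + outs g then (1, p) else (0, p - outs g + ins g))) = \<phi> (1, p))"
    unfolding const_on_exch w all_less_add using c by (elim conjE) (simp add: ends_def ac_simps cong: core_ok_cong)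
next
  fix \<psi> :: "node \<Rightarrow> node set"
  assume "const_on (exch_rel g h e t (0 \<in> b) (1 \<in> b)) \<psi>"
  then show "const_on (tarcs 0 (position g + ins g + (e + ins h + t)) [g, h] b)
      (\<lambda>u. \<psi> (retr 2 (\<lambda>j p. if p < position g + outs g then (1, p) else (0, p - outs g + ins g)) u))"
    unfolding const_on_exch const_on_exch_left[OF assms] by (simp add: retr_def ac_simps cong: core_ok_cong)
qed (simp_all add: low_exch)

lemma exchange_right_realizes:
  assumes "k = position g + ins g + e"
  shows "realizes (position g + ins g + (e + ins h + t)) [place k h, g] b (exch_rel g h e t (1 \<in> b) (0 \<in> b))
    (retr 2 (\<lambda>j p. if p < position g + ins g + e then (0, p) else (1, p - ins g + outs g))) {}"
proof (rule realizesI2)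
  fix \<phi> :: "node \<Rightarrow> node set"
  assume "const_on (tarcs 0 (position g + ins g + (e + ins h + t)) [place k h, g] b) \<phi>"
  note c = this[unfolded const_on_exch_right[OF assms]]
  have w: "wd (position g + ins g + (e + ins h + t)) (take 1 [place k h, g]) = position g + ins g + e + outs h + t"
    by simp
  show "const_on (exch_rel g h e t (1 \<in> b) (0 \<in> b)) (\<lambda>u. \<phi> (ends 2 u)) \<and>
    (\<forall>p<wd (position g + ins g + (e + ins h + t)) (take 1 [place k h, g]). (1, p) \<notin> {} \<longrightarrow>
      \<phi> (ends 2 (if p < position g + ins g + e then (0, p) else (1, p - ins g + outs g))) = \<phi> (1, p))"
    unfolding const_on_exch w all_less_add using c by (elim conjE) (simp add: ends_def ac_simps cong: core_ok_cong)
next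
  fix \<psi> :: "node \<Rightarrow> node set"
  assume "const_on (exch_rel g h e t (1 \<in> b) (0 \<in> b)) \<psi>"
  then show "const_on (tarcs 0 (position g + ins g + (e + ins h + t)) [place k h, g] b)
      (\<lambda>u. \<psi> (retr 2 (\<lambda>j p. if p < position g + ins g + e then (0, p) else (1, p - ins g + outs g)) u))"
    unfolding const_on_exch const_on_exch_right[OF assms] by (simp add: retr_def ac_simps cong: core_ok_cong)
qed (simp_all add: low_exch)

section \<open>Comparing the two sides of a move\<close>

text \<open>Needed to invert isomorphisms out of the homology of a renamed complex. Cosets of the
  boundaries can be added because the image of the matrix is closed under addition.\<close>

lemma homology_closed:
  assumes "A \<in> carrier (homology St c)" "B \<in> carrier (homology St c)"
  shows "A \<otimes>\<^bsub>homology St c\<^esub> B \<in> carrier (homology St c)"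
proof -
  let ?I = "hdiff St c ` hchains St" and ?Z = "hcycles St c"
  interpret Z: comm_group ?Z by (rule comm_group_hcycles)
  obtain f g where f: "f \<in> carrier ?Z" "A = ?I #>\<^bsub>?Z\<^esub> f" and g: "g \<in> carrier ?Z" "B = ?I #>\<^bsub>?Z\<^esub> g"
    using assms by (auto simp: homology_def FactGroup_def RCOSETS_def)
  have "A <#>\<^bsub>?Z\<^esub> B = ?I #>\<^bsub>?Z\<^esub> (f \<otimes>\<^bsub>?Z\<^esub> g)"
  proof
    show "A <#>\<^bsub>?Z\<^esub> B \<subseteq> ?I #>\<^bsub>?Z\<^esub> (f \<otimes>\<^bsub>?Z\<^esub> g)"
    proof
      fix u assume "u \<in> A <#>\<^bsub>?Z\<^esub> B"
      then obtain a b where ab: "a \<in> hchains St" "b \<in> hchains St"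
        and u: "u = (\<lambda>s. (hdiff St c a s + f s) + (hdiff St c b s + g s))"
        unfolding f(2) g(2) set_mult_def r_coset_def by (auto simp: hcycles_def)
      have "u = (\<lambda>s. hdiff St c (\<lambda>s. a s + b s) s + (f s + g s))"
        unfolding u hdiff_add by (simp add: ac_simps)
      then show "u \<in> ?I #>\<^bsub>?Z\<^esub> (f \<otimes>\<^bsub>?Z\<^esub> g)"
        using hchains_add[OF ab] unfolding r_coset_def by (auto simp: hcycles_def)
    qed
    show "?I #>\<^bsub>?Z\<^esub> (f \<otimes>\<^bsub>?Z\<^esub> g) \<subseteq> A <#>\<^bsub>?Z\<^esub> B"
    proof
      fix u assume "u \<in> ?I #>\<^bsub>?Z\<^esub> (f \<otimes>\<^bsub>?Z\<^esub> g)"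
      then obtain a where a: "a \<in> hchains St" and u: "u = (\<lambda>s. hdiff St c a s + (f s + g s))"
        unfolding r_coset_def by (auto simp: hcycles_def)
      have "(\<lambda>s. hdiff St c a s + f s) \<in> A" using a unfolding f(2) r_coset_def by (auto simp: hcycles_def)
      moreover have "g \<in> B"
        unfolding g(2) r_coset_def by (rule UN_I[OF image_eqI[where f = "hdiff St c" and x = "\<lambda>s. 0" and b = "\<lambda>s. 0", OF _ hchains_zero]]) (simp_all add: hcycles_def fun_eq_iff)
      moreover have "u = (\<lambda>s. hdiff St c a s + f s) \<otimes>\<^bsub>?Z\<^esub> g" unfolding u by (simp add: hcycles_def ac_simps)
      ultimately show "u \<in> A <#>\<^bsub>?Z\<^esub> B" unfolding set_mult_def by blast
    qed
  qed
  then show ?thesis using Z.m_closed[OF f(1) g(1)] by (auto simp: homology_def FactGroup_def RCOSETS_def)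
qed

lemma iso_sym_closed:
  assumes cl: "\<And>x y. x \<in> carrier G \<Longrightarrow> y \<in> carrier G \<Longrightarrow> x \<otimes>\<^bsub>G\<^esub> y \<in> carrier G" and "G \<cong> H"
  shows "H \<cong> G"
proof -
  obtain h where h: "h \<in> hom G H" "bij_betw h (carrier G) (carrier H)"
    using assms(2) by (auto simp: is_iso_def iso_def)
  let ?i = "inv_into (carrier G) h"
  have b: "bij_betw ?i (carrier H) (carrier G)" by (rule bij_betw_inv_into[OF h(2)])
  have "?i \<in> hom H G"
  proof (rule homI)
    show i: "?i x \<in> carrier G" if "x \<in> carrier H" for x using bij_betwE[OF b] that by blast
    show "?i (x \<otimes>\<^bsub>H\<^esub> y) = ?i x \<otimes>\<^bsub>G\<^esub> ?i y" if "x \<in> carrier H" "y \<in> carrier H" for x y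
    proof -
      have "h (?i x \<otimes>\<^bsub>G\<^esub> ?i y) = x \<otimes>\<^bsub>H\<^esub> y"
        using hom_mult[OF h(1) i[OF that(1)] i[OF that(2)]] that bij_betw_inv_into_right[OF h(2)] by simp
      then show ?thesis
        using bij_betw_inv_into_left[OF h(2) cl[OF i[OF that(1)] i[OF that(2)]]] by simp
    qed
  qed
  then show ?thesis using b unfolding is_iso_def iso_def by blast
qed

lemma iso_via_homology: "homology St c \<cong> G \<Longrightarrow> homology St c \<cong> H \<Longrightarrow> G \<cong> H"
  using iso_sym_closed[OF homology_closed] iso_trans by blast

definition same_Kh :: "slice list \<Rightarrow> slice list \<Rightarrow> bool" where
  "same_Kh M M' \<longleftrightarrow> (\<forall>X Y. tangle 0 (X @ M @ Y) 0 \<longrightarrow> tangle 0 (X @ M' @ Y) 0 \<longrightarrow> Kh (X @ M @ Y) \<cong> Kh (X @ M' @ Y))"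

lemma same_KhI:
  assumes "unmarked M" "unmarked M'"
    and "\<And>X Y. split_diagram X M Y \<Longrightarrow> split_diagram X M' Y \<Longrightarrow>
      \<exists>n EL \<rho> AL. skel_homology X n Y EL \<rho> AL \<cong> Kh (X @ M @ Y) \<and> skel_homology X n Y EL \<rho> AL \<cong> Kh (X @ M' @ Y)"
  shows "same_Kh M M'"
  unfolding same_Kh_def
proof (intro allI impI)
  fix X Y assume "tangle 0 (X @ M @ Y) 0" "tangle 0 (X @ M' @ Y) 0"
  then have "split_diagram X M Y" "split_diagram X M' Y" using assms by (auto simp: split_diagram_def)
  from assms(3)[OF this] show "Kh (X @ M @ Y) \<cong> Kh (X @ M' @ Y)"
    unfolding skel_homology_def using iso_via_homology by blast
qed

lemma same_Kh_isotopy: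
  assumes un: "unmarked M" "unmarked M'" and cr: "crossings M' = crossings M"
    and loc: "\<And>m n. tangle m M n \<Longrightarrow> \<exists>\<rho> g g'. (\<forall>b. realizes m M b (\<rho> b) g {}) \<and> (\<forall>b. realizes m M' b (\<rho> b) g' {})"
    and w: "\<And>m n n'. tangle m M n \<Longrightarrow> tangle m M' n' \<Longrightarrow> n = n'"
  shows "same_Kh M M'"
proof (rule same_KhI[OF un])
  fix X Y assume s: "split_diagram X M Y" "split_diagram X M' Y"
  have t: "tangle (wd 0 X) M (wd (wd 0 X) M)" "tangle (wd 0 X) M' (wd (wd 0 X) M')"
    using s by (auto simp: split_diagram_def tangle_append)
  obtain \<rho> g g' where r: "\<And>b. realizes (wd 0 X) M b (\<rho> b) g {}" "\<And>b. realizes (wd 0 X) M' b (\<rho> b) g' {}"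
    using loc[OF t(1)] by blast
  have l: "ladj M' = ladj M" by (simp add: ladj_def fun_eq_iff cr)
  have "skel_homology X (wd (wd 0 X) M) Y ((\<lambda>b. b) ` Pow (crossings M)) \<rho> (ladj M) \<cong> Kh (X @ M @ Y)"
    by (rule split_diagram.skel_isotopy[OF s(1), where g = g]) (auto simp: inj_on_def r)
  moreover have "skel_homology X (wd (wd 0 X) M') Y ((\<lambda>b. b) ` Pow (crossings M')) \<rho> (ladj M') \<cong> Kh (X @ M' @ Y)"
    by (rule split_diagram.skel_isotopy[OF s(2), where g = g']) (auto simp: inj_on_def r)
  ultimately show "\<exists>n EL \<rho> AL. skel_homology X n Y EL \<rho> AL \<cong> Kh (X @ M @ Y) \<and> skel_homology X n Y EL \<rho> AL \<cong> Kh (X @ M' @ Y)"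
    unfolding cr l w[OF t] by blast
qed

lemma unmarked_simps [simp]: "unmarked []" "unmarked (g # D) \<longleftrightarrow> (\<forall>i. g \<noteq> Mark i) \<and> unmarked D"
    "unmarked (A @ B) \<longleftrightarrow> unmarked A \<and> unmarked B"
  by (auto simp: unmarked_def)

lemma zigzag_left_same_Kh: "same_Kh [Cup i, Cap (Suc i)] []"
proof (rule same_Kh_isotopy)
  fix m n assume "tangle m [Cup i, Cap (Suc i)] n"
  then obtain t where m: "m = Suc (i + t)" using less_iff_Suc_add[of i m] by auto
  show "\<exists>\<rho> g g'. (\<forall>b. realizes m [Cup i, Cap (Suc i)] b (\<rho> b) g {}) \<and> (\<forall>b. realizes m [] b (\<rho> b) g' {})"
    unfolding m by (intro exI conjI allI) (rule zigzag_left_realizes, rule realizes_Nil)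
qed (auto simp: crossings_Cons)

lemma zigzag_right_same_Kh: "same_Kh [Cup (Suc i), Cap i] []"
proof (rule same_Kh_isotopy)
  fix m n assume "tangle m [Cup (Suc i), Cap i] n"
  then obtain t where m: "m = Suc (i + t)" using less_iff_Suc_add[of i m] by auto
  show "\<exists>\<rho> g g'. (\<forall>b. realizes m [Cup (Suc i), Cap i] b (\<rho> b) g {}) \<and> (\<forall>b. realizes m [] b (\<rho> b) g' {})"
    unfolding m by (intro exI conjI allI) (rule zigzag_right_realizes, rule realizes_Nil)
qed (auto simp: crossings_Cons)

lemma slide_cup_same_Kh: "same_Kh [Cup i, Cross (Suc i) c] [Cup (Suc i), Cross i (\<not> c)]"
proof (rule same_Kh_isotopy)
  fix m n assume "tangle m [Cup i, Cross (Suc i) c] n"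
  then obtain t where m: "m = Suc (i + t)" using less_iff_Suc_add[of i m] by auto
  show "\<exists>\<rho> g g'. (\<forall>b. realizes m [Cup i, Cross (Suc i) c] b (\<rho> b) g {}) \<and>
      (\<forall>b. realizes m [Cup (Suc i), Cross i (\<not> c)] b (\<rho> b) g' {})"
    unfolding m
    by (rule exI[of _ "\<lambda>b. sarc (Cup (if (1 \<in> b) = c then Suc i else i)) True (Suc (i + t)) 0"])
       (intro exI conjI allI, rule slide_cup_left_realizes, rule slide_cup_right_realizes)
qed (auto simp: crossings_Cons)

lemma slide_cap_same_Kh: "same_Kh [Cross (Suc i) c, Cap i] [Cross i (\<not> c), Cap (Suc i)]"
proof (rule same_Kh_isotopy)
  fix m n assume "tangle m [Cross (Suc i) c, Cap i] n"
  then have "i + 3 \<le> m" by simp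
  then obtain t where m: "m = Suc (Suc (Suc (i + t)))" using le_iff_add[of "i + 3" m] by (auto simp: eval_nat_numeral)
  show "\<exists>\<rho> g g'. (\<forall>b. realizes m [Cross (Suc i) c, Cap i] b (\<rho> b) g {}) \<and>
      (\<forall>b. realizes m [Cross i (\<not> c), Cap (Suc i)] b (\<rho> b) g' {})"
    unfolding m
    by (rule exI[of _ "\<lambda>b. sarc (Cap (if (0 \<in> b) = c then Suc i else i)) True (Suc (Suc (Suc (i + t)))) 0"])
       (intro exI conjI allI, rule slide_cap_left_realizes, rule slide_cap_right_realizes)
qed (auto simp: crossings_Cons)

text \<open>The exchange also swaps the indices of the two slices, so that the vertices of the
  second local cube are renamed by \<open>k \<mapsto> 1 - k\<close>.\<close>

lemma exchange_same_Kh: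
  assumes pos: "position g + outs g \<le> position h" and un: "unmarked [g, h]"
  shows "same_Kh [g, h] [place (position h - outs g + ins g) h, g]"
proof (rule same_KhI[OF un])
  define e where "e = position h - (position g + outs g)"
  have ph: "position h = position g + outs g + e" using pos by (simp add: e_def)
  have k: "position h - outs g + ins g = position g + ins g + e" using ph by simp
  let ?M = "[g, h]" and ?M' = "[place (position h - outs g + ins g) h, g]"
  show "unmarked ?M'" using un by (cases h) auto
  fix X Y assume s: "split_diagram X ?M Y" "split_diagram X ?M' Y"
  have "tangle (wd 0 X) ?M (wd (wd 0 X) ?M)" using s by (auto simp: split_diagram_def tangle_append)
  then have "position g + ins g \<le> wd 0 X" "position g + (e + ins h) \<le> wd 0 X - ins g" using ph by simp_all
  then have "position g + ins g + (e + ins h) \<le> wd 0 X" by linarith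
  then obtain t where m: "wd 0 X = position g + ins g + (e + ins h + t)"
    using le_iff_add[of "position g + ins g + (e + ins h)" "wd 0 X"] by (auto simp: ac_simps)
  have n: "wd (wd 0 X) ?M' = wd (wd 0 X) ?M" unfolding m by simp
  let ?sw = "\<lambda>b. (\<lambda>k. 1 - k :: nat) ` b"
  let ?\<rho> = "\<lambda>b. exch_rel g h e t (0 \<in> b) (1 \<in> b)"
  have cr: "crossings ?M \<subseteq> {0, 1}" "crossings ?M' \<subseteq> {0, 1}"
    by (auto simp: crossings_def less_Suc_eq)
  have crsw: "crossings ?M = ?sw (crossings ?M')" 
    by (cases g; cases h) (auto simp: crossings_Cons)
  have sw01: "(0 \<in> ?sw b) = (1 \<in> b)" "(1 \<in> ?sw b) = (0 \<in> b)" if "b \<subseteq> {0, 1}" for b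
    using that by (force)+
  have swsw: "?sw (?sw b) = b" if "b \<subseteq> {0, 1}" for b
  proof -
    have "1 - (1 - k) = k" if "k \<in> b" for k using that \<open>b \<subseteq> {0, 1}\<close> by auto
    then show ?thesis by (force simp: image_image)
  qed
  have inj: "inj_on ?sw (Pow (crossings ?M'))"
  proof (rule inj_on_inverseI[where g = ?sw])
    fix b assume "b \<in> Pow (crossings ?M')"
    then have "b \<subseteq> {0, 1}" using cr(2) by (meson PowD subset_trans)
    then show "?sw (?sw b) = b" by (rule swsw)
  qed
  have pow: "?sw ` Pow (crossings ?M') = Pow (crossings ?M)"
    unfolding crsw by (rule image_Pow_surj) simp
  have "skel_homology X (wd (wd 0 X) ?M) Y ((\<lambda>b. b) ` Pow (crossings ?M)) ?\<rho> (ladj ?M) \<cong> Kh (X @ ?M @ Y)"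
  proof (rule split_diagram.skel_isotopy[OF s(1)])
    show "realizes (wd 0 X) ?M b (?\<rho> b) (retr 2 (\<lambda>j p. if p < position g + outs g then (1, p) else (0, p - outs g + ins g))) {}" for b
      unfolding m by (rule exchange_left_realizes[OF ph])
  qed simp_all
  moreover have "skel_homology X (wd (wd 0 X) ?M') Y (?sw ` Pow (crossings ?M')) ?\<rho> (ladj ?M) \<cong> Kh (X @ ?M' @ Y)"
  proof (rule split_diagram.skel_isotopy[OF s(2) inj])
    show "realizes (wd 0 X) ?M' b (?\<rho> (?sw b)) (retr 2 (\<lambda>j p. if p < position g + ins g + e then (0, p) else (1, p - ins g + outs g))) {}"
      if "b \<subseteq> crossings ?M'" for b
    proof -
      have "b \<subseteq> {0, 1}" using that cr by blast
      from sw01[OF this] show ?thesis unfolding m by (simp only: exchange_right_realizes[OF k])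
    qed
    fix b b' assume b: "b \<subseteq> crossings ?M'" "b' \<subseteq> crossings ?M'"
    show "ladj ?M (?sw b) (?sw b') \<longleftrightarrow> ladj ?M' b b'"
    proof
      assume "ladj ?M (?sw b) (?sw b')"
      then obtain k where k: "k \<in> crossings ?M'" "1 - k \<notin> ?sw b" "?sw b' = insert (1 - k) (?sw b)"
        unfolding ladj_def crsw by blast
      then have "k \<notin> b" "?sw b' = ?sw (insert k b)" by auto
      then have "b' = insert k b" using inj_onD[OF inj, of b' "insert k b"] b k(1) by blast
      then show "ladj ?M' b b'" using k \<open>k \<notin> b\<close> unfolding ladj_def by blast
    next
      assume "ladj ?M' b b'"
      then obtain k where k: "k \<in> crossings ?M'" "k \<notin> b" "b' = insert k b" unfolding ladj_def by blast
      have "1 - k \<notin> ?sw b"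
      proof
        assume "1 - k \<in> ?sw b"
        then obtain j where "j \<in> b" "1 - k = 1 - j" by blast
        moreover have "j \<in> {0, 1}" "k \<in> {0, 1}" using \<open>j \<in> b\<close> b cr k(1) by blast+
        ultimately show False using k(2) by auto
      qed
      then show "ladj ?M (?sw b) (?sw b')" using k unfolding ladj_def crsw by blast
    qed
  qed
  ultimately show "\<exists>n EL \<rho> AL. skel_homology X n Y EL \<rho> AL \<cong> Kh (X @ ?M @ Y) \<and> skel_homology X n Y EL \<rho> AL \<cong> Kh (X @ ?M' @ Y)"
    unfolding n pow image_ident by blast
qed


text \<open>Closedness of \<open>Z\<close> under arcs is again the constancy of a function along the
  arcs, namely of the indicator of \<open>Z\<close>.\<close>

lemma local_circleI:
  assumes "Z \<noteq> {}" "const_on (tarcs 0 m M b) (\<lambda>u. u \<in> Z)"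
    and "\<And>\<phi> :: node \<Rightarrow> node set. const_on (tarcs 0 m M b) \<phi> \<Longrightarrow> \<forall>u\<in>Z. \<forall>u'\<in>Z. \<phi> u = \<phi> u'"
    and "\<And>j p. (j, p) \<in> Z \<Longrightarrow> 0 < j \<and> j < length M \<and> p < wd m (take j M)"
  shows "local_circle m M b Z"
  unfolding local_circle_def gen_rel_const_on
proof (intro conjI)
  show "\<forall>(u, u')\<in>tarcs 0 m M b. (u \<in> Z) = (u' \<in> Z)" using assms(2) unfolding const_on_def by blast
  show "\<forall>u\<in>Z. 0 < fst u \<and> fst u < length M \<and> snd u < wd m (take (fst u) M)" using assms(4) by auto
qed (use assms(1,3) in blast)+

lemma R1_cup_circle: "(1 \<in> b) = c \<Longrightarrow> local_circle (i + t) [Cup i, Cross i c] b {(1, i), (1, Suc i)}"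
  by (rule local_circleI; (simp add: model_simps)?; (elim conjE disjE)?; (simp add: model_simps)?; (fastforce | metis)?)

lemma R1_cap_circle: "(0 \<in> b) = c \<Longrightarrow> local_circle (Suc (Suc (i + t))) [Cross i c, Cap i] b {(1, i), (1, Suc i)}"
  by (rule local_circleI; (simp add: model_simps)?; (elim conjE disjE)?; (simp add: model_simps)?; (fastforce | metis)?)

lemma R2_circle: "(0 \<in> b) = c \<Longrightarrow> (1 \<in> b) = (\<not> c) \<Longrightarrow>
    local_circle (Suc (Suc (i + t))) [Cross i c, Cross i (\<not> c)] b {(1, i), (1, Suc i)}"
  by (rule local_circleI; (simp add: model_simps)?; (elim conjE disjE)?; (simp add: model_simps)?; (fastforce | metis)?)

lemma R3_left_circle: "local_circle (Suc (Suc (Suc (i + t)))) (R3_left i) {0} {(1, i), (1, Suc i), (2, i), (2, Suc i)}"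
  by (rule local_circleI; (simp add: model_simps)?; (elim conjE disjE)?; (simp add: model_simps)?; (fastforce | metis)?)

lemma R3_right_circle: "local_circle (Suc (Suc (Suc (i + t)))) (R3_right i) {2}
    {(1, Suc i), (1, Suc (Suc i)), (2, Suc i), (2, Suc (Suc i))}"
  by (rule local_circleI; (simp add: model_simps)?; (elim conjE disjE)?; (simp add: model_simps)?; (fastforce | metis)?)

text \<open>Both versions of the first move: the vertices that survive are compared with the
  vertices of the diagram with the single slice \<open>g\<close>.\<close>

lemma R1_same_Kh:
  assumes un: "unmarked M" and cr: "crossings M = {k}" "crossings [g] = {}" "\<And>i. g \<noteq> Mark i"
    and Z: "\<And>m n b. tangle m M n \<Longrightarrow> (k \<in> b) = c \<Longrightarrow> local_circle m M b Z"
    and real: "\<And>m n. tangle m M n \<Longrightarrow> \<exists>h. \<forall>b. (k \<in> b) = c \<longrightarrow> realizes m M b (sarc g True m 0) h Z"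
    and t: "((k, position (M ! k)) \<in> Z) \<noteq> ((Suc k, Suc (position (M ! k))) \<in> Z)"
    and g: "\<And>r m. sarc g r m 0 = sarc g True m 0" and w: "\<And>m n. tangle m M n \<Longrightarrow> wd m [g] = n"
  shows "same_Kh M [g]"
proof (rule same_KhI[OF un])
  show "unmarked [g]" using cr(3) by simp
  fix X Y assume s: "split_diagram X M Y" "split_diagram X [g] Y"
  have t0: "tangle (wd 0 X) M (wd (wd 0 X) M)" using s by (auto simp: split_diagram_def tangle_append)
  obtain h where h: "\<And>b. (k \<in> b) = c \<Longrightarrow> realizes (wd 0 X) M b (sarc g True (wd 0 X) 0) h Z"
    using real[OF t0] by blast
  let ?VL = "{b. b \<subseteq> crossings M \<and> (k \<in> b \<longleftrightarrow> c)}"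
  have VL: "?VL = {if c then {k} else {}}" unfolding cr(1) by auto
  have nl: "\<not> ladj M b b'" if "b \<in> ?VL" "b' \<in> ?VL" for b b'
    using that unfolding ladj_def cr(1) by auto
  have "skel_homology X (wd (wd 0 X) M) Y ((\<lambda>b. {}) ` ?VL) (\<lambda>b. sarc g True (wd 0 X) 0) (\<lambda>_ _. False) \<cong> Kh (X @ M @ Y)"
  proof (rule split_diagram.skel_R1[OF s(1), where k = k and s = c and Z = Z and g = h])
    show "inj_on (\<lambda>b. {}) ?VL" unfolding VL by simp
    show "split_diagram.touches M k Z" unfolding split_diagram.touches_def[OF s(1)] by (rule t)
  qed (use cr h Z[OF t0] nl in auto)
  moreover have "skel_homology X (wd (wd 0 X) [g]) Y ((\<lambda>b. {}) ` Pow (crossings [g])) (\<lambda>b. sarc g True (wd 0 X) 0) (\<lambda>_ _. False) \<cong> Kh (X @ [g] @ Y)"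
  proof (rule split_diagram.skel_isotopy[OF s(2), where g = "\<lambda>u. u"])
    show "realizes (wd 0 X) [g] b (sarc g True (wd 0 X) 0) (\<lambda>u. u) {}" for b
      using realizes_single[of "wd 0 X" g b] g[of "0 \<in> b"] by simp
  qed (simp_all add: cr ladj_def)
  moreover have e: "(\<lambda>b. {} :: nat set) ` ?VL = (\<lambda>b. {}) ` Pow (crossings [g])" unfolding VL cr(2) by simp
  ultimately show "\<exists>n EL \<rho> AL. skel_homology X n Y EL \<rho> AL \<cong> Kh (X @ M @ Y) \<and> skel_homology X n Y EL \<rho> AL \<cong> Kh (X @ [g] @ Y)"
    unfolding e w[OF t0] by blast
qed

lemma R1_cup_same_Kh: "same_Kh [Cup i, Cross i c] [Cup i]"
proof (rule R1_same_Kh[where k = 1 and c = c and Z = "{(1, i), (1, Suc i)}"])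
  show "\<exists>h. \<forall>b. (1 \<in> b) = c \<longrightarrow> realizes m [Cup i, Cross i c] b (sarc (Cup i) True m 0) h {(1, i), (1, Suc i)}"
    if tg: "tangle m [Cup i, Cross i c] n" for m n
  proof -
    obtain t where m: "m = i + t" using tg le_iff_add[of i m] by auto
    show ?thesis unfolding m using R1_cup_realizes by blast
  qed
  show "local_circle m [Cup i, Cross i c] b {(1, i), (1, Suc i)}"
    if tg: "tangle m [Cup i, Cross i c] n" "(1 \<in> b) = c" for m n b
  proof -
    obtain t where m: "m = i + t" using tg le_iff_add[of i m] by auto
    show ?thesis unfolding m by (rule R1_cup_circle[OF tg(2)])
  qed
qed (auto simp: crossings_Cons sarc_def)

lemma R1_cap_same_Kh: "same_Kh [Cross i c, Cap i] [Cap i]"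
proof (rule R1_same_Kh[where k = 0 and c = c and Z = "{(1, i), (1, Suc i)}"])
  have m: "\<exists>t. m = Suc (Suc (i + t))" if "tangle m [Cross i c, Cap i] n" for m n
    using that le_iff_add[of "i + 2" m] by auto
  show "\<exists>h. \<forall>b. (0 \<in> b) = c \<longrightarrow> realizes m [Cross i c, Cap i] b (sarc (Cap i) True m 0) h {(1, i), (1, Suc i)}"
    if "tangle m [Cross i c, Cap i] n" for m n
    using m[OF that] R1_cap_realizes by blast
  show "local_circle m [Cross i c, Cap i] b {(1, i), (1, Suc i)}"
    if "tangle m [Cross i c, Cap i] n" "(0 \<in> b) = c" for m n b
    using m[OF that(1)] R1_cap_circle[OF that(2)] by blast
qed (auto simp: crossings_Cons sarc_def)

text \<open>Depending on the sign, the bigon closes up at the 1-resolution of the first or of the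
  second crossing.\<close>

lemma R2_same_Kh: "same_Kh [Cross i c, Cross i (\<not> c)] []"
proof (rule same_KhI)
  let ?M = "[Cross i c, Cross i (\<not> c)]"
  fix X Y assume s: "split_diagram X ?M Y" "split_diagram X [] Y"
  let ?p = "if c then 0 else 1 :: nat" and ?q = "if c then 1 else 0 :: nat" and ?Z = "{(1, i), (1, Suc i)} :: node set"
  have "tangle (wd 0 X) ?M (wd (wd 0 X) ?M)" using s by (auto simp: split_diagram_def tangle_append)
  then have "i + 2 \<le> wd 0 X" by simp
  then obtain t where m: "wd 0 X = Suc (Suc (i + t))" using le_iff_add[of "i + 2" "wd 0 X"] by auto
  have cr: "crossings ?M = {0, 1}" by (auto simp: crossings_Cons)
  let ?VL = "{b. b \<subseteq> crossings ?M \<and> ?q \<in> b \<and> ?p \<notin> b}"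
  have VL: "?VL = {{?q}}" unfolding cr by auto
  have nl: "\<not> ladj ?M b b'" if "b \<in> ?VL" "b' \<in> ?VL" for b b'
    using that unfolding VL ladj_def by auto
  have "skel_homology X (wd (wd 0 X) ?M) Y ((\<lambda>b. {}) ` ?VL) (\<lambda>b. id_rel (wd 0 X)) (\<lambda>_ _. False) \<cong> Kh (X @ ?M @ Y)"
  proof (rule split_diagram.skel_R2[OF s(1), where p = ?p and q = ?q and Z = ?Z and g = "retr 2 (\<lambda>j p. (0, p))"])
    show "inj_on (\<lambda>b. {}) ?VL" unfolding VL by simp
    show "realizes (wd 0 X) ?M b (id_rel (wd 0 X)) (retr 2 (\<lambda>j p. (0, p))) {}" if "b \<in> ?VL" for b
      unfolding m by (rule R2_realizes) (use that in \<open>simp_all split: if_splits\<close>)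
    show "local_circle (wd 0 X) ?M (insert ?p b) ?Z" if "b \<subseteq> crossings ?M - {?p, ?q}" for b
    proof -
      have "b = {}" using that unfolding cr by (auto split: if_splits)
      then show ?thesis unfolding m by (intro R2_circle) simp_all
    qed
    show "split_diagram.touches ?M ?p ?Z" "split_diagram.touches ?M ?q ?Z"
      unfolding split_diagram.touches_def[OF s(1)] by simp_all
  qed (use cr nl in auto)
  moreover have "skel_homology X (wd (wd 0 X) []) Y ((\<lambda>b. {}) ` Pow (crossings [])) (\<lambda>b. id_rel (wd 0 X)) (\<lambda>_ _. False) \<cong> Kh (X @ [] @ Y)"
    by (rule split_diagram.skel_isotopy[OF s(2), where g = "\<lambda>u. u"]) (simp_all add: ladj_def realizes_Nil)
  moreover have e: "(\<lambda>b. {} :: nat set) ` ?VL = (\<lambda>b. {}) ` Pow (crossings [])" unfolding VL by simp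
  moreover have w: "wd (wd 0 X) ?M = wd (wd 0 X) []" by (simp add: m)
  ultimately show "\<exists>n EL \<rho> AL. skel_homology X n Y EL \<rho> AL \<cong> Kh (X @ ?M @ Y) \<and> skel_homology X n Y EL \<rho> AL \<cong> Kh (X @ [] @ Y)"
    unfolding e w by blast
qed simp_all

lemma subset3_cases:
  assumes "b \<subseteq> {0, 1, 2 :: nat}"
  obtains "b = {}" | "b = {0}" | "b = {1}" | "b = {2}" | "b = {0, 1}" | "b = {0, 2}" | "b = {1, 2}" | "b = {0, 1, 2}"
proof -
  have "b \<in> Pow {0, 1, 2}" using assms by simp
  then have "b = {} \<or> b = {0} \<or> b = {1} \<or> b = {2} \<or> b = {0, 1} \<or> b = {0, 2} \<or> b = {1, 2} \<or> b = {0, 1, 2}"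
    unfolding Pow_insert Pow_empty by (simp add: image_Un insert_commute)
  then show thesis using that by blast
qed

text \<open>A resolution without the middle crossing 1 that survives is the identity on the three
  strands. On the two sides of the move it is given by different sets, whence it gets a name of its
  own.\<close>

definition R3_name :: "nat set \<Rightarrow> nat set" where
  "R3_name b = (if 1 \<in> b then b else {})"

text \<open>The identity is adjacent to both cup-cap pairs. On each side of the move one of these
  two adjacencies is an edge and the other one is a zigzag.\<close>

definition R3_adj :: "nat set \<Rightarrow> nat set \<Rightarrow> bool" where
  "R3_adj e e' \<longleftrightarrow> 1 \<in> e' \<and> (if 1 \<in> e then \<exists>k\<in>{0, 2} - e. e' = insert k e else (0 \<in> e') \<noteq> (2 \<in> e'))"

text \<open>Common to both sides of the move, where \<open>p\<close> and \<open>q\<close> are the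
  outer crossings in one or the other order.\<close>

lemma R3_skeleton:
  assumes s: "split_diagram X M Y" and m: "wd 0 X = Suc (Suc (Suc (i + t)))" and cr: "crossings M = {0, 1, 2}"
    and pq: "{p, q} = {0, 2}" "p \<noteq> q"
    and r1: "\<And>b b'. (b, b') \<in> {({q}, {1, q}), ({1}, {0, 1}), ({1}, {1, 2}), ({0, 1}, {0, 1, 2}), ({1, 2}, {0, 1, 2})} \<Longrightarrow>
       \<exists>g. realizes (wd 0 X) M b (R3_rel i t (R3_name b)) g {} \<and> realizes (wd 0 X) M b' (R3_rel i t (R3_name b')) g {}"
    and r3: "\<exists>g \<rho>1 \<rho>2. realizes (wd 0 X) M {q} \<rho>1 g {} \<and> realizes (wd 0 X) M {0, 2} \<rho>2 g {}"
    and Z: "local_circle (wd 0 X) M {p} Z" and t: "\<And>k. k \<le> 2 \<Longrightarrow> ((k, position (M ! k)) \<in> Z) \<noteq> ((Suc k, Suc (position (M ! k))) \<in> Z)"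
  shows "skel_homology X (wd (wd 0 X) M) Y {{}, {1}, {0, 1}, {1, 2}, {0, 1, 2}} (R3_rel i t) R3_adj \<cong> Kh (X @ M @ Y)"
proof -
  have pq': "p = 0 \<and> q = 2 \<or> p = 2 \<and> q = 0" using pq by (auto simp: doubleton_eq_iff)
  let ?VL = "{b. b \<subseteq> crossings M \<and> (1 \<in> b \<or> q \<in> b \<and> p \<notin> b)}"
  have VLD: "b = {q} \<or> b = {1} \<or> b = {0, 1} \<or> b = {1, 2} \<or> b = {0, 1, 2}" if "b \<in> ?VL" for b
  proof -
    have "b \<subseteq> {0, 1, 2}" "1 \<in> b \<or> q \<in> b \<and> p \<notin> b" using that cr by auto
    then show ?thesis using pq' by (cases rule: subset3_cases) auto
  qed
  have VL: "?VL = {{q}, {1}, {0, 1}, {1, 2}, {0, 1, 2}}"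
  proof
    show "?VL \<subseteq> {{q}, {1}, {0, 1}, {1, 2}, {0, 1, 2}}"
    proof
      fix b assume "b \<in> ?VL"
      from VLD[OF this] show "b \<in> {{q}, {1}, {0, 1}, {1, 2}, {0, 1, 2}}" by (simp only: insert_iff empty_iff simp_thms)
    qed
    show "{{q}, {1}, {0, 1}, {1, 2}, {0, 1, 2}} \<subseteq> ?VL" using pq' by (auto simp: cr)
  qed
  have pairs: "(b, b') \<in> {({q}, {1, q}), ({1}, {0, 1}), ({1}, {1, 2}), ({0, 1}, {0, 1, 2}), ({1, 2}, {0, 1, 2})}"
    if b: "b \<in> ?VL" "b' \<in> ?VL" and l: "ladj M b b'" for b b'
  proof -
    obtain k where k: "k \<in> {0, 1, 2} - b" "b' = insert k b" using l unfolding ladj_def cr by blast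
    have b': "1 \<in> b' \<or> q \<in> b' \<and> p \<notin> b'" using b(2) by simp
    show ?thesis using VLD[OF b(1)] k(1) b' pq' unfolding k(2)
      by (elim disjE conjE; hypsubst?; auto simp: insert_commute)
  qed
  have ex: "\<exists>g. realizes (wd 0 X) M b (R3_rel i t (R3_name b)) g {}" if "b \<in> ?VL" for b
    using VLD[OF that] r1[of "{q}" "{1, q}"] r1[of "{1}" "{0, 1}"] r1[of "{1}" "{1, 2}"] r1[of "{0, 1}" "{0, 1, 2}"]
    by (elim disjE) (simp_all, blast+)
  have "skel_homology X (wd (wd 0 X) M) Y (R3_name ` ?VL) (R3_rel i t) R3_adj \<cong> Kh (X @ M @ Y)"
  proof (rule split_diagram.skel_R3[OF s, where p = p and q = q and r = 1 and Z = Z])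
    show "inj_on R3_name ?VL" using pq' unfolding VL by (auto simp: inj_on_def R3_name_def)
    show "\<exists>g. realizes (wd 0 X) M b (R3_rel i t (R3_name b)) g {} \<and> realizes (wd 0 X) M b' (R3_rel i t (R3_name b')) g {}"
      if "b \<in> ?VL" "b' \<in> ?VL" "ladj M b b'" for b b'
      by (rule r1[OF pairs[OF that]])
    have e: "b = {}" if "b \<subseteq> crossings M - {p, q, 1}" for b
      using that pq unfolding cr by auto
    show "\<exists>g \<rho>1 \<rho>2. realizes (wd 0 X) M (insert q b) \<rho>1 g {} \<and> realizes (wd 0 X) M (insert q (insert p b)) \<rho>2 g {}"
      if "b \<subseteq> crossings M - {p, q, 1}" for b
    proof -
      have "insert q (insert p b) = {0, 2}" "insert q b = {q}" unfolding e[OF that] using pq' by auto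
      then show ?thesis using r3 by (simp only:)
    qed
    show "local_circle (wd 0 X) M (insert p b) Z" if "b \<subseteq> crossings M - {p, q, 1}" for b
      using Z e[OF that] by simp
    show "split_diagram.touches M p Z" "split_diagram.touches M q Z" "split_diagram.touches M 1 Z"
      unfolding split_diagram.touches_def[OF s] by (rule t; use pq' in auto)+
    show "R3_adj (R3_name b) (R3_name b') \<longleftrightarrow> ladj M b b' \<or>
       (\<exists>v\<subseteq>crossings M - {p, q, 1}. b = insert q v \<and> b' = insert 1 (insert p v))" if b: "b \<in> ?VL" "b' \<in> ?VL" for b b'
    proof -
      have "(\<exists>v\<subseteq>crossings M - {p, q, 1}. b = insert q v \<and> b' = insert 1 (insert p v)) \<longleftrightarrow> b = {q} \<and> b' = {1, p}"
      proof
        assume "\<exists>v\<subseteq>crossings M - {p, q, 1}. b = insert q v \<and> b' = insert 1 (insert p v)"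
        then obtain v where v: "v \<subseteq> crossings M - {p, q, 1}" "b = insert q v" "b' = insert 1 (insert p v)" by blast
        show "b = {q} \<and> b' = {1, p}" using v(2,3) unfolding e[OF v(1)] by simp
      next
        assume "b = {q} \<and> b' = {1, p}"
        then show "\<exists>v\<subseteq>crossings M - {p, q, 1}. b = insert q v \<and> b' = insert 1 (insert p v)"
          by (intro exI[of _ "{}"]) simp
      qed
      moreover have "R3_adj (R3_name b) (R3_name b') \<longleftrightarrow> ladj M b b' \<or> b = {q} \<and> b' = {1, p}"
      proof (cases "1 \<in> b")
        case True
        then have bq: "b \<noteq> {q}" using pq' by auto
        show ?thesis
        proof (cases "1 \<in> b'")
          case b': True
          then show ?thesis using True bq unfolding R3_adj_def R3_name_def ladj_def cr by auto
        next
          case False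
          then have "\<not> ladj M b b'" using True unfolding ladj_def by blast
          then show ?thesis using False bq unfolding R3_adj_def R3_name_def by simp
        qed
      next
        case False
        then have bq: "b = {q}" using VLD[OF b(1)] by auto
        show ?thesis
        proof (cases "1 \<in> b'")
          case True
          have "R3_adj (R3_name b) (R3_name b') \<longleftrightarrow> (0 \<in> b') \<noteq> (2 \<in> b')"
            using True False unfolding R3_adj_def R3_name_def by simp
          also have "\<dots> \<longleftrightarrow> b' = {0, 1} \<or> b' = {1, 2}"
          proof -
            have A: "b' = {1} \<or> b' = {0, 1} \<or> b' = {1, 2} \<or> b' = {0, 1, 2}"
              using VLD[OF b(2)] True bq pq' by (elim disjE) simp_all
            show ?thesis
            proof
              assume "(0 \<in> b') \<noteq> (2 \<in> b')"
              then show "b' = {0, 1} \<or> b' = {1, 2}" using A by (elim disjE) simp_all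
            next
              assume "b' = {0, 1} \<or> b' = {1, 2}"
              then show "(0 \<in> b') \<noteq> (2 \<in> b')" by (elim disjE) simp_all
            qed
          qed
          also have "\<dots> \<longleftrightarrow> b' = {1, q} \<or> b' = {1, p}"
            using pq'
          proof
            assume "p = 0 \<and> q = 2"
            then show ?thesis by (simp only: insert_commute[of 1 0]) (rule disj_commute)
          next
            assume "p = 2 \<and> q = 0"
            then show ?thesis by (simp only: insert_commute[of 1 0])
          qed
          also have "b' = {1, q} \<longleftrightarrow> ladj M b b'"
            using True False unfolding bq ladj_def cr by auto
          finally show ?thesis using bq by simp
        next
          case b': False
          then have "b' = {q}" using VLD[OF b(2)] by auto
          then show ?thesis using False b' unfolding bq R3_adj_def R3_name_def ladj_def by auto
        qed
      qed
      ultimately show ?thesis by simp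
    qed
  qed (use cr pq' ex in auto)
  moreover have "R3_name ` ?VL = {{}, {1}, {0, 1}, {1, 2}, {0, 1, 2}}"
  proof -
    have "R3_name {q} = {}" using pq' by (auto simp: R3_name_def)
    moreover have "R3_name {1} = {1}" "R3_name {0, 1} = {0, 1}" "R3_name {1, 2} = {1, 2}" "R3_name {0, 1, 2} = {0, 1, 2}"
      by (simp_all add: R3_name_def)
    ultimately show ?thesis unfolding VL image_insert image_empty by (simp only:)
  qed
  ultimately show ?thesis by simp
qed

text \<open>The pattern of signs in which the outer crossings are opposite, so that, on either side,
  the resolution of one of them by itself leaves a circle; the outer crossings exchange their roles
  between the two sides.\<close>

lemma R3_base_same_Kh: "same_Kh (R3_left i) (R3_right i)"
proof (rule same_KhI)
  fix X Y assume s: "split_diagram X (R3_left i) Y" "split_diagram X (R3_right i) Y"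
  have "tangle (wd 0 X) (R3_left i) (wd (wd 0 X) (R3_left i))" using s by (auto simp: split_diagram_def tangle_append)
  then have "Suc i \<le> wd 0 X - 2" by simp
  then have "i + 3 \<le> wd 0 X" by linarith
  then obtain t where m: "wd 0 X = Suc (Suc (Suc (i + t)))" using le_iff_add[of "i + 3" "wd 0 X"]
    by (auto simp: eval_nat_numeral)
  have N: "R3_name {2} = {}" "R3_name {0} = {}" "R3_name {1} = {1}" "R3_name {0, 1} = {0, 1}" "R3_name {1, 2} = {1, 2}"
    "R3_name {0, 1, 2} = {0, 1, 2}" "R3_name {1, 0} = {0, 1}" "{1, 0} = {0, 1 :: nat}" by (auto simp: R3_name_def)
  have "skel_homology X (wd (wd 0 X) (R3_left i)) Y {{}, {1}, {0, 1}, {1, 2}, {0, 1, 2}} (R3_rel i t) R3_adj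
      \<cong> Kh (X @ R3_left i @ Y)"
  proof (rule R3_skeleton[OF s(1) m, where p = 0 and q = 2])
    have f1: "\<exists>g. realizes (wd 0 X) (R3_left i) {2} (R3_rel i t (R3_name {2})) g {} \<and>
        realizes (wd 0 X) (R3_left i) {1, 2} (R3_rel i t (R3_name {1, 2})) g {}"
      unfolding m N using R3_left_1[of i t] R3_left_2[of i t] by blast
    have f2: "\<exists>g. realizes (wd 0 X) (R3_left i) {1} (R3_rel i t (R3_name {1})) g {} \<and>
        realizes (wd 0 X) (R3_left i) {0, 1} (R3_rel i t (R3_name {0, 1})) g {}"
      unfolding m N using R3_left_3[of i t] R3_left_4[of i t] by blast
    have f3: "\<exists>g. realizes (wd 0 X) (R3_left i) {1} (R3_rel i t (R3_name {1})) g {} \<and>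
        realizes (wd 0 X) (R3_left i) {1, 2} (R3_rel i t (R3_name {1, 2})) g {}"
      unfolding m N using R3_left_5[of i t] R3_left_6[of i t] by blast
    have f4: "\<exists>g. realizes (wd 0 X) (R3_left i) {0, 1} (R3_rel i t (R3_name {0, 1})) g {} \<and>
        realizes (wd 0 X) (R3_left i) {0, 1, 2} (R3_rel i t (R3_name {0, 1, 2})) g {}"
      unfolding m N using R3_left_7[of i t] R3_left_8[of i t] by blast
    have f5: "\<exists>g. realizes (wd 0 X) (R3_left i) {1, 2} (R3_rel i t (R3_name {1, 2})) g {} \<and>
        realizes (wd 0 X) (R3_left i) {0, 1, 2} (R3_rel i t (R3_name {0, 1, 2})) g {}"
      unfolding m N using R3_left_9[of i t] R3_left_10[of i t] by blast
    show "\<exists>g. realizes (wd 0 X) (R3_left i) b (R3_rel i t (R3_name b)) g {} \<and>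
        realizes (wd 0 X) (R3_left i) b' (R3_rel i t (R3_name b')) g {}"
      if "(b, b') \<in> {({2}, {1, 2}), ({1}, {0, 1}), ({1}, {1, 2}), ({0, 1}, {0, 1, 2}), ({1, 2}, {0, 1, 2})}" for b b'
      using that f1 f2 f3 f4 f5 unfolding insert_iff empty_iff prod.inject
      by (elim disjE conjE FalseE) (simp_all only:)
    show "\<exists>g \<rho>1 \<rho>2. realizes (wd 0 X) (R3_left i) {2} \<rho>1 g {} \<and> realizes (wd 0 X) (R3_left i) {0, 2} \<rho>2 g {}"
      unfolding m using R3_left_11 R3_left_12 by blast
    show "local_circle (wd 0 X) (R3_left i) {0} {(1, i), (1, Suc i), (2, i), (2, Suc i)}"
      unfolding m by (rule R3_left_circle)
    show "((k, position (R3_left i ! k)) \<in> {(1, i), (1, Suc i), (2, i), (2, Suc i)}) \<noteq>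
      ((Suc k, Suc (position (R3_left i ! k))) \<in> {(1, i), (1, Suc i), (2, i), (2, Suc i)})" if "k \<le> 2" for k
    proof -
      have "k = 0 \<or> k = 1 \<or> k = 2" using that by auto
      then show ?thesis by auto
    qed
  qed (auto simp: crossings_Cons)
  moreover have "skel_homology X (wd (wd 0 X) (R3_right i)) Y {{}, {1}, {0, 1}, {1, 2}, {0, 1, 2}} (R3_rel i t) R3_adj
      \<cong> Kh (X @ R3_right i @ Y)"
  proof (rule R3_skeleton[OF s(2) m, where p = 2 and q = 0])
    have f1: "\<exists>g. realizes (wd 0 X) (R3_right i) {0} (R3_rel i t (R3_name {0})) g {} \<and>
        realizes (wd 0 X) (R3_right i) {1, 0} (R3_rel i t (R3_name {1, 0})) g {}"
      unfolding m N using R3_right_1[of i t] R3_right_2[of i t] by blast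
    have f2: "\<exists>g. realizes (wd 0 X) (R3_right i) {1} (R3_rel i t (R3_name {1})) g {} \<and>
        realizes (wd 0 X) (R3_right i) {0, 1} (R3_rel i t (R3_name {0, 1})) g {}"
      unfolding m N using R3_right_3[of i t] R3_right_4[of i t] by blast
    have f3: "\<exists>g. realizes (wd 0 X) (R3_right i) {1} (R3_rel i t (R3_name {1})) g {} \<and>
        realizes (wd 0 X) (R3_right i) {1, 2} (R3_rel i t (R3_name {1, 2})) g {}"
      unfolding m N using R3_right_5[of i t] R3_right_6[of i t] by blast
    have f4: "\<exists>g. realizes (wd 0 X) (R3_right i) {0, 1} (R3_rel i t (R3_name {0, 1})) g {} \<and>
        realizes (wd 0 X) (R3_right i) {0, 1, 2} (R3_rel i t (R3_name {0, 1, 2})) g {}"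
      unfolding m N using R3_right_7[of i t] R3_right_8[of i t] by blast
    have f5: "\<exists>g. realizes (wd 0 X) (R3_right i) {1, 2} (R3_rel i t (R3_name {1, 2})) g {} \<and>
        realizes (wd 0 X) (R3_right i) {0, 1, 2} (R3_rel i t (R3_name {0, 1, 2})) g {}"
      unfolding m N using R3_right_9[of i t] R3_right_10[of i t] by blast
    show "\<exists>g. realizes (wd 0 X) (R3_right i) b (R3_rel i t (R3_name b)) g {} \<and>
        realizes (wd 0 X) (R3_right i) b' (R3_rel i t (R3_name b')) g {}"
      if "(b, b') \<in> {({0}, {1, 0}), ({1}, {0, 1}), ({1}, {1, 2}), ({0, 1}, {0, 1, 2}), ({1, 2}, {0, 1, 2})}" for b b'
      using that f1 f2 f3 f4 f5 unfolding insert_iff empty_iff prod.inject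
      by (elim disjE conjE FalseE) (simp_all only:)
    show "\<exists>g \<rho>1 \<rho>2. realizes (wd 0 X) (R3_right i) {0} \<rho>1 g {} \<and> realizes (wd 0 X) (R3_right i) {0, 2} \<rho>2 g {}"
      unfolding m using R3_right_11 R3_right_12 by blast
    show "local_circle (wd 0 X) (R3_right i) {2} {(1, Suc i), (1, Suc (Suc i)), (2, Suc i), (2, Suc (Suc i))}"
      unfolding m by (rule R3_right_circle)
    show "((k, position (R3_right i ! k)) \<in> {(1, Suc i), (1, Suc (Suc i)), (2, Suc i), (2, Suc (Suc i))}) \<noteq>
      ((Suc k, Suc (position (R3_right i ! k))) \<in> {(1, Suc i), (1, Suc (Suc i)), (2, Suc i), (2, Suc (Suc i))})" if "k \<le> 2" for k
    proof -
      have "k = 0 \<or> k = 1 \<or> k = 2" using that by auto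
      then show ?thesis by auto
    qed
  qed (auto simp: crossings_Cons)
  moreover have w: "wd (wd 0 X) (R3_right i) = wd (wd 0 X) (R3_left i)" by (simp add: m)
  ultimately show "\<exists>n EL \<rho> AL. skel_homology X n Y EL \<rho> AL \<cong> Kh (X @ R3_left i @ Y) \<and> skel_homology X n Y EL \<rho> AL \<cong> Kh (X @ R3_right i @ Y)"
    unfolding w by blast
qed simp_all


section \<open>The remaining patterns of the third move\<close>

text \<open>Words in the generators of the braid group on three strands and their inverses: the
  first component of a letter chooses the generator, the second one is the sign.\<close>

definition braid :: "nat \<Rightarrow> (bool \<times> bool) list \<Rightarrow> slice list" where
  "braid i = map (\<lambda>(k, b). Cross (if k then Suc i else i) b)"

definition braid_eq :: "nat \<Rightarrow> (bool \<times> bool) list \<Rightarrow> (bool \<times> bool) list \<Rightarrow> bool" where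
  "braid_eq i w w' \<longleftrightarrow> (\<forall>X Y. i + 3 \<le> wd 0 X \<longrightarrow> tangle 0 X (wd 0 X) \<longrightarrow> tangle (wd 0 X) Y 0 \<longrightarrow>
     Kh (X @ braid i w @ Y) \<cong> Kh (X @ braid i w' @ Y))"

lemma braid_append: "braid i (u @ w) = braid i u @ braid i w"
  by (simp add: braid_def)

lemma wd_braid [simp]: "i + 3 \<le> m \<Longrightarrow> wd m (braid i w) = m"
proof (induction w)
  case (Cons x w)
  then have "Suc (Suc (m - 2)) = m" by simp
  then show ?case using Cons by (auto simp: braid_def split_beta)
qed (simp add: braid_def)

lemma tangle_braid: "i + 3 \<le> m \<Longrightarrow> tangle m (braid i w) m"
proof (induction w)
  case (Cons x w)
  then have "Suc (Suc (m - 2)) = m" by simp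
  then show ?case using Cons by (auto simp: braid_def split_beta)
qed (simp add: braid_def)

lemma tangle_context:
  assumes "i + 3 \<le> wd 0 X" "tangle 0 X (wd 0 X)" "tangle (wd 0 X) Y 0"
  shows "tangle 0 (X @ braid i w @ Y) 0"
  unfolding tangle_append using assms tangle_braid[of i "wd 0 X" w] by simp

lemma Kh_iso_sym: "tangle 0 D 0 \<Longrightarrow> Kh D \<cong> G \<Longrightarrow> G \<cong> Kh D"
  unfolding diagram.Kh_homology[OF diagram.intro] by (rule iso_sym_closed[OF homology_closed])

lemma braid_eq_refl: "braid_eq i w w"
  by (simp add: braid_eq_def)

lemma braid_eq_sym: "braid_eq i w w' \<Longrightarrow> braid_eq i w' w"
  unfolding braid_eq_def using Kh_iso_sym tangle_context by blast

lemma braid_eq_trans: "braid_eq i u v \<Longrightarrow> braid_eq i v w \<Longrightarrow> braid_eq i u w"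
  unfolding braid_eq_def using iso_trans by blast

lemma braid_eq_context:
  assumes "braid_eq i w w'"
  shows "braid_eq i (u @ w @ v) (u @ w' @ v)"
  unfolding braid_eq_def
proof (intro allI impI)
  fix X Y assume a: "i + 3 \<le> wd 0 X" "tangle 0 X (wd 0 X)" "tangle (wd 0 X) Y 0"
  have "i + 3 \<le> wd 0 (X @ braid i u)" "tangle 0 (X @ braid i u) (wd 0 (X @ braid i u))"
    "tangle (wd 0 (X @ braid i u)) (braid i v @ Y) 0"
    using a tangle_braid[OF a(1)] by (simp_all add: tangle_append)
  with assms have "Kh ((X @ braid i u) @ braid i w @ braid i v @ Y) \<cong> Kh ((X @ braid i u) @ braid i w' @ braid i v @ Y)"
    unfolding braid_eq_def by blast
  then show "Kh (X @ braid i (u @ w @ v) @ Y) \<cong> Kh (X @ braid i (u @ w' @ v) @ Y)"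
    by (simp add: braid_append)
qed

lemma same_Kh_braid_eq: "same_Kh (braid i w) (braid i w') \<Longrightarrow> braid_eq i w w'"
  unfolding same_Kh_def braid_eq_def using tangle_context by blast

definition binv :: "(bool \<times> bool) list \<Rightarrow> (bool \<times> bool) list" where
  "binv w = rev (map (\<lambda>(k, b). (k, \<not> b)) w)"

lemma braid_cancel: "braid_eq i [(k, b), (k, \<not> b)] []"
  by (rule same_Kh_braid_eq) (use R2_same_Kh[of "if k then Suc i else i" b] in \<open>simp add: braid_def\<close>)

lemma braid_cancel': "braid_eq i [(k, \<not> b), (k, b)] []"
  using braid_cancel[of i k "\<not> b"] by simp

lemma binv_right: "braid_eq i (w @ binv w) []"
proof (induction w)
  case (Cons x w)
  obtain k b where x: "x = (k, b)" by (cases x)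
  have "braid_eq i ([x] @ (w @ binv w) @ [(k, \<not> b)]) ([x] @ [] @ [(k, \<not> b)])" by (rule braid_eq_context[OF Cons.IH])
  then show ?case using braid_eq_trans[OF _ braid_cancel[of i k b]] by (simp add: binv_def x)
qed (simp add: binv_def braid_eq_refl)

lemma binv_left: "braid_eq i (binv w @ w) []"
  using binv_right[of i "binv w"] by (simp add: binv_def rev_map comp_def split_def)

text \<open>In a group an equation implies that of the inverses; here inverses are available through
  the second move.\<close>

lemma braid_eq_inv:
  assumes "braid_eq i w w'"
  shows "braid_eq i (binv w) (binv w')"
proof -
  have 1: "braid_eq i (binv w @ (w' @ binv w')) (binv w)"
    using braid_eq_context[OF binv_right[of i w'], of "binv w" "[]"] by simp
  have 2: "braid_eq i (binv w @ w @ binv w') (binv w @ w' @ binv w')" by (rule braid_eq_context[OF assms])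
  have 3: "braid_eq i ([] @ (binv w @ w) @ binv w') ([] @ [] @ binv w')" by (rule braid_eq_context[OF binv_left])
  show ?thesis using braid_eq_trans[OF braid_eq_sym[OF 1] braid_eq_trans[OF braid_eq_sym[OF 2]]] 3 by simp
qed

text \<open>With \<open>s\<close>, \<open>t\<close> for the two generators and capitals for their
  inverses, the case \<open>s t S = T s t\<close> is the one with a bigon. The others follow in the
  braid group: \<open>s t s = t (T s t) s = t (s t S) s = t s t\<close>, further \<open>S t s = S (t
  s t) T = S (s t s) T = t s T\<close>, and the remaining three are inverses of these.\<close>

lemma braid_R3:
  assumes "a = c \<longrightarrow> b = a"
  shows "braid_eq i [(False, a), (True, b), (False, c)] [(True, c), (False, b), (True, a)]"
proof -
  let ?s = "(False, True)" and ?S = "(False, False)" and ?t = "(True, True)" and ?T = "(True, False)"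
  have base: "braid_eq i [?s, ?t, ?S] [?T, ?s, ?t]"
    by (rule same_Kh_braid_eq) (use R3_base_same_Kh[of i] in \<open>simp add: braid_def\<close>)
  have pos: "braid_eq i [?s, ?t, ?s] [?t, ?s, ?t]"
  proof -
    have 1: "braid_eq i [?t, ?T, ?s, ?t, ?s] [?s, ?t, ?s]"
      using braid_eq_context[OF braid_cancel[of i True True], of "[]" "[?s, ?t, ?s]"] by simp
    have 2: "braid_eq i [?t, ?s, ?t, ?S, ?s] [?t, ?T, ?s, ?t, ?s]"
      using braid_eq_context[OF base, of "[?t]" "[?s]"] by simp
    have 3: "braid_eq i [?t, ?s, ?t, ?S, ?s] [?t, ?s, ?t]"
      using braid_eq_context[OF braid_cancel'[of i False True], of "[?t, ?s, ?t]" "[]"] by simp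
    show ?thesis by (rule braid_eq_trans[OF braid_eq_sym[OF braid_eq_trans[OF 2 1]] 3])
  qed
  have neg: "braid_eq i [?S, ?T, ?S] [?T, ?S, ?T]" using braid_eq_inv[OF pos] by (simp add: binv_def)
  have base': "braid_eq i [?s, ?T, ?S] [?T, ?S, ?t]" using braid_eq_inv[OF base] by (simp add: binv_def)
  have mix: "braid_eq i [?S, ?t, ?s] [?t, ?s, ?T]"
  proof -
    have 1: "braid_eq i [?S, ?t, ?s, ?t, ?T] [?S, ?t, ?s]"
      using braid_eq_context[OF braid_cancel[of i True True], of "[?S, ?t, ?s]" "[]"] by simp
    have 2: "braid_eq i [?S, ?s, ?t, ?s, ?T] [?S, ?t, ?s, ?t, ?T]"
      using braid_eq_context[OF pos, of "[?S]" "[?T]"] by simp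
    have 3: "braid_eq i [?S, ?s, ?t, ?s, ?T] [?t, ?s, ?T]"
      using braid_eq_context[OF braid_cancel'[of i False True], of "[]" "[?t, ?s, ?T]"] by simp
    show ?thesis by (rule braid_eq_trans[OF braid_eq_sym[OF braid_eq_trans[OF 2 1]] 3])
  qed
  have mix': "braid_eq i [?S, ?T, ?s] [?t, ?S, ?T]" using braid_eq_inv[OF mix] by (simp add: binv_def)
  show ?thesis using assms pos neg base base' mix mix' by (cases a; cases b; cases c) simp_all
qed

lemma R3_same_Kh:
  assumes "a = c \<longrightarrow> b = a"
  shows "same_Kh [Cross i a, Cross (Suc i) b, Cross i c] [Cross (Suc i) c, Cross i b, Cross (Suc i) a]"
  unfolding same_Kh_def
proof (intro allI impI)
  fix X Y assume "tangle 0 (X @ [Cross i a, Cross (Suc i) b, Cross i c] @ Y) 0"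
  then have "tangle 0 X (wd 0 X)" and i: "i + 2 \<le> wd 0 X \<and> Suc i \<le> wd 0 X - 2" and Y: "tangle (wd 0 X - 2 + 2) Y 0"
    by (simp_all add: tangle_append)
  have "i + 3 \<le> wd 0 X" using i by linarith
  moreover have "tangle (wd 0 X) Y 0"
  proof -
    have "wd 0 X - 2 + 2 = wd 0 X" using i by linarith
    then show ?thesis using Y by metis
  qed
  ultimately show "Kh (X @ [Cross i a, Cross (Suc i) b, Cross i c] @ Y) \<cong> Kh (X @ [Cross (Suc i) c, Cross i b, Cross (Suc i) a] @ Y)"
    using braid_R3[OF assms, of i, unfolded braid_eq_def, rule_format, of X Y] \<open>tangle 0 X (wd 0 X)\<close> by (simp add: braid_def)
qed

section \<open>Invariance\<close>

lemma move_unmarked: "move M M' \<Longrightarrow> unmarked M \<longleftrightarrow> unmarked M'"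
proof (induction rule: move.induct)
  case (exchange g h)
  have "(\<forall>i. place k h \<noteq> Mark i) \<longleftrightarrow> (\<forall>i. h \<noteq> Mark i)" for k by (cases h) auto
  then show ?case by auto
qed simp_all

lemma move_same_Kh: "move M M' \<Longrightarrow> unmarked M \<Longrightarrow> same_Kh M M'"
proof (induction rule: move.induct)
  case (exchange g h)
  then show ?case by (rule exchange_same_Kh)
qed (rule zigzag_left_same_Kh zigzag_right_same_Kh slide_cup_same_Kh slide_cap_same_Kh R1_cup_same_Kh R1_cap_same_Kh
    R2_same_Kh R3_same_Kh; assumption)+

text \<open>By induction on the sequence of moves, with the marked tangle \<open>T\<close> as a part
  of the context below the move. Absence of marks and validity of the diagram are carried along,
  since a step in the reverse direction needs them for the other diagram.\<close>

theorem tangle_equiv_Kh: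
  assumes "tangle_equiv k S S'"
  shows "(unmarked S \<longleftrightarrow> unmarked S') \<and> (tangle k S 0 \<longleftrightarrow> tangle k S' 0) \<and>
    (\<forall>T. tangle 0 T k \<longrightarrow> tangle k S 0 \<longrightarrow> unmarked S \<longrightarrow> Kh (T @ S) \<cong> Kh (T @ S'))"
  using assms
proof (induction rule: tangle_equiv.induct)
  case (sym D D')
  have "Kh (T @ D') \<cong> Kh (T @ D)" if T: "tangle 0 T k" "tangle k D' 0" "unmarked D'" for T
  proof (rule Kh_iso_sym)
    show "tangle 0 (T @ D) 0" using T sym.IH tangle_wd[OF T(1)] by (simp add: tangle_append)
    show "Kh (T @ D) \<cong> Kh (T @ D')" using T sym.IH by blast
  qed
  then show ?case using sym.IH by blast
next
  case (trans D D' D'')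
  then show ?case using iso_trans by blast
next
  case (in_context M M' X Y)
  have "Kh (T @ X @ M @ Y) \<cong> Kh (T @ X @ M' @ Y)" if T: "tangle 0 T k" and u: "unmarked (X @ M @ Y)" for T
  proof -
    have "same_Kh M M'" using move_same_Kh[OF in_context(1)] u by simp
    moreover have "tangle 0 ((T @ X) @ M @ Y) 0" "tangle 0 ((T @ X) @ M' @ Y) 0"
      using T tangle_wd[OF T] in_context(2,3) by (simp_all add: tangle_append)
    ultimately have "Kh ((T @ X) @ M @ Y) \<cong> Kh ((T @ X) @ M' @ Y)" unfolding same_Kh_def by blast
    then show ?thesis by simp
  qed
  then show ?case using in_context move_unmarked[OF in_context(1)] by simp
qed simp_all

theorem theorem2p12:
  fixes T S S' :: "slice list" and k :: nat and \<omega> :: "(real \<times> real \<times> real) set"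
  assumes "tangle 0 T k"
    and "tangle k S 0" "unmarked S"
    and "tangle k S' 0" "unmarked S'"
    and "marking_data (T @ S) \<omega>" "marking_data (T @ S') \<omega>"
    and "\<omega> \<subseteq> {(x, y, z). y \<le> real (length T)}"
    and "good (T @ S) \<omega>" "good (T @ S') \<omega>"
    and "tangle_equiv k S S'"
  shows "Kh (T @ S) \<cong> Kh (T @ S')"
  using tangle_equiv_Kh[OF assms(11)] assms(1-3) by blast

end
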